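(* Let $P_y$ be a right pyramid in $\mathbb R^3$ whose base $B$ is a regular $n$-gon. Then there exists a free boundary minimal annulus $A$ in $P_y$ which is a graph over $B$. $A$ is invariant under the rotation by $2\pi/n$ about the line through the apex and the center of $B$. One component of $\partial A$ is convex and closed in $B$ and the other is convex in each remaining face of $P_y$.
   Context: A right pyramid $P_y$ with base $B$ and apex $p$ is the cone from $p$ over $B$, where $p$ lies on the line perpendicular to $B$ through the center of $B$. A free boundary minimal annulus in $P_y$ is a minimal surface in $P_y$ of annulus type whose boundary lies on $\partial P_y$ and which meets $\partial P_y$ orthogonally along its boundary. "$A$ is a graph over $B$" means that $A$ is a graph over its orthogonal projection into the plane of $B$. "The other is convex in each remaining face" means that the intersection of the other boundary component with each face of $P_y$ different from $B$ is a convex planar curve. *)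

theory Defs
  imports "HOL-Analysis.Analysis"
begin

definition regular_polygon :: "nat \<Rightarrow> real^3 \<Rightarrow> (real^3) set \<Rightarrow> bool" where
  "regular_polygon n c B \<longleftrightarrow> n \<ge> 3 \<and>
     (\<exists>e\<^sub>1 e\<^sub>2 \<rho>. norm e\<^sub>1 = 1 \<and> norm e\<^sub>2 = 1 \<and> orthogonal e\<^sub>1 e\<^sub>2 \<and> \<rho> > 0 \<and>
        B = convex hull ((\<lambda>k. c + \<rho> *\<^sub>R (cos (2 * pi * real k / real n) *\<^sub>R e\<^sub>1
                                    + sin (2 * pi * real k / real n) *\<^sub>R e\<^sub>2)) ` {..<n}))"

definition normal_to :: "(real^3) set \<Rightarrow> real^3 \<Rightarrow> bool" where
  "normal_to S v \<longleftrightarrow> (\<forall>x\<in>S. \<forall>y\<in>S. orthogonal v (x - y))"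

definition right_pyramid :: "(real^3) set \<Rightarrow> (real^3) set \<Rightarrow> real^3 \<Rightarrow> real^3 \<Rightarrow> bool" where
  "right_pyramid P B c p \<longleftrightarrow>
     p \<noteq> c \<and> normal_to B (p - c) \<and> P = (\<Union>b\<in>B. closed_segment p b)"

text \<open>Rotation by the angle \<open>\<theta>\<close> about the line through \<open>c\<close> with direction \<open>w \<noteq> 0\<close>
  (Rodrigues' formula).\<close>

definition axis_rotation :: "real^3 \<Rightarrow> real^3 \<Rightarrow> real \<Rightarrow> real^3 \<Rightarrow> real^3" where
  "axis_rotation c w \<theta> x =
     (let u = sgn w; y = x - c
      in c + cos \<theta> *\<^sub>R y + sin \<theta> *\<^sub>R cross3 u y + ((1 - cos \<theta>) * (u \<bullet> y)) *\<^sub>R u)"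

text \<open>Surfaces are parametrized over domains of \<open>\<complex> = \<real>\<^sup>2\<close>, with coordinate directions
  \<open>1\<close> and \<open>\<i>\<close>.\<close>

definition pderiv_dir :: "complex \<Rightarrow> (complex \<Rightarrow> real^3) \<Rightarrow> complex \<Rightarrow> real^3" where
  "pderiv_dir v X z = frechet_derivative X (at z) v"

primrec C_on :: "nat \<Rightarrow> (complex \<Rightarrow> real^3) \<Rightarrow> complex set \<Rightarrow> bool" where
  "C_on 0 X S \<longleftrightarrow> continuous_on S X"
| "C_on (Suc k) X S \<longleftrightarrow>
     (\<forall>z\<in>S. X differentiable (at z)) \<and> (\<forall>v. C_on k (pderiv_dir v X) S)"

definition unit_normal :: "(complex \<Rightarrow> real^3) \<Rightarrow> complex \<Rightarrow> real^3" where
  "unit_normal X z = sgn (cross3 (pderiv_dir 1 X z) (pderiv_dir \<i> X z))"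

definition mean_curvature :: "(complex \<Rightarrow> real^3) \<Rightarrow> complex \<Rightarrow> real" where
  "mean_curvature X z =
     (let X\<^sub>u = pderiv_dir 1 X z; X\<^sub>v = pderiv_dir \<i> X z; \<nu> = unit_normal X z;
          E = X\<^sub>u \<bullet> X\<^sub>u; F = X\<^sub>u \<bullet> X\<^sub>v; G = X\<^sub>v \<bullet> X\<^sub>v;
          L = pderiv_dir 1 (pderiv_dir 1 X) z \<bullet> \<nu>;
          M = pderiv_dir 1 (pderiv_dir \<i> X) z \<bullet> \<nu>;
          N = pderiv_dir \<i> (pderiv_dir \<i> X) z \<bullet> \<nu>
      in (E * N - 2 * F * M + G * L) / (2 * (E * G - F\<^sup>2)))"

text \<open>Two vectors in \<open>\<real>\<^sup>3\<close> are linearly independent iff their cross product is nonzero.\<close>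

definition minimal_immersion_on :: "complex set \<Rightarrow> (complex \<Rightarrow> real^3) \<Rightarrow> bool" where
  "minimal_immersion_on S X \<longleftrightarrow> (\<forall>k. C_on k X S) \<and>
     (\<forall>z\<in>S. cross3 (pderiv_dir 1 X z) (pderiv_dir \<i> X z) \<noteq> 0 \<and> mean_curvature X z = 0)"

definition open_annulus :: "real \<Rightarrow> real \<Rightarrow> complex set" where
  "open_annulus r R = {z. r < cmod z \<and> cmod z < R}"

definition closed_annulus :: "real \<Rightarrow> real \<Rightarrow> complex set" where
  "closed_annulus r R = {z. r \<le> cmod z \<and> cmod z \<le> R}"

definition edge_points :: "(real^3) set \<Rightarrow> (real^3) set" where
  "edge_points P = \<Union> {F \<inter> F' | F F'. F facet_of P \<and> F' facet_of P \<and> F \<noteq> F'}"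

text \<open>\<open>X\<close> is an immersion of class \<open>C\<^sup>1\<close> up to the part \<open>T\<close> of the boundary of the open
  domain \<open>S\<close>.\<close>

definition C1_immersion_up_to :: "complex set \<Rightarrow> complex set \<Rightarrow> (complex \<Rightarrow> real^3) \<Rightarrow> bool" where
  "C1_immersion_up_to S T X \<longleftrightarrow>
     (\<exists>X\<^sub>u X\<^sub>v. continuous_on (S \<union> T) X\<^sub>u \<and> continuous_on (S \<union> T) X\<^sub>v \<and>
        (\<forall>z\<in>S. X\<^sub>u z = pderiv_dir 1 X z \<and> X\<^sub>v z = pderiv_dir \<i> X z) \<and>
        (\<forall>z\<in>S \<union> T. cross3 (X\<^sub>u z) (X\<^sub>v z) \<noteq> 0))"

text \<open>\<open>A\<close> is an embedded free boundary minimal annulus in the polytope \<open>P\<close>, with boundary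
  components \<open>\<Gamma>\<close> and \<open>\<Gamma>'\<close> (the two play symmetric roles, by inversion of the parameter
  annulus).

  Where \<open>\<partial>A\<close> crosses an edge of \<open>P\<close> the surface has a corner, so there no \<open>C\<^sup>1\<close> immersion
  of a smooth annulus up to the boundary can exist; at these finitely many points only the
  tangent plane is required to extend continuously.  The tangent planes up to the boundary
  are given by the continuous unit normal \<open>\<nu>\<close>, and orthogonality to \<open>\<partial>P\<close> says that \<open>\<nu>\<close> is
  orthogonal to the normal of every facet through the boundary point (both facets, at an
  edge).\<close>

definition free_boundary_minimal_annulus ::
    "(real^3) set \<Rightarrow> (real^3) set \<Rightarrow> (real^3) set \<Rightarrow> (real^3) set \<Rightarrow> bool" where
  "free_boundary_minimal_annulus P A \<Gamma> \<Gamma>' \<longleftrightarrow>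
     (\<exists>X r R \<nu>. 0 < r \<and> r < R \<and>
        continuous_on (closed_annulus r R) X \<and> inj_on X (closed_annulus r R) \<and>
        A = X ` closed_annulus r R \<and> \<Gamma> = X ` sphere 0 r \<and> \<Gamma>' = X ` sphere 0 R \<and>
        minimal_immersion_on (open_annulus r R) X \<and>
        (let T = sphere 0 r \<union> sphere 0 R; K = {z \<in> T. X z \<in> edge_points P}
         in finite K \<and> C1_immersion_up_to (open_annulus r R) (T - K) X) \<and>
        continuous_on (closed_annulus r R) \<nu> \<and>
        (\<forall>z\<in>open_annulus r R. \<nu> z = unit_normal X z) \<and>
        A \<subseteq> P \<and> \<Gamma> \<union> \<Gamma>' \<subseteq> frontier P \<and>
        (\<forall>z\<in>sphere 0 r \<union> sphere 0 R. \<forall>F w.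
            F facet_of P \<and> X z \<in> F \<and> normal_to F w \<longrightarrow> orthogonal (\<nu> z) w))"

text \<open>\<open>A\<close> is the graph of a continuous function over a subset \<open>D\<close> of the plane of \<open>B\<close>; this
  \<open>D\<close> is the orthogonal projection of \<open>A\<close>.\<close>

definition graph_over :: "(real^3) set \<Rightarrow> (real^3) set \<Rightarrow> bool" where
  "graph_over B A \<longleftrightarrow>
     (\<exists>u D f. norm u = 1 \<and> normal_to B u \<and> D \<subseteq> affine hull B \<and> continuous_on D f \<and>
        A = (\<lambda>q. q + f q *\<^sub>R u) ` D)"

text \<open>A planar curve, closed or not, is convex if it is simple and lies on the boundary of a
  two-dimensional convex set of its plane; if it is closed, it is then the whole boundary.\<close>

definition convex_planar_curve :: "(real \<Rightarrow> real^3) \<Rightarrow> bool" where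
  "convex_planar_curve g \<longleftrightarrow> simple_path g \<and>
     (\<exists>K. convex K \<and> aff_dim K = 2 \<and> path_image g \<subseteq> rel_frontier K)"

end

theory Submission
 imports Defs "HOL-Complex_Analysis.Complex_Analysis"
begin

text \<open>
 The surface is found from its Gauss map. Choose coordinates with the base in the plane of height
 \<open>0\<close>, and write \<open>\<epsilon> = \<pi>/n\<close> and \<open>T\<close> for the slope of the lateral faces. A unit vector that is
 not vertical can be written as \<open>(cos \<theta>, sin \<theta>, - sinh t) / cosh t\<close>, and for a normal \<open>\<zeta> = t + \<i>\<theta>\<close> is the
 logarithm of the Gauss map in stereographic projection. Meeting the base orthogonally means \<open>t = 0\<close>;
 meeting the \<open>k\<close>-th lateral face orthogonally means \<open>sinh t = T cos (\<theta> - 2k\<epsilon>)\<close>. A surface of the wanted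
 kind that turns once around the axis should therefore have as Gauss image the region between
 the line \<open>t = 0\<close> and the lowest of these arcs. Its double \<open>S\<close> under \<open>t \<mapsto> - t\<close> is simply connected and
 invariant under conjugation, negation and translation by \<open>2\<i>\<epsilon>\<close>, so uniqueness of normalized Riemann
 maps provides a conformal map \<open>\<psi>\<close> from a strip \<open>\<bar>Re w\<bar> < l\<close> onto \<open>S\<close> with the same symmetries; the half
 strip \<open>0 < Re w < l\<close> is the universal cover of the parameter annulus.

 All boundary curves lie in planes that the surface meets orthogonally, so they are lines of curvature
 (Joachimsthal), and the Hopf differential is real on the boundary. It may be taken to be
 \<open>dw\<^sup>2\<close>, which forces the height differential \<open>dw / \<psi>'\<close> and the null curve with derivative
 \<open>(sinh \<psi>, - \<i> cosh \<psi>, 1) / \<psi>'\<close>. Its real part \<open>X\<close> is minimal with the prescribed normal. The periods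
 vanish by symmetry: a horizontal period would be fixed by a nontrivial rotation, and the
 height is invariant because its complex primitive is imaginary on the imaginary axis. Hence \<open>X\<close> closes up to an annulus
 that is invariant under the rotation by \<open>2\<epsilon>\<close>.

 Three points need work. (1) Boundary regularity. A map that straightens the boundary of \<open>S\<close>
 (a complex Gudermannian function on a side, a power of a Moebius function of \<open>exp\<close> at a
 corner) turns \<open>\<psi>\<close> into a function with real boundary values, to which the reflection principle
 \<open>weak_Schwarz_reflection\<close> applies; the derivative at a
 boundary point is then positive by \<open>deriv_at_real_boundary_pos\<close>. On the sides \<open>\<psi>'\<close> extends
 without zeros, and at a corner it vanishes to an order less than \<open>2/3\<close> (\<open>corner_quarter\<close>), so that
 \<open>1 / \<psi>'\<close> has a primitive that is continuous up to the corner. (2) Embeddedness. On a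
 fundamental rectangle the maximum principle gives the signs of \<open>Re \<psi>'\<close>, \<open>Im \<psi>'\<close> and \<open>Im (\<psi>' / cosh \<psi>)\<close>
 (\<open>DX_key\<close>). These make the components of \<open>X\<close> in the directions of the two symmetry planes and of their
 normals monotone along the coordinate lines, and the height increasing with \<open>Re w\<close>; so the projection to the base is
 injective, every piece stays in its sector, and the linear function defining a face attains its
 maximum exactly on the corresponding boundary arc (\<open>f_inj_mod\<close>, \<open>face_ineq\<close>). (3) Convexity. On each boundary
 curve \<open>\<theta>\<close> increases, and the derivative of the component in the direction of the normal of the surface at a point with angle \<open>\<phi>\<close>
 is a positive multiple of \<open>sin (\<phi> - \<theta>)\<close>; hence the curve has a strictly
 supporting line at each of its points (\<open>base_support\<close>, \<open>face_support\<close>). A final scaling puts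
 the faces at the right height.
\<close>

section \<open>Boundary behaviour of holomorphic functions\<close>

abbreviation "at_upper x \<equiv> at (complex_of_real x) within {z. 0 < Im z}"
abbreviation "full_turn m \<equiv> of_int m * (2 * complex_of_real pi * \<i>)"

text \<open>Only the imaginary part of \<open>F\<close> is assumed to have boundary values, so the classical reflection principle
 does not apply to \<open>F\<close>. It applies to a primitive: as \<open>F\<close> is bounded, its primitive is Lipschitz and
 extends continuously to the diameter, where its imaginary part has derivative \<open>0\<close>. The
 derivative of the reflected primitive extends \<open>F\<close>.\<close>
lemma weak_Schwarz_reflection:
 fixes F :: "complex \<Rightarrow> complex"
 assumes r: "0 < r" and hol: "F holomorphic_on (ball 0 r \<inter> {z. 0 < Im z})"
  and bd: "\<And>z. z \<in> ball 0 r \<Longrightarrow> 0 < Im z \<Longrightarrow> norm (F z) \<le> M"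
  and lim: "\<And>x. \<bar>x\<bar> < r \<Longrightarrow> ((\<lambda>z. Im (F z)) \<longlongrightarrow> 0) (at_upper x)"
 obtains G where "G holomorphic_on ball 0 r"
  "\<And>z. z \<in> ball 0 r \<Longrightarrow> 0 < Im z \<Longrightarrow> G z = F z"
  "\<And>x. \<bar>x\<bar> < r \<Longrightarrow> Im (G (of_real x)) = 0"
proof -
 define U where "U = ball 0 r \<inter> {z::complex. 0 < Im z}"
 have U: "open U" "convex U"
  unfolding U_def by (auto intro!: open_Int convex_Int open_halfspace_Im_gt convex_halfspace_Im_gt)
 obtain P where P: "\<And>z. z \<in> U \<Longrightarrow> (P has_field_derivative F z) (at z)"
  using holomorphic_convex_primitive'[OF U(2,1)] hol U_def by (metis at_within_open U(1))
 have lip: "norm (P z - P w) \<le> M * norm (z - w)" if "z \<in> U" "w \<in> U" for z w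
  by (rule field_differentiable_bound[OF U(2), of P F]) (use P that bd U_def in "auto intro: has_field_derivative_at_within")
 have M: "M \<ge> 0"
  by (rule order_trans[OF norm_ge_zero bd[of "\<i> * of_real (r/2)"]]) (use r in "auto simp: norm_mult")
 have "uniformly_continuous_on U P"
  unfolding uniformly_continuous_on_def
 proof (intro allI impI)
  fix e :: real assume "e > 0"
  then show "\<exists>d>0. \<forall>x\<in>U. \<forall>x'\<in>U. dist x' x < d \<longrightarrow> dist (P x') (P x) < e"
   using lip M
   apply (intro exI[of _ "e / (M+1)"])
   apply (auto simp: dist_norm field_simps)
   by (smt (verit, best) mult_le_cancel_right norm_ge_zero mult.commute zero_less_mult_iff distrib_left)
 qed
 then obtain Q where Qu: "uniformly_continuous_on (closure U) Q" and QP: "\<And>x. x \<in> U \<Longrightarrow> P x = Q x"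
  using uniformly_continuous_on_extension_on_closure by metis
 have Qc: "continuous_on (closure U) Q" by (rule uniformly_continuous_imp_continuous[OF Qu])
 have near: "\<exists>h0>0. \<forall>h. 0 < h \<and> h < h0 \<longrightarrow> of_real x + \<i> * of_real h \<in> U" if "\<bar>x\<bar> < r" for x
 proof -
  have "norm (of_real x + \<i> * of_real h :: complex) < r" if "0 < h" "h < r - \<bar>x\<bar>" for h
  proof -
   have "norm (of_real x + \<i> * of_real h :: complex) \<le> \<bar>x\<bar> + h"
    using norm_triangle_ineq[of "of_real x" "\<i> * of_real h :: complex"] that by (simp add: norm_mult)
   then show ?thesis using that by linarith
  qed
  then show ?thesis using that by (intro exI[of _ "r - \<bar>x\<bar>"]) (auto simp: U_def)
 qed
 have tl: "((\<lambda>h. of_real x + \<i> * of_real h :: complex) \<longlongrightarrow> of_real x) (at_right 0)" for x :: real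
  by (rule tendsto_eq_intros refl)+ (auto simp: at_within_def intro: filterlim_ident)
 have evU: "\<forall>\<^sub>F h in at_right 0. of_real x + \<i> * of_real h \<in> U" if "\<bar>x\<bar> < r" for x
  using near[OF that] unfolding eventually_at_right_field by auto
 have clU: "of_real x \<in> closure U" if "\<bar>x\<bar> < r" for x
 proof (rule Lim_in_closed_set[OF closed_closure _ _ tl])
  show "\<forall>\<^sub>F h in at_right 0. of_real x + \<i> * of_real h \<in> closure U"
   by (rule eventually_mono[OF evU[OF that]]) (use closure_subset in auto)
 qed auto
 have Qlim: "((\<lambda>h. P (of_real x + \<i> * of_real h)) \<longlongrightarrow> Q (of_real x)) (at_right 0)" if "\<bar>x\<bar> < r" for x
 proof -
  have "(Q \<longlongrightarrow> Q (of_real x)) (at (of_real x) within closure U)"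
   using Qc clU[OF that] by (simp add: continuous_on_def)
  moreover have "filterlim (\<lambda>h. of_real x + \<i> * of_real h :: complex) (at (of_real x) within closure U) (at_right 0)"
   unfolding filterlim_at using tl evU[OF that] closure_subset
   by (auto elim!: eventually_mono simp: eventually_at_filter)
  ultimately have "((\<lambda>h. Q (of_real x + \<i> * of_real h)) \<longlongrightarrow> Q (of_real x)) (at_right 0)"
   by (rule filterlim_compose)
  then show ?thesis
   by (rule Lim_transform_eventually) (use evU[OF that] QP in "auto elim!: eventually_mono")
 qed
 define u where "u x = Im (Q (of_real x))" for x :: real
 have der: "(u has_field_derivative 0) (at x)" if x: "x \<in> {-r<..<r}" for x
 proof -
  have "(u has_derivative (*) 0) (at x)"
   unfolding has_derivative_at_alt
  proof (intro conjI allI impI)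
   show "bounded_linear ((*) (0::real))" by (rule bounded_linear_mult_right)
   fix e :: real assume e: "e > 0"
   obtain d where d: "d > 0" and dd: "\<And>z. 0 < Im z \<Longrightarrow> z \<noteq> of_real x \<Longrightarrow> dist z (of_real x) < d \<Longrightarrow> \<bar>Im (F z)\<bar> < e"
   proof -
    have "\<bar>x\<bar> < r" using x by auto
    from lim[OF this] e obtain d where "d > 0" "\<And>z. 0 < Im z \<Longrightarrow> 0 < dist z (of_real x) \<and> dist z (of_real x) < d \<Longrightarrow> dist (Im (F z)) 0 < e"
     unfolding Lim_within by blast
    then show ?thesis by (intro that[of d]) auto
   qed
   define d' where "d' = min d (r - \<bar>x\<bar>) / 2"
   have d': "d' > 0" using d x by (auto simp: d'_def)
   have key: "\<bar>u y - u x\<bar> \<le> e * \<bar>y - x\<bar>" if y: "\<bar>y - x\<bar> < d'" for y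
   proof -
    have "d' \<le> (r - \<bar>x\<bar>) / 2" by (simp add: d'_def)
    then have yr: "\<bar>y\<bar> < r" using y x by (auto simp: abs_if split: if_splits)
    have pt: "of_real s + \<i> * of_real h \<in> U \<and> \<bar>Im (F (of_real s + \<i> * of_real h))\<bar> < e" if "\<bar>s - x\<bar> < d'" "0 < h" "h < d'" for s h
    proof -
     have 1: "norm (of_real s + \<i> * of_real h - of_real x :: complex) \<le> \<bar>s - x\<bar> + h"
     proof -
      have "of_real s + \<i> * of_real h - of_real x = of_real (s - x) + \<i> * (of_real h :: complex)" by simp
      then show ?thesis
       using norm_triangle_ineq[of "of_real (s - x)" "\<i> * of_real h :: complex"] that(2)
       by (simp only: norm_of_real norm_mult norm_ii mult_1 abs_of_pos)
     qed
     have 2: "norm (of_real s + \<i> * of_real h :: complex) \<le> \<bar>s\<bar> + h"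
      using norm_triangle_ineq[of "of_real s" "\<i> * of_real h :: complex"] that by (simp add: norm_mult algebra_simps)
     have "d' \<le> (r - \<bar>x\<bar>) / 2" "d' \<le> d / 2" by (simp_all add: d'_def)
     then have 3: "\<bar>s\<bar> + h < r" "\<bar>s - x\<bar> + h < d" using that by (auto simp: abs_if split: if_splits)
     have "of_real s + \<i> * of_real h \<noteq> (of_real x :: complex)" using that by (auto simp: complex_eq_iff)
     then have "\<bar>Im (F (of_real s + \<i> * of_real h))\<bar> < e"
      using 1 3 that by (intro dd) (auto simp: dist_norm)
     moreover have "of_real s + \<i> * of_real h \<in> U"
      using 2 3 that unfolding U_def by (simp add: mem_ball_0 del: mem_ball)
     ultimately show ?thesis by simp
    qed
    have b: "\<bar>Im (P (of_real y + \<i> * of_real h)) - Im (P (of_real x + \<i> * of_real h))\<bar> \<le> e * \<bar>y - x\<bar>"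
     if h: "0 < h" "h < d'" for h
    proof -
     have "norm ((\<lambda>s. Im (P (of_real s + \<i> * of_real h))) y - (\<lambda>s. Im (P (of_real s + \<i> * of_real h))) x) \<le> e * norm (y - x)"
     proof (rule field_differentiable_bound[of "closed_segment x y" _ "\<lambda>s. Im (F (of_real s + \<i> * of_real h))"])
      fix s assume s: "s \<in> closed_segment x y"
      have sx: "\<bar>s - x\<bar> < d'" using s y by (auto simp: closed_segment_eq_real_ivl split: if_splits)
      note q = pt[OF sx h]
      have "((\<lambda>s. P (of_real s + \<i> * of_real h)) has_vector_derivative (1 * F (of_real s + \<i> * of_real h))) (at s)"
       by (rule field_vector_diff_chain_at[where g=P and f="\<lambda>s. of_real s + \<i> * of_real h", unfolded o_def])
         (auto intro!: derivative_eq_intros P q[THEN conjunct1] simp: has_vector_derivative_def scaleR_conv_of_real)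
      then have "((\<lambda>s. Im (P (of_real s + \<i> * of_real h))) has_vector_derivative Im (1 * F (of_real s + \<i> * of_real h))) (at s)"
       by (rule bounded_linear.has_vector_derivative[OF bounded_linear_Im])
      then show "((\<lambda>s. Im (P (of_real s + \<i> * of_real h))) has_field_derivative Im (F (of_real s + \<i> * of_real h))) (at s within closed_segment x y)"
       by (auto simp: has_real_derivative_iff_has_vector_derivative intro: has_vector_derivative_at_within)
      show "norm (Im (F (of_real s + \<i> * of_real h))) \<le> e" using q by auto
     qed auto
     then show ?thesis by simp
    qed
    have "((\<lambda>h. \<bar>Im (P (of_real y + \<i> * of_real h)) - Im (P (of_real x + \<i> * of_real h))\<bar>) \<longlongrightarrow> \<bar>u y - u x\<bar>) (at_right 0)"
     unfolding u_def using Qlim[of x] Qlim[OF yr] x by (auto intro!: tendsto_intros)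
    then show ?thesis
     by (rule tendsto_upperbound)
       (use b d' in "auto simp: eventually_at_right_field intro!: exI[of _ d']")
   qed
   show "\<exists>d>0. \<forall>y. norm (y - x) < d \<longrightarrow> norm (u y - u x - 0 * (y - x)) \<le> e * norm (y - x)"
    using key d' by (intro exI[of _ d']) auto
  qed
  then show ?thesis by (simp add: has_field_derivative_def)
 qed
 \<comment> \<open>\<open>u\<close> is the imaginary part of the primitive on the diameter; subtracting its value makes the primitive real there.\<close>
 have uc: "u x = u 0" if "\<bar>x\<bar> < r" for x
 proof -
  have "\<exists>c. \<forall>x\<in>{-r<..<r}. u x = c"
   by (rule has_field_derivative_zero_constant, simp, rule has_field_derivative_at_within, rule der)
  then obtain c where "\<forall>x\<in>{-r<..<r}. u x = c" by blast
  then have "u x = c" "u 0 = c" using that r by (auto simp: abs_less_iff)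
  then show ?thesis by simp
 qed
 define H where "H z = Q z - \<i> * of_real (u 0)" for z
 have clos: "ball 0 r \<inter> {z::complex. 0 \<le> Im z} \<subseteq> closure U"
 proof
  fix z :: complex assume z: "z \<in> ball 0 r \<inter> {z. 0 \<le> Im z}"
  show "z \<in> closure U"
  proof (cases "Im z = 0")
   case True
   then have "z = of_real (Re z)" by (simp add: complex_eq_iff)
   moreover have "\<bar>Re z\<bar> < r" using z abs_Re_le_cmod[of z] by auto
   ultimately show ?thesis using clU by metis
  next
   case False then show ?thesis using z closure_subset by (force simp: U_def)
  qed
 qed
 define Hr where "Hr z = (if 0 \<le> Im z then H z else cnj (H (cnj z)))" for z
 have Hr: "Hr holomorphic_on ball 0 r"
  unfolding Hr_def
 proof (rule Schwarz_reflection)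
  have "P holomorphic_on U" using P holomorphic_on_open U(1) by blast
  then have "Q holomorphic_on U" using QP by (auto cong: holomorphic_cong)
  then show "H holomorphic_on (ball 0 r \<inter> {z. 0 < Im z})"
   unfolding H_def U_def by (intro holomorphic_intros)
  show "continuous_on (ball 0 r \<inter> {z. 0 \<le> Im z}) H"
   unfolding H_def by (intro continuous_intros continuous_on_subset[OF Qc clos])
  fix z :: complex assume z: "z \<in> ball 0 r" "z \<in> \<real>"
  then obtain x where x: "z = of_real x" "\<bar>x\<bar> < r" by (auto elim!: Reals_cases)
  show "H z \<in> \<real>" using uc[OF x(2)] x by (auto simp: H_def u_def complex_is_Real_iff)
 qed auto
 define G where "G = deriv Hr"
 have Ghol: "G holomorphic_on ball 0 r" unfolding G_def by (rule holomorphic_deriv[OF Hr]) auto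
 have GF: "G z = F z" if "z \<in> ball 0 r" "0 < Im z" for z
 proof -
  have zU: "z \<in> U" using that by (auto simp: U_def)
  have "(Hr has_field_derivative F z) (at z)"
  proof (rule has_field_derivative_transform_within_open[OF _ U(1) zU])
   show "((\<lambda>w. P w - \<i> * of_real (u 0)) has_field_derivative F z) (at z)"
    by (rule derivative_eq_intros P[OF zU] refl)+ simp
  qed (use QP in "auto simp: Hr_def H_def U_def")
  then show ?thesis unfolding G_def by (rule DERIV_imp_deriv)
 qed
 have "Im (G (of_real x)) = 0" if x: "\<bar>x\<bar> < r" for x
 proof -
  have "isCont G (of_real x)"
   using holomorphic_on_imp_continuous_on[OF Ghol] x by (auto simp: continuous_on_eq_continuous_at)
  then have "((\<lambda>h. Im (G (of_real x + \<i> * of_real h))) \<longlongrightarrow> Im (G (of_real x))) (at_right 0)"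
   by (intro tendsto_intros isCont_tendsto_compose[OF _ tl])
  then have 1: "((\<lambda>h. Im (F (of_real x + \<i> * of_real h))) \<longlongrightarrow> Im (G (of_real x))) (at_right 0)"
   by (rule Lim_transform_eventually) (use evU[OF x] GF U_def in "auto elim!: eventually_mono")
  have "filterlim (\<lambda>h. of_real x + \<i> * of_real h :: complex) (at_upper x) (at_right 0)"
   unfolding filterlim_at using tl by (auto simp: eventually_at_right_field complex_eq_iff intro!: exI[of _ 1])
  from filterlim_compose[OF lim[OF x] this]
  have "((\<lambda>h. Im (F (of_real x + \<i> * of_real h))) \<longlongrightarrow> 0) (at_right 0)" .
  then show ?thesis using tendsto_unique[OF _ 1] by auto
 qed
 then show ?thesis using that Ghol GF by blast
qed

text \<open>If \<open>G - G 0\<close> vanished to order \<open>n \<ge> 2\<close>, its imaginary part would change sign in a half disc, since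
 \<open>Im (c\<^sup>n g)\<close> takes both signs for \<open>c\<close> in the upper half plane. So \<open>n = 1\<close>. This is Hopf's
 boundary lemma for reflected functions.\<close>
lemma deriv_at_real_boundary_pos:
 assumes r: "0 < r" and hol: "G holomorphic_on ball 0 r"
  and re: "\<And>x. \<bar>x\<bar> < r \<Longrightarrow> Im (G (of_real x)) = 0"
  and pos: "\<And>z. z \<in> ball 0 r \<Longrightarrow> 0 < Im z \<Longrightarrow> 0 < Im (G z)"
 shows "Im (deriv G 0) = 0" "0 < Re (deriv G 0)"
proof -
 define f where "f z = G z - G 0" for z
 have fhol: "f holomorphic_on ball 0 r" unfolding f_def by (intro holomorphic_intros hol)
 have imf: "Im (f z) = Im (G z)" for z using re[of 0] r by (simp add: f_def)
 have nc: "\<not> f constant_on ball 0 r"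
 proof
  assume "f constant_on ball 0 r"
  then have "f (\<i> * of_real (r/2)) = f 0" using r by (auto simp: constant_on_def norm_mult)
  moreover have "Im (f (\<i> * of_real (r/2))) > 0" unfolding imf using r by (intro pos) (auto simp: norm_mult)
  ultimately show False using imf[of 0] re[of 0] r by simp
 qed
 have z0: "0 \<in> ball (0::complex) r" and f00: "f 0 = 0" using r by (auto simp: f_def)
 obtain g s n where g: "0 < n" "0 < s" "ball (0::complex) s \<subseteq> ball 0 r" "g holomorphic_on ball 0 s"
   "\<And>w. w \<in> ball 0 s \<Longrightarrow> f w = w^n * g w" "\<And>w. w \<in> ball 0 s \<Longrightarrow> g w \<noteq> 0"
  by (rule holomorphic_factor_zero_nonconstant[OF fhol open_ball connected_ball z0 f00 nc], rule that, (assumption | simp)+)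
 have gc: "isCont g 0"
  using holomorphic_on_imp_continuous_on[OF g(4)] g(2) by (auto simp: continuous_on_eq_continuous_at)
 have tz: "((\<lambda>h. of_real h * c) \<longlongrightarrow> (0::complex)) (at_right 0)" for c
  by (rule tendsto_eq_intros refl)+ (auto simp: at_within_def intro: filterlim_ident)
 have gl: "((\<lambda>h. g (of_real h * c)) \<longlongrightarrow> g 0) (at_right 0)" for c
  using isCont_tendsto_compose[OF gc tz[of c]] .
 have ev: "\<forall>\<^sub>F h in at_right 0. of_real h * c \<in> ball 0 s" for c :: complex
  using topological_tendstoD[OF tz[of c], of "ball 0 s"] g(2) by auto
 have evp: "\<forall>\<^sub>F h in at_right (0::real). 0 < h" by (simp add: eventually_at_filter)
 have rv: "((\<lambda>h. Im (f (of_real h * c)) / h^n) \<longlongrightarrow> Im (c^n * g 0)) (at_right 0)" for c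
 proof (rule Lim_transform_eventually)
  show "((\<lambda>h. Im (c^n * g (of_real h * c))) \<longlongrightarrow> Im (c^n * g 0)) (at_right 0)"
   by (intro tendsto_intros gl)
  show "\<forall>\<^sub>F h in at_right 0. Im (c^n * g (of_real h * c)) = Im (f (of_real h * c)) / h^n"
   using ev[of c] evp
  proof eventually_elim
   case (elim h)
   have "f (of_real h * c) = of_real (h^n) * (c^n * g (of_real h * c))"
    using g(5)[OF elim(1)] by (simp add: power_mult_distrib)
   then have "Im (f (of_real h * c)) = h^n * Im (c^n * g (of_real h * c))"
    by (simp only: times_complex.sel Re_complex_of_real Im_complex_of_real mult_zero_left add_0_right)
   then show ?case using elim(2) by simp
  qed
 qed
 have g0r: "Im (g 0) = 0"
 proof -
  have "((\<lambda>h::real. 0::real) \<longlongrightarrow> Im (1^n * g 0)) (at_right 0)"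
  proof (rule Lim_transform_eventually[OF rv[of 1]], rule eventually_mono[OF ev[of 1]])
   fix h :: real assume "of_real h * 1 \<in> ball (0::complex) s"
   then have "of_real h * 1 \<in> ball (0::complex) r" using g(3) by blast
   then show "Im (f (of_real h * 1)) / h^n = 0" using re[of h] imf by simp
  qed
  then have "0 = Im (1^n * g 0)" by (intro tendsto_unique[OF _ tendsto_const]) simp_all
  then show ?thesis by simp
 qed
 have ge: "0 \<le> Im (c^n * g 0)" if c: "Im c > 0" for c
 proof (rule tendsto_lowerbound[OF rv[of c]])
  show "\<forall>\<^sub>F h in at_right 0. 0 \<le> Im (f (of_real h * c)) / h^n"
   using ev[of c] evp
  proof eventually_elim
   case (elim h)
   have "of_real h * c \<in> ball 0 r" using elim g(3) by auto
   then have "0 < Im (G (of_real h * c))" by (rule pos) (use elim c in auto)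
   then show ?case using elim imf by simp
  qed
 qed auto
 have g0: "g 0 \<noteq> 0" using g by auto
 define a where "a = Re (g 0)"
 have ga: "g 0 = of_real a" "a \<noteq> 0" using g0r g0 by (auto simp: a_def complex_eq_iff)
 have ge2: "0 \<le> a * sin (real n * \<phi>)" if "0 < \<phi>" "\<phi> < pi" for \<phi> :: real
 proof -
  have "Im (cis \<phi> ^ n * g 0) = a * sin (real n * \<phi>)" unfolding ga Complex.DeMoivre by simp
  then show ?thesis using ge[of "cis \<phi>"] that sin_gt_zero[of \<phi>] by simp
 qed
 have "n = 1"
 proof (rule ccontr)
  assume "n \<noteq> 1"
  then have n2: "real n \<ge> 2" using g(1) by simp
  show False
  proof (cases "a > 0")
   case True
   have "0 \<le> a * sin (n * (3*pi/(2*n)))"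
    using n2 by (intro ge2) (auto simp: field_simps)
   also have "real n * (3*pi/(2*n)) = 3*pi/2" using n2 by (simp add: field_simps)
   also have "sin (3*pi/2) = -1" by (metis mult.commute sin_3over2_pi times_divide_eq_left times_divide_eq_right)
   finally show False using True by simp
  next
   case False
   have "0 \<le> a * sin (n * (pi/(2*n)))"
    using n2 by (intro ge2) (auto simp: field_simps)
   also have "real n * (pi/(2*n)) = pi/2" using n2 by (simp add: field_simps)
   finally show False using False ga by simp
  qed
 qed
 have "(f has_field_derivative (1 * g 0 + deriv g 0 * 0)) (at 0)"
 proof (rule has_field_derivative_transform_within_open[of "\<lambda>w. w * g w" _ _ "ball 0 s"])
  have "(g has_field_derivative deriv g 0) (at 0)"
   using g by (intro holomorphic_derivI[OF g(4)]) auto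
  then show "((\<lambda>w. w * g w) has_field_derivative 1 * g 0 + deriv g 0 * 0) (at 0)"
   by (auto intro!: derivative_eq_intros)
 qed (use g \<open>n = 1\<close> in auto)
 then have "(f has_field_derivative g 0) (at 0)" by simp
 then have "((\<lambda>z. f z + G 0) has_field_derivative g 0) (at 0)" by (auto intro!: derivative_eq_intros)
 then have dG: "deriv G 0 = g 0" unfolding f_def by (auto intro: DERIV_imp_deriv)
 show "Im (deriv G 0) = 0" using dG g0r by simp
 have "a \<ge> 0" using ge2[of "pi/2"] \<open>n = 1\<close> by simp
 then show "0 < Re (deriv G 0)" using dG ga by simp
qed

lemma normalized_Riemann_map:
 assumes S: "open S" "simply_connected S" "S \<noteq> UNIV" and a: "a \<in> S"
 obtains f where "f holomorphic_on S" "inj_on f S" "f ` S = ball 0 1" "f a = 0"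
  "Im (deriv f a) = 0" "0 < Re (deriv f a)"
proof -
 have "\<exists>f g. f holomorphic_on S \<and> g holomorphic_on ball 0 1 \<and>
      (\<forall>z \<in> S. f z \<in> ball 0 1 \<and> g(f z) = z) \<and> (\<forall>z \<in> ball 0 1. g z \<in> S \<and> f(g z) = z)"
  using Riemann_mapping_theorem[of S] S a by (metis emptyE)
 then obtain f g where fg: "f holomorphic_on S" "g holomorphic_on ball 0 1"
   "\<And>z. z \<in> S \<Longrightarrow> f z \<in> ball 0 1 \<and> g (f z) = z" "\<And>z. z \<in> ball 0 1 \<Longrightarrow> g z \<in> S \<and> f (g z) = z"
  by blast
 obtain h k where hk: "h (f a) = 0" "h holomorphic_on ball 0 1" "h ` ball 0 1 \<subseteq> ball 0 1"
   "k holomorphic_on ball 0 1" "k ` ball 0 1 \<subseteq> ball 0 1"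
   "\<And>z. z \<in> ball 0 1 \<Longrightarrow> h (k z) = z" "\<And>z. z \<in> ball 0 1 \<Longrightarrow> k (h z) = z"
  using fg(3)[OF a] by (blast intro: ball_biholomorphism_exists[of "f a" thesis])
 define F where "F = h \<circ> f"
 have Fh: "F holomorphic_on S" unfolding F_def
  by (rule holomorphic_on_compose_gen[OF fg(1) hk(2)]) (use fg in auto)
 have inv: "g (k (F z)) = z" if "z \<in> S" for z using fg(3)[OF that] hk by (simp add: F_def)
 then have Finj: "inj_on F S" by (intro inj_on_inverseI[where g="g \<circ> k"]) simp
 have Fim: "F ` S = ball 0 1"
 proof
  show "F ` S \<subseteq> ball 0 1" using fg hk by (auto simp: F_def)
  show "ball 0 1 \<subseteq> F ` S"
  proof
   fix z :: complex assume z: "z \<in> ball 0 1"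
   then have "F (g (k z)) = z" "g (k z) \<in> S" using fg hk by (auto simp: F_def image_subset_iff)
   then show "z \<in> F ` S" by force
  qed
 qed
 have d: "deriv F a \<noteq> 0" by (rule holomorphic_injective_imp_regular[OF Fh S(1) Finj a])
 define c where "c = of_real (norm (deriv F a)) / deriv F a"
 have nc: "norm c = 1" using d by (simp add: c_def norm_divide)
 show thesis
 proof (rule that)
  show "(\<lambda>z. c * F z) holomorphic_on S" by (intro holomorphic_intros Fh)
  show "inj_on (\<lambda>z. c * F z) S" using Finj nc by (auto simp: inj_on_def)
  show "(\<lambda>z. c * F z) ` S = ball 0 1"
  proof
   show "(\<lambda>z. c * F z) ` S \<subseteq> ball 0 1" using Fim nc by (auto simp: norm_mult)
   show "ball 0 1 \<subseteq> (\<lambda>z. c * F z) ` S"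
   proof
    fix z :: complex assume "z \<in> ball 0 1"
    then have "z / c \<in> F ` S" using Fim nc by (simp add: norm_divide)
    then obtain x where "x \<in> S" "F x = z / c" by auto
    then show "z \<in> (\<lambda>z. c * F z) ` S" using nc by (intro image_eqI[of _ _ x]) auto
   qed
  qed
  show "c * F a = 0" using hk by (simp add: F_def)
  have "((\<lambda>z. c * F z) has_field_derivative c * deriv F a) (at a)"
   by (rule DERIV_cmult[OF holomorphic_derivI[OF Fh S(1) a]])
  then have "deriv (\<lambda>z. c * F z) a = of_real (norm (deriv F a))" using d by (simp add: DERIV_imp_deriv c_def)
  then show "Im (deriv (\<lambda>z. c * F z) a) = 0" "0 < Re (deriv (\<lambda>z. c * F z) a)" using d by auto
 qed
qed

lemma normalized_Riemann_map_unique: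
 assumes S: "open S" "a \<in> S"
  and f: "f holomorphic_on S" "inj_on f S" "f ` S = ball 0 1" "f a = 0"
  and g: "g holomorphic_on S" "inj_on g S" "g ` S = ball 0 1" "g a = 0"
  and c: "0 < c" "deriv f a = of_real c * deriv g a"
  and z: "z \<in> S"
 shows "f z = g z"
proof -
 have half: "norm (deriv (f \<circ> h) 0) \<le> 1 \<and> (f \<circ> h) holomorphic_on ball 0 1 \<and> (\<forall>z. norm z < 1 \<longrightarrow> norm ((f \<circ> h) z) < 1)
   \<and> deriv (f \<circ> h) 0 = deriv f a / deriv g a"
  if f: "f holomorphic_on S" "f ` S = ball 0 1" "f a = 0"
   and g: "inj_on g S" "g ` S = ball 0 1" "g a = 0"
   and h: "h holomorphic_on ball 0 1" "\<And>z. z \<in> S \<Longrightarrow> deriv g z * deriv h (g z) = 1" "\<And>z. z \<in> S \<Longrightarrow> h (g z) = z"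
  for f g h
 proof -
  have hS: "h w \<in> S" if "w \<in> ball 0 1" for w using that h g by (metis imageE)
  have hol: "(f \<circ> h) holomorphic_on ball 0 1"
   by (rule holomorphic_on_compose_gen[OF h(1) f(1)]) (use hS in auto)
  have lt: "norm ((f \<circ> h) w) < 1" if "norm w < 1" for w
  proof -
   have "f (h w) \<in> ball 0 1" using hS[of w] f(2) that by auto
   then show ?thesis by simp
  qed
  have h0: "h 0 = a" using h(3)[OF S(2)] g(3) by simp
  have "norm (deriv (f \<circ> h) 0) \<le> 1"
   by (rule Schwarz_Lemma(2)[OF hol _ lt, of 0]) (use h0 f in auto)
  moreover have "deriv (f \<circ> h) 0 = deriv f a * deriv h 0"
  proof -
   have "((f \<circ> h) has_field_derivative deriv f (h 0) * deriv h 0) (at 0)"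
    by (rule DERIV_chain) (use h0 holomorphic_derivI[OF f(1) S] holomorphic_derivI[OF h(1)] in auto)
   then show ?thesis using h0 by (simp add: DERIV_imp_deriv)
  qed
  moreover have "deriv h 0 = 1 / deriv g a"
   using h(2)[OF S(2)] g(3) by (metis mult_zero_left nonzero_eq_divide_eq mult.commute zero_neq_one)
  ultimately show ?thesis using hol lt by auto
 qed
 obtain h where h: "h holomorphic_on ball 0 1" "\<And>z. z \<in> S \<Longrightarrow> deriv g z * deriv h (g z) = 1" "\<And>z. z \<in> S \<Longrightarrow> h (g z) = z"
  using holomorphic_has_inverse[OF g(1) S(1) g(2)] g(3) by metis
 obtain k where k: "k holomorphic_on ball 0 1" "\<And>z. z \<in> S \<Longrightarrow> deriv f z * deriv k (f z) = 1" "\<And>z. z \<in> S \<Longrightarrow> k (f z) = z"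
  using holomorphic_has_inverse[OF f(1) S(1) f(2)] f(3) by metis
 note H = half[OF f(1,3,4) g(2,3,4) h]
 note K = half[OF g(1,3,4) f(2,3,4) k]
 have nz: "deriv g a \<noteq> 0" "deriv f a \<noteq> 0"
  using holomorphic_injective_imp_regular S f g by blast+
 have dc: "deriv (f \<circ> h) 0 = of_real c" using H c nz by simp
 have "deriv (g \<circ> k) 0 = of_real (1 / c)" using K c nz by simp
 moreover have "norm (deriv (f \<circ> h) 0) \<le> 1" "norm (deriv (g \<circ> k) 0) \<le> 1" using H K by blast+
 ultimately have "c \<le> 1" "1 / c \<le> 1" using dc c(1) by (simp_all add: norm_divide)
 then have c1: "c = 1" using c(1) by (simp add: field_simps)
 have h0: "h 0 = a" using h(3)[OF S(2)] g(4) by simp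
 have "\<exists>\<alpha>. (\<forall>z. norm z < 1 \<longrightarrow> (f \<circ> h) z = \<alpha> * z) \<and> norm \<alpha> = 1"
 proof (rule Schwarz_Lemma(3)[of "f \<circ> h" 0])
  show "(f \<circ> h) 0 = 0" using h0 f(4) by simp
  show "(\<exists>z. norm z < 1 \<and> z \<noteq> 0 \<and> norm ((f \<circ> h) z) = norm z) \<or> norm (deriv (f \<circ> h) 0) = 1"
   using dc c1 by simp
 qed (use H in auto)
 then obtain \<alpha> where al: "\<And>z. norm z < 1 \<Longrightarrow> (f \<circ> h) z = \<alpha> * z" by blast
 have "((f \<circ> h) has_field_derivative \<alpha>) (at 0)"
  by (rule has_field_derivative_transform_within_open[of "\<lambda>z. \<alpha> * z" _ _ "ball 0 1"])
    (auto intro!: derivative_eq_intros simp: al[symmetric])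
 then have "\<alpha> = 1" using dc c1 DERIV_imp_deriv by fastforce
 moreover have "norm (g z) < 1" using g(3) z by auto
 ultimately show ?thesis using al[of "g z"] h(3)[OF z] by simp
qed

lemma at_within_ne_bot_of_closure:
 fixes w :: complex
 assumes "open U" "w \<in> closure U" shows "at w within U \<noteq> bot"
proof -
 have "w islimpt U"
  using assms unfolding closure_def by (auto intro: interior_limit_point simp: interior_open)
 then show ?thesis by (simp add: trivial_limit_within)
qed

text \<open>Boundary values. At points without a limit the value is arbitrary.\<close>
definition lext :: "complex set \<Rightarrow> (complex \<Rightarrow> complex) \<Rightarrow> complex \<Rightarrow> complex" where
 "lext U f w = Lim (at w within U) f"

lemma lext_eq:
 assumes "open U" "w \<in> closure U" "(f \<longlongrightarrow> L) (at w within U)"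
 shows "lext U f w = L"
 unfolding lext_def by (rule tendsto_Lim[OF at_within_ne_bot_of_closure[OF assms(1,2)] assms(3)])

lemma lext_tendsto:
 assumes "open U" "w \<in> closure U" "\<exists>L. (f \<longlongrightarrow> L) (at w within U)"
 shows "(f \<longlongrightarrow> lext U f w) (at w within U)"
 using assms lext_eq by metis

lemma continuous_on_lext:
 assumes U: "open U" and f: "continuous_on U f" and S: "S \<subseteq> closure U"
  and lim: "\<And>w. w \<in> S \<Longrightarrow> \<exists>L. (f \<longlongrightarrow> L) (at w within U)"
 shows "continuous_on S (lext U f)"
 unfolding continuous_on_iff
proof (intro ballI allI impI)
 fix w e assume w: "w \<in> S" and e: "(0::real) < e"
 have fl: "(f \<longlongrightarrow> lext U f v) (at v within U)" if "v \<in> S" for v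
  using lext_tendsto[OF U _ lim] that S by blast
 obtain d where d: "d > 0" "\<And>u. u \<in> U \<Longrightarrow> u \<noteq> w \<Longrightarrow> dist u w < d \<Longrightarrow> dist (f u) (lext U f w) < e/2"
  using fl[OF w] e unfolding Lim_within by (metis half_gt_zero dist_pos_lt)
 show "\<exists>d>0. \<forall>x'\<in>S. dist x' w < d \<longrightarrow> dist (lext U f x') (lext U f w) < e"
 proof (intro exI[of _ d] conjI ballI impI d(1))
  fix v assume v: "v \<in> S" "dist v w < d"
  show "dist (lext U f v) (lext U f w) < e"
  proof (cases "v = w")
   case False
   have "dist (lext U f v) (lext U f w) \<le> e/2"
   proof (rule tendsto_upperbound)
    show "((\<lambda>u. dist (f u) (lext U f w)) \<longlongrightarrow> dist (lext U f v) (lext U f w)) (at v within U)"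
     by (intro tendsto_intros fl v)
    have "\<forall>\<^sub>F u in nhds v. u \<in> ball w d - {w}"
     by (rule eventually_nhds_in_open) (use v False in "auto simp: dist_commute")
    then show "\<forall>\<^sub>F u in at v within U. dist (f u) (lext U f w) \<le> e/2"
     unfolding eventually_at_filter
     by eventually_elim (use d(2) in "force simp: dist_commute")
    show "at v within U \<noteq> bot" using v S U by (intro at_within_ne_bot_of_closure) auto
   qed
   then show ?thesis using e by simp
  qed (use e in auto)
 qed
qed

text \<open>Convexity of the domain turns the limit of the derivative into an arbitrarily small Lipschitz constant for
 \<open>F w - D w0 * w\<close> near \<open>w0\<close>, which passes to the closure.\<close>
lemma has_field_derivative_extends:
 fixes F D :: "complex \<Rightarrow> complex"
 assumes U: "open U" "convex U" and S: "U \<subseteq> S" "S \<subseteq> closure U"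
  and F: "continuous_on S F" and der: "\<And>w. w \<in> U \<Longrightarrow> (F has_field_derivative D w) (at w)"
  and w0: "w0 \<in> S" and D: "(D \<longlongrightarrow> D w0) (at w0 within U)"
 shows "(F has_field_derivative D w0) (at w0 within S)"
 unfolding has_field_derivative_def has_derivative_within_alt
proof (intro conjI allI impI)
 show "bounded_linear ((*) (D w0))" by (rule bounded_linear_mult_right)
 fix e :: real assume e: "e > 0"
 obtain d where d: "d > 0" "\<And>u. u \<in> U \<Longrightarrow> dist u w0 < d \<Longrightarrow> norm (D u - D w0) \<le> e"
  using D e unfolding Lim_within dist_norm
  by (metis dist_norm dist_pos_lt less_imp_le norm_zero right_minus_eq)
 define B where "B = U \<inter> ball w0 d"
 have B: "open B" "convex B" using U by (auto simp: B_def convex_Int)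
 define G where "G w = F w - D w0 * w" for w
 have lip: "norm (G x - G y) \<le> e * norm (x - y)" if "x \<in> B" "y \<in> B" for x y
 proof (rule field_differentiable_bound[OF B(2)])
  fix w assume w: "w \<in> B"
  show "(G has_field_derivative (D w - D w0)) (at w within B)"
   unfolding G_def
   by (rule derivative_eq_intros has_field_derivative_at_within[OF der] refl | use w in "simp add: B_def")+
  show "norm (D w - D w0) \<le> e" using w d by (auto simp: B_def dist_commute)
 qed (use that in auto)
 have Gc: "(G \<longlongrightarrow> G w) (at w within B)" if "w \<in> S" for w
 proof -
  have "(F \<longlongrightarrow> F w) (at w within B)"
   using F that S(1) by (auto simp: continuous_on_def B_def intro: tendsto_within_subset)
  then show ?thesis unfolding G_def by (intro tendsto_intros)
 qed
 have cl: "w \<in> closure B" if "w \<in> S" "dist w w0 < d" for w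
  unfolding B_def using open_Int_closure_subset[of "ball w0 d" U] that S(2) by (auto simp: dist_commute Int_commute)
 have lip2: "norm (G x - G y) \<le> e * norm (x - y)" if x: "x \<in> S" "dist x w0 < d" and y: "y \<in> B" for x y
 proof (rule tendsto_le[OF at_within_ne_bot_of_closure[OF B(1) cl[OF x]]])
  show "((\<lambda>u. norm (G u - G y)) \<longlongrightarrow> norm (G x - G y)) (at x within B)" by (intro tendsto_intros Gc x)
  show "((\<lambda>u. e * norm (u - y)) \<longlongrightarrow> e * norm (x - y)) (at x within B)" by (intro tendsto_intros)
  show "\<forall>\<^sub>F u in at x within B. norm (G u - G y) \<le> e * norm (u - y)"
   using lip y by (auto simp: eventually_at_filter)
 qed
 have lip3: "norm (G x - G y) \<le> e * norm (x - y)" if x: "x \<in> S" "dist x w0 < d" and y: "y \<in> S" "dist y w0 < d" for x y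
 proof (rule tendsto_le[OF at_within_ne_bot_of_closure[OF B(1) cl[OF y]]])
  show "((\<lambda>u. norm (G x - G u)) \<longlongrightarrow> norm (G x - G y)) (at y within B)" by (intro tendsto_intros Gc y)
  show "((\<lambda>u. e * norm (x - u)) \<longlongrightarrow> e * norm (x - y)) (at y within B)" by (intro tendsto_intros)
  show "\<forall>\<^sub>F u in at y within B. norm (G x - G u) \<le> e * norm (x - u)"
   using lip2[OF x] by (auto simp: eventually_at_filter)
 qed
 show "\<exists>d>0. \<forall>y\<in>S. norm (y - w0) < d \<longrightarrow> norm (F y - F w0 - D w0 * (y - w0)) \<le> e * norm (y - w0)"
  using lip3[OF _ _ w0] d(1) by (intro exI[of _ d]) (auto simp: G_def dist_norm algebra_simps)
qed

text \<open>The substitution \<open>w = w0 - v\<^sup>3\<close> absorbs the singularity \<open>\<bar>w - w0\<bar> powr (- 2/3)\<close>: the composed function has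
 bounded derivative on a convex sector of opening angle \<open>\<pi>/3\<close>, whose cube is the half plane.\<close>
lemma limit_of_bounded_singular_derivative:
 fixes F :: "complex \<Rightarrow> complex"
 assumes r: "0 < r" and l: "Re w0 = l"
  and der: "\<And>w. Re w < l \<Longrightarrow> dist w w0 < r \<Longrightarrow> (F has_field_derivative D w) (at w)"
  and bd: "\<And>w. Re w < l \<Longrightarrow> dist w w0 < r \<Longrightarrow> norm (D w) * norm (w - w0) powr (2/3) \<le> C"
 shows "\<exists>L. (F \<longlongrightarrow> L) (at w0 within {w. Re w < l})"
proof -
 define V where "V = {v::complex. sqrt 3 * \<bar>Im v\<bar> < Re v}"
 define r1 where "r1 = min 1 r"
 have r1: "0 < r1" "r1 \<le> 1" "r1 \<le> r" using r by (auto simp: r1_def)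
 define B where "B = V \<inter> ball 0 r1"
 have Vconv: "convex V"
 proof -
  have "V = {v. (Complex (-1) (sqrt 3)) \<bullet> v < 0} \<inter> {v. (Complex (-1) (- sqrt 3)) \<bullet> v < 0}"
   by (auto simp: V_def inner_complex_def abs_if split: if_splits)
     (smt (verit, best) real_sqrt_ge_zero mult_nonneg_nonneg mult_nonneg_nonpos)+
  then show ?thesis by (auto intro!: convex_Int convex_halfspace_lt)
 qed
 have cube: "Re (v^3) > 0" if "v \<in> V" for v
 proof -
  have x: "Re v > 0" using that by (auto simp: V_def) (smt (verit, best) real_sqrt_ge_zero mult_nonneg_nonneg)
  have "(sqrt 3 * \<bar>Im v\<bar>)^2 < (Re v)^2"
   by (rule power_strict_mono) (use that in "auto simp: V_def")
  then have "3 * (Im v)^2 < (Re v)^2" by (simp add: power_mult_distrib)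
  moreover have "Re (v^3) = Re v * ((Re v)^2 - 3 * (Im v)^2)"
   by (simp add: power3_eq_cube power2_eq_square algebra_simps)
  ultimately show ?thesis using x by simp
 qed
 have Bp: "Re (w0 - v^3) < l" "dist (w0 - v^3) w0 < r" if "v \<in> B" for v
 proof -
  show "Re (w0 - v^3) < l" using cube[of v] that l by (simp add: B_def)
  have "norm v ^ 3 \<le> norm v" using power_decreasing[of 1 3 "norm v"] that r1 by (auto simp: B_def)
  then show "dist (w0 - v^3) w0 < r" using that r1 by (auto simp: B_def dist_norm norm_power)
 qed
 have lip: "norm (F (w0 - x^3) - F (w0 - y^3)) \<le> (3 * C) * norm (x - y)" if xy: "x \<in> B" "y \<in> B" for x y
 proof (rule field_differentiable_bound[of B "\<lambda>v. F (w0 - v^3)" "\<lambda>v. D (w0 - v^3) * (- 3 * v^2)"])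
  show "convex B" unfolding B_def using Vconv by (auto intro: convex_Int)
  fix v assume v: "v \<in> B"
  have "((\<lambda>v. F (w0 - v^3)) has_field_derivative D (w0 - v^3) * (- 3 * v^2)) (at v)"
   by (rule DERIV_chain2[where g="\<lambda>v. w0 - v^3", OF der[OF Bp[OF v]]]) (auto intro!: derivative_eq_intros)
  then show "((\<lambda>v. F (w0 - v^3)) has_field_derivative D (w0 - v^3) * (- 3 * v^2)) (at v within B)"
   by (rule has_field_derivative_at_within)
  have vn: "norm v > 0" using v by (auto simp: B_def V_def)
  have "norm (w0 - v^3 - w0) powr (2/3) = norm v ^ 2"
  proof -
   have "norm (w0 - v^3 - w0) = norm v powr 3" using vn by (simp add: norm_power)
   then have "norm (w0 - v^3 - w0) powr (2/3) = norm v powr (3 * (2/3))" by (simp only: powr_powr)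
   then show ?thesis using vn by simp
  qed
  then have "norm (D (w0 - v^3)) * norm v ^2 \<le> C" using bd[OF Bp[OF v]] by simp
  then show "norm (D (w0 - v^3) * (- 3 * v^2)) \<le> 3 * C" by (simp add: norm_mult norm_power)
 qed (use xy in auto)
 have root: "\<exists>v\<in>B. w = w0 - v^3 \<and> norm v = norm (w0 - w) powr (1/3)" if w: "Re w < l" "norm (w0 - w) < r1^3" for w
 proof -
  define z where "z = w0 - w"
  have z: "Re z > 0" "z \<noteq> 0" using w l by (auto simp: z_def)
  define v where "v = exp (Ln z / 3)"
  have a: "\<bar>Im (Ln z)\<bar> < pi/2" using Re_Ln_pos_lt[OF z(2)] z by simp
  have nv: "norm v = norm z powr (1/3)" using z by (simp add: v_def powr_def)
  have v3: "v^3 = z" using z by (simp add: v_def flip: exp_of_nat_mult)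
  define \<alpha> where "\<alpha> = Im (Ln z) / 3"
  have al: "\<bar>\<alpha>\<bar> < pi/6" using a by (simp add: \<alpha>_def)
  have "sqrt 3 * sin \<bar>\<alpha>\<bar> < cos \<bar>\<alpha>\<bar>"
  proof -
   have "sin \<bar>\<alpha>\<bar> < sin (pi/6)" using al by (intro sin_monotone_2pi) auto
   moreover have "cos (pi/6) < cos \<bar>\<alpha>\<bar>" using al by (intro cos_monotone_0_pi) auto
   moreover have "sqrt 3 * sin (pi/6) = cos (pi/6)" by (simp add: sin_30 cos_30)
   moreover have "sqrt 3 * sin \<bar>\<alpha>\<bar> < sqrt 3 * sin (pi/6)"
    by (rule mult_strict_left_mono[OF calculation(1)]) simp
   ultimately show ?thesis by linarith
  qed
  moreover have "sin \<bar>\<alpha>\<bar> = \<bar>sin \<alpha>\<bar>" using al proof (cases "\<alpha> \<ge> 0")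
   case True then show ?thesis using al sin_ge_zero[of \<alpha>] by simp
  next
   case False then show ?thesis using al sin_ge_zero[of "-\<alpha>"] by simp
  qed
  ultimately have s: "sqrt 3 * \<bar>sin \<alpha>\<bar> < cos \<alpha>" by simp
  have "Re v = norm v * cos \<alpha>" "Im v = norm v * sin \<alpha>" by (simp_all add: v_def Re_exp Im_exp \<alpha>_def)
  moreover have "norm v > 0" by (simp add: v_def)
  ultimately have "v \<in> V" using s
   by (auto simp: V_def abs_mult mult.left_commute[of "sqrt 3"])
  moreover have "norm v < r1"
  proof (rule ccontr)
   assume "\<not> norm v < r1"
   then have "r1^3 \<le> norm v ^3" using r1 by (intro power_mono) auto
   also have "\<dots> = norm z" using v3 by (simp flip: norm_power)
   finally show False using w by (simp add: z_def)
  qed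
  ultimately show ?thesis using v3 nv by (intro bexI[of _ v]) (auto simp: B_def z_def)
 qed
 have osc: "norm (F w - F w') \<le> (3 * \<bar>C\<bar>) * (norm (w0 - w) powr (1/3) + norm (w0 - w') powr (1/3))"
  if w: "Re w < l" "norm (w0 - w) < r1^3" "Re w' < l" "norm (w0 - w') < r1^3" for w w'
 proof -
  obtain v v' where v: "v \<in> B" "w = w0 - v^3" "norm v = norm (w0 - w) powr (1/3)"
    "v' \<in> B" "w' = w0 - v'^3" "norm v' = norm (w0 - w') powr (1/3)"
   using root[OF w(1,2)] root[OF w(3,4)] by blast
  have "norm (F w - F w') \<le> (3 * C) * norm (v - v')" using lip[of v v'] v by simp
  also have "\<dots> \<le> (3 * \<bar>C\<bar>) * norm (v - v')" by (intro mult_right_mono) auto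
  also have "\<dots> \<le> (3 * \<bar>C\<bar>) * (norm v + norm v')" by (intro mult_left_mono norm_triangle_ineq4) auto
  finally show ?thesis using v by simp
 qed
 have small: "\<exists>\<delta>>0. \<forall>w. norm (w0 - w) < \<delta> \<longrightarrow> norm (w0 - w) < r1^3 \<and> (3 * \<bar>C\<bar>) * (norm (w0 - w) powr (1/3)) < e" if e: "e > 0" for e :: real
 proof -
  define \<eta> where "\<eta> = e / (3 * \<bar>C\<bar> + 1)"
  have eta: "\<eta> > 0" using e by (simp add: \<eta>_def add_nonneg_pos)
  have "(3 * \<bar>C\<bar>) * (norm (w0 - w) powr (1/3)) < e" if "norm (w0 - w) < \<eta> ^ 3" for w
  proof -
   have "norm (w0 - w) powr (1/3) \<le> (\<eta> powr 3) powr (1/3)"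
    by (rule powr_mono2) (use that eta in auto)
   also have "\<dots> = \<eta> powr (3 * (1/3))" by (simp only: powr_powr)
   also have "\<dots> = \<eta>" using eta by simp
   finally have "norm (w0 - w) powr (1/3) \<le> \<eta>" .
   then have "(3 * \<bar>C\<bar>) * (norm (w0 - w) powr (1/3)) \<le> (3 * \<bar>C\<bar>) * \<eta>" by (intro mult_left_mono) auto
   also have "\<dots> < (3 * \<bar>C\<bar> + 1) * \<eta>" using eta by (simp add: distrib_right)
   also have "\<dots> = e" using e by (simp add: \<eta>_def)
   finally show ?thesis .
  qed
  then show ?thesis using eta r1 by (intro exI[of _ "min (r1^3) (\<eta>^3)"]) auto
 qed
 define \<phi> where "\<phi> k = w0 - of_real (inverse (real (Suc k)))" for k
 have ph: "Re (\<phi> k) < l" "norm (w0 - \<phi> k) = inverse (real (Suc k))" for k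
  using l by (auto simp: \<phi>_def simp del: of_real_inverse)
 have phs: "\<exists>N. \<forall>k\<ge>N. norm (w0 - \<phi> k) < \<delta>" if "\<delta> > 0" for \<delta>
  using LIMSEQ_inverse_real_of_nat that unfolding LIMSEQ_iff ph by auto
 have "Cauchy (\<lambda>k. F (\<phi> k))"
 proof (rule CauchyI)
  fix e :: real assume e: "e > 0"
  obtain d where d: "d > 0" "\<And>w. norm (w0 - w) < d \<Longrightarrow> norm (w0 - w) < r1^3 \<and> (3 * \<bar>C\<bar>) * (norm (w0 - w) powr (1/3)) < e/2"
   using small[of "e/2"] e by auto
  obtain N where N: "\<And>k. k \<ge> N \<Longrightarrow> norm (w0 - \<phi> k) < d" using phs[OF d(1)] by auto
  have "norm (F (\<phi> m) - F (\<phi> k)) < e" if "m \<ge> N" "k \<ge> N" for m k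
   using osc[OF ph(1)[of m] _ ph(1)[of k]] d(2)[OF N[OF that(1)]] d(2)[OF N[OF that(2)]] by (auto simp: distrib_left)
  then show "\<exists>M. \<forall>m\<ge>M. \<forall>n\<ge>M. norm (F (\<phi> m) - F (\<phi> n)) < e" by blast
 qed
 then obtain L where L: "(\<lambda>k. F (\<phi> k)) \<longlonglongrightarrow> L" by (auto simp: Cauchy_convergent_iff convergent_def)
 have "(F \<longlongrightarrow> L) (at w0 within {w. Re w < l})"
  unfolding Lim_within
 proof (intro allI impI)
  fix e :: real assume e: "e > 0"
  obtain d where d: "d > 0" "\<And>w. norm (w0 - w) < d \<Longrightarrow> norm (w0 - w) < r1^3 \<and> (3 * \<bar>C\<bar>) * (norm (w0 - w) powr (1/3)) < e/3"
   using small[of "e/3"] e by auto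
  obtain N where N: "\<And>k. k \<ge> N \<Longrightarrow> norm (w0 - \<phi> k) < d" using phs[OF d(1)] by auto
  obtain N2 where N2: "\<And>k. k \<ge> N2 \<Longrightarrow> norm (F (\<phi> k) - L) < e/3"
   using L e unfolding LIMSEQ_iff by (metis divide_pos_pos zero_less_numeral)
  define k where "k = max N N2"
  have "dist (F w) L < e" if w: "Re w < l" "dist w w0 < d" for w
  proof -
   have wd: "norm (w0 - w) < d" using w by (simp add: dist_norm norm_minus_commute)
   have 1: "norm (F w - F (\<phi> k)) < e/3 + e/3"
    using osc[OF w(1) _ ph(1)[of k]] d(2)[OF wd] d(2)[OF N[of k]] by (auto simp: distrib_left k_def)
   have 2: "norm (F (\<phi> k) - L) < e/3" by (rule N2) (simp add: k_def)
   have "norm (F w - L) \<le> norm (F w - F (\<phi> k)) + norm (F (\<phi> k) - L)" using norm_triangle_ineq[of "F w - F (\<phi> k)" "F (\<phi> k) - L"] by simp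
   then show ?thesis using 1 2 by (simp add: dist_norm)
  qed
  then show "\<exists>d>0. \<forall>x\<in>{w. Re w < l}. 0 < dist x w0 \<and> dist x w0 < d \<longrightarrow> dist (F x) L < e"
   using d(1) by blast
 qed
 then show ?thesis by blast
qed

section \<open>The Gauss image and its conformal map onto a strip\<close>

definition disc_of_strip :: "complex \<Rightarrow> complex" where
 "disc_of_strip w = - \<i> * (exp (\<i> * w) - 1) / (exp (\<i> * w) + 1)"

definition strip_of_disc :: "complex \<Rightarrow> complex" where
 "strip_of_disc z = - \<i> * Ln ((1 + \<i> * z) / (1 - \<i> * z))"

abbreviation "std_strip \<equiv> {w::complex. \<bar>Re w\<bar> < pi/2}"

lemma open_vertical_strip: "open {w::complex. \<bar>Re w\<bar> < l}"
 by (intro open_Collect_less continuous_intros)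

lemma convex_vertical_strip: "convex {w::complex. \<bar>Re w\<bar> < l}"
proof -
 have "{w::complex. \<bar>Re w\<bar> < l} = {w. Re w < l} \<inter> {w. Re w > - l}" by auto
 then show ?thesis using convex_halfspace_Re_lt convex_halfspace_Re_gt by (auto intro: convex_Int)
qed

lemma Re_exp_i_pos: "\<bar>Re w\<bar> < pi/2 \<Longrightarrow> 0 < Re (exp (\<i> * w))"
 by (auto simp: Re_exp intro!: mult_pos_pos cos_gt_zero_pi)

lemma norm_cayley_less_1:
 assumes "0 < Re e" shows "norm ((e - 1) / (e + 1)) < 1"
proof -
 have "e + 1 \<noteq> 0" using assms by (auto simp: complex_eq_iff)
 moreover have "(norm (e - 1))^2 < (norm (e + 1))^2"
  using assms unfolding cmod_power2 by (simp add: power2_eq_square algebra_simps)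
 then have "norm (e - 1) < norm (e + 1)" by (rule power_less_imp_less_base) simp
 ultimately show ?thesis by (simp add: norm_divide divide_less_eq)
qed

lemma disc_of_strip:
 shows "disc_of_strip holomorphic_on std_strip"
  and "\<bar>Re w\<bar> < pi/2 \<Longrightarrow> norm (disc_of_strip w) < 1"
  and "\<bar>Re w\<bar> < pi/2 \<Longrightarrow> strip_of_disc (disc_of_strip w) = w"
proof -
 have ne: "exp (\<i> * w) + 1 \<noteq> 0" if "\<bar>Re w\<bar> < pi/2" for w
  using Re_exp_i_pos[OF that] by (auto simp: complex_eq_iff)
 show "disc_of_strip holomorphic_on std_strip"
  unfolding disc_of_strip_def using ne by (auto intro!: holomorphic_intros)
 assume w: "\<bar>Re w\<bar> < pi/2"
 show "norm (disc_of_strip w) < 1"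
  using norm_cayley_less_1[OF Re_exp_i_pos[OF w]] by (simp add: disc_of_strip_def norm_mult norm_divide)
 define e where "e = exp (\<i> * w)"
 have e: "e + 1 \<noteq> 0" using ne[OF w] by (simp add: e_def)
 have "(1 + \<i> * disc_of_strip w) / (1 - \<i> * disc_of_strip w) = e"
 proof -
  have "\<i> * disc_of_strip w = (e - 1) / (e + 1)"
   using e unfolding disc_of_strip_def e_def[symmetric] by (simp add: divide_simps)
  then have "(1 + \<i> * disc_of_strip w) = 2 * e / (e + 1)" "(1 - \<i> * disc_of_strip w) = 2 / (e + 1)"
   using e by (simp_all add: field_simps)
  then show ?thesis using e by simp
 qed
 moreover have "Ln e = \<i> * w" unfolding e_def by (rule Ln_exp) (use w in auto)
 ultimately show "strip_of_disc (disc_of_strip w) = w" by (simp add: strip_of_disc_def)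
qed

text \<open>The Cayley transform maps the unit disc to the right half plane.\<close>
lemma strip_of_disc_Re_pos:
 assumes "norm z < 1" shows "1 - \<i> * z \<noteq> 0" "0 < Re ((1 + \<i> * z) / (1 - \<i> * z))"
proof -
 have *: "1 - \<i> * z \<noteq> 0"
 proof
  assume "1 - \<i> * z = 0"
  then have "norm (\<i> * z) = 1" by (metis norm_one right_minus_eq)
  then show False using assms by (simp add: norm_mult)
 qed
 have "Re ((1 + \<i> * z) * cnj (1 - \<i> * z)) = 1 - (norm z)^2"
  unfolding cmod_power2 by (simp add: power2_eq_square algebra_simps)
 moreover have "(norm z)^2 < 1" using assms by (simp add: power_less_one_iff)
 ultimately have "Re ((1 + \<i> * z) * cnj (1 - \<i> * z)) > 0" by simp
 moreover have "(1 + \<i> * z) / (1 - \<i> * z) = ((1 + \<i> * z) * cnj (1 - \<i> * z)) / of_real ((norm (1 - \<i> * z))^2)"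
  by (subst complex_div_cnj) simp
 ultimately show "0 < Re ((1 + \<i> * z) / (1 - \<i> * z))"
  using * by (metis Re_divide_of_real divide_pos_pos norm_eq_zero zero_less_power2)
 show "1 - \<i> * z \<noteq> 0" by fact
qed

lemma strip_of_disc:
 shows "strip_of_disc holomorphic_on ball 0 1"
  and "norm z < 1 \<Longrightarrow> \<bar>Re (strip_of_disc z)\<bar> < pi/2"
  and "norm z < 1 \<Longrightarrow> disc_of_strip (strip_of_disc z) = z"
proof -
 show "strip_of_disc holomorphic_on ball 0 1"
  unfolding strip_of_disc_def using strip_of_disc_Re_pos
  by (auto intro!: holomorphic_intros simp: complex_nonpos_Reals_iff) (metis less_le_not_le)+
 assume z: "norm z < 1"
 note n = strip_of_disc_Re_pos[OF z]
 show "\<bar>Re (strip_of_disc z)\<bar> < pi/2" using Re_Ln_pos_lt_imp[OF n(2)] by (simp add: strip_of_disc_def)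
 define e where "e = (1 + \<i> * z) / (1 - \<i> * z)"
 have e: "exp (\<i> * strip_of_disc z) = e"
 proof -
  have "e \<noteq> 0" using n(2) unfolding e_def[symmetric] by auto
  then show ?thesis unfolding strip_of_disc_def e_def[symmetric] by (simp add: exp_Ln)
 qed
 have "e * (1 - \<i> * z) = 1 + \<i> * z" using n by (simp add: e_def)
 then have "(e - 1) = \<i> * z * (e + 1)" by (simp add: algebra_simps)
 moreover have "e + 1 \<noteq> 0" using n(2) by (auto simp: complex_eq_iff e_def[symmetric])
 ultimately show "disc_of_strip (strip_of_disc z) = z" by (simp add: disc_of_strip_def e)
qed

lemma normalized_strip_map_unique:
 assumes S: "open S" "a \<in> S"
  and f: "f holomorphic_on S" "inj_on f S" "f ` S = std_strip" "f a = 0"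
  and g: "g holomorphic_on S" "inj_on g S" "g ` S = std_strip" "g a = 0"
  and c: "0 < c" "deriv f a = of_real c * deriv g a"
  and z: "z \<in> S"
 shows "f z = g z"
proof -
 have bij: "disc_of_strip ` std_strip = ball 0 1"
 proof
  show "disc_of_strip ` std_strip \<subseteq> ball 0 1" using disc_of_strip(2) by auto
  show "ball 0 1 \<subseteq> disc_of_strip ` std_strip"
   using strip_of_disc(2,3) by (force intro: image_eqI[of _ _ "strip_of_disc x" for x])
 qed
 have inj: "inj_on disc_of_strip std_strip"
  using disc_of_strip(3) by (intro inj_on_inverseI[of _ strip_of_disc]) auto
 have d0: "deriv (disc_of_strip \<circ> f) a = deriv disc_of_strip 0 * deriv f a"
  if "f holomorphic_on S" "f a = 0" for f
  using deriv_chain[of f a disc_of_strip] that S disc_of_strip(1) open_vertical_strip[of "pi/2"]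
   holomorphic_on_imp_differentiable_at by fastforce
 have "(disc_of_strip \<circ> f) z = (disc_of_strip \<circ> g) z"
 proof (rule normalized_Riemann_map_unique[OF S _ _ _ _ _ _ _ _ c(1) _ z])
  show "disc_of_strip \<circ> f holomorphic_on S" "disc_of_strip \<circ> g holomorphic_on S"
   using holomorphic_on_compose_gen[OF f(1) disc_of_strip(1)] holomorphic_on_compose_gen[OF g(1) disc_of_strip(1)] f g by auto
  show "inj_on (disc_of_strip \<circ> f) S" "inj_on (disc_of_strip \<circ> g) S"
   using f g inj by (auto intro!: comp_inj_on)
  show "(disc_of_strip \<circ> f) ` S = ball 0 1" "(disc_of_strip \<circ> g) ` S = ball 0 1"
   unfolding image_comp[symmetric] f g bij by auto
  show "(disc_of_strip \<circ> f) a = 0" "(disc_of_strip \<circ> g) a = 0" using f g by (auto simp: disc_of_strip_def)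
  show "deriv (disc_of_strip \<circ> f) a = of_real c * deriv (disc_of_strip \<circ> g) a"
   unfolding d0[OF f(1,4)] d0[OF g(1,4)] c by simp
 qed
 then show ?thesis using inj f(3) g(3) z unfolding inj_on_def comp_def by blast
qed

lemma normalized_strip_map:
 assumes S: "open S" "simply_connected S" "S \<noteq> UNIV" and a: "a \<in> S"
 obtains f where "f holomorphic_on S" "inj_on f S" "f ` S = std_strip" "f a = 0"
  "Im (deriv f a) = 0" "0 < Re (deriv f a)"
proof -
 obtain f where f: "f holomorphic_on S" "inj_on f S" "f ` S = ball 0 1" "f a = 0"
  "Im (deriv f a) = 0" "0 < Re (deriv f a)" using normalized_Riemann_map[OF S a] by blast
 have bij: "strip_of_disc ` ball 0 1 = std_strip"
 proof
  show "strip_of_disc ` ball 0 1 \<subseteq> std_strip" using strip_of_disc(2) by auto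
  show "std_strip \<subseteq> strip_of_disc ` ball 0 1"
   using disc_of_strip(2,3) by (force intro: image_eqI[of _ _ "disc_of_strip x" for x])
 qed
 have inj: "inj_on strip_of_disc (ball 0 1)"
  using strip_of_disc(3) by (intro inj_on_inverseI[of _ disc_of_strip]) auto
 have ds: "(strip_of_disc has_field_derivative 2) (at 0)"
  unfolding strip_of_disc_def by (rule derivative_eq_intros refl | simp add: mult.assoc)+
 show thesis
 proof (rule that[of "strip_of_disc \<circ> f"])
  show "strip_of_disc \<circ> f holomorphic_on S"
   using holomorphic_on_compose_gen[OF f(1) strip_of_disc(1)] f by auto
  show "inj_on (strip_of_disc \<circ> f) S" using f inj by (auto intro!: comp_inj_on)
  show "(strip_of_disc \<circ> f) ` S = std_strip" unfolding image_comp[symmetric] f bij ..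
  show "(strip_of_disc \<circ> f) a = 0" using f by (simp add: strip_of_disc_def)
  have "(strip_of_disc \<circ> f has_field_derivative 2 * deriv f a) (at a)"
   by (rule DERIV_chain) (use f ds holomorphic_derivI[OF f(1) S(1) a] in auto)
  then have "deriv (strip_of_disc \<circ> f) a = 2 * deriv f a" by (rule DERIV_imp_deriv)
  then show "Im (deriv (strip_of_disc \<circ> f) a) = 0" "0 < Re (deriv (strip_of_disc \<circ> f) a)" using f by auto
 qed
qed

locale gauss_polygon =
 fixes n :: nat and T :: real
 assumes n3: "3 \<le> n" and T: "0 < T"
begin

definition "eps = pi / real n"
abbreviation "per \<equiv> 2 * \<i> * complex_of_real eps"
abbreviation "turn k \<equiv> of_int (2 * k) * (\<i> * complex_of_real eps)"
text \<open>The even \<open>2 * eps\<close>-periodic extension of \<open>cos\<close> from \<open>[- eps, eps]\<close>; \<open>arccos (cos \<theta>)\<close> is the triangle wave.\<close>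
definition "cc \<theta> = cos (arccos (cos (real n * \<theta>)) / real n)" for \<theta> :: real
text \<open>The doubled Gauss image in the logarithmic coordinate \<open>t + \<i>\<theta>\<close>: its right boundary consists of the arcs on
 which the normal is orthogonal to the normal of a lateral face.\<close>
definition "S = {\<zeta>. \<bar>sinh (Re \<zeta>)\<bar> < T * cc (Im \<zeta>)}"

lemma npos: "0 < real n" using n3 by simp
lemma eps: "0 < eps" "eps \<le> pi/3" "eps < pi/2" "real n * eps = pi"
proof -
 show "0 < eps" "real n * eps = pi" using n3 by (auto simp: eps_def)
 show e3: "eps \<le> pi/3" unfolding eps_def using n3 by (intro divide_left_mono) auto
 then show "eps < pi/2" by (rule order_le_less_trans) auto
qed

lemma cc_bounds: "0 < cc \<theta>" "cc \<theta> \<le> 1"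
proof -
 have "0 \<le> arccos (cos (real n * \<theta>))" "arccos (cos (real n * \<theta>)) \<le> pi"
  using arccos_lbound arccos_ubound by (auto simp: arccos_lbound arccos_ubound)
 then have "0 \<le> arccos (cos (real n * \<theta>)) / real n" "arccos (cos (real n * \<theta>)) / real n \<le> eps"
  using npos by (auto simp: eps_def divide_right_mono)
 then show "0 < cc \<theta>" "cc \<theta> \<le> 1" unfolding cc_def using eps by (auto intro!: cos_gt_zero_pi)
qed

lemma cc_eq: "\<bar>\<theta>\<bar> \<le> eps \<Longrightarrow> cc \<theta> = cos \<theta>"
proof -
 assume "\<bar>\<theta>\<bar> \<le> eps"
 then have "real n * \<bar>\<theta>\<bar> \<le> pi" using eps(4) npos by (metis mult_le_cancel_left_pos)
 then have "arccos (cos (real n * \<bar>\<theta>\<bar>)) = real n * \<bar>\<theta>\<bar>" by (intro arccos_cos) auto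
 moreover have "cos (real n * \<bar>\<theta>\<bar>) = cos (real n * \<theta>)" by (cases "\<theta> \<ge> 0") auto
 ultimately show ?thesis using npos by (simp add: cc_def)
qed

lemma cc_minus [simp]: "cc (- \<theta>) = cc \<theta>" by (simp add: cc_def)

lemma cc_shift [simp]: "cc (\<theta> + 2 * eps) = cc \<theta>"
proof -
 have "real n * (\<theta> + 2 * eps) = real n * \<theta> + 2 * pi" using eps(4) by (simp add: algebra_simps)
 then show ?thesis by (simp add: cc_def)
qed

lemma continuous_cc: "continuous_on UNIV cc"
 unfolding cc_def by (intro continuous_intros continuous_on_arccos) (use npos in auto)

lemma continuous_on_cc [continuous_intros]:
 "continuous_on A f \<Longrightarrow> continuous_on A (\<lambda>x. cc (f x))"
 using continuous_on_compose2[OF continuous_cc] by blast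

lemma S_open: "open S"
 unfolding S_def by (intro open_Collect_less continuous_intros)

lemma S_0: "0 \<in> S" using cc_bounds T by (simp add: S_def)

lemma S_Re_bound: "\<zeta> \<in> S \<Longrightarrow> \<bar>sinh (Re \<zeta>)\<bar> < T"
 using cc_bounds(2)[of "Im \<zeta>"] T mult_left_mono[of "cc (Im \<zeta>)" 1 T] unfolding S_def mem_Collect_eq by linarith

lemma S_ne_UNIV: "S \<noteq> UNIV"
proof
 assume "S = UNIV"
 then have "of_real (arsinh T) \<in> S" by simp
 from S_Re_bound[OF this] show False using T by simp
qed

text \<open>Rescaling each horizontal segment straightens \<open>S\<close> to a strip.\<close>
lemma S_simply_connected: "simply_connected S"
proof -
 define f where "f \<zeta> = Complex (sinh (Re \<zeta>) / (T * cc (Im \<zeta>))) (Im \<zeta>)" for \<zeta>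
 define g where "g \<zeta> = Complex (arsinh (Re \<zeta> * (T * cc (Im \<zeta>)))) (Im \<zeta>)" for \<zeta>
 have p: "T * cc y > 0" for y using T cc_bounds by simp
 have "{w::complex. \<bar>Re w\<bar> < 1} homeomorphic S"
 proof (rule homeomorphicI)
  have ne: "cc y \<noteq> 0" for y using cc_bounds[of y] by simp
  show "continuous_on {w::complex. \<bar>Re w\<bar> < 1} g" unfolding g_def Complex_eq
   by (intro continuous_intros continuous_on_compose2[OF continuous_on_arsinh[of UNIV]]) auto
  show "continuous_on S f" unfolding f_def Complex_eq by (intro continuous_intros) (use T ne in auto)
  show "f (g x) = x" for x using T cc_bounds(1)[of "Im x"] by (simp add: f_def g_def complex_eq_iff)
  show fg: "g (f y) = y" for y using T cc_bounds(1)[of "Im y"] by (simp add: f_def g_def arsinh_sinh_real complex_eq_iff)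
  show "g ` {w::complex. \<bar>Re w\<bar> < 1} = S"
  proof
   show "g ` {w::complex. \<bar>Re w\<bar> < 1} \<subseteq> S"
    using p T cc_bounds by (auto simp: g_def S_def abs_mult) (smt (verit) mult_less_cancel_right2)
   show "S \<subseteq> g ` {w::complex. \<bar>Re w\<bar> < 1}"
   proof
    fix \<zeta> assume "\<zeta> \<in> S"
    then have "\<bar>Re (f \<zeta>)\<bar> < 1" using p[of "Im \<zeta>"] T cc_bounds(1)[of "Im \<zeta>"] by (simp add: f_def S_def abs_mult)
    then show "\<zeta> \<in> g ` {w::complex. \<bar>Re w\<bar> < 1}" using fg[of \<zeta>] by (metis (mono_tags) imageI mem_Collect_eq)
   qed
  qed
  show "f ` S = {w::complex. \<bar>Re w\<bar> < 1}"
  proof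
   show "f ` S \<subseteq> {w::complex. \<bar>Re w\<bar> < 1}"
   proof (rule image_subsetI)
    fix \<zeta> assume "\<zeta> \<in> S"
    then show "f \<zeta> \<in> {w::complex. \<bar>Re w\<bar> < 1}"
     using T cc_bounds(1)[of "Im \<zeta>"] by (simp add: f_def S_def abs_mult)
   qed
   show "{w::complex. \<bar>Re w\<bar> < 1} \<subseteq> f ` S"
   proof
    fix w :: complex assume "w \<in> {w. \<bar>Re w\<bar> < 1}"
    then have "g w \<in> S" using p[of "Im w"] T cc_bounds(1)[of "Im w"]
     by (auto simp: g_def S_def abs_mult)
    moreover have "f (g w) = w" using T cc_bounds(1)[of "Im w"] by (simp add: f_def g_def complex_eq_iff)
    ultimately show "w \<in> f ` S" by (metis imageI)
   qed
  qed
 qed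
 then show ?thesis
  using homeomorphic_simply_connected convex_imp_simply_connected[OF convex_vertical_strip[of 1]] by blast
qed

lemma S_sym: "cnj \<zeta> \<in> S \<longleftrightarrow> \<zeta> \<in> S" "- \<zeta> \<in> S \<longleftrightarrow> \<zeta> \<in> S" "\<zeta> + per \<in> S \<longleftrightarrow> \<zeta> \<in> S"
 by (auto simp: S_def)

text \<open>Each symmetry of \<open>S\<close> conjugates the normalized conformal map into another normalized one, so that
 uniqueness applies. For the translation the image of \<open>0\<close> moves along the imaginary axis, which
 gives the period \<open>p\<close>.\<close>
lemma strip_map_exists:
 obtains V p where "V holomorphic_on S" "inj_on V S" "V ` S = std_strip" "V 0 = 0"
  "Im (deriv V 0) = 0" "0 < Re (deriv V 0)" "0 < p"
  "\<And>z. z \<in> S \<Longrightarrow> V (cnj z) = cnj (V z)" "\<And>z. z \<in> S \<Longrightarrow> V (- z) = - V z"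
  "\<And>z. z \<in> S \<Longrightarrow> V (z + per) = V z + \<i> * of_real p"
proof -
 obtain V where V: "V holomorphic_on S" "inj_on V S" "V ` S = std_strip" "V 0 = 0"
  "Im (deriv V 0) = 0" "0 < Re (deriv V 0)"
  using normalized_strip_map[OF S_open S_simply_connected S_ne_UNIV S_0] by blast
 have dV: "(V has_field_derivative deriv V z) (at z)" if "z \<in> S" for z
  by (rule holomorphic_derivI[OF V(1) S_open that])
 have V0: "V z = 0 \<longleftrightarrow> z = 0" if "z \<in> S" for z using V(2,4) S_0 that by (metis inj_onD)
 have stripeq: "\<bar>Re (V z)\<bar> < pi/2" if "z \<in> S" for z using V(3) that by auto
 have cnjV: "cnj (V (cnj z)) = V z" if z: "z \<in> S" for z
 proof -
  have "(cnj \<circ> V \<circ> cnj) z = V z"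
  proof (rule normalized_strip_map_unique[OF S_open S_0 _ _ _ _ V(1-4) zero_less_one _ z])
   have im: "cnj ` S = S" using S_sym(1) by (auto intro!: image_eqI[of _ _ "cnj x" for x])
   show "cnj \<circ> V \<circ> cnj holomorphic_on S"
    using holomorphic_on_compose_cnj_cnj[of V S] V(1) im S_open by simp
   show "inj_on (cnj \<circ> V \<circ> cnj) S"
   proof (rule inj_onI)
    fix x y assume xy: "x \<in> S" "y \<in> S" "(cnj \<circ> V \<circ> cnj) x = (cnj \<circ> V \<circ> cnj) y"
    show "x = y"
     using inj_onD[OF V(2), of "cnj x" "cnj y"] xy S_sym(1) by simp
   qed
   have "(cnj \<circ> V \<circ> cnj) ` S = cnj ` V ` cnj ` S" unfolding image_comp o_assoc ..
   also have "\<dots> = std_strip" unfolding im V(3)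
    using image_eqI[of _ cnj "cnj x" std_strip for x] by fastforce
   finally show "(cnj \<circ> V \<circ> cnj) ` S = std_strip" .
   show "(cnj \<circ> V \<circ> cnj) 0 = 0" by (simp add: V)
   have "(cnj \<circ> V \<circ> cnj has_field_derivative cnj (deriv V 0)) (at 0)"
    using has_field_derivative_cnj_cnj[of V "deriv V 0" 0] dV[OF S_0] by simp
   moreover have "cnj (deriv V 0) = deriv V 0" using V(5) by (simp add: complex_eq_iff)
   ultimately show "deriv (cnj \<circ> V \<circ> cnj) 0 = of_real 1 * deriv V 0" by (simp add: DERIV_imp_deriv)
  qed
  then show ?thesis by simp
 qed
 have oddV: "- V (- z) = V z" if z: "z \<in> S" for z
 proof (rule normalized_strip_map_unique[OF S_open S_0 _ _ _ _ V(1-4) zero_less_one _ z])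
  have d: "((\<lambda>z. - V (- z)) has_field_derivative deriv V (- z)) (at z)" if "z \<in> S" for z
  proof -
   have "((\<lambda>z. V (- z)) has_field_derivative deriv V (- z) * (-1)) (at z)"
    by (rule DERIV_chain2[OF dV]) (use that S_sym in "auto intro!: derivative_eq_intros")
   then show ?thesis using DERIV_minus by fastforce
  qed
  show "(\<lambda>z. - V (- z)) holomorphic_on S"
   using d S_open holomorphic_on_open by blast
  show "inj_on (\<lambda>z. - V (- z)) S"
  proof (rule inj_onI)
   fix x y assume "x \<in> S" "y \<in> S" "- V (- x) = - V (- y)"
   then show "x = y" using inj_onD[OF V(2), of "- x" "- y"] S_sym(2) by simp
  qed
  show "(\<lambda>z. - V (- z)) ` S = std_strip"
  proof
   show "(\<lambda>z. - V (- z)) ` S \<subseteq> std_strip" using stripeq S_sym(2) by auto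
   show "std_strip \<subseteq> (\<lambda>z. - V (- z)) ` S"
   proof
    fix w assume "w \<in> std_strip"
    then have "- w \<in> V ` S" unfolding V(3) by simp
    then obtain s where "s \<in> S" "- w = V s" by auto
    then show "w \<in> (\<lambda>z. - V (- z)) ` S" using S_sym(2) by (intro image_eqI[of _ _ "- s"]) (auto simp: minus_equation_iff[of w])
   qed
  qed
  show "deriv (\<lambda>z. - V (- z)) 0 = of_real 1 * deriv V 0" using d[OF S_0] by (simp add: DERIV_imp_deriv)
 qed (use V in auto)
 have axis: "\<i> * of_real y \<in> S" for y using T cc_bounds by (simp add: S_def)
 define u where "u y = Im (V (\<i> * of_real y))" for y :: real
 have Vu: "V (\<i> * of_real y) = \<i> * of_real (u y)" for y
 proof -
  have "V (\<i> * of_real y) = - V (cnj (\<i> * of_real y))" using oddV[OF axis[of y]] by simp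
  also have "\<dots> = - cnj (V (\<i> * of_real y))" using cnjV[OF axis[of y]] by (metis complex_cnj_cnj)
  finally have "Re (V (\<i> * of_real y)) = 0" by (simp add: complex_eq_iff)
  then show ?thesis by (simp add: u_def complex_eq_iff)
 qed
 define v where "v y = Re (deriv V (\<i> * of_real y))" for y :: real
 have du: "deriv V (\<i> * of_real y) = of_real (v y) \<and> (u has_field_derivative v y) (at y)" for y
 proof -
  have "((\<lambda>y. V (\<i> * of_real y)) has_vector_derivative (\<i> * deriv V (\<i> * of_real y))) (at y)"
   by (rule field_vector_diff_chain_at[where g=V and f="\<lambda>y. \<i> * of_real y", unfolded o_def])
     (auto intro!: derivative_eq_intros dV axis simp: has_vector_derivative_def scaleR_conv_of_real)
  then have *: "((\<lambda>y. \<i> * of_real (u y)) has_vector_derivative (\<i> * deriv V (\<i> * of_real y))) (at y)"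
   by (simp add: Vu)
  from bounded_linear.has_vector_derivative[OF bounded_linear_Im this]
  have 1: "(u has_field_derivative v y) (at y)" by (simp add: has_real_derivative_iff_has_vector_derivative v_def)
  from bounded_linear.has_vector_derivative[OF bounded_linear_Re *]
  have "((\<lambda>y. 0) has_vector_derivative - Im (deriv V (\<i> * of_real y))) (at y)" by simp
  then have "Im (deriv V (\<i> * of_real y)) = 0"
   using vector_derivative_unique_at[OF _ has_vector_derivative_const] by fastforce
  then show ?thesis using 1 by (auto simp: complex_eq_iff v_def)
 qed
 have v0: "v 0 > 0" using V(6) by (simp add: v_def)
 have vne: "v y \<noteq> 0" for y
  using holomorphic_injective_imp_regular[OF V(1) S_open V(2) axis[of y]] du[of y] by auto
 have vc: "continuous_on UNIV v" unfolding v_def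
  by (intro continuous_intros continuous_on_compose2[OF holomorphic_on_imp_continuous_on[OF holomorphic_deriv[OF V(1) S_open]]])
    (use axis in auto)
 have vpos: "v y > 0" if "y \<ge> 0" for y
 proof (rule ccontr)
  assume "\<not> v y > 0"
  then have "\<exists>x\<ge>0. x \<le> y \<and> v x = 0"
   using that v0 by (intro IVT2') (auto intro: continuous_on_subset[OF vc])
  then show False using vne by auto
 qed
 define p where "p = u (2 * eps)"
 have "u 0 < u (2 * eps)"
  by (rule DERIV_pos_imp_increasing) (use eps du vpos in "auto intro!: exI")
 then have p: "p > 0" using V(4) by (simp add: p_def u_def)
 have shV: "V (z + per) - \<i> * of_real p = V z" if z: "z \<in> S" for z
 proof (rule normalized_strip_map_unique[OF S_open S_0 _ _ _ _ V(1-4) _ _ z])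
  have d: "((\<lambda>z. V (z + per) - \<i> * of_real p) has_field_derivative deriv V (z + per)) (at z)"
   if "z \<in> S" for z
  proof -
   have "((\<lambda>z. V (z + per)) has_field_derivative deriv V (z + per) * 1) (at z)"
    by (rule DERIV_chain2[OF dV]) (use that S_sym in "auto intro!: derivative_eq_intros")
   then show ?thesis by (auto intro!: derivative_eq_intros)
  qed
  show "(\<lambda>z. V (z + per) - \<i> * of_real p) holomorphic_on S"
   using d S_open holomorphic_on_open by blast
  show "inj_on (\<lambda>z. V (z + per) - \<i> * of_real p) S"
  proof (rule inj_onI)
   fix x y assume "x \<in> S" "y \<in> S" "V (x + per) - \<i> * of_real p = V (y + per) - \<i> * of_real p"
   then show "x = y" using inj_onD[OF V(2), of "x + per" "y + per"] S_sym(3) by simp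
  qed
  show "(\<lambda>z. V (z + per) - \<i> * of_real p) ` S = std_strip"
  proof
   show "(\<lambda>z. V (z + per) - \<i> * of_real p) ` S \<subseteq> std_strip" using stripeq S_sym(3) by auto
   show "std_strip \<subseteq> (\<lambda>z. V (z + per) - \<i> * of_real p) ` S"
   proof
    fix w assume "w \<in> std_strip"
    then have "w + \<i> * of_real p \<in> V ` S" unfolding V(3) by simp
    then obtain s where s: "s \<in> S" "w + \<i> * of_real p = V s" by auto
    then have "s - per \<in> S" using S_sym(3)[of "s - per"] by simp
    then show "w \<in> (\<lambda>z. V (z + per) - \<i> * of_real p) ` S"
     using s by (intro image_eqI[of _ _ "s - per"]) (auto simp flip: s(2))
   qed
  qed
  have e2: "per = \<i> * of_real (2 * eps)" by simp
  show "V (0 + per) - \<i> * of_real p = 0"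
   using Vu[of "2 * eps"] unfolding p_def e2[symmetric] by simp
  show "0 < v (2 * eps) / v 0" using vpos[of "2*eps"] v0 eps by simp
  have "deriv V per = of_real (v (2 * eps))" using du[of "2 * eps"] unfolding e2 by blast
  then show "deriv (\<lambda>z. V (z + per) - \<i> * of_real p) 0 = of_real (v (2 * eps) / v 0) * deriv V 0"
   using d[OF S_0] du[of 0] v0 by (simp add: DERIV_imp_deriv)
 qed
 show thesis
 proof (rule that[OF V p])
  show "V (cnj z) = cnj (V z)" if "z \<in> S" for z using cnjV[OF that] by (metis complex_cnj_cnj)
  show "V (- z) = - V z" if "z \<in> S" for z using oddV[OF that] by (metis minus_minus)
  show "V (z + per) = V z + \<i> * of_real p" if "z \<in> S" for z using shV[OF that] by (metis diff_add_cancel)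
 qed
qed

end

section \<open>The Gauss map in the strip parameter\<close>

lemma real_nonvanishing_pos:
 fixes f :: "complex \<Rightarrow> complex"
 assumes "continuous_on A f" "connected A" "a \<in> A" "0 < Re (f a)" "w \<in> A"
  and "\<And>z. z \<in> A \<Longrightarrow> Im (f z) = 0" "\<And>z. z \<in> A \<Longrightarrow> f z \<noteq> 0"
 shows "0 < Re (f w)"
proof (rule ccontr)
 assume "\<not> 0 < Re (f w)"
 have c: "connected ((\<lambda>z. Re (f z)) ` A)"
  by (intro connected_continuous_image continuous_intros assms)
 have "0 \<in> (\<lambda>z. Re (f z)) ` A"
  by (rule connectedD_interval[OF c, of "Re (f w)" "Re (f a)"]) (use assms(3-5) \<open>\<not> 0 < Re (f w)\<close> in auto)
 then show False using assms(6,7) by (auto simp: complex_eq_iff)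
qed

lemma connected_nonvanishing_pos:
 fixes f :: "complex \<Rightarrow> real"
 assumes "continuous_on A f" "connected A" "a \<in> A" "0 < f a" "w \<in> A"
  and "\<And>z. z \<in> A \<Longrightarrow> f z \<noteq> 0"
 shows "0 < f w"
 using real_nonvanishing_pos[of A "\<lambda>z. of_real (f z)" a w] assms
 by (auto intro!: continuous_intros)

text \<open>\<open>\<psi>\<close> is the inverse of the conformal map of \<open>S\<close>, with the strip scaled so that strip and image have the
 same translation period; the half width \<open>l\<close> is then determined by \<open>n\<close> and \<open>T\<close>.\<close>
locale gauss_map = gauss_polygon +
 fixes l :: real and \<psi> :: "complex \<Rightarrow> complex"
 assumes l: "0 < l"
  and \<psi>_hol: "\<psi> holomorphic_on {w. \<bar>Re w\<bar> < l}"
  and \<psi>_inj: "inj_on \<psi> {w. \<bar>Re w\<bar> < l}"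
  and \<psi>_im: "\<psi> ` {w. \<bar>Re w\<bar> < l} = S"
  and \<psi>_cnj: "\<bar>Re w\<bar> < l \<Longrightarrow> \<psi> (cnj w) = cnj (\<psi> w)"
  and \<psi>_minus: "\<bar>Re w\<bar> < l \<Longrightarrow> \<psi> (- w) = - \<psi> w"
  and \<psi>_shift: "\<bar>Re w\<bar> < l \<Longrightarrow> \<psi> (w + per) = \<psi> w + per"
  and \<psi>_pos: "0 < Re (deriv \<psi> 0)"

lemma (in gauss_polygon) gauss_map_exists: "\<exists>l \<psi>. gauss_map n T l \<psi>"
proof -
 obtain V p where V: "V holomorphic_on S" "inj_on V S" "V ` S = std_strip" "V 0 = 0"
  "Im (deriv V 0) = 0" "0 < Re (deriv V 0)" "0 < p"
  "\<And>z. z \<in> S \<Longrightarrow> V (cnj z) = cnj (V z)" "\<And>z. z \<in> S \<Longrightarrow> V (- z) = - V z"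
  "\<And>z. z \<in> S \<Longrightarrow> V (z + per) = V z + \<i> * of_real p"
  by (rule strip_map_exists) blast
 obtain g where g: "g holomorphic_on std_strip" "\<And>z. z \<in> S \<Longrightarrow> deriv V z * deriv g (V z) = 1"
   "\<And>z. z \<in> S \<Longrightarrow> g (V z) = z"
  using holomorphic_has_inverse[OF V(1) S_open V(2)] V(3) by metis
 \<comment> \<open>The scaling factor that makes the periods agree.\<close>
 define a where "a = p / (2 * eps)"
 have a: "a > 0" "a * (2 * eps) = p" using V(7) eps by (auto simp: a_def)
 define l where "l = pi / 2 / a"
 have l: "l > 0" using a by (simp add: l_def)
 have str: "\<bar>Re (of_real a * w)\<bar> < pi/2 \<longleftrightarrow> \<bar>Re w\<bar> < l" for w
  using a by (simp add: l_def abs_mult field_simps)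
 define \<psi> where "\<psi> w = g (of_real a * w)" for w
 have gV: "\<exists>z\<in>S. of_real a * w = V z \<and> \<psi> w = z" if "\<bar>Re w\<bar> < l" for w
 proof -
  have "of_real a * w \<in> V ` S" unfolding V(3) using str[of w] that by simp
  then show ?thesis using g(3) by (auto simp: \<psi>_def)
 qed
 have Vpsi: "\<psi> (V z / of_real a) = z" if "z \<in> S" for z using a g(3)[OF that] by (simp add: \<psi>_def)
 have VS: "\<bar>Re (V z / of_real a)\<bar> < l" if "z \<in> S" for z
 proof -
  have "\<bar>Re (V z)\<bar> < pi/2" using V(3) that by auto
  then show ?thesis using str[of "V z / of_real a"] a by simp
 qed
 have "gauss_map n T l \<psi>"
 proof (unfold_locales)
  show "0 < l" by fact
  show "\<psi> holomorphic_on {w. \<bar>Re w\<bar> < l}"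
   unfolding \<psi>_def
   by (rule holomorphic_on_compose_gen[OF _ g(1), unfolded o_def]) (use str in "auto intro!: holomorphic_intros")
  show "inj_on \<psi> {w. \<bar>Re w\<bar> < l}"
  proof (rule inj_onI)
   fix x y assume xy: "x \<in> {w. \<bar>Re w\<bar> < l}" "y \<in> {w. \<bar>Re w\<bar> < l}" "\<psi> x = \<psi> y"
   then have "of_real a * x = of_real a * y" using gV[of x] gV[of y] by auto
   then show "x = y" using a by simp
  qed
  show "\<psi> ` {w. \<bar>Re w\<bar> < l} = S"
  proof
   show "\<psi> ` {w. \<bar>Re w\<bar> < l} \<subseteq> S" using gV by auto
   show "S \<subseteq> \<psi> ` {w. \<bar>Re w\<bar> < l}" using Vpsi VS by (force intro: image_eqI[of _ _ "V z / of_real a" for z])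
  qed
  have d: "(\<psi> has_field_derivative deriv g 0 * of_real a) (at 0)"
  proof -
   have "(g has_field_derivative deriv g 0) (at (of_real a * 0))"
    using holomorphic_derivI[OF g(1) open_vertical_strip] by simp
   then show ?thesis unfolding \<psi>_def
    by (rule DERIV_chain2[where g="\<lambda>w. of_real a * w"]) (auto intro!: derivative_eq_intros)
  qed
  have "deriv V 0 * deriv g 0 = 1" using g(2)[OF S_0] V(4) by simp
  moreover have "deriv V 0 = of_real (Re (deriv V 0))" using V(5) by (simp add: complex_eq_iff)
  ultimately have "deriv g 0 = of_real (1 / Re (deriv V 0))"
   using V(6) by (metis mult_zero_left nonzero_eq_divide_eq mult.commute of_real_1 of_real_divide zero_neq_one)
  then show "0 < Re (deriv \<psi> 0)" using d V(6) a by (simp add: DERIV_imp_deriv)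
  fix w :: complex assume w: "\<bar>Re w\<bar> < l"
  obtain z where z: "z \<in> S" "of_real a * w = V z" "\<psi> w = z" using gV[OF w] by blast
  have wz: "w = V z / of_real a" using z(2) a by (simp add: field_simps)
  have "cnj w = V (cnj z) / of_real a" using wz V(8)[OF z(1)] by simp
  then show "\<psi> (cnj w) = cnj (\<psi> w)" using Vpsi[of "cnj z"] z S_sym by simp
  have "- w = V (- z) / of_real a" using wz V(9)[OF z(1)] by simp
  then show "\<psi> (- w) = - \<psi> w" using Vpsi[of "- z"] z S_sym by simp
  have "w + per = V (z + per) / of_real a"
   using wz V(10)[OF z(1)] a by (simp add: field_simps flip: a(2))
  then show "\<psi> (w + per) = \<psi> w + per"
   using Vpsi[of "z + per"] z S_sym by simp
 qed
 then show ?thesis by blast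
qed

context gauss_map begin

abbreviation "Str \<equiv> {w::complex. \<bar>Re w\<bar> < l}"
definition "D = deriv \<psi>"

lemma Str_open: "open Str" by (rule open_vertical_strip)

lemma \<psi>_D: "\<bar>Re w\<bar> < l \<Longrightarrow> (\<psi> has_field_derivative D w) (at w)"
 unfolding D_def by (intro holomorphic_derivI[OF \<psi>_hol Str_open]) auto

lemma D_hol: "D holomorphic_on Str" unfolding D_def by (intro holomorphic_deriv \<psi>_hol Str_open)
lemma D_cont: "continuous_on Str D" by (rule holomorphic_on_imp_continuous_on[OF D_hol])
lemma \<psi>_cont: "continuous_on Str \<psi>" by (rule holomorphic_on_imp_continuous_on[OF \<psi>_hol])

lemma D_ne: "\<bar>Re w\<bar> < l \<Longrightarrow> D w \<noteq> 0"
 unfolding D_def using holomorphic_injective_imp_regular[OF \<psi>_hol Str_open \<psi>_inj] by simp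

lemma \<psi>_S: "\<bar>Re w\<bar> < l \<Longrightarrow> \<psi> w \<in> S" using \<psi>_im by auto

lemma D_cnj: assumes "\<bar>Re w\<bar> < l" shows "D (cnj w) = cnj (D w)"
proof -
 have "(cnj \<circ> \<psi> \<circ> cnj has_field_derivative cnj (D w)) (at (cnj w))"
  by (rule has_field_derivative_cnj_cnj) (use \<psi>_D assms in simp)
 then have "(\<psi> has_field_derivative cnj (D w)) (at (cnj w))"
  by (rule has_field_derivative_transform_within_open[OF _ Str_open]) (use assms in "auto simp: \<psi>_cnj")
 then show ?thesis unfolding D_def by (rule DERIV_imp_deriv)
qed

lemma D_minus: assumes "\<bar>Re w\<bar> < l" shows "D (- w) = D w"
proof -
 have "((\<lambda>z. \<psi> (- z)) has_field_derivative D w * (-1)) (at (- w))"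
  by (rule DERIV_chain2[where f=\<psi> and g=uminus]) (use \<psi>_D[OF assms] in "auto intro!: derivative_eq_intros")
 then have "((\<lambda>z. - \<psi> (- z)) has_field_derivative - (D w * (-1))) (at (- w))" by (rule DERIV_minus)
 then have "(\<psi> has_field_derivative - (D w * (-1))) (at (- w))"
  by (rule has_field_derivative_transform_within_open[OF _ Str_open]) (use assms in "auto simp: \<psi>_minus")
 then show ?thesis unfolding D_def by (auto dest: DERIV_imp_deriv)
qed

lemma D_shift: assumes "\<bar>Re w\<bar> < l" shows "D (w + per) = D w"
proof -
 have "((\<lambda>z. \<psi> (z + per)) has_field_derivative D (w + per) * 1) (at w)"
  by (rule DERIV_chain2[OF \<psi>_D]) (use assms in "auto intro!: derivative_eq_intros")
 then have "((\<lambda>z. \<psi> z + per) has_field_derivative D (w + per) * 1) (at w)"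
  by (rule has_field_derivative_transform_within_open[OF _ Str_open]) (use assms in "auto simp: \<psi>_shift")
 moreover have "((\<lambda>z. \<psi> z + per) has_field_derivative D w) (at w)"
  using \<psi>_D[OF assms] by (auto intro!: derivative_eq_intros)
 ultimately show ?thesis using DERIV_unique by fastforce
qed

lemma D_real:
 assumes "\<bar>Re w\<bar> < l" and "Re w = 0 \<or> Im w = 0 \<or> Im w = eps"
 shows "Im (D w) = 0"
proof -
 consider "Re w = 0" | "Im w = 0" | "Im w = eps" using assms by blast
 then have "cnj (D w) = D w"
 proof cases
  case 1
  then have "w = - cnj w" by (simp add: complex_eq_iff)
  then show ?thesis using D_minus[of "cnj w"] D_cnj[of w] assms(1) by simp
 next
  case 2
  then have "w = cnj w" by (simp add: complex_eq_iff)
  then show ?thesis using D_cnj[of w] assms(1) by simp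
 next
  case 3
  then have "w = cnj w + per" by (simp add: complex_eq_iff)
  then show ?thesis using D_cnj[of w] D_shift[of "cnj w"] assms(1) by simp
 qed
 then show ?thesis by (simp add: complex_eq_iff)
qed

text \<open>The symmetry lines form a connected set on which the derivative is real without zeros; so it keeps the sign that it has at \<open>0\<close>.\<close>
lemma D_pos:
 assumes "\<bar>Re w\<bar> < l" and "Re w = 0 \<or> Im w = 0 \<or> Im w = eps"
 shows "0 < Re (D w)"
proof -
 have c: "connected ({w. Im w = y} \<inter> Str)" "connected {w::complex. Re w = 0}" for y :: real
  by (intro convex_connected convex_Int convex_vertical_strip; simp add: convex_def flip: distrib_right)+
 have D0: "continuous_on {w. Re w = 0} D" by (rule continuous_on_subset[OF D_cont]) (use l in auto)
 have Re0: "0 < Re (D w)" if "Re w = 0" for w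
  by (rule real_nonvanishing_pos[OF D0 c(2), of 0])
    (use that l D_real D_ne \<psi>_pos in "auto simp: D_def")
 have "0 < Re (D w)" if "Im w = y" "y = 0 \<or> y = eps" for y
  by (rule real_nonvanishing_pos[of "{w. Im w = y} \<inter> Str" D "\<i> * of_real y"])
    (use that c l D_real D_ne Re0[of "\<i> * of_real y"] assms in "auto intro: continuous_on_subset[OF D_cont]")
 then show ?thesis using assms(2) Re0 by auto
qed

text \<open>By injectivity, \<open>\<psi> w\<close> is fixed by a reflection exactly when \<open>w\<close> is.\<close>
lemma \<psi>_Re_zero_iff: assumes w: "\<bar>Re w\<bar> < l" shows "Re (\<psi> w) = 0 \<longleftrightarrow> Re w = 0"
proof -
 have a: "\<psi> (- cnj w) = - cnj (\<psi> w)" using \<psi>_minus[of "cnj w"] \<psi>_cnj[of w] w by simp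
 have "Re (\<psi> w) = 0 \<longleftrightarrow> \<psi> (- cnj w) = \<psi> w" unfolding a by (auto simp: complex_eq_iff)
 also have "\<dots> \<longleftrightarrow> - cnj w = w" using \<psi>_inj w by (auto dest: inj_onD)
 also have "\<dots> \<longleftrightarrow> Re w = 0" by (auto simp: complex_eq_iff)
 finally show ?thesis .
qed

lemma \<psi>_Im_zero_iff: assumes w: "\<bar>Re w\<bar> < l" shows "Im (\<psi> w) = 0 \<longleftrightarrow> Im w = 0"
proof -
 have "Im (\<psi> w) = 0 \<longleftrightarrow> \<psi> (cnj w) = \<psi> w" unfolding \<psi>_cnj[OF w] by (auto simp: complex_eq_iff)
 also have "\<dots> \<longleftrightarrow> cnj w = w" using \<psi>_inj w by (auto dest: inj_onD)
 also have "\<dots> \<longleftrightarrow> Im w = 0" by (auto simp: complex_eq_iff)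
 finally show ?thesis .
qed

lemma \<psi>_Im_eps_iff: assumes w: "\<bar>Re w\<bar> < l" shows "Im (\<psi> w) = eps \<longleftrightarrow> Im w = eps"
proof -
 have a: "\<psi> (cnj w + per) = cnj (\<psi> w) + per"
  using \<psi>_shift[of "cnj w"] \<psi>_cnj[of w] w by simp
 have "Im (\<psi> w) = eps \<longleftrightarrow> \<psi> (cnj w + per) = \<psi> w" unfolding a by (auto simp: complex_eq_iff)
 also have "\<dots> \<longleftrightarrow> cnj w + per = w" using \<psi>_inj w by (auto dest: inj_onD)
 also have "\<dots> \<longleftrightarrow> Im w = eps" by (auto simp: complex_eq_iff)
 finally show ?thesis .
qed

lemma \<psi>_0: "\<psi> 0 = 0" using \<psi>_minus[of 0] l by simp

lemma \<psi>_Re_pos: assumes "0 < Re w" "Re w < l" shows "0 < Re (\<psi> w)"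
proof -
 define x where "x = l / 2"
 have "Re (\<psi> (of_real 0)) < Re (\<psi> (of_real x))"
 proof (rule DERIV_pos_imp_increasing[where f="\<lambda>x. Re (\<psi> (of_real x))"])
  show "0 < x" using l by (simp add: x_def)
  fix s assume s: "0 \<le> s" "s \<le> x"
  have sl: "\<bar>Re (complex_of_real s)\<bar> < l" using s l by (simp add: x_def)
  have "((\<lambda>y. \<psi> (of_real y)) has_vector_derivative (1 * D (of_real s))) (at s)"
   by (rule field_vector_diff_chain_at[where g=\<psi> and f="\<lambda>y. of_real y", unfolded o_def])
     (use \<psi>_D[OF sl] in "auto intro!: derivative_eq_intros simp: has_vector_derivative_def scaleR_conv_of_real")
  from bounded_linear.has_vector_derivative[OF bounded_linear_Re this]
  show "\<exists>y. ((\<lambda>x. Re (\<psi> (of_real x))) has_field_derivative y) (at s) \<and> 0 < y"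
   using D_pos[OF sl] by (auto simp: has_real_derivative_iff_has_vector_derivative)
 qed
 then have x: "0 < Re (\<psi> (of_real x))" using \<psi>_0 by simp
 show ?thesis
 proof (rule connected_nonvanishing_pos[of "{w. 0 < Re w} \<inter> Str" "\<lambda>w. Re (\<psi> w)" "of_real x"])
  show "connected ({w. 0 < Re w} \<inter> Str)"
   using convex_halfspace_Re_gt[of 0] by (intro convex_connected convex_Int convex_vertical_strip) auto
 qed (use x l assms \<psi>_Re_zero_iff in "auto simp: x_def intro!: continuous_intros continuous_on_subset[OF \<psi>_cont]")
qed

lemma \<psi>_Im_bounds: assumes "0 < Im w" "Im w < eps" "\<bar>Re w\<bar> < l" shows "0 < Im (\<psi> w)" "Im (\<psi> w) < eps"
proof -
 define u where "u y = Im (\<psi> (\<i> * of_real y))" for y :: real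
 have du: "\<exists>d. (u has_field_derivative d) (at y) \<and> 0 < d" for y
 proof -
  have sl: "\<bar>Re (\<i> * complex_of_real y)\<bar> < l" using l by simp
  have "((\<lambda>y. \<psi> (\<i> * of_real y)) has_vector_derivative (\<i> * D (\<i> * of_real y))) (at y)"
   by (rule field_vector_diff_chain_at[where g=\<psi> and f="\<lambda>y. \<i> * of_real y", unfolded o_def])
     (use \<psi>_D[OF sl] in "auto intro!: derivative_eq_intros simp: has_vector_derivative_def scaleR_conv_of_real")
  from bounded_linear.has_vector_derivative[OF bounded_linear_Im this]
  show ?thesis using D_pos[OF sl] unfolding u_def by (auto simp: has_real_derivative_iff_has_vector_derivative)
 qed
 have inc: "u x < u y" if "x < y" for x y by (rule DERIV_pos_imp_increasing[OF that]) (use du in auto)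
 have u0: "u 0 = 0" "u eps = eps" using \<psi>_0 \<psi>_Im_eps_iff[of "\<i> * of_real eps"] l by (auto simp: u_def)
 have p: "0 < u (eps/2)" "u (eps/2) < eps" using inc[of 0 "eps/2"] inc[of "eps/2" eps] u0 eps by auto
 define A where "A = {w. 0 < Im w} \<inter> {w. Im w < eps} \<inter> Str"
 have A: "connected A" unfolding A_def
  using convex_halfspace_Im_gt[of 0] convex_halfspace_Im_lt[of eps] by (intro convex_connected convex_Int convex_vertical_strip) auto
 have cA: "continuous_on A \<psi>" by (rule continuous_on_subset[OF \<psi>_cont]) (auto simp: A_def)
 have wA: "w \<in> A" "\<i> * of_real (eps/2) \<in> A" using assms l eps by (auto simp: A_def)
 show "0 < Im (\<psi> w)"
  by (rule connected_nonvanishing_pos[OF _ A wA(2) _ wA(1)])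
    (use p \<psi>_Im_zero_iff in "auto simp: u_def A_def intro!: continuous_intros cA[unfolded A_def]")
 have ne: "Im (\<psi> z) \<noteq> eps" if "z \<in> A" for z using \<psi>_Im_eps_iff[of z] that by (auto simp: A_def)
 have "0 < eps - Im (\<psi> w)"
 proof (rule connected_nonvanishing_pos[OF _ A wA(2) _ wA(1)])
  show "eps - Im (\<psi> z) \<noteq> 0" if "z \<in> A" for z using ne[OF that] by simp
 qed (use p in "auto simp: u_def intro!: continuous_intros cA")
 then show "Im (\<psi> w) < eps" by simp
qed

lemma \<psi>_Im_bounds': assumes "\<bar>Im w\<bar> < eps" "\<bar>Re w\<bar> < l" shows "\<bar>Im (\<psi> w)\<bar> < eps"
proof -
 consider "Im w = 0" | "0 < Im w" | "Im w < 0" by linarith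
 then show ?thesis
 proof cases
  case 1 then show ?thesis using \<psi>_Im_zero_iff[OF assms(2)] eps by simp
 next
  case 2 then show ?thesis using \<psi>_Im_bounds[of w] assms by simp
 next
  case 3 then show ?thesis using \<psi>_Im_bounds[of "cnj w"] \<psi>_cnj[of w] assms by simp
 qed
qed

lemma \<psi>_Im_range: assumes "0 \<le> Im w" "Im w \<le> eps" "\<bar>Re w\<bar> < l" shows "0 \<le> Im (\<psi> w)" "Im (\<psi> w) \<le> eps"
 using \<psi>_Im_bounds[of w] \<psi>_Im_zero_iff[of w] \<psi>_Im_eps_iff[of w] assms eps
 by (smt (verit))+

lemma \<psi>_Im_range': assumes "\<bar>Im w\<bar> \<le> eps" "\<bar>Re w\<bar> < l" shows "\<bar>Im (\<psi> w)\<bar> \<le> eps"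
proof (cases "0 \<le> Im w")
 case True then show ?thesis using \<psi>_Im_range[of w] assms by simp
next
 case False then show ?thesis using \<psi>_Im_range[of "cnj w"] \<psi>_cnj[of w] assms by simp
qed

lemma \<psi>_below: assumes "\<bar>Im w\<bar> \<le> eps" "0 \<le> Re w" "Re w < l" shows "sinh (Re (\<psi> w)) < T * cos (Im (\<psi> w))"
 using \<psi>_S[of w] \<psi>_Im_range'[of w] assms cc_eq[of "Im (\<psi> w)"] by (simp add: S_def)

text \<open>The points of \<open>S\<close> with \<open>\<bar>\<theta>\<bar> \<le> eps\<close> whose defining inequality has slack \<open>\<delta>\<close> form a compact set, and its
 preimage stays away from the boundary of the strip.\<close>
lemma \<psi>_proper:
 assumes d: "0 < \<delta>"
 obtains \<eta> where "0 < \<eta>" "\<eta> < l"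
  "\<And>w. \<bar>Im w\<bar> \<le> eps \<Longrightarrow> l - \<eta> < Re w \<Longrightarrow> Re w < l \<Longrightarrow> T * cos (Im (\<psi> w)) - \<delta> < sinh (Re (\<psi> w))"
proof -
 define K where "K = {\<zeta>. \<bar>Im \<zeta>\<bar> \<le> eps \<and> \<bar>sinh (Re \<zeta>)\<bar> \<le> T * cc (Im \<zeta>) - \<delta>}"
 have KS: "K \<subseteq> S" using d by (auto simp: K_def S_def)
 have "closed K" unfolding K_def
  by (intro closed_Collect_conj closed_Collect_le continuous_intros)
 moreover have "bounded K"
 proof (rule boundedI)
  fix z assume z: "z \<in> K"
  then have "\<bar>sinh (Re z)\<bar> < T" using KS S_Re_bound by blast
  then have "\<bar>Re z\<bar> \<le> T" using real_le_abs_sinh[of "Re z"] unfolding sinh_field_def exp_minus by linarith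
  then show "norm z \<le> T + eps" using z cmod_le[of z] by (auto simp: K_def)
 qed
 ultimately have K: "compact K" by (simp add: compact_eq_bounded_closed)
 obtain g where g: "g holomorphic_on S" "\<And>z. z \<in> Str \<Longrightarrow> g (\<psi> z) = z"
  by (rule holomorphic_has_inverse[OF \<psi>_hol Str_open \<psi>_inj], unfold \<psi>_im, rule that; assumption)
 have gS: "\<bar>Re (g z)\<bar> < l" if zS: "z \<in> S" for z
 proof -
  obtain w where "w \<in> Str" "\<psi> w = z" using zS unfolding \<psi>_im[symmetric] by auto
  then show ?thesis using g(2) by auto
 qed
 have "compact ((\<lambda>z. Re (g z)) ` K)"
  by (intro compact_continuous_image K continuous_intros continuous_on_subset[OF holomorphic_on_imp_continuous_on[OF g(1)] KS])
 then have cpt: "compact (insert 0 ((\<lambda>z. Re (g z)) ` K))" by simp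
 obtain m where m: "m \<in> insert 0 ((\<lambda>z. Re (g z)) ` K)" "\<And>y. y \<in> insert 0 ((\<lambda>z. Re (g z)) ` K) \<Longrightarrow> y \<le> m"
  using compact_attains_sup[OF cpt] by blast
 have ml: "m < l" "0 \<le> m" using m gS KS l by (auto simp: subset_iff) (smt (verit))
 show thesis
 proof (rule that[of "(l - m) / 2"])
  show "0 < (l - m) / 2" "(l - m) / 2 < l" using ml l by auto
  fix w assume w: "\<bar>Im w\<bar> \<le> eps" "l - (l - m) / 2 < Re w" "Re w < l"
  have wp: "0 < Re w" using w ml by (simp add: field_simps)
  have "\<psi> w \<notin> K"
  proof
   assume "\<psi> w \<in> K"
   then have "Re (g (\<psi> w)) \<le> m" using m(2) by blast
   then have "Re w \<le> m" using g(2)[of w] wp w by simp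
   then show False using w ml by (simp add: field_simps)
  qed
  moreover have "\<bar>Im (\<psi> w)\<bar> \<le> eps" using \<psi>_Im_range' w wp by simp
  moreover have "0 < Re (\<psi> w)" using \<psi>_Re_pos wp w by simp
  ultimately show "T * cos (Im (\<psi> w)) - \<delta> < sinh (Re (\<psi> w))"
   using cc_eq[of "Im (\<psi> w)"] by (auto simp: K_def)
 qed
qed

end

section \<open>Boundary regularity on the open sides\<close>

lemma Re_Im_sinh_cosh:
 fixes z :: complex
 shows "Re (sinh z) = sinh (Re z) * cos (Im z)" "Im (sinh z) = cosh (Re z) * sin (Im z)"
  "Re (cosh z) = cosh (Re z) * cos (Im z)" "Im (cosh z) = sinh (Re z) * sin (Im z)"
 by (auto simp: sinh_field_def cosh_field_def Re_exp Im_exp field_simps)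

lemma complex_cosh_ne_0:
 fixes z :: complex assumes "\<bar>Im z\<bar> < pi/2" shows "0 < Re (cosh z)" "cosh z \<noteq> 0"
proof -
 show "0 < Re (cosh z)" using assms by (auto simp: Re_Im_sinh_cosh intro!: mult_pos_pos cos_gt_zero_pi)
 then show "cosh z \<noteq> 0" by auto
qed

lemma complex_hyperbolic_pythagoras: "(cosh z)^2 - (sinh z)^2 = (1::complex)"
 by (rule hyperbolic_pythagoras)

text \<open>\<open>gd\<close> is the complex Gudermannian function. Its real part \<open>arctan (sinh t / cos \<theta>)\<close> is constant on the
 arcs \<open>sinh t = T * cos \<theta>\<close>, so it straightens the sides of the Gauss image.\<close>
definition gdu :: "complex \<Rightarrow> complex" where
 "gdu z = (1 + \<i> * sinh z) / cosh z"

definition gd :: "complex \<Rightarrow> complex" where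
 "gd z = - \<i> * Ln (gdu z)"

lemma gdu_Re_Im:
 assumes z: "\<bar>Im z\<bar> < pi/2"
 shows "0 < Re (gdu z)" "Im (gdu z) / Re (gdu z) = sinh (Re z) / cos (Im z)"
proof -
 have c: "cos (Im z) > 0" using z by (intro cos_gt_zero_pi) auto
 have s: "sin (Im z) < cosh (Re z)"
 proof -
  have "sin (Im z) \<noteq> 1" using c by (metis cos_one_sin_zero order_less_irrefl sin_cos_squared_add2 add_cancel_right_right power2_eq_square mult_1 zero_eq_power2 cos_squared_eq diff_self)
  then have "sin (Im z) < 1" using sin_le_one[of "Im z"] by linarith
  also have "1 \<le> cosh (Re z)" by (rule cosh_real_ge_1)
  finally show ?thesis .
 qed
 define N where "N = (norm (cosh z))^2"
 have N: "N > 0" using complex_cosh_ne_0[OF z] by (simp add: N_def)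
 define t where "t = Re z" define \<theta> where "\<theta> = Im z"
 have p: "(cosh t)^2 = (sinh t)^2 + 1" "(sin \<theta>)^2 = 1 - (cos \<theta>)^2" by (simp_all add: cosh_square_eq sin_squared_eq)
 have g: "gdu z = ((1 + \<i> * sinh z) * cnj (cosh z)) / of_real N"
  unfolding gdu_def N_def by (subst complex_div_cnj) simp
 have "Re ((1 + \<i> * sinh z) * cnj (cosh z)) = cos \<theta> * (cosh t - sin \<theta> * ((cosh t)^2 - (sinh t)^2))"
  by (simp add: Re_Im_sinh_cosh t_def[symmetric] \<theta>_def[symmetric] power2_eq_square algebra_simps)
 also have "\<dots> = cos \<theta> * (cosh t - sin \<theta>)" using p by simp
 finally have re: "Re (gdu z) = cos \<theta> * (cosh t - sin \<theta>) / N" unfolding g Re_divide_of_real by simp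
 have "Im ((1 + \<i> * sinh z) * cnj (cosh z)) = sinh t * (cosh t * (cos \<theta> * cos \<theta> + sin \<theta> * sin \<theta>) - sin \<theta>)"
  by (simp add: Re_Im_sinh_cosh t_def[symmetric] \<theta>_def[symmetric] algebra_simps del: sin_cos_squared_add3)
 also have "\<dots> = sinh t * (cosh t - sin \<theta>)" by simp
 finally have im: "Im (gdu z) = sinh t * (cosh t - sin \<theta>) / N" unfolding g Im_divide_of_real by simp
 show "0 < Re (gdu z)" unfolding re using c s N by (simp add: t_def \<theta>_def)
 show "Im (gdu z) / Re (gdu z) = sinh (Re z) / cos (Im z)"
  unfolding re im using c s N by (simp add: t_def \<theta>_def)
qed

lemma Re_gd: assumes "\<bar>Im z\<bar> < pi/2" shows "Re (gd z) = arctan (sinh (Re z) / cos (Im z))"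
proof -
 have "gdu z \<noteq> 0" using gdu_Re_Im(1)[OF assms] by auto
 then have "Re (gd z) = Arg (gdu z)" by (simp add: gd_def Arg_eq_Im_Ln)
 then show ?thesis using arg_conv_arctan[OF gdu_Re_Im(1)[OF assms]] gdu_Re_Im(2)[OF assms] by simp
qed

lemma gd_deriv: assumes z: "\<bar>Im z\<bar> < pi/2" shows "(gd has_field_derivative 1 / cosh z) (at z)"
proof -
 have c: "cosh z \<noteq> 0" using complex_cosh_ne_0[OF z] by simp
 have g: "gdu z \<notin> \<real>\<^sub>\<le>\<^sub>0" using gdu_Re_Im(1)[OF z] by (auto simp: complex_nonpos_Reals_iff)
 have n: "1 + \<i> * sinh z \<noteq> 0" using gdu_Re_Im(1)[OF z] by (auto simp: gdu_def)
 have d: "(gdu has_field_derivative ((\<i> * cosh z * cosh z - (1 + \<i> * sinh z) * sinh z) / (cosh z * cosh z))) (at z)"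
  unfolding gdu_def using c by (auto intro!: derivative_eq_intros)
 have "\<i> * cosh z * cosh z - (1 + \<i> * sinh z) * sinh z = \<i> * ((cosh z)^2 - (sinh z)^2) - sinh z"
  by (simp add: power2_eq_square algebra_simps)
 also have "\<dots> = \<i> * (1 + \<i> * sinh z)" unfolding complex_hyperbolic_pythagoras by (simp add: algebra_simps)
 finally have d: "(gdu has_field_derivative (\<i> * (1 + \<i> * sinh z) / (cosh z * cosh z))) (at z)" using d by simp
 have "(gd has_field_derivative - \<i> * (inverse (gdu z) * (\<i> * (1 + \<i> * sinh z) / (cosh z * cosh z)))) (at z)"
  unfolding gd_def by (intro DERIV_cmult DERIV_chain2[where f=Ln and g=gdu, OF has_field_derivative_Ln[OF g]] d)
 moreover have "- \<i> * (inverse (gdu z) * (\<i> * (1 + \<i> * sinh z) / (cosh z * cosh z))) = 1 / cosh z"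
 proof -
  define a where "a = 1 + \<i> * sinh z"
  have "- \<i> * (inverse (a / cosh z) * (\<i> * a / (cosh z * cosh z))) = (- \<i> * \<i>) * (a * inverse a) * (cosh z / (cosh z * cosh z))"
  proof -
   have "- \<i> * (x * (\<i> * y)) = - \<i> * \<i> * (x * y)" for x y :: complex by (simp add: complex_eq_iff)
   from this[of "inverse (a / cosh z)" "a / (cosh z * cosh z)"] show ?thesis by (simp add: divide_inverse mult_ac)
  qed
  then show ?thesis using c n unfolding gdu_def a_def[symmetric] by simp
 qed
 ultimately show ?thesis by simp
qed

lemma gd_inverse:
 assumes z: "\<bar>Im z\<bar> < pi/2" shows "z = - Ln ((1 - sin (gd z)) / cos (gd z))"
proof -
 have c: "cosh z \<noteq> 0" using complex_cosh_ne_0[OF z] by simp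
 have n: "1 + \<i> * sinh z \<noteq> 0" using gdu_Re_Im(1)[OF z] by (auto simp: gdu_def)
 have g0: "gdu z \<noteq> 0" using gdu_Re_Im(1)[OF z] by auto
 have e1: "exp (\<i> * gd z) = (1 + \<i> * sinh z) / cosh z" using g0 by (simp add: gd_def gdu_def)
 have m: "(1 + \<i> * sinh z) * (1 - \<i> * sinh z) = (cosh z)^2"
  using complex_hyperbolic_pythagoras[of z] by (simp add: algebra_simps power2_eq_square)
 have "exp (- (\<i> * gd z)) = cosh z / (1 + \<i> * sinh z)" unfolding exp_minus e1 by simp
 also have "\<dots> = (1 - \<i> * sinh z) / cosh z" using m c n by (simp add: field_simps power2_eq_square)
 finally have e2: "exp (- (\<i> * gd z)) = (1 - \<i> * sinh z) / cosh z" .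
 have cos: "cos (gd z) = 1 / cosh z" unfolding cos_exp_eq e1 e2 using c by (simp add: field_simps)
 have sin: "sin (gd z) = sinh z / cosh z" unfolding sin_exp_eq e1 e2 using c by (simp add: field_simps)
 have "(1 - sin (gd z)) / cos (gd z) = cosh z - sinh z" unfolding cos sin using c by (simp add: field_simps)
 also have "\<dots> = exp (- z)" by (rule cosh_minus_sinh)
 finally show ?thesis using z Ln_exp[of "- z"] by simp
qed

lemma gd_inverse_cont:
 fixes F :: "'a \<Rightarrow> complex"
 assumes F: "(F \<longlongrightarrow> a) G" and a: "\<bar>Re a\<bar> < pi/2"
 shows "((\<lambda>x. - Ln ((1 - sin (F x)) / cos (F x))) \<longlongrightarrow> - Ln ((1 - sin a) / cos a)) G"
proof -
 have s: "sinh (\<i> * a) = \<i> * sin a" "cosh (\<i> * a) = cos a"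
  by (simp_all add: sinh_field_def cosh_field_def sin_exp_eq cos_exp_eq field_simps)
 have im: "\<bar>Im (\<i> * a)\<bar> < pi/2" using a by simp
 have "gdu (\<i> * a) = (1 - sin a) / cos a" by (simp add: gdu_def s)
 then have "0 < Re ((1 - sin a) / cos a)" using gdu_Re_Im(1)[OF im] by simp
 then have "(1 - sin a) / cos a \<notin> \<real>\<^sub>\<le>\<^sub>0" by (auto simp: complex_nonpos_Reals_iff)
 moreover have "cos a \<noteq> 0" using complex_cosh_ne_0[OF im] s by simp
 ultimately show ?thesis by (intro tendsto_intros isCont_tendsto_compose[OF isCont_sin F] isCont_tendsto_compose[OF isCont_cos F]) auto
qed

context gauss_map begin

definition "HS = {w::complex. 0 < Re w \<and> Re w < l}"

lemma HS: "open HS" "convex HS" "HS \<subseteq> Str"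
proof -
 have "HS = {w. 0 < Re w} \<inter> {w. Re w < l}" by (auto simp: HS_def)
 then show "open HS" "convex HS"
  using open_halfspace_Re_gt open_halfspace_Re_lt convex_halfspace_Re_gt convex_halfspace_Re_lt
  by (auto intro: convex_Int)
 show "HS \<subseteq> Str" using l by (auto simp: HS_def)
qed

lemma \<psi>_range_bound: "\<bar>Re w\<bar> < l \<Longrightarrow> \<bar>Re (\<psi> w)\<bar> \<le> T"
 using S_Re_bound[OF \<psi>_S, of w] real_le_abs_sinh[of "Re (\<psi> w)"] unfolding sinh_field_def exp_minus by linarith

text \<open>The rotated function \<open>\<i> * (arctan T - gd (\<psi> w))\<close> is real on the side and has positive imaginary part inside; it
 reflects, and its derivative on the side is positive.\<close>
lemma side_regularity:
 assumes w0: "Re w0 = l" "\<bar>Im w0\<bar> < eps"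
 obtains L c where "0 < c" "(\<psi> \<longlongrightarrow> L) (at w0 within HS)" "(D \<longlongrightarrow> of_real c * cosh L) (at w0 within HS)"
proof -
 define r where "r = min l (eps - \<bar>Im w0\<bar>)"
 have r: "r > 0" using w0 l by (simp add: r_def)
 define W where "W s = w0 + \<i> * s" for s :: complex
 have W: "W s \<in> HS" "\<bar>Im (W s)\<bar> < eps" "\<bar>Re (W s)\<bar> < l" "\<bar>Im (\<psi> (W s))\<bar> < eps" if s: "s \<in> ball 0 r" "0 < Im s" for s
 proof -
  have "\<bar>Im s\<bar> < r" "\<bar>Re s\<bar> < r" using s abs_Im_le_cmod[of s] abs_Re_le_cmod[of s] by auto
  then show "W s \<in> HS" "\<bar>Im (W s)\<bar> < eps" "\<bar>Re (W s)\<bar> < l" using s w0 by (auto simp: W_def HS_def r_def)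
  then show "\<bar>Im (\<psi> (W s))\<bar> < eps" by (intro \<psi>_Im_bounds')
 qed
 define F where "F w = gd (\<psi> w)" for w
 define \<tau> where "\<tau> = arctan T"
 have tau: "0 < \<tau>" "\<tau> < pi/2" using T arctan_ubound by (auto simp: \<tau>_def)
 define Fs where "Fs s = \<i> * (of_real \<tau> - F (W s))" for s
 have dF: "(F has_field_derivative (1 / cosh (\<psi> w)) * D w) (at w)" if "\<bar>Re w\<bar> < l" "\<bar>Im (\<psi> w)\<bar> < eps" for w
  unfolding F_def by (rule DERIV_chain2[OF gd_deriv \<psi>_D]) (use that eps in auto)
 have dFs: "(Fs has_field_derivative (1 / cosh (\<psi> (W s))) * D (W s)) (at s)" if s: "s \<in> ball 0 r" "0 < Im s" for s
 proof -
  have "((\<lambda>s. F (W s)) has_field_derivative ((1 / cosh (\<psi> (W s))) * D (W s)) * \<i>) (at s)"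
   by (rule DERIV_chain2[OF dF]) (use W[OF s] in "auto simp: W_def intro!: derivative_eq_intros")
  then have "(Fs has_field_derivative \<i> * (0 - ((1 / cosh (\<psi> (W s))) * D (W s)) * \<i>)) (at s)"
   unfolding Fs_def by (intro DERIV_cmult DERIV_diff DERIV_const)
  moreover have "\<i> * (0 - ((1 / cosh (\<psi> (W s))) * D (W s)) * \<i>) = (1 / cosh (\<psi> (W s))) * D (W s)"
   by (simp add: algebra_simps)
  ultimately show ?thesis by simp
 qed
 have U: "open (ball 0 r \<inter> {s. 0 < Im s})" by (intro open_Int open_halfspace_Im_gt open_ball)
 have hol: "Fs holomorphic_on (ball 0 r \<inter> {s. 0 < Im s})"
  unfolding holomorphic_on_open[OF U] using dFs by blast
 have ImFs: "Im (Fs s) = arctan T - arctan (sinh (Re (\<psi> (W s))) / cos (Im (\<psi> (W s))))" if s: "s \<in> ball 0 r" "0 < Im s" for s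
  unfolding Fs_def F_def using Re_gd[of "\<psi> (W s)"] W(4)[OF s] eps by (simp add: \<tau>_def)
 have cosp: "0 < cos (Im (\<psi> (W s)))" "cos eps \<le> cos (Im (\<psi> (W s)))" if s: "s \<in> ball 0 r" "0 < Im s" for s
 proof -
  have "cos eps \<le> cos \<bar>Im (\<psi> (W s))\<bar>" using W(4)[OF s] eps pi_half_less_two by (intro cos_monotone_0_pi_le) auto
  then show "cos eps \<le> cos (Im (\<psi> (W s)))" by (simp add: abs_if split: if_splits)
  moreover have "0 < cos eps" using eps by (intro cos_gt_zero_pi) auto
  ultimately show "0 < cos (Im (\<psi> (W s)))" by linarith
 qed
 have pos: "0 < Im (Fs s)" if s: "s \<in> ball 0 r" "0 < Im s" for s
 proof -
  have "sinh (Re (\<psi> (W s))) < T * cos (Im (\<psi> (W s)))"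
   by (rule \<psi>_below) (use W[OF s] in "auto simp: HS_def")
  then have "sinh (Re (\<psi> (W s))) / cos (Im (\<psi> (W s))) < T" using cosp(1)[OF s] by (simp add: field_simps)
  then show ?thesis unfolding ImFs[OF s] by (simp add: arctan_less_iff)
 qed
 have bd: "\<exists>M. \<forall>s. s \<in> ball 0 r \<longrightarrow> 0 < Im s \<longrightarrow> norm (Fs s) \<le> M"
 proof -
  define K where "K = cbox (Complex (-T) (-eps)) (Complex T eps)"
  have "continuous_on K gd"
   by (intro continuous_at_imp_continuous_on ballI DERIV_isCont[OF gd_deriv]) (use eps in "auto simp: K_def in_cbox_complex_iff")
  then have "bounded (gd ` K)" by (intro compact_imp_bounded compact_continuous_image) (auto simp: K_def)
  then obtain M where M: "\<And>z. z \<in> K \<Longrightarrow> norm (gd z) \<le> M" by (auto simp: bounded_iff)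
  have "norm (Fs s) \<le> \<bar>\<tau>\<bar> + M" if s: "s \<in> ball 0 r" "0 < Im s" for s
  proof -
   have "\<psi> (W s) \<in> K" using W[OF s] \<psi>_range_bound[of "W s"] by (auto simp: K_def in_cbox_complex_iff)
   then have "norm (F (W s)) \<le> M" using M by (simp add: F_def)
   moreover have "norm (Fs s) \<le> norm (complex_of_real \<tau>) + norm (F (W s))"
    unfolding Fs_def norm_mult norm_ii mult_1 by (rule norm_triangle_ineq4)
   ultimately show ?thesis by simp
  qed
  then show ?thesis by blast
 qed
 then obtain M where M: "\<And>s. s \<in> ball 0 r \<Longrightarrow> 0 < Im s \<Longrightarrow> norm (Fs s) \<le> M" by blast
 have lim: "((\<lambda>s. Im (Fs s)) \<longlongrightarrow> 0) (at_upper x)" if x: "\<bar>x\<bar> < r" for x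
 proof (rule tendstoI)
  fix e :: real assume e: "e > 0"
  have "isCont arctan T" by (rule isCont_arctan)
  then obtain d where d: "d > 0" "\<And>u. dist u T < d \<Longrightarrow> dist (arctan u) (arctan T) < e"
   using e unfolding continuous_at_eps_delta by blast
  have ce: "0 < cos eps" using eps by (intro cos_gt_zero_pi) auto
  obtain \<eta> where \<eta>: "0 < \<eta>" "\<eta> < l"
   "\<And>w. \<bar>Im w\<bar> \<le> eps \<Longrightarrow> l - \<eta> < Re w \<Longrightarrow> Re w < l \<Longrightarrow> T * cos (Im (\<psi> w)) - d * cos eps < sinh (Re (\<psi> w))"
   using \<psi>_proper[of "d * cos eps"] d(1) ce by auto
  have "\<forall>\<^sub>F s in nhds (of_real x). s \<in> ball 0 r \<inter> {s. Im s < \<eta>}"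
   by (rule eventually_nhds_in_open) (use x \<eta> in "auto intro!: open_Int open_halfspace_Im_lt")
  then show "\<forall>\<^sub>F s in at_upper x. dist (Im (Fs s)) 0 < e"
   unfolding eventually_at_filter
  proof eventually_elim
   case (elim s)
   show ?case
   proof (intro impI)
    assume "s \<in> {s. 0 < Im s}"
    then have s: "s \<in> ball 0 r" "0 < Im s" "Im s < \<eta>" using elim by auto
    have "T * cos (Im (\<psi> (W s))) - d * cos eps < sinh (Re (\<psi> (W s)))"
     by (rule \<eta>(3)) (use W[OF s(1,2)] s w0 in "auto simp: W_def")
    then have "T * cos (Im (\<psi> (W s))) - d * cos (Im (\<psi> (W s))) < sinh (Re (\<psi> (W s)))"
     using cosp(2)[OF s(1,2)] d(1) by (smt (verit) mult_left_mono)
    then have "T - d < sinh (Re (\<psi> (W s))) / cos (Im (\<psi> (W s)))"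
     using cosp(1)[OF s(1,2)] by (simp add: field_simps)
    moreover have "sinh (Re (\<psi> (W s))) / cos (Im (\<psi> (W s))) < T"
     using pos[OF s(1,2)] unfolding ImFs[OF s(1,2)] by (simp add: arctan_less_iff)
    ultimately have "dist (arctan (sinh (Re (\<psi> (W s))) / cos (Im (\<psi> (W s))))) (arctan T) < e"
     by (intro d(2)) (simp add: dist_real_def)
    then show "dist (Im (Fs s)) 0 < e" unfolding ImFs[OF s(1,2)] by (simp add: dist_real_def)
   qed
  qed
 qed
 obtain G where G: "G holomorphic_on ball 0 r"
  "\<And>z. z \<in> ball 0 r \<Longrightarrow> 0 < Im z \<Longrightarrow> G z = Fs z" "\<And>x. \<bar>x\<bar> < r \<Longrightarrow> Im (G (of_real x)) = 0"
 proof (rule weak_Schwarz_reflection[of r Fs M])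
  fix G assume "G holomorphic_on ball 0 r"
   "\<And>z. z \<in> ball 0 r \<Longrightarrow> 0 < Im z \<Longrightarrow> G z = Fs z" "\<And>x. \<bar>x\<bar> < r \<Longrightarrow> Im (G (of_real x)) = 0"
  then show thesis by (rule that)
 qed (use r hol M lim in auto)
 have dG: "Im (deriv G 0) = 0" "0 < Re (deriv G 0)"
  using deriv_at_real_boundary_pos[OF r G(1,3)] G(2) pos by auto
 define c where "c = Re (deriv G 0)"
 have dGc: "deriv G 0 = of_real c" using dG by (simp add: c_def complex_eq_iff)
 define sw where "sw w = - \<i> * (w - w0)" for w
 have Wsw: "W (sw w) = w" for w by (simp add: W_def sw_def)
 have swl: "(sw \<longlongrightarrow> 0) (at w0 within HS)"
  unfolding sw_def by (rule tendsto_eq_intros refl | simp)+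
 have ev: "\<forall>\<^sub>F w in at w0 within HS. sw w \<in> ball 0 r \<and> 0 < Im (sw w)"
 proof -
  have "\<forall>\<^sub>F w in at w0 within HS. sw w \<in> ball 0 r" using topological_tendstoD[OF swl, of "ball 0 r"] r by simp
  moreover have "\<forall>\<^sub>F w in at w0 within HS. 0 < Im (sw w)"
   using w0 by (auto simp: eventually_at_filter HS_def sw_def)
  ultimately show ?thesis by eventually_elim auto
 qed
 have Gc: "isCont G 0" "isCont (deriv G) 0"
  using holomorphic_on_imp_continuous_on[OF G(1)] holomorphic_on_imp_continuous_on[OF holomorphic_deriv[OF G(1)]] r
  by (auto simp: continuous_on_eq_continuous_at)
 have Fl: "(F \<longlongrightarrow> of_real \<tau> + \<i> * G 0) (at w0 within HS)"
 proof (rule Lim_transform_eventually)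
  show "((\<lambda>w. of_real \<tau> + \<i> * G (sw w)) \<longlongrightarrow> of_real \<tau> + \<i> * G 0) (at w0 within HS)"
   by (intro tendsto_intros isCont_tendsto_compose[OF Gc(1) swl])
  show "\<forall>\<^sub>F w in at w0 within HS. of_real \<tau> + \<i> * G (sw w) = F w"
   using ev by eventually_elim (simp add: G(2) Fs_def Wsw algebra_simps)
 qed
 have Rea: "\<bar>Re (of_real \<tau> + \<i> * G 0)\<bar> < pi/2" using tau G(3)[of 0] r by simp
 define L where "L = - Ln ((1 - sin (of_real \<tau> + \<i> * G 0)) / cos (of_real \<tau> + \<i> * G 0))"
 have L: "(\<psi> \<longlongrightarrow> L) (at w0 within HS)"
  unfolding L_def
 proof (rule Lim_transform_eventually[OF gd_inverse_cont[OF Fl Rea]])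
  show "\<forall>\<^sub>F w in at w0 within HS. - Ln ((1 - sin (F w)) / cos (F w)) = \<psi> w"
   using ev
  proof eventually_elim
   case (elim w)
   then show ?case using gd_inverse[of "\<psi> w"] W(4)[of "sw w"] eps by (simp add: Wsw F_def)
  qed
 qed
 have "(D \<longlongrightarrow> deriv G 0 * cosh L) (at w0 within HS)"
 proof (rule Lim_transform_eventually)
  show "((\<lambda>w. deriv G (sw w) * cosh (\<psi> w)) \<longlongrightarrow> deriv G 0 * cosh L) (at w0 within HS)"
   by (intro tendsto_intros isCont_tendsto_compose[OF Gc(2) swl] L)
  show "\<forall>\<^sub>F w in at w0 within HS. deriv G (sw w) * cosh (\<psi> w) = D w"
   using ev
  proof eventually_elim
   case (elim w)
   have "(G has_field_derivative (1 / cosh (\<psi> (W (sw w)))) * D (W (sw w))) (at (sw w))"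
    by (rule has_field_derivative_transform_within_open[OF dFs U]) (use elim G(2) in auto)
   then have "deriv G (sw w) = D w / cosh (\<psi> w)" by (simp add: DERIV_imp_deriv Wsw)
   moreover have "cosh (\<psi> w) \<noteq> 0" using complex_cosh_ne_0[of "\<psi> w"] W(4)[of "sw w"] elim eps by (simp add: Wsw)
   ultimately show ?case by simp
  qed
 qed
 then have "(D \<longlongrightarrow> of_real c * cosh L) (at w0 within HS)" unfolding dGc .
 moreover have "0 < c" using dG by (simp add: c_def)
 ultimately show thesis using L that by blast
qed

end

text \<open>Compares the distances of a point of a sector from its side before and after the sector of angle \<open>g\<close> is opened to a half plane.\<close>
lemma sin_ratio_bound:
 assumes b: "0 \<le> b" "b \<le> g" and g: "0 < g" "g < pi"
 shows "sin (pi * b / g) \<le> pi * sin b / sin g"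
proof -
 have cv: "convex_on {0..pi} (\<lambda>x. - sin x)"
  by (rule convex_on_realI[where f'="\<lambda>x. - cos x"]) (auto intro!: derivative_eq_intros cos_monotone_0_pi_le)
 have "(\<lambda>x. - sin x) ((1 - b/g) *\<^sub>R 0 + (b/g) *\<^sub>R g) \<le> (1 - b/g) * (- sin 0) + (b/g) * (- sin g)"
  by (rule convex_onD[OF cv]) (use b g in auto)
 then have 1: "b / g * sin g \<le> sin b" using g by simp
 have sg: "sin g > 0" using g by (intro sin_gt_zero) auto
 have "sin (pi * b / g) \<le> pi * b / g" using b g by (intro sin_x_le_x) auto
 also have "\<dots> = pi * (b / g * sin g) / sin g" using sg by simp
 also have "\<dots> \<le> pi * sin b / sin g" using 1 sg by (intro divide_right_mono mult_left_mono) auto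
 finally show ?thesis .
qed

context gauss_map begin

section \<open>Boundary regularity at the corners\<close>

text \<open>At a corner the symmetry line \<open>\<theta> = eps\<close> meets the arc \<open>sinh t = T * cos \<theta>\<close> in the point \<open>t0 + \<i> eps\<close>. Under
 \<open>kk\<close> the line becomes the positive real axis and the arc a part of a circle through
 \<open>exp t0\<close> and \<open>- exp (- t0)\<close>. The Moebius map \<open>qq\<close> sends these two points to \<open>0\<close> and \<open>\<infinity>\<close>, and so half of the Gauss
 image near the corner becomes a sector with vertex \<open>0\<close>, whose angle is \<open>gam\<close>.\<close>
definition "t0 = arsinh (T * cos eps)"
definition "gam = pi/2 + arctan (T * sin eps / cosh t0)"
definition "kk z = exp (z - \<i> * of_real eps)" for z :: complex
definition "qq z = (of_real (exp t0) - kk z) / (kk z + of_real (exp (- t0)))" for z :: complex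

lemma t0: "sinh t0 = T * cos eps" "0 < t0"
proof -
 show "sinh t0 = T * cos eps" by (simp add: t0_def)
 have "0 < cos eps" using eps by (intro cos_gt_zero_pi) auto
 then show "0 < t0" using T by (simp add: t0_def)
qed

text \<open>The upper bound \<open>5 * pi / 6\<close>, which comes from \<open>eps \<le> pi / 3\<close>, keeps the order of vanishing of \<open>\<psi>'\<close> at the
 corner below \<open>2/3\<close>.\<close>
lemma gam: "pi/2 < gam" "gam < 5 * pi / 6" "0 < sin gam" "cosh t0 * cos gam + T * sin eps * sin gam = 0"
proof -
 have ce: "0 < cos eps" "0 < sin eps" using eps by (auto intro!: cos_gt_zero_pi sin_gt_zero)
 have ch: "0 < cosh t0" by (rule cosh_real_pos)
 define a where "a = arctan (T * sin eps / cosh t0)"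
 have a0: "0 < a" using T ce ch by (simp add: a_def)
 have "T * sin eps / cosh t0 < tan eps"
 proof -
  have "T * cos eps < cosh t0" using t0(1) sinh_less_cosh_real[of t0] by simp
  then show ?thesis using ce ch by (simp add: tan_def field_simps)
 qed
 then have "a < arctan (tan eps)" by (simp add: a_def arctan_less_iff)
 also have "\<dots> = eps" using eps by (intro arctan_tan) auto
 finally have a1: "a < eps" .
 show "pi/2 < gam" using a0 by (simp add: gam_def a_def)
 show g2: "gam < 5 * pi / 6" using a1 eps(2) by (simp add: gam_def a_def)
 have cs: "cos gam = - sin a" "sin gam = cos a" by (simp_all add: gam_def a_def[symmetric] sin_add cos_add)
 have ca: "cos a > 0" unfolding a_def using arctan_lbound arctan_ubound by (intro cos_gt_zero_pi) auto
 then show "0 < sin gam" unfolding cs .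
 have "tan a = T * sin eps / cosh t0" by (simp add: a_def tan_arctan)
 then have "sin a = T * sin eps / cosh t0 * cos a" using ca by (simp add: tan_def field_simps)
 then show "cosh t0 * cos gam + T * sin eps * sin gam = 0" unfolding cs using ch by simp
qed

lemma qq_formulas:
 assumes z: "0 \<le> Im z" "Im z \<le> eps" "\<bar>Re z\<bar> \<le> T"
 defines "N \<equiv> (norm (kk z + of_real (exp (- t0))))^2"
 shows "exp (- 2 * t0) \<le> N" "kk z + of_real (exp (- t0)) \<noteq> 0"
  "Im (qq z) = 2 * cosh t0 * (exp (Re z) * sin (eps - Im z)) / N"
  "Im (qq z * cis (- gam)) = sin gam * (2 * exp (Re z) * (sinh (Re z) - T * cos (Im z))) / N"
  "norm (qq z) \<le> (exp t0 + exp T) * exp t0"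
proof -
 define \<phi> where "\<phi> = Im z - eps"
 have ph: "\<bar>\<phi>\<bar> < pi/2" using z eps by (simp add: \<phi>_def)
 have k: "Re (kk z) = exp (Re z) * cos \<phi>" "Im (kk z) = exp (Re z) * sin \<phi>"
  by (simp_all add: kk_def Re_exp Im_exp \<phi>_def)
 have "0 < cos \<phi>" using ph by (intro cos_gt_zero_pi) auto
 then have rk: "0 < Re (kk z)" using k by simp
 have rd: "exp (- t0) \<le> Re (kk z + of_real (exp (- t0)))" using rk by simp
 also have "\<dots> \<le> norm (kk z + of_real (exp (- t0)))" by (rule complex_Re_le_cmod)
 finally have nd: "exp (- t0) \<le> norm (kk z + of_real (exp (- t0)))" .
 then have "(exp (- t0))^2 \<le> N" unfolding N_def by (intro power_mono) auto
 then show "exp (- 2 * t0) \<le> N" by (simp flip: exp_of_nat_mult)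
 show ne: "kk z + of_real (exp (- t0)) \<noteq> 0" using nd by auto
 have Np: "N > 0" using ne by (simp add: N_def)
 have nk: "norm (kk z) \<le> exp T" using z by (simp add: kk_def norm_exp_eq_Re)
 have "norm (of_real (exp t0) - kk z) \<le> exp t0 + exp T"
  using norm_triangle_ineq4[of "of_real (exp t0)" "kk z"] nk by simp
 then have "norm (qq z) \<le> (exp t0 + exp T) / exp (- t0)"
  unfolding qq_def norm_divide by (rule frac_le[rotated]) (use nd in "auto intro: add_nonneg_nonneg")
 then show "norm (qq z) \<le> (exp t0 + exp T) * exp t0" by (simp add: exp_minus divide_inverse)
 have q: "qq z = ((of_real (exp t0) - kk z) * cnj (kk z + of_real (exp (- t0)))) / of_real N"
  unfolding qq_def N_def by (subst complex_div_cnj) simp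
 have ee: "exp t0 * exp (- t0) = 1" "exp t0 + exp (- t0) = 2 * cosh t0" "exp t0 - exp (- t0) = 2 * sinh t0"
  by (simp_all add: cosh_field_def sinh_field_def flip: exp_add)
 have "Im ((of_real (exp t0) - kk z) * cnj (kk z + of_real (exp (- t0)))) = - (exp t0 + exp (- t0)) * Im (kk z)"
  by (simp add: algebra_simps)
 then have iq: "Im (qq z) = - 2 * cosh t0 * Im (kk z) / N" unfolding q Im_divide_of_real ee by simp
 show "Im (qq z) = 2 * cosh t0 * (exp (Re z) * sin (eps - Im z)) / N"
 proof -
  have "sin \<phi> = - sin (eps - Im z)" using sin_minus[of "eps - Im z"] by (simp add: \<phi>_def)
  then show ?thesis unfolding iq k by simp
 qed
 have "Re ((of_real (exp t0) - kk z) * cnj (kk z + of_real (exp (- t0)))) =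
   exp t0 * exp (- t0) + (exp t0 - exp (- t0)) * Re (kk z) - ((Re (kk z))^2 + (Im (kk z))^2)"
  by (simp add: algebra_simps power2_eq_square)
 then have rq: "Re (qq z) = (1 + 2 * sinh t0 * Re (kk z) - ((Re (kk z))^2 + (Im (kk z))^2)) / N"
  unfolding q Re_divide_of_real ee by simp
 have nn: "(Re (kk z))^2 + (Im (kk z))^2 = (exp (Re z))^2"
  unfolding k by (simp add: power_mult_distrib flip: distrib_left)
 have es: "2 * exp (Re z) * sinh (Re z) = (exp (Re z))^2 - 1"
 proof -
  have "2 * exp (Re z) * sinh (Re z) = exp (Re z) * exp (Re z) - exp (Re z) * exp (- Re z)"
   by (simp add: sinh_field_def right_diff_distrib)
  then show ?thesis by (simp add: power2_eq_square flip: exp_add)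
 qed
 have ct: "cos (Im z) = cos \<phi> * cos eps - sin \<phi> * sin eps"
  using cos_add[of \<phi> eps] by (simp add: \<phi>_def)
 have "Im (qq z * cis (- gam)) = Im (qq z) * cos gam - Re (qq z) * sin gam" by simp
 also have "\<dots> = (- 2 * cosh t0 * Im (kk z) * cos gam
   - (1 + 2 * sinh t0 * Re (kk z) - ((Re (kk z))^2 + (Im (kk z))^2)) * sin gam) / N"
  unfolding iq rq by (simp only: times_divide_eq_left diff_divide_distrib[symmetric])
 also have "- 2 * cosh t0 * Im (kk z) * cos gam
   - (1 + 2 * sinh t0 * Re (kk z) - ((Re (kk z))^2 + (Im (kk z))^2)) * sin gam
  = - 2 * Im (kk z) * (cosh t0 * cos gam + T * sin eps * sin gam)
   + sin gam * ((exp (Re z))^2 - 1 - 2 * T * (cos eps * Re (kk z) - sin eps * Im (kk z)))"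
  unfolding nn t0 by (simp add: algebra_simps)
 also have "\<dots> = sin gam * (2 * exp (Re z) * (sinh (Re z) - T * cos (Im z)))"
  unfolding gam es[symmetric] k ct by (simp add: algebra_simps)
 finally show "Im (qq z * cis (- gam)) = sin gam * (2 * exp (Re z) * (sinh (Re z) - T * cos (Im z))) / N" .
qed

lemma qq_deriv:
 assumes "kk z + of_real (exp (- t0)) \<noteq> 0"
 shows "(qq has_field_derivative - kk z * of_real (2 * cosh t0) / (kk z + of_real (exp (- t0)))^2) (at z)"
proof -
 have k: "(kk has_field_derivative kk z) (at z)" unfolding kk_def by (auto intro!: derivative_eq_intros)
 have "(qq has_field_derivative ((0 - kk z) * (kk z + of_real (exp (- t0))) - (of_real (exp t0) - kk z) * (kk z + 0)) /
  ((kk z + of_real (exp (- t0))) * (kk z + of_real (exp (- t0))))) (at z)"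
  unfolding qq_def by (intro DERIV_divide DERIV_diff DERIV_add DERIV_const k assms)
 moreover have "(0 - kk z) * (kk z + of_real (exp (- t0))) - (of_real (exp t0) - kk z) * (kk z + 0) = - kk z * of_real (2 * cosh t0)"
  by (simp add: cosh_field_def algebra_simps)
 ultimately show ?thesis by (simp add: power2_eq_square)
qed

lemma qq_inverse:
 assumes "kk z + of_real (exp (- t0)) \<noteq> 0" "\<bar>Im (z - \<i> * of_real eps)\<bar> < pi"
 shows "z = \<i> * of_real eps + Ln ((of_real (exp t0) - qq z * of_real (exp (- t0))) / (1 + qq z))"
proof -
 define d where "d = kk z + of_real (exp (- t0))"
 have d: "d \<noteq> 0" using assms by (simp add: d_def)
 have c2: "complex_of_real (2 * cosh t0) = of_real (exp t0) + of_real (exp (- t0))" by (simp add: cosh_field_def)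
 have e1: "complex_of_real (exp t0) * of_real (exp (- t0)) = 1" by (simp flip: exp_add of_real_mult)
 have "1 + qq z = of_real (2 * cosh t0) / d" using d unfolding qq_def d_def[symmetric]
  unfolding c2 by (simp add: field_simps) (simp add: d_def)
 moreover have "of_real (exp t0) - qq z * of_real (exp (- t0)) = kk z * of_real (2 * cosh t0) / d"
  using d unfolding qq_def d_def[symmetric]
  unfolding c2 by (simp add: field_simps del: of_real_add) (use e1 in "simp add: d_def algebra_simps")
 moreover have "of_real (2 * cosh t0) \<noteq> (0::complex)" using cosh_real_pos[of t0] by (metis mult_pos_pos of_real_eq_0_iff order_less_irrefl zero_less_numeral)
 ultimately have "(of_real (exp t0) - qq z * of_real (exp (- t0))) / (1 + qq z) = kk z" using d by simp
 then show ?thesis using Ln_exp[of "z - \<i> * of_real eps"] assms(2) by (simp add: kk_def)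
qed

end

context gauss_map begin

definition "w0 = Complex l eps"
abbreviation "Rect \<equiv> cbox 0 (Complex l eps)"
definition "QS = {w::complex. 0 < Re w \<and> Re w < l \<and> 0 < Im w \<and> Im w < eps}"

lemma qq_at_QS:
 assumes w: "w \<in> QS"
 defines "q \<equiv> qq (\<psi> w)"
 shows "0 < Im q" "Im (q * cis (- gam)) < 0" "0 < Im (Ln q)" "Im (Ln q) < gam"
  "norm q \<le> (exp t0 + exp T) * exp t0"
  "- Im (q * cis (- gam)) \<le> 2 * exp T * (T * cos (Im (\<psi> w)) - sinh (Re (\<psi> w))) * exp (2 * t0)"
  "kk (\<psi> w) + of_real (exp (- t0)) \<noteq> 0"
  "2 / (exp T + 1)^2 \<le> norm (deriv qq (\<psi> w))"
  "norm (deriv qq (\<psi> w)) \<le> exp T * (2 * cosh t0) * exp (2 * t0)"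
proof -
 define z where "z = \<psi> w"
 have wl: "\<bar>Re w\<bar> < l" using w by (simp add: QS_def)
 have z: "0 < Im z" "Im z < eps" "0 < Re z" "\<bar>Re z\<bar> \<le> T"
  using \<psi>_Im_bounds[of w] \<psi>_Re_pos[of w] \<psi>_range_bound[OF wl] w by (auto simp: QS_def z_def)
 have zb: "sinh (Re z) < T * cos (Im z)" unfolding z_def by (rule \<psi>_below) (use w in "auto simp: QS_def")
 define N where "N = (norm (kk z + of_real (exp (- t0))))^2"
 note f = qq_formulas[of z, folded N_def, OF less_imp_le[OF z(1)] less_imp_le[OF z(2)] z(4)]
 have N: "0 < N" using f(1) by (smt (verit) exp_gt_zero)
 have qz: "q = qq z" by (simp add: q_def z_def)
 have "0 < sin (eps - Im z)" using z eps by (intro sin_gt_zero) auto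
 then show p1: "0 < Im q" unfolding qz f(3) using N cosh_real_pos[of t0] by simp
 show p2: "Im (q * cis (- gam)) < 0" unfolding qz f(4)
  using N gam(3) zb by (intro divide_neg_pos mult_pos_neg) auto
 show p3: "0 < Im (Ln q)" using Im_Ln_pos_lt_imp[OF p1] by simp
 have q0: "q \<noteq> 0" using p1 by auto
 have "q * cis (- gam) = exp (Ln q + \<i> * of_real (- gam))" using q0 unfolding exp_add cis_conv_exp by simp
 then have "Im (q * cis (- gam)) = exp (Re (Ln q)) * sin (Im (Ln q) - gam)" by (simp add: Im_exp)
 then have sn: "sin (Im (Ln q) - gam) < 0" using p2 by (simp add: mult_less_0_iff)
 show "Im (Ln q) < gam"
 proof (rule ccontr)
  assume "\<not> Im (Ln q) < gam"
  then have "0 \<le> sin (Im (Ln q) - gam)" using Im_Ln_pos_lt_imp[OF p1] gam by (intro sin_ge_zero) auto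
  then show False using sn by simp
 qed
 show "norm q \<le> (exp t0 + exp T) * exp t0" unfolding qz by (rule f(5))
 define B where "B = T * cos (Im z) - sinh (Re z)"
 have B: "0 < B" using zb by (simp add: B_def)
 have "- Im (q * cis (- gam)) = (sin gam * (2 * exp (Re z)) * B) / N"
  unfolding qz f(4) B_def by (simp add: algebra_simps diff_divide_distrib)
 also have "\<dots> \<le> (1 * (2 * exp T) * B) / exp (- 2 * t0)"
  using f(1) B z gam(3) by (intro frac_le mult_mono) auto
 also have "\<dots> = 2 * exp T * B * exp (2 * t0)" by (simp add: exp_minus field_simps)
 finally show "- Im (q * cis (- gam)) \<le> 2 * exp T * (T * cos (Im (\<psi> w)) - sinh (Re (\<psi> w))) * exp (2 * t0)"
  by (simp add: B_def z_def)
 show ne: "kk (\<psi> w) + of_real (exp (- t0)) \<noteq> 0" using f(2) by (simp add: z_def)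
 have dq: "norm (deriv qq z) = exp (Re z) * (2 * cosh t0) / N"
  using DERIV_imp_deriv[OF qq_deriv[OF f(2)]] cosh_real_pos[of t0]
  by (simp add: norm_mult norm_divide N_def norm_power kk_def)
 have "norm (kk z + of_real (exp (- t0))) \<le> exp T + 1"
 proof -
  have "norm (kk z + of_real (exp (- t0))) \<le> norm (kk z) + norm (complex_of_real (exp (- t0)))" by (rule norm_triangle_ineq)
  also have "norm (kk z) \<le> exp T" using z by (simp add: kk_def)
  also have "norm (complex_of_real (exp (- t0))) \<le> 1" using t0 by simp
  finally show ?thesis by simp
 qed
 then have N2: "N \<le> (exp T + 1)^2" unfolding N_def by (intro power_mono) auto
 have "1 * (2 * 1) \<le> exp (Re z) * (2 * cosh t0)" using z cosh_real_ge_1[of t0] by (intro mult_mono) auto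
 then have "2 / (exp T + 1)^2 \<le> exp (Re z) * (2 * cosh t0) / N" using N N2 by (intro frac_le) auto
 then show "2 / (exp T + 1)^2 \<le> norm (deriv qq (\<psi> w))" using dq by (simp add: z_def)
 have "exp (Re z) * (2 * cosh t0) / N \<le> exp T * (2 * cosh t0) / exp (- 2 * t0)"
  using f(1) z cosh_real_pos[of t0] by (intro frac_le mult_mono) auto
 then show "norm (deriv qq (\<psi> w)) \<le> exp T * (2 * cosh t0) * exp (2 * t0)"
  using dq by (simp add: z_def exp_minus field_simps)
qed

text \<open>Near the corner, half of the half strip is a quarter plane. Taking the square of \<open>w0 - w\<close> and the power \<open>pi / gam\<close> of
 \<open>qq\<close> maps both quarter plane and sector to half planes, and yields a function \<open>F\<close> to which reflection
 applies. Its extension \<open>G\<close> has a simple zero, so \<open>qq (\<psi> w)\<close> behaves like \<open>(w0 - w) powr (2 * gam / pi)\<close>, and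
 \<open>D w\<close> like the power with exponent \<open>2 * gam / pi - 1 < 2/3\<close>.\<close>
lemma corner_quarter:
 obtains C r where "(\<psi> \<longlongrightarrow> Complex t0 eps) (at w0 within QS)" "(D \<longlongrightarrow> 0) (at w0 within QS)"
  "0 < r" "\<And>w. w \<in> QS \<Longrightarrow> dist w w0 < r \<Longrightarrow> norm (w - w0) powr (2/3) \<le> C * norm (D w)"
proof -
 define a where "a = pi / gam"
 have g0: "0 < gam" "gam < pi" using gam pi_gt_zero by linarith+
 have a: "1 < a" "a > 0" "a * gam = pi" using g0 by (auto simp: a_def)
 define r where "r = min 1 (min l eps)"
 have r: "0 < r" "r \<le> 1" "r \<le> l" "r \<le> eps" using l eps by (auto simp: r_def)
 define R where "R = r^2"
 have R: "0 < R" "R \<le> 1" using r by (auto simp: R_def power_le_one)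
 define W where "W s = w0 - csqrt s" for s
 have cs: "norm (csqrt s) < r" if "norm s < R" for s
 proof -
  have "norm (csqrt s) ^ 2 = norm s" by (metis norm_power power2_csqrt)
  then have "norm (csqrt s) ^ 2 < r ^ 2" using that by (simp add: R_def)
  then show ?thesis by (rule power_less_imp_less_base) (use r in auto)
 qed
 have csq: "0 < Re (csqrt s)" "0 < Im (csqrt s)" if "0 < Im s" for s
 proof -
  have "Im s = 2 * Re (csqrt s) * Im (csqrt s)"
   by (metis power2_csqrt Im_power2)
  then have p: "0 < Re (csqrt s) * Im (csqrt s)" using that by linarith
  show "0 < Re (csqrt s)" using csqrt_principal[of s] p unfolding zero_less_mult_iff by linarith
  then show "0 < Im (csqrt s)" using p unfolding zero_less_mult_iff by linarith
 qed
 have WQ: "W s \<in> QS" if s: "s \<in> ball 0 R" "0 < Im s" for s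
 proof -
  have "norm (csqrt s) < r" using cs s by simp
  then have "Re (csqrt s) < r" "Im (csqrt s) < r"
   using abs_Re_le_cmod[of "csqrt s"] abs_Im_le_cmod[of "csqrt s"] by linarith+
  then show ?thesis using csq[OF s(2)] r by (auto simp: QS_def W_def w0_def)
 qed
 define q where "q s = qq (\<psi> (W s))" for s
 define F where "F s = exp (of_real a * Ln (q s))" for s
 have Ub: "open (ball 0 R \<inter> {s::complex. 0 < Im s})" by (intro open_Int open_halfspace_Im_gt open_ball)
 have qn: "q s \<noteq> 0" if s: "s \<in> ball 0 R" "0 < Im s" for s
  using qq_at_QS(1)[OF WQ[OF s]] by (auto simp: q_def)
 have dF: "(F has_field_derivative F s * (of_real a * (inverse (q s) * (deriv qq (\<psi> (W s)) * (D (W s) * (- inverse (2 * csqrt s))))))) (at s)"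
  if s: "s \<in> ball 0 R" "0 < Im s" for s
 proof -
  have "s \<notin> \<real>\<^sub>\<le>\<^sub>0" using s by (auto simp: complex_nonpos_Reals_iff)
  then have dW: "(W has_field_derivative (- inverse (2 * csqrt s))) (at s)"
   unfolding W_def by (auto intro!: derivative_eq_intros simp: inverse_eq_divide)
  have dq: "(qq has_field_derivative deriv qq (\<psi> (W s))) (at (\<psi> (W s)))"
   using qq_deriv[OF qq_at_QS(7)[OF WQ[OF s]]] by (metis DERIV_imp_deriv)
  have "\<bar>Re (W s)\<bar> < l" using WQ[OF s] by (auto simp: QS_def)
  then have "(q has_field_derivative (deriv qq (\<psi> (W s)) * (D (W s) * (- inverse (2 * csqrt s))))) (at s)"
   unfolding q_def
   by (intro DERIV_chain2[where f=qq and g="\<lambda>s. \<psi> (W s)", OF dq] DERIV_chain2[where f=\<psi> and g=W, OF \<psi>_D dW])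
  moreover have "q s \<notin> \<real>\<^sub>\<le>\<^sub>0" using qq_at_QS(1)[OF WQ[OF s]] by (auto simp: complex_nonpos_Reals_iff q_def)
  ultimately show ?thesis unfolding F_def
   by (intro DERIV_chain2[where f=exp and g="\<lambda>s. of_real a * Ln (q s)", OF DERIV_exp] DERIV_cmult
      DERIV_chain2[where f=Ln and g=q, OF has_field_derivative_Ln])
 qed
 have hol: "F holomorphic_on (ball 0 R \<inter> {s. 0 < Im s})"
  unfolding holomorphic_on_open[OF Ub] using dF by blast
 have nF: "norm (F s) = norm (q s) powr a" if s: "s \<in> ball 0 R" "0 < Im s" for s
  using qn[OF s] by (simp add: F_def powr_def)
 have ImF: "Im (F s) = norm (q s) powr a * sin (a * Im (Ln (q s)))" if s: "s \<in> ball 0 R" "0 < Im s" for s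
  using qn[OF s] by (simp add: F_def powr_def Im_exp)
 have al: "0 < Im (Ln (q s))" "Im (Ln (q s)) < gam" if s: "s \<in> ball 0 R" "0 < Im s" for s
  using qq_at_QS(3,4)[OF WQ[OF s]] by (auto simp: q_def)
 have pos: "0 < Im (F s)" if s: "s \<in> ball 0 R" "0 < Im s" for s
 proof -
  have "a * Im (Ln (q s)) < pi" using al[OF s] a by (metis mult_less_cancel_left_pos)
  then have "0 < sin (a * Im (Ln (q s)))" using al[OF s] a by (intro sin_gt_zero) auto
  then show ?thesis unfolding ImF[OF s] using qn[OF s] by simp
 qed
 define M where "M = (exp t0 + exp T) * exp t0"
 have M0: "M > 0" by (auto simp: M_def intro!: mult_pos_pos add_pos_pos)
 have qM: "norm (q s) \<le> M" if s: "s \<in> ball 0 R" "0 < Im s" for s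
  using qq_at_QS(5)[OF WQ[OF s]] by (simp add: q_def M_def)
 have bd: "norm (F s) \<le> M powr a" if s: "s \<in> ball 0 R" "0 < Im s" for s
  unfolding nF[OF s] using qM[OF s] a by (intro powr_mono2) auto
 \<comment> \<open>\<open>F\<close> is close to the real axis when \<open>q\<close> is close to the far side of the sector.\<close>
 have est: "Im (F s) \<le> M powr (a - 1) * (pi / sin gam) * (- Im (q s * cis (- gam)))" if s: "s \<in> ball 0 R" "0 < Im s" for s
 proof -
  define b where "b = gam - Im (Ln (q s))"
  have b: "0 \<le> b" "b \<le> gam" using al[OF s] by (auto simp: b_def)
  have nq: "norm (q s) > 0" using qn[OF s] by simp
  have "q s * cis (- gam) = exp (Ln (q s) + \<i> * of_real (- gam))" using qn[OF s] unfolding exp_add cis_conv_exp by simp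
  then have iq: "- Im (q s * cis (- gam)) = norm (q s) * sin b"
   using qn[OF s] sin_minus[of b] by (simp add: Im_exp b_def)
  have "sin (a * Im (Ln (q s))) = sin (pi - pi * b / gam)"
  proof -
   have "a * Im (Ln (q s)) = pi - pi * b / gam" using g0 by (simp add: a_def b_def field_simps)
   then show ?thesis by simp
  qed
  also have "\<dots> = sin (pi * b / gam)" by simp
  also have "\<dots> \<le> pi * sin b / sin gam" by (rule sin_ratio_bound[OF b g0])
  finally have "Im (F s) \<le> norm (q s) powr a * (pi * sin b / sin gam)" unfolding ImF[OF s] by (intro mult_left_mono) auto
  also have "norm (q s) powr a = norm (q s) powr (a - 1) * norm (q s)" using nq by (simp add: powr_diff)
  also have "norm (q s) powr (a - 1) * norm (q s) * (pi * sin b / sin gam) = norm (q s) powr (a - 1) * (pi / sin gam * (norm (q s) * sin b))" by simp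
  also have "\<dots> \<le> M powr (a - 1) * (pi / sin gam * (norm (q s) * sin b))"
   using qM[OF s] a b g0 gam(3) by (intro mult_right_mono powr_mono2 mult_nonneg_nonneg divide_nonneg_nonneg sin_ge_zero) auto
  finally show ?thesis unfolding iq by (simp add: mult.assoc)
 qed
 \<comment> \<open>Over the negative real axis, including \<open>0\<close>, the point \<open>W s\<close> tends to the face side, where \<open>\<psi>\<close> is proper.\<close>
 have small: "\<forall>\<^sub>F s in at_upper x. s \<in> ball 0 R \<and> 0 < Im s \<and> - Im (q s * cis (- gam)) < e"
  if x: "- R < x" "x \<le> 0" and e: "0 < e" for x e
 proof -
  define d where "d = e / (2 * exp T * exp (2 * t0))"
  have d: "d > 0" using e by (simp add: d_def)
  obtain \<eta> where \<eta>: "0 < \<eta>" "\<eta> < l"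
   "\<And>w. \<bar>Im w\<bar> \<le> eps \<Longrightarrow> l - \<eta> < Re w \<Longrightarrow> Re w < l \<Longrightarrow> T * cos (Im (\<psi> w)) - d < sinh (Re (\<psi> w))"
   using \<psi>_proper[OF d] by blast
  have "((\<lambda>s. sqrt ((cmod s + Re s) / 2)) \<longlongrightarrow> sqrt ((cmod (of_real x) + Re (of_real x)) / 2)) (at_upper x)"
   by (intro tendsto_intros) auto
  then have "((\<lambda>s. Re (csqrt s)) \<longlongrightarrow> 0) (at_upper x)"
   using x by simp
  then have 1: "\<forall>\<^sub>F s in at_upper x. Re (csqrt s) < \<eta>"
   using \<eta>(1) by (rule order_tendstoD)
  have 2: "\<forall>\<^sub>F s in at_upper x. s \<in> ball 0 R \<and> 0 < Im s"
  proof -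
   have "\<forall>\<^sub>F s in nhds (of_real x). s \<in> ball (0::complex) R"
    by (rule eventually_nhds_in_open) (use x in auto)
   then show ?thesis unfolding eventually_at_filter by eventually_elim auto
  qed
  show ?thesis using 1 2
  proof eventually_elim
   case (elim s)
   have WS: "W s \<in> QS" using WQ elim by blast
   then have "T * cos (Im (\<psi> (W s))) - d < sinh (Re (\<psi> (W s)))"
    using elim by (intro \<eta>(3)) (auto simp: QS_def W_def w0_def)
   then have "2 * exp T * (T * cos (Im (\<psi> (W s))) - sinh (Re (\<psi> (W s)))) * exp (2 * t0) < 2 * exp T * d * exp (2 * t0)"
    by simp
   also have "\<dots> = e" by (simp add: d_def)
   finally show ?case using qq_at_QS(6)[OF WS] elim by (simp add: q_def)
  qed
 qed
 have bot: "at_upper x \<noteq> bot" for x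
 proof (rule at_within_ne_bot_of_closure[OF open_halfspace_Im_gt])
  show "complex_of_real x \<in> closure {s. 0 < Im s}"
   unfolding closure_approachable
  proof (intro allI impI)
   fix e :: real assume "e > 0"
   then show "\<exists>y\<in>{s. 0 < Im s}. dist y (complex_of_real x) < e"
    by (intro bexI[of _ "Complex x (e/2)"]) (auto simp: dist_norm cmod_def)
  qed
 qed
 \<comment> \<open>Over the positive real axis \<open>W s\<close> tends to an interior point of the strip on the symmetry line.\<close>
 have line: "\<exists>L. (F \<longlongrightarrow> L) (at_upper x) \<and> Im L = 0 \<and> 0 < Re L" if x: "0 < x" "x < R" for x
 proof -
  define w where "w = W (of_real x)"
  have cx: "csqrt (of_real x) = of_real (sqrt x)" using csqrt_of_real_nonneg[of "of_real x"] x by simp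
  have "sqrt x < r" using cs[of "of_real x"] x unfolding cx by simp
  then have w: "Im w = eps" "0 < Re w" "Re w < l" using x r by (auto simp: w_def W_def cx w0_def)
  have wl: "\<bar>Re w\<bar> < l" using w by simp
  define z where "z = \<psi> w"
  have z: "Im z = eps" "0 < Re z" "\<bar>Re z\<bar> \<le> T" "sinh (Re z) < T * cos (Im z)"
   unfolding z_def
   by (rule \<psi>_Im_eps_iff[OF wl, THEN iffD2, OF w(1)], rule \<psi>_Re_pos[OF w(2,3)], rule \<psi>_range_bound[OF wl],
     rule \<psi>_below, use w eps in simp_all)
  have zz: "0 \<le> Im z" "Im z \<le> eps" using z eps by auto
  note f = qq_formulas[OF zz z(3)]
  have Np: "0 < (norm (kk z + of_real (exp (- t0))))^2" using f(2) by simp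
  have iq: "Im (qq z) = 0" unfolding f(3) using z by simp
  have "Im (qq z * cis (- gam)) < 0" unfolding f(4)
   using Np gam(3) z by (intro divide_neg_pos mult_pos_neg) auto
  then have rq: "0 < Re (qq z)" using iq gam(3) by (simp add: zero_less_mult_iff)
  have nR: "complex_of_real x \<notin> \<real>\<^sub>\<le>\<^sub>0" using x by (auto simp: complex_nonpos_Reals_iff)
  have "isCont csqrt (of_real x)" by (rule continuous_at_csqrt[OF nR])
  then have "(csqrt \<longlongrightarrow> csqrt (of_real x)) (at_upper x)"
   unfolding isCont_def by (rule tendsto_within_subset) simp
  then have "(W \<longlongrightarrow> w) (at_upper x)"
   unfolding W_def w_def by (intro tendsto_intros)
  then have "((\<lambda>s. \<psi> (W s)) \<longlongrightarrow> z) (at_upper x)"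
   unfolding z_def by (rule isCont_tendsto_compose[OF DERIV_isCont[OF \<psi>_D[OF wl]]])
  then have ql: "(q \<longlongrightarrow> qq z) (at_upper x)"
   unfolding q_def by (rule isCont_tendsto_compose[OF DERIV_isCont[OF qq_deriv[OF f(2)]]])
  have "qq z \<notin> \<real>\<^sub>\<le>\<^sub>0" using rq by (auto simp: complex_nonpos_Reals_iff)
  then have "(F \<longlongrightarrow> exp (of_real a * Ln (qq z))) (at_upper x)"
   unfolding F_def by (intro tendsto_intros ql)
  moreover have "qq z = of_real (Re (qq z))" using iq by (simp add: complex_eq_iff)
  then have "Ln (qq z) = of_real (ln (Re (qq z)))" using Ln_of_real[OF rq] by simp
  then have "exp (of_real a * Ln (qq z)) = of_real (exp (a * ln (Re (qq z))))" by (simp flip: exp_of_real)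
  ultimately show ?thesis by (intro exI[of _ "exp (of_real a * Ln (qq z))"]) auto
 qed
 have lim: "((\<lambda>s. Im (F s)) \<longlongrightarrow> 0) (at_upper x)" if x: "\<bar>x\<bar> < R" for x
 proof (cases "0 < x")
  case True
  then obtain L where L: "(F \<longlongrightarrow> L) (at_upper x)" "Im L = 0" using line x by auto
  from tendsto_Im[OF L(1)] L(2) show ?thesis by simp
 next
  case False
  show ?thesis
  proof (rule tendstoI)
   fix e :: real assume e: "e > 0"
   define A where "A = M powr (a - 1) * (pi / sin gam)"
   have A: "A > 0" using M0 gam(3) by (simp add: A_def)
   have "\<forall>\<^sub>F s in at_upper x. s \<in> ball 0 R \<and> 0 < Im s \<and> - Im (q s * cis (- gam)) < e / A"
    by (rule small) (use x False e A in auto)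
   then show "\<forall>\<^sub>F s in at_upper x. dist (Im (F s)) 0 < e"
   proof eventually_elim
    case (elim s)
    have "Im (F s) \<le> A * (- Im (q s * cis (- gam)))" using est elim unfolding A_def by blast
    also have "\<dots> < A * (e / A)" using elim A by (intro mult_strict_left_mono) auto
    finally show ?case using pos[of s] elim A by simp
   qed
  qed
 qed
 obtain G where G: "G holomorphic_on ball 0 R"
  "\<And>z. z \<in> ball 0 R \<Longrightarrow> 0 < Im z \<Longrightarrow> G z = F z" "\<And>x. \<bar>x\<bar> < R \<Longrightarrow> Im (G (of_real x)) = 0"
 proof (rule weak_Schwarz_reflection[of R F "M powr a"])
  fix G assume "G holomorphic_on ball 0 R"
   "\<And>z. z \<in> ball 0 R \<Longrightarrow> 0 < Im z \<Longrightarrow> G z = F z" "\<And>x. \<bar>x\<bar> < R \<Longrightarrow> Im (G (of_real x)) = 0"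
  then show thesis by (rule that)
 qed (use R hol bd lim in auto)
 have Gcont: "isCont G s" if "norm s < R" for s
  using holomorphic_on_imp_continuous_on[OF G(1)] that by (auto simp: continuous_on_eq_continuous_at)
 have FG: "(F \<longlongrightarrow> G (of_real x)) (at_upper x)" if x: "\<bar>x\<bar> < R" for x
 proof (rule Lim_transform_eventually)
  have "isCont G (of_real x)" using Gcont x by simp
  then show "(G \<longlongrightarrow> G (of_real x)) (at_upper x)"
   unfolding isCont_def by (rule tendsto_within_subset) simp
  have "\<forall>\<^sub>F s in nhds (of_real x). s \<in> ball (0::complex) R"
   by (rule eventually_nhds_in_open) (use x in auto)
  then show "\<forall>\<^sub>F s in at_upper x. G s = F s"
   unfolding eventually_at_filter by eventually_elim (use G(2) in auto)
 qed
 have Gpos: "0 < Re (G (of_real x))" if x: "0 < x" "x < R" for x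
 proof -
  obtain L where L: "(F \<longlongrightarrow> L) (at_upper x)" "0 < Re L" using line x by blast
  have "G (of_real x) = L" by (rule tendsto_unique[OF bot FG L(1)]) (use x in auto)
  then show ?thesis using L by simp
 qed
 have rg: "((\<lambda>x. Re (G (of_real x))) \<longlongrightarrow> Re (G 0)) (at_right 0)"
 proof -
  have "((\<lambda>x. complex_of_real x) \<longlongrightarrow> 0) (at_right 0)"
   by (rule tendsto_eq_intros refl)+ (auto simp: at_within_def intro: filterlim_ident)
  then show ?thesis using R by (intro tendsto_intros isCont_tendsto_compose[OF Gcont]) auto
 qed
 have g0pos: "0 \<le> Re (G 0)"
  by (rule tendsto_lowerbound[OF rg])
    (use Gpos R in "auto simp: eventually_at_right_field intro!: exI[of _ R] less_imp_le")
 have LnF: "q s = exp (Ln (F s) / of_real a)" if s: "s \<in> ball 0 R" "0 < Im s" for s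
 proof -
  have "a * Im (Ln (q s)) < a * gam" using al[OF s] a by (intro mult_strict_left_mono) auto
  moreover have "0 < a * Im (Ln (q s))" using al[OF s] a by simp
  ultimately have "- pi < Im (of_real a * Ln (q s))" "Im (of_real a * Ln (q s)) \<le> pi" using a by auto
  then have "Ln (F s) = of_real a * Ln (q s)" unfolding F_def by (rule Ln_exp)
  then show ?thesis using a qn[OF s] by simp
 qed
 \<comment> \<open>A positive value would place the limit of \<open>q\<close> on the open positive axis, away from the far side of the sector.\<close>
 have G0: "G 0 = 0"
 proof (rule ccontr)
  assume ne: "G 0 \<noteq> 0"
  define g where "g = Re (G 0)"
  have Gg: "G 0 = of_real g" using G(3)[of 0] R by (simp add: g_def complex_eq_iff)
  have "g \<noteq> 0" using ne Gg by auto
  then have g: "0 < g" using g0pos unfolding g_def by linarith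
  have Fl: "(F \<longlongrightarrow> of_real g) (at 0 within {s. 0 < Im s})" using FG[of 0] R Gg by simp
  have "complex_of_real g \<notin> \<real>\<^sub>\<le>\<^sub>0" using g by (auto simp: complex_nonpos_Reals_iff)
  then have "((\<lambda>s. exp (Ln (F s) / of_real a)) \<longlongrightarrow> exp (Ln (of_real g) / of_real a)) (at 0 within {s. 0 < Im s})"
   using a by (intro tendsto_intros Fl) auto
  moreover have "exp (Ln (of_real g) / of_real a) = complex_of_real (exp (ln g / a))"
   using Ln_of_real[OF g] by (simp flip: exp_of_real)
  ultimately have "((\<lambda>s. exp (Ln (F s) / of_real a)) \<longlongrightarrow> complex_of_real (exp (ln g / a))) (at 0 within {s. 0 < Im s})" by simp
  then have "((\<lambda>s. - Im (exp (Ln (F s) / of_real a) * cis (- gam))) \<longlongrightarrow> - Im (complex_of_real (exp (ln g / a)) * cis (- gam))) (at 0 within {s. 0 < Im s})"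
   by (intro tendsto_intros)
  then have "((\<lambda>s. - Im (exp (Ln (F s) / of_real a) * cis (- gam))) \<longlongrightarrow> exp (ln g / a) * sin gam) (at 0 within {s. 0 < Im s})" by simp
  moreover define e where "e = exp (ln g / a) * sin gam / 2"
  have e: "0 < e" using gam(3) by (simp add: e_def)
  moreover have "e < exp (ln g / a) * sin gam" using gam(3) by (simp add: e_def)
  ultimately have "\<forall>\<^sub>F s in at 0 within {s. 0 < Im s}. e < - Im (exp (Ln (F s) / of_real a) * cis (- gam))"
   by (intro order_tendstoD)
  moreover have "\<forall>\<^sub>F s in at 0 within {s. 0 < Im s}. s \<in> ball 0 R \<and> 0 < Im s \<and> - Im (q s * cis (- gam)) < e"
   using small[of 0 e] R e by simp
  ultimately have "\<forall>\<^sub>F s in at (0::complex) within {s. 0 < Im s}. False"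
   by eventually_elim (use LnF in auto)
  then show False using bot[of 0] by (simp add: trivial_limit_def)
 qed
 have dG: "Im (deriv G 0) = 0" "0 < Re (deriv G 0)"
  using deriv_at_real_boundary_pos[OF R(1) G(1,3)] G(2) pos by auto
 define c where "c = norm (deriv G 0)"
 have c: "c > 0" using dG by (auto simp: c_def)
 obtain \<rho> where \<rho>: "0 < \<rho>" "\<rho> \<le> R" "\<And>s. s \<noteq> 0 \<Longrightarrow> norm s < \<rho> \<Longrightarrow>
   c / 2 * norm s \<le> norm (G s) \<and> norm (G s) \<le> 2 * c * norm s \<and> c / 2 \<le> norm (deriv G s) \<and> norm (deriv G s) \<le> 2 * c"
 proof -
  have "(G has_field_derivative deriv G 0) (at 0)" by (rule holomorphic_derivI[OF G(1)]) (use R in auto)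
  then have t1: "((\<lambda>s. norm (G s / s)) \<longlongrightarrow> c) (at 0)" unfolding c_def has_field_derivative_iff by (auto simp: G0 intro: tendsto_norm)
  have 1: "\<forall>\<^sub>F s in at 0. c / 2 < norm (G s / s)" "\<forall>\<^sub>F s in at 0. norm (G s / s) < 2 * c"
   by (rule order_tendstoD[OF t1], use c in simp)+
  have "isCont (deriv G) 0"
   using holomorphic_on_imp_continuous_on[OF holomorphic_deriv[OF G(1)]] R
   by (auto simp: continuous_on_eq_continuous_at)
  then have t2: "((\<lambda>s. norm (deriv G s)) \<longlongrightarrow> c) (at 0)" unfolding c_def isCont_def by (intro tendsto_norm)
  have 2: "\<forall>\<^sub>F s in at 0. c / 2 < norm (deriv G s)" "\<forall>\<^sub>F s in at 0. norm (deriv G s) < 2 * c"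
   by (rule order_tendstoD[OF t2], use c in simp)+
  have "\<forall>\<^sub>F s in at 0. c / 2 * norm s \<le> norm (G s) \<and> norm (G s) \<le> 2 * c * norm s \<and> c / 2 \<le> norm (deriv G s) \<and> norm (deriv G s) \<le> 2 * c"
   using 1 2 eventually_neq_at_within[of 0]
   by eventually_elim (auto simp: norm_divide field_simps)
  then obtain d where d: "d > 0" "\<And>s. s \<noteq> 0 \<Longrightarrow> norm s < d \<Longrightarrow>
   c / 2 * norm s \<le> norm (G s) \<and> norm (G s) \<le> 2 * c * norm s \<and> c / 2 \<le> norm (deriv G s) \<and> norm (deriv G s) \<le> 2 * c"
   unfolding eventually_at by (auto simp: dist_norm)
  show thesis by (rule that[of "min d R"]) (use d R in auto)
 qed
 define m1 where "m1 = 2 / (exp T + 1)^2"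
 define m2 where "m2 = exp T * (2 * cosh t0) * exp (2 * t0)"
 have "0 < exp T + 1" by (simp add: add_pos_pos)
 then have m: "m1 > 0" "m2 > 0" using cosh_real_pos[of t0] by (simp_all add: m1_def m2_def)
 define \<kappa> where "\<kappa> = 1 / a - 1"
 have kap: "\<kappa> < 0" "0 < \<kappa> + 1/2" "\<kappa> + 1/2 \<le> 1/3"
  using a gam by (auto simp: \<kappa>_def a_def field_simps)
 \<comment> \<open>The chain rule solved for \<open>D (W s)\<close>; \<open>\<kappa> + 1/2\<close> is half the order of vanishing of \<open>D\<close>.\<close>
 have main: "norm (q s) \<le> (2 * c * norm s) powr (1 / a) \<and>
   norm (D (W s)) \<le> (2 * c) * (2 * norm s powr (1/2)) * (c / 2 * norm s) powr \<kappa> / (a * m1) \<and>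
   (c / 2) * (2 * norm s powr (1/2)) * (2 * c * norm s) powr \<kappa> / (a * m2) \<le> norm (D (W s))"
  if s0: "norm s < \<rho>" "0 < Im s" for s
 proof -
  have s: "s \<in> ball 0 R" "0 < Im s" and sn: "s \<noteq> 0" using s0 \<rho> by auto
  define X where "X = norm (F s)"
  have Xq: "X = norm (q s) powr a" unfolding X_def by (rule nF[OF s])
  have nq: "norm (q s) > 0" using qn[OF s] by simp
  have X: "X > 0" using nq Xq by simp
  have GX: "norm (G s) = X" using G(2)[OF s] by (simp add: X_def)
  note r3 = \<rho>(3)[OF sn s0(1), unfolded GX]
  have q1: "norm (q s) = X powr (1 / a)" unfolding Xq powr_powr using a nq by simp
  have "(G has_field_derivative F s * (of_real a * (inverse (q s) * (deriv qq (\<psi> (W s)) * (D (W s) * (- inverse (2 * csqrt s))))))) (at s)"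
   by (rule has_field_derivative_transform_within_open[OF dF[OF s] Ub]) (use s G(2) in auto)
  then have "norm (deriv G s) = norm (F s * (of_real a * (inverse (q s) * (deriv qq (\<psi> (W s)) * (D (W s) * (- inverse (2 * csqrt s)))))))"
   by (simp add: DERIV_imp_deriv)
  also have "\<dots> = X * (a * (norm (deriv qq (\<psi> (W s))) * norm (D (W s)))) / (norm (q s) * (2 * norm s powr (1/2)))"
  proof -
   have n2: "norm (csqrt s) = norm s powr (1/2)" by (simp add: powr_half_sqrt)
   have "norm (F s * (of_real a * (inverse (q s) * (deriv qq (\<psi> (W s)) * (D (W s) * (- inverse (2 * csqrt s)))))))
    = X * (a * (inverse (norm (q s)) * (norm (deriv qq (\<psi> (W s))) * (norm (D (W s)) * inverse (2 * norm s powr (1/2))))))"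
    by (simp only: norm_mult norm_inverse norm_minus_cancel X_def norm_of_real abs_of_pos[OF a(2)] norm_numeral n2)
   also have "\<dots> = X * (a * (norm (deriv qq (\<psi> (W s))) * norm (D (W s)))) / (norm (q s) * (2 * norm s powr (1/2)))"
    by (simp only: divide_inverse inverse_mult_distrib mult_ac)
   finally show ?thesis .
  qed
  finally have dGs: "norm (deriv G s) = X * (a * (norm (deriv qq (\<psi> (W s))) * norm (D (W s)))) / (norm (q s) * (2 * norm s powr (1/2)))" .
  have sp: "norm s powr (1/2) > 0" using sn by simp
  define d where "d = norm (deriv qq (\<psi> (W s)))"
  have d: "m1 \<le> d" "d \<le> m2" using qq_at_QS(8,9)[OF WQ[OF s]] by (auto simp: d_def m1_def m2_def)
  have Xk: "X powr \<kappa> = norm (q s) / X" using X by (simp add: \<kappa>_def powr_diff q1)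
  have De: "norm (D (W s)) = norm (deriv G s) * (2 * norm s powr (1/2)) * X powr \<kappa> / (a * d)"
   unfolding Xk dGs d_def[symmetric] using X nq sp a d m by (simp add: field_simps)
  have up: "X powr \<kappa> \<le> (c / 2 * norm s) powr \<kappa>"
   by (rule powr_mono2') (use kap r3 c sn in auto)
  have lo: "(2 * c * norm s) powr \<kappa> \<le> X powr \<kappa>"
   by (rule powr_mono2') (use kap r3 X in auto)
  show ?thesis
  proof (intro conjI)
   show "norm (q s) \<le> (2 * c * norm s) powr (1 / a)" unfolding q1 using r3 X a by (intro powr_mono2) auto
   show "norm (D (W s)) \<le> (2 * c) * (2 * norm s powr (1/2)) * (c / 2 * norm s) powr \<kappa> / (a * m1)"
    unfolding De using up r3 d m a c by (intro frac_le mult_mono mult_nonneg_nonneg) auto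
   show "(c / 2) * (2 * norm s powr (1/2)) * (2 * c * norm s) powr \<kappa> / (a * m2) \<le> norm (D (W s))"
    unfolding De using lo r3 d m a c by (intro frac_le mult_mono mult_nonneg_nonneg mult_pos_pos) auto
  qed
 qed
 define sw where "sw w = (w0 - w)^2" for w
 have swW: "0 < Im (sw w)" "W (sw w) = w" "norm (sw w) = (norm (w - w0))^2" if "w \<in> QS" for w
 proof -
  have v: "0 < Re (w0 - w)" "0 < Im (w0 - w)" using that by (auto simp: QS_def w0_def)
  then show "0 < Im (sw w)" by (simp add: sw_def Im_power2)
  show "W (sw w) = w" unfolding W_def sw_def using csqrt_square[of "w0 - w"] v by simp
  show "norm (sw w) = (norm (w - w0))^2" by (simp add: sw_def norm_power norm_minus_commute)
 qed
 have swl: "((\<lambda>w. norm (sw w)) \<longlongrightarrow> 0) (at w0 within QS)"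
  unfolding sw_def by (rule tendsto_eq_intros refl | simp)+
 have ev: "\<forall>\<^sub>F w in at w0 within QS. w \<in> QS \<and> norm (sw w) < \<rho>"
  using order_tendstoD(2)[OF swl \<rho>(1)] by (auto simp: eventually_at_filter elim: eventually_mono)
 have pw: "((\<lambda>w. (K * norm (sw w)) powr b) \<longlongrightarrow> 0) (at w0 within QS)" if "K \<ge> 0" "b > 0" for K b
  by (rule tendsto_zero_powrI[OF _ tendsto_const]) (use that in "auto intro!: tendsto_mult_right_zero swl")
 show thesis
 proof (rule that)
  have "(D \<longlongrightarrow> 0) (at w0 within QS)"
  proof (rule Lim_null_comparison)
   define A where "A = (2 * c) * 2 * (c / 2) powr \<kappa> / (a * m1)"
   show "\<forall>\<^sub>F w in at w0 within QS. norm (D w) \<le> A * (1 * norm (sw w)) powr (\<kappa> + 1/2)"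
    using ev
   proof eventually_elim
    case (elim w)
    have "norm (D (W (sw w))) \<le> (2 * c) * (2 * norm (sw w) powr (1/2)) * (c / 2 * norm (sw w)) powr \<kappa> / (a * m1)"
     using main[of "sw w"] swW elim by blast
    also have "(c / 2 * norm (sw w)) powr \<kappa> = (c / 2) powr \<kappa> * norm (sw w) powr \<kappa>" by (rule powr_mult)
    also have "(2 * c) * (2 * norm (sw w) powr (1/2)) * ((c / 2) powr \<kappa> * norm (sw w) powr \<kappa>) / (a * m1)
      = A * (1 * norm (sw w)) powr (\<kappa> + 1/2)" unfolding powr_add A_def by simp
    finally show ?case using swW elim by simp
   qed
   show "((\<lambda>w. A * (1 * norm (sw w)) powr (\<kappa> + 1/2)) \<longlongrightarrow> 0) (at w0 within QS)"
    using kap by (intro tendsto_mult_right_zero pw) auto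
  qed
  then show "(D \<longlongrightarrow> 0) (at w0 within QS)" .
  have ql: "((\<lambda>w. q (sw w)) \<longlongrightarrow> 0) (at w0 within QS)"
  proof (rule Lim_null_comparison)
   show "\<forall>\<^sub>F w in at w0 within QS. norm (q (sw w)) \<le> (2 * c * norm (sw w)) powr (1 / a)"
    using ev by eventually_elim (use main swW in blast)
   show "((\<lambda>w. (2 * c * norm (sw w)) powr (1 / a)) \<longlongrightarrow> 0) (at w0 within QS)"
    using c a by (intro pw) auto
  qed
  show "(\<psi> \<longlongrightarrow> Complex t0 eps) (at w0 within QS)"
  proof (rule Lim_transform_eventually)
   have nr: "(of_real (exp t0) - 0 * of_real (exp (- t0))) / (1 + 0) \<notin> (\<real>\<^sub>\<le>\<^sub>0 :: complex set)"
    by (auto simp: complex_nonpos_Reals_iff)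
   have "((\<lambda>w. \<i> * of_real eps + Ln ((of_real (exp t0) - q (sw w) * of_real (exp (- t0))) / (1 + q (sw w)))) \<longlongrightarrow>
     \<i> * of_real eps + Ln ((of_real (exp t0) - 0 * of_real (exp (- t0))) / (1 + 0))) (at w0 within QS)"
    by (intro tendsto_intros ql nr) auto
   moreover have "Ln (of_real (exp t0)) = of_real t0" using Ln_of_real[of "exp t0"] by simp
   then have "\<i> * of_real eps + Ln ((of_real (exp t0) - 0 * of_real (exp (- t0))) / (1 + 0)) = Complex t0 eps"
    by (simp add: complex_eq_iff)
   ultimately show "((\<lambda>w. \<i> * of_real eps + Ln ((of_real (exp t0) - q (sw w) * of_real (exp (- t0))) / (1 + q (sw w)))) \<longlongrightarrow>
     Complex t0 eps) (at w0 within QS)" by simp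
   show "\<forall>\<^sub>F w in at w0 within QS. \<i> * of_real eps + Ln ((of_real (exp t0) - q (sw w) * of_real (exp (- t0))) / (1 + q (sw w))) = \<psi> w"
    using ev
   proof eventually_elim
    case (elim w)
    have wQ: "w \<in> QS" using elim by simp
    have "0 < Im (\<psi> w)" "Im (\<psi> w) < eps" using \<psi>_Im_bounds[of w] wQ by (auto simp: QS_def)
    then have "\<bar>Im (\<psi> w - \<i> * of_real eps)\<bar> < pi" using eps by simp
    from qq_inverse[OF qq_at_QS(7)[OF wQ] this] show ?case using swW[OF wQ] by (simp add: q_def)
   qed
  qed
  define r' where "r' = min 1 (sqrt \<rho>)"
  show "0 < r'" using \<rho> by (simp add: r'_def)
  define A where "A = c / 2 * 2 * (2 * c) powr \<kappa> / (a * m2)"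
  have A: "A > 0" using c a m by (simp add: A_def)
  show "norm (w - w0) powr (2/3) \<le> 1 / A * norm (D w)" if w: "w \<in> QS" "dist w w0 < r'" for w
  proof -
   define \<sigma> where "\<sigma> = norm (w - w0)"
   have sg: "0 < \<sigma>" "\<sigma> < 1" "\<sigma> < sqrt \<rho>" using w by (auto simp: \<sigma>_def r'_def dist_norm QS_def w0_def)
   have "\<sigma>^2 < (sqrt \<rho>)^2" using sg by (intro power_strict_mono) auto
   then have sr: "norm (sw w) < \<rho>" using swW[OF w(1)] \<rho> by (simp add: \<sigma>_def)
   have ns: "norm (sw w) = \<sigma> powr 2" using swW[OF w(1)] sg by (simp add: \<sigma>_def)
   have "A * norm (sw w) powr (1/3) \<le> A * norm (sw w) powr (\<kappa> + 1/2)"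
    using A kap sg swW(3)[OF w(1)] by (intro mult_left_mono powr_mono') (auto simp: \<sigma>_def power_le_one)
   also have "\<dots> = (c / 2) * (2 * norm (sw w) powr (1/2)) * (2 * c * norm (sw w)) powr \<kappa> / (a * m2)"
   proof -
    have "(2 * c * norm (sw w)) powr \<kappa> = (2 * c) powr \<kappa> * norm (sw w) powr \<kappa>" by (rule powr_mult)
    then show ?thesis by (simp add: A_def powr_add)
   qed
   also have "\<dots> \<le> norm (D w)" using main[OF sr swW(1)[OF w(1)]] swW(2)[OF w(1)] by simp
   finally have "A * norm (sw w) powr (1/3) \<le> norm (D w)" .
   moreover have "norm (sw w) powr (1/3) = \<sigma> powr (2 * (1/3))" unfolding ns powr_powr ..
   ultimately show ?thesis using A by (simp add: \<sigma>_def field_simps)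
  qed
 qed
qed

end

section \<open>Boundary values and the sign inequalities\<close>

lemma tendsto_within_isometry:
 fixes f :: "complex \<Rightarrow> complex"
 assumes lim: "((\<lambda>x. f (\<rho> x)) \<longlongrightarrow> L) (at w within S')"
  and iso: "\<And>x y. dist (\<rho> x) (\<rho> y) = dist x y"
  and inv: "\<And>x. x \<in> S \<Longrightarrow> \<sigma> x \<in> S' \<and> \<rho> (\<sigma> x) = x"
 shows "(f \<longlongrightarrow> L) (at (\<rho> w) within S)"
 unfolding Lim_within
proof (intro allI impI)
 fix e :: real assume "e > 0"
 then obtain d where d: "d > 0" "\<And>x. x \<in> S' \<Longrightarrow> 0 < dist x w \<and> dist x w < d \<Longrightarrow> dist (f (\<rho> x)) L < e"
  using lim unfolding Lim_within by blast
 have "dist (f x) L < e" if x: "x \<in> S" "0 < dist x (\<rho> w)" "dist x (\<rho> w) < d" for x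
  using d(2)[of "\<sigma> x"] inv[OF x(1)] iso[of "\<sigma> x" w] x by auto
 then show "\<exists>d>0. \<forall>x\<in>S. 0 < dist x (\<rho> w) \<and> dist x (\<rho> w) < d \<longrightarrow> dist (f x) L < e"
  using d(1) by blast
qed

text \<open>Near \<open>w\<close> the values of \<open>f\<close> on \<open>B\<close> are limits of its values on \<open>A\<close>.\<close>
lemma tendsto_within_dense:
 fixes f :: "complex \<Rightarrow> complex"
 assumes A: "open A" and B: "B \<subseteq> closure A" and f: "\<And>x. x \<in> B \<Longrightarrow> isCont f x"
  and lim: "(f \<longlongrightarrow> L) (at w within A)"
 shows "(f \<longlongrightarrow> L) (at w within B)"
 unfolding Lim_within
proof (intro allI impI)
 fix e :: real assume e: "e > 0"
 then obtain d where d: "d > 0" "\<And>x. x \<in> A \<Longrightarrow> 0 < dist x w \<and> dist x w < d \<Longrightarrow> dist (f x) L < e/2"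
  using lim unfolding Lim_within by (metis half_gt_zero)
 have "dist (f x) L < e" if x: "x \<in> B" "0 < dist x w" "dist x w < d" for x
 proof -
  have "dist (f x) L \<le> e/2"
  proof (rule tendsto_upperbound)
   show "((\<lambda>u. dist (f u) L) \<longlongrightarrow> dist (f x) L) (at x within A)"
    using f[OF x(1)] by (intro tendsto_intros) (auto simp: isCont_def intro: tendsto_within_subset)
   have "\<forall>\<^sub>F u in nhds x. u \<in> ball w d - {w}"
    by (rule eventually_nhds_in_open) (use x in "auto simp: dist_commute")
   then show "\<forall>\<^sub>F u in at x within A. dist (f u) L \<le> e/2"
    unfolding eventually_at_filter
    by eventually_elim (use d(2) in "force simp: dist_commute")
   show "at x within A \<noteq> bot" using x B A by (intro at_within_ne_bot_of_closure) auto
  qed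
  then show ?thesis using e by simp
 qed
 then show "\<exists>d>0. \<forall>x\<in>B. 0 < dist x w \<and> dist x w < d \<longrightarrow> dist (f x) L < e" using d(1) by blast
qed

context gauss_map begin

text \<open>The closed half strip is the parameter domain. Corners are the points that are mapped to the lateral edges of
 the pyramid.\<close>
definition "\<Omega> = {w::complex. 0 \<le> Re w \<and> Re w \<le> l}"
definition "corners = {w::complex. Re w = l \<and> (\<exists>k::int. Im w = (2 * of_int k + 1) * eps)}"

lemma \<Omega>_closure: "\<Omega> \<subseteq> closure HS"
proof
 fix w assume w: "w \<in> \<Omega>"
 show "w \<in> closure HS" unfolding closure_approachable
 proof (intro allI impI)
  fix e :: real assume e: "e > 0"
  define s where "s = min (e / l) 1 / 2"
  have s: "0 < s" "s < 1" "s * l < e"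
  proof -
   show "0 < s" "s < 1" using e l by (auto simp: s_def)
   have "s * l \<le> (e / l / 2) * l" using l by (intro mult_right_mono) (auto simp: s_def)
   then show "s * l < e" using e l by simp
  qed
  define x where "x = (1 - s) * Re w + s * (l / 2)"
  have "0 < x" using w s l by (auto simp: x_def \<Omega>_def intro!: add_nonneg_pos)
  moreover have "x < l"
  proof -
   have "x \<le> (1 - s) * l + s * (l/2)" unfolding x_def using w s by (intro add_right_mono mult_left_mono) (auto simp: \<Omega>_def)
   also have "\<dots> < l" using s l by (simp add: algebra_simps)
   finally show ?thesis .
  qed
  moreover have "dist (Complex x (Im w)) w < e"
  proof -
   have "x - Re w = s * (l/2 - Re w)" by (simp add: x_def algebra_simps)
   then have "\<bar>x - Re w\<bar> = s * \<bar>l/2 - Re w\<bar>" using s by (simp add: abs_mult)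
   also have "\<dots> \<le> s * l" using w s l by (intro mult_left_mono) (auto simp: \<Omega>_def abs_if)
   finally show ?thesis using s by (simp add: dist_norm cmod_def)
  qed
  ultimately show "\<exists>y\<in>HS. dist y w < e" by (intro bexI[of _ "Complex x (Im w)"]) (auto simp: HS_def)
 qed
qed

lemma HS_ne_bot: "w \<in> \<Omega> \<Longrightarrow> at w within HS \<noteq> bot"
 using at_within_ne_bot_of_closure[OF HS(1)] \<Omega>_closure by blast

lemma \<psi>_isCont: "\<bar>Re w\<bar> < l \<Longrightarrow> isCont \<psi> w"
 using \<psi>_cont Str_open by (simp add: continuous_on_eq_continuous_at)
lemma D_isCont: "\<bar>Re w\<bar> < l \<Longrightarrow> isCont D w"
 using D_cont Str_open by (simp add: continuous_on_eq_continuous_at)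

lemma QS: "open QS" "QS \<subseteq> HS" "QS = box 0 (Complex l eps)" "closure QS = Rect"
proof -
 show q: "QS = box 0 (Complex l eps)" by (auto simp: QS_def in_box_complex_iff)
 show "open QS" unfolding q by (rule open_box)
 show "QS \<subseteq> HS" by (auto simp: QS_def HS_def)
 have "Complex (l/2) (eps/2) \<in> box 0 (Complex l eps)" using l eps by (auto simp: in_box_complex_iff)
 then show "closure QS = Rect" unfolding q by (intro closure_box) auto
qed

lemma rect_iff: "w \<in> Rect \<longleftrightarrow> 0 \<le> Re w \<and> Re w \<le> l \<and> 0 \<le> Im w \<and> Im w \<le> eps"
 by (auto simp: in_cbox_complex_iff)

text \<open>The two quarters at a corner are exchanged by the reflection \<open>\<rho>\<close> in the symmetry line.\<close>
lemma corner_full: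
 obtains C r where "(\<psi> \<longlongrightarrow> Complex t0 eps) (at w0 within HS)" "(D \<longlongrightarrow> 0) (at w0 within HS)"
  "0 < r" "\<And>w. w \<in> HS \<Longrightarrow> dist w w0 < r \<Longrightarrow> norm (w - w0) powr (2/3) \<le> C * norm (D w)"
proof -
 obtain C r where Q: "(\<psi> \<longlongrightarrow> Complex t0 eps) (at w0 within QS)" "(D \<longlongrightarrow> 0) (at w0 within QS)"
  "0 < r" "\<And>w. w \<in> QS \<Longrightarrow> dist w w0 < r \<Longrightarrow> norm (w - w0) powr (2/3) \<le> C * norm (D w)"
  by (rule corner_quarter) blast
 define Q1 where "Q1 = HS \<inter> {w. 0 < Im w \<and> Im w \<le> eps}"
 define Q2 where "Q2 = HS \<inter> {w. eps \<le> Im w \<and> Im w < 2 * eps}"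
 define \<rho> where "\<rho> w = cnj w + per" for w
 have Q1c: "Q1 \<subseteq> closure QS" unfolding QS(4) by (auto simp: Q1_def HS_def rect_iff)
 have HSl: "w \<in> HS \<Longrightarrow> \<bar>Re w\<bar> < l" for w by (auto simp: HS_def)
 have iso: "dist (\<rho> x) (\<rho> y) = dist x y" for x y by (simp add: \<rho>_def dist_norm flip: complex_cnj_diff)
 have rr: "\<rho> (\<rho> x) = x" for x by (simp add: \<rho>_def)
 have rw0: "\<rho> w0 = w0" by (simp add: \<rho>_def w0_def complex_eq_iff)
 have r12: "\<rho> x \<in> Q1" if "x \<in> Q2" for x using that by (auto simp: \<rho>_def Q1_def Q2_def HS_def)
 have r\<psi>: "\<psi> (\<rho> x) = cnj (\<psi> x) + per" "D (\<rho> x) = cnj (D x)" if "x \<in> HS" for x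
  using \<psi>_shift[of "cnj x"] \<psi>_cnj[of x] D_shift[of "cnj x"] D_cnj[of x] HSl[OF that] by (simp_all add: \<rho>_def)
 have p1: "(\<psi> \<longlongrightarrow> Complex t0 eps) (at w0 within Q1)" "(D \<longlongrightarrow> 0) (at w0 within Q1)"
  using tendsto_within_dense[OF QS(1) Q1c _ Q(1)] tendsto_within_dense[OF QS(1) Q1c _ Q(2)]
   HSl \<psi>_isCont D_isCont by (auto simp: Q1_def)
 have ev1: "\<forall>\<^sub>F x in at w0 within Q1. x \<in> Q1" by (simp add: eventually_at_filter)
 have "(\<psi> \<longlongrightarrow> Complex t0 eps) (at (\<rho> w0) within Q2)"
 proof (rule tendsto_within_isometry[of \<psi> \<rho> _ _ Q1 _ \<rho>])
  have "((\<lambda>x. cnj (\<psi> x) + per) \<longlongrightarrow> cnj (Complex t0 eps) + per) (at w0 within Q1)"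
   by (intro tendsto_intros p1)
  moreover have "cnj (Complex t0 eps) + per = Complex t0 eps" by (simp add: complex_eq_iff)
  ultimately have "((\<lambda>x. cnj (\<psi> x) + per) \<longlongrightarrow> Complex t0 eps) (at w0 within Q1)" by simp
  then show "((\<lambda>x. \<psi> (\<rho> x)) \<longlongrightarrow> Complex t0 eps) (at w0 within Q1)"
   by (rule Lim_transform_eventually) (use ev1 r\<psi> in "auto elim!: eventually_mono simp: Q1_def")
 qed (use iso rr r12 in auto)
 moreover have "(D \<longlongrightarrow> 0) (at (\<rho> w0) within Q2)"
 proof (rule tendsto_within_isometry[of D \<rho> _ _ Q1 _ \<rho>])
  have "((\<lambda>x. cnj (D x)) \<longlongrightarrow> cnj 0) (at w0 within Q1)" by (intro tendsto_intros p1)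
  then have "((\<lambda>x. cnj (D x)) \<longlongrightarrow> 0) (at w0 within Q1)" by simp
  then show "((\<lambda>x. D (\<rho> x)) \<longlongrightarrow> 0) (at w0 within Q1)"
   by (rule Lim_transform_eventually) (use ev1 r\<psi> in "auto elim!: eventually_mono simp: Q1_def")
 qed (use iso rr r12 in auto)
 ultimately have p2: "(\<psi> \<longlongrightarrow> Complex t0 eps) (at w0 within Q2)" "(D \<longlongrightarrow> 0) (at w0 within Q2)" unfolding rw0 by auto
 have near: "x \<in> Q1 \<union> Q2" if "x \<in> HS" "dist x w0 < eps" for x
 proof -
  have "\<bar>Im (x - w0)\<bar> < eps" using that(2) abs_Im_le_cmod[of "x - w0"] by (simp add: dist_norm)
  then show ?thesis using that(1) by (auto simp: Q1_def Q2_def w0_def)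
 qed
 have tr: "(f \<longlongrightarrow> L) (at w0 within HS)" if "(f \<longlongrightarrow> L) (at w0 within Q1)" "(f \<longlongrightarrow> L) (at w0 within Q2)" for f :: "complex \<Rightarrow> complex" and L
 proof (rule Lim_transform_within_set[OF Lim_Un[OF that]])
  have "\<forall>\<^sub>F x in at w0. x \<in> ball w0 eps" by (rule eventually_at_in_open') (use eps in auto)
  then show "\<forall>\<^sub>F x in at w0. (x \<in> Q1 \<union> Q2) = (x \<in> HS)"
   by eventually_elim (use near in "auto simp: Q1_def Q2_def dist_commute")
 qed
 have b1: "norm (w - w0) powr (2/3) \<le> C * norm (D w)" if w: "w \<in> Q1" "dist w w0 < r" for w
 proof (rule tendsto_le)
  have wc: "w \<in> closure QS" using w Q1c by blast
  show "at w within QS \<noteq> bot" by (rule at_within_ne_bot_of_closure[OF QS(1) wc])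
  have wn: "w \<noteq> w0" using w by (auto simp: Q1_def HS_def w0_def)
  show "((\<lambda>w. norm (w - w0) powr (2/3)) \<longlongrightarrow> norm (w - w0) powr (2/3)) (at w within QS)"
   using wn by (intro tendsto_intros) auto
  have "isCont D w" using w HSl by (intro D_isCont) (auto simp: Q1_def)
  then show "((\<lambda>w. C * norm (D w)) \<longlongrightarrow> C * norm (D w)) (at w within QS)"
   by (intro tendsto_intros) (auto simp: isCont_def intro: tendsto_within_subset)
  have "\<forall>\<^sub>F u in nhds w. u \<in> ball w0 r"
   by (rule eventually_nhds_in_open) (use w in "auto simp: dist_commute")
  then show "\<forall>\<^sub>F u in at w within QS. norm (u - w0) powr (2/3) \<le> C * norm (D u)"
   unfolding eventually_at_filter by eventually_elim (use Q(4) in "auto simp: dist_commute")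
 qed
 show thesis
 proof (rule that[OF tr[OF p1(1) p2(1)] tr[OF p1(2) p2(2)]])
  show "0 < min r eps" using Q(3) eps by simp
  fix w assume w: "w \<in> HS" "dist w w0 < min r eps"
  show "norm (w - w0) powr (2/3) \<le> C * norm (D w)"
  proof (cases "w \<in> Q1")
   case False
   then have w2: "w \<in> Q2" using near w by auto
   have "norm (\<rho> w - w0) powr (2/3) \<le> C * norm (D (\<rho> w))"
    using b1[OF r12[OF w2]] iso[of w w0] w rw0 by simp
   moreover have "norm (\<rho> w - w0) = norm (w - w0)" using iso[of w w0] rw0 by (simp add: dist_norm)
   ultimately show ?thesis using r\<psi>(2)[OF w(1)] by simp
  qed (use b1 w in auto)
 qed
qed

lemma shift_int:
 assumes "\<bar>Re w\<bar> < l"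
 shows "\<psi> (w + turn k) = \<psi> w + turn k \<and> D (w + turn k) = D w"
proof (induction k rule: int_induct[where k=0])
 case (step1 i)
 have e: "w + turn (i + 1) = (w + turn i) + per"
  by (simp add: algebra_simps)
 show ?case unfolding e using step1 \<psi>_shift[of "w + turn i"] D_shift[of "w + turn i"] assms
  by (simp add: algebra_simps)
next
 case (step2 i)
 have e: "w + turn i = (w + turn (i - 1)) + per"
  by (simp add: algebra_simps)
 show ?case using step2 \<psi>_shift[of "w + turn (i - 1)"] D_shift[of "w + turn (i - 1)"] assms
  unfolding e[symmetric] by (simp add: algebra_simps)
qed simp

lemma reduce_Im: obtains k :: int where "- eps < y - of_int (2 * k) * eps" "y - of_int (2 * k) * eps \<le> eps"
proof -
 define k where "k = \<lceil>(y - eps) / (2 * eps)\<rceil>"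
 have "of_int k - 1 < (y - eps) / (2 * eps)" "(y - eps) / (2 * eps) \<le> of_int k" unfolding k_def by linarith+
 then show thesis using eps by (intro that[of k]) (auto simp: field_simps)
qed

text \<open>Translations and reflections move every boundary point to the side or corner of one fundamental piece.\<close>
lemma boundary_point:
 assumes w: "Re w = l"
 obtains L M C r where "(\<psi> \<longlongrightarrow> L) (at w within HS)" "(D \<longlongrightarrow> M) (at w within HS)" "w \<notin> corners \<Longrightarrow> M \<noteq> 0"
  "0 < r" "\<And>v. v \<in> HS \<Longrightarrow> dist v w < r \<Longrightarrow> norm (v - w) powr (2/3) \<le> C * norm (D v)"
proof -
 obtain k :: int where k: "- eps < Im w - of_int (2 * k) * eps" "Im w - of_int (2 * k) * eps \<le> eps" by (rule reduce_Im)
 define a where "a = turn k"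
 define v where "v = w - a"
 have v: "Re v = l" "- eps < Im v" "Im v \<le> eps" using w k by (auto simp: v_def a_def)
 have "\<exists>L M C r. (\<psi> \<longlongrightarrow> L) (at v within HS) \<and> (D \<longlongrightarrow> M) (at v within HS) \<and> (Im v < eps \<longrightarrow> M \<noteq> 0) \<and>
  0 < r \<and> (\<forall>u\<in>HS. dist u v < r \<longrightarrow> norm (u - v) powr (2/3) \<le> C * norm (D u))"
 proof (cases "Im v < eps")
  case True
  obtain L c where Lc: "0 < c" "(\<psi> \<longlongrightarrow> L) (at v within HS)" "(D \<longlongrightarrow> of_real c * cosh L) (at v within HS)"
   by (rule side_regularity[of v]) (use v True in auto)
  have "\<forall>\<^sub>F u in at v within HS. \<bar>Im u\<bar> < eps"
  proof -
   have "\<forall>\<^sub>F u in nhds v. u \<in> {u. - eps < Im u} \<inter> {u. Im u < eps}"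
    by (rule eventually_nhds_in_open) (use v True in "auto intro!: open_Int open_halfspace_Im_gt open_halfspace_Im_lt")
   then show ?thesis unfolding eventually_at_filter by eventually_elim auto
  qed
  then have "\<forall>\<^sub>F u in at v within HS. \<bar>Im (\<psi> u)\<bar> \<le> eps"
   unfolding eventually_at_filter by eventually_elim (use \<psi>_Im_bounds' in "force simp: HS_def")
  moreover have "((\<lambda>u. \<bar>Im (\<psi> u)\<bar>) \<longlongrightarrow> \<bar>Im L\<bar>) (at v within HS)" by (intro tendsto_intros Lc)
  ultimately have "\<bar>Im L\<bar> \<le> eps"
   by (intro tendsto_upperbound[OF _ _ HS_ne_bot[of v]]) (use v l in "auto simp: \<Omega>_def")
  then have "cosh L \<noteq> 0" using eps by (intro complex_cosh_ne_0) auto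
  then have M: "of_real c * cosh L \<noteq> 0" using Lc by simp
  define m where "m = norm (of_real c * cosh L) / 2"
  have m: "0 < m" "m < norm (of_real c * cosh L)" using M by (auto simp: m_def)
  have "\<forall>\<^sub>F u in at v within HS. m < norm (D u)"
   by (rule order_tendstoD(1)[OF tendsto_norm[OF Lc(3)] m(2)])
  then obtain d where d: "d > 0" "\<And>u. u \<in> HS \<Longrightarrow> u \<noteq> v \<Longrightarrow> dist u v < d \<Longrightarrow> m < norm (D u)"
   unfolding eventually_at by blast
  have "norm (u - v) powr (2/3) \<le> 1 / m * norm (D u)" if u: "u \<in> HS" "dist u v < min d 1" for u
  proof -
   have "u \<noteq> v" using u(1) v by (auto simp: HS_def)
   then have 1: "m < norm (D u)" using d u by auto
   have "norm (u - v) powr (2/3) \<le> 1 powr (2/3)" by (rule powr_mono2) (use u in "auto simp: dist_norm")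
   then have "m * norm (u - v) powr (2/3) \<le> m" using m mult_left_mono[of "norm (u - v) powr (2/3)" 1 m] by simp
   then have "m * norm (u - v) powr (2/3) \<le> norm (D u)" using 1 by linarith
   then show ?thesis using m by (simp add: pos_le_divide_eq mult.commute)
  qed
  then show ?thesis using Lc M d(1)
   by (intro exI[of _ L] exI[of _ "of_real c * cosh L"] exI[of _ "1 / m"] exI[of _ "min d 1"]) auto
 next
  case False
  then have "v = w0" using v by (auto simp: w0_def complex_eq_iff)
  moreover obtain C r where "(\<psi> \<longlongrightarrow> Complex t0 eps) (at w0 within HS)" "(D \<longlongrightarrow> 0) (at w0 within HS)"
   "0 < r" "\<And>w. w \<in> HS \<Longrightarrow> dist w w0 < r \<Longrightarrow> norm (w - w0) powr (2/3) \<le> C * norm (D w)"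
   by (rule corner_full) blast
  ultimately show ?thesis using False
   by (intro exI[of _ "Complex t0 eps"] exI[of _ 0] exI[of _ C] exI[of _ r]) auto
 qed
 then obtain L M C r where H: "(\<psi> \<longlongrightarrow> L) (at v within HS)" "(D \<longlongrightarrow> M) (at v within HS)" "Im v < eps \<longrightarrow> M \<noteq> 0"
  "0 < r" "\<forall>u\<in>HS. dist u v < r \<longrightarrow> norm (u - v) powr (2/3) \<le> C * norm (D u)" by blast
 have aS: "u - a \<in> HS \<longleftrightarrow> u \<in> HS" "u + a \<in> HS \<longleftrightarrow> u \<in> HS" for u by (auto simp: HS_def a_def)
 have sh: "\<psi> (u + a) = \<psi> u + a" "D (u + a) = D u" if "u \<in> HS" for u
  using shift_int[of u k] that by (auto simp: HS_def a_def)
 have ev: "\<forall>\<^sub>F u in at v within HS. u \<in> HS" by (simp add: eventually_at_filter)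
 have wv: "w = v + a" by (simp add: v_def)
 show thesis
 proof (rule that)
  have "((\<lambda>x. \<psi> (x + a)) \<longlongrightarrow> L + a) (at v within HS)"
   by (rule Lim_transform_eventually[OF tendsto_add[OF H(1) tendsto_const[of a]]])
     (use ev sh in "auto elim!: eventually_mono")
  then show "(\<psi> \<longlongrightarrow> L + a) (at w within HS)" unfolding wv
   by (rule tendsto_within_isometry[where \<sigma>="\<lambda>u. u - a"]) (use aS in auto)
  have "((\<lambda>x. D (x + a)) \<longlongrightarrow> M) (at v within HS)"
   by (rule Lim_transform_eventually[OF H(2)]) (use ev sh in "auto elim!: eventually_mono")
  then show "(D \<longlongrightarrow> M) (at w within HS)" unfolding wv
   by (rule tendsto_within_isometry[where \<sigma>="\<lambda>u. u - a"]) (use aS in auto)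
  show "M \<noteq> 0" if "w \<notin> corners"
  proof -
   have "Im v \<noteq> eps"
   proof
    assume "Im v = eps"
    then have "Im w = (2 * of_int k + 1) * eps" by (simp add: v_def a_def algebra_simps)
    then show False using that w by (auto simp: corners_def)
   qed
   then show ?thesis using H(3) v by simp
  qed
  show "0 < r" by fact
  fix u assume u: "u \<in> HS" "dist u w < r"
  have "norm ((u - a) - v) powr (2/3) \<le> C * norm (D (u - a))"
  proof -
   have "dist (u - a) v < r" using u by (simp add: dist_norm v_def)
   then show ?thesis using H(5) aS(1)[of u] u by blast
  qed
  moreover have "D (u - a) = D u" using sh(2)[of "u - a"] aS u by simp
  ultimately show "norm (u - w) powr (2/3) \<le> C * norm (D u)" by (simp add: wv algebra_simps)
 qed
qed

definition "\<Psi> = lext HS \<psi>"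
definition "DX = lext HS D"

lemma lim_within_HS:
 assumes "0 \<le> Re w" "Re w < l"
 shows "(\<psi> \<longlongrightarrow> \<psi> w) (at w within HS)" "(D \<longlongrightarrow> D w) (at w within HS)"
 using \<psi>_isCont[of w] D_isCont[of w] assms by (auto simp: isCont_def intro: tendsto_within_subset)

lemma \<Psi>_lim: assumes "w \<in> \<Omega>" shows "(\<psi> \<longlongrightarrow> \<Psi> w) (at w within HS)" "(D \<longlongrightarrow> DX w) (at w within HS)"
proof -
 have wc: "w \<in> closure HS" using assms \<Omega>_closure by blast
 have "(\<exists>L. (\<psi> \<longlongrightarrow> L) (at w within HS)) \<and> (\<exists>L. (D \<longlongrightarrow> L) (at w within HS))"
 proof (cases "Re w = l")
  case True
  then show ?thesis by (rule boundary_point) blast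
 next
  case False
  then show ?thesis using lim_within_HS[of w] assms by (auto simp: \<Omega>_def)
 qed
 then show "(\<psi> \<longlongrightarrow> \<Psi> w) (at w within HS)" "(D \<longlongrightarrow> DX w) (at w within HS)"
  unfolding \<Psi>_def DX_def using lext_tendsto[OF HS(1) wc] by blast+
qed

lemma \<Psi>_eq: assumes "0 \<le> Re w" "Re w < l" shows "\<Psi> w = \<psi> w" "DX w = D w"
 using tendsto_unique[OF HS_ne_bot \<Psi>_lim(1) lim_within_HS(1), of w]
  tendsto_unique[OF HS_ne_bot \<Psi>_lim(2) lim_within_HS(2), of w] assms by (auto simp: \<Omega>_def)

lemma \<Psi>_cont: "continuous_on \<Omega> \<Psi>" "continuous_on \<Omega> DX"
 unfolding \<Psi>_def DX_def
 by (rule continuous_on_lext[OF HS(1) _ \<Omega>_closure] ; use HS(3) \<Psi>_lim in "auto intro: continuous_on_subset[OF \<psi>_cont] continuous_on_subset[OF D_cont]")+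

lemma \<Omega>_agree:
 fixes f g :: "complex \<Rightarrow> 'a::t2_space"
 assumes "continuous_on \<Omega> f" "continuous_on \<Omega> g" "\<And>w. w \<in> HS \<Longrightarrow> f w = g w" "w \<in> \<Omega>"
 shows "f w = g w"
proof (rule tendsto_unique[OF HS_ne_bot[OF assms(4)]])
 have sub: "HS \<subseteq> \<Omega>" by (auto simp: HS_def \<Omega>_def)
 show "(f \<longlongrightarrow> f w) (at w within HS)"
  using assms(1,4) sub by (auto simp: continuous_on_def intro: tendsto_within_subset)
 have "(g \<longlongrightarrow> g w) (at w within HS)"
  using assms(2,4) sub by (auto simp: continuous_on_def intro: tendsto_within_subset)
 then show "(f \<longlongrightarrow> g w) (at w within HS)"
  by (rule Lim_transform_eventually) (use assms(3) in "auto simp: eventually_at_filter")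
qed

lemma \<Omega>_sym: "cnj w \<in> \<Omega> \<longleftrightarrow> w \<in> \<Omega>" "w + per \<in> \<Omega> \<longleftrightarrow> w \<in> \<Omega>"
 by (auto simp: \<Omega>_def)

lemma \<Psi>_sym:
 assumes w: "w \<in> \<Omega>"
 shows "\<Psi> (cnj w) = cnj (\<Psi> w)" "DX (cnj w) = cnj (DX w)"
  "\<Psi> (w + per) = \<Psi> w + per" "DX (w + per) = DX w"
proof -
 have c1: "continuous_on \<Omega> (\<lambda>w. \<Psi> (cnj w))" "continuous_on \<Omega> (\<lambda>w. DX (cnj w))"
  by (rule continuous_on_compose2[OF \<Psi>_cont(1)] continuous_on_compose2[OF \<Psi>_cont(2)], auto intro!: continuous_intros simp: \<Omega>_def)+
 have c2: "continuous_on \<Omega> (\<lambda>w. \<Psi> (w + per))" "continuous_on \<Omega> (\<lambda>w. DX (w + per))"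
  by (rule continuous_on_compose2[OF \<Psi>_cont(1)] continuous_on_compose2[OF \<Psi>_cont(2)], auto intro!: continuous_intros simp: \<Omega>_def)+
 note e = \<Psi>_eq \<psi>_cnj D_cnj \<psi>_shift D_shift
 show "\<Psi> (cnj w) = cnj (\<Psi> w)"
  by (rule \<Omega>_agree[OF c1(1) _ _ w]) (use e in "auto intro!: continuous_intros \<Psi>_cont simp: HS_def")
 show "DX (cnj w) = cnj (DX w)"
  by (rule \<Omega>_agree[OF c1(2) _ _ w]) (use e in "auto intro!: continuous_intros \<Psi>_cont simp: HS_def")
 show "\<Psi> (w + per) = \<Psi> w + per"
  by (rule \<Omega>_agree[OF c2(1) _ _ w]) (use e in "auto intro!: continuous_intros \<Psi>_cont simp: HS_def")
 show "DX (w + per) = DX w"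
  by (rule \<Omega>_agree[OF c2(2) _ _ w]) (use e in "auto intro!: continuous_intros \<Psi>_cont simp: HS_def")
qed

lemma DX_ne: assumes "w \<in> \<Omega>" "w \<notin> corners" shows "DX w \<noteq> 0"
proof (cases "Re w = l")
 case True
 obtain M where M: "(D \<longlongrightarrow> M) (at w within HS)" "M \<noteq> 0"
  by (rule boundary_point[OF True]) (use assms in blast)
 then show ?thesis using tendsto_unique[OF HS_ne_bot[OF assms(1)] \<Psi>_lim(2)[OF assms(1)] M(1)] by simp
next
 case False
 then show ?thesis using \<Psi>_eq[of w] D_ne[of w] assms l by (auto simp: \<Omega>_def)
qed

lemma rect_sub: "Rect \<subseteq> \<Omega>" by (auto simp: rect_iff \<Omega>_def)

lemma rect_closed_ineq:
 fixes g :: "complex \<Rightarrow> real"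
 assumes "continuous_on Rect g" "\<And>w. w \<in> QS \<Longrightarrow> 0 \<le> g w" "w \<in> Rect"
 shows "0 \<le> g w"
 using continuous_ge_on_closure[of QS g w 0] assms unfolding QS(4) by auto

lemma \<Psi>_cont_rect: "continuous_on Rect \<Psi>" "continuous_on Rect DX"
 by (rule continuous_on_subset[OF \<Psi>_cont(1) rect_sub] continuous_on_subset[OF \<Psi>_cont(2) rect_sub])+

lemma \<Psi>_rect:
 assumes w: "w \<in> Rect"
 shows "0 \<le> Re (\<Psi> w)" "0 \<le> Im (\<Psi> w)" "Im (\<Psi> w) \<le> eps" "sinh (Re (\<Psi> w)) \<le> T * cos (Im (\<Psi> w))"
proof -
 have Q: "\<Psi> v = \<psi> v" if "v \<in> QS" for v using \<Psi>_eq[of v] that by (auto simp: QS_def)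
 show "0 \<le> Re (\<Psi> w)" by (rule rect_closed_ineq[OF _ _ w])
   (use Q \<psi>_Re_pos in "force intro!: continuous_intros \<Psi>_cont_rect simp: QS_def")+
 show "0 \<le> Im (\<Psi> w)" by (rule rect_closed_ineq[OF _ _ w])
   (use Q \<psi>_Im_bounds in "force intro!: continuous_intros \<Psi>_cont_rect simp: QS_def")+
 have "0 \<le> eps - Im (\<Psi> w)" by (rule rect_closed_ineq[OF _ _ w])
   (use Q \<psi>_Im_bounds in "force intro!: continuous_intros \<Psi>_cont_rect simp: QS_def")+
 then show "Im (\<Psi> w) \<le> eps" by simp
 have "0 \<le> T * cos (Im (\<Psi> w)) - sinh (Re (\<Psi> w))"
 proof (rule rect_closed_ineq[OF _ _ w])
  fix v assume v: "v \<in> QS"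
  then show "0 \<le> T * cos (Im (\<Psi> v)) - sinh (Re (\<Psi> v))"
   unfolding Q[OF v] using \<psi>_below[of v] by (simp add: QS_def)
 qed (intro continuous_intros \<Psi>_cont_rect)
 then show "sinh (Re (\<Psi> w)) \<le> T * cos (Im (\<Psi> w))" by simp
qed

lemma face_eq: assumes "Re w = l" "0 \<le> Im w" "Im w \<le> eps" shows "sinh (Re (\<Psi> w)) = T * cos (Im (\<Psi> w))"
proof (rule antisym)
 have wr: "w \<in> Rect" using assms l by (simp add: rect_iff)
 have wO: "w \<in> \<Omega>" using wr rect_sub by blast
 show "sinh (Re (\<Psi> w)) \<le> T * cos (Im (\<Psi> w))" by (rule \<Psi>_rect(4)[OF wr])
 show "T * cos (Im (\<Psi> w)) \<le> sinh (Re (\<Psi> w))"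
 proof (rule field_le_epsilon)
  fix e :: real assume e: "e > 0"
  obtain \<eta> where \<eta>: "0 < \<eta>" "\<eta> < l"
   "\<And>w. \<bar>Im w\<bar> \<le> eps \<Longrightarrow> l - \<eta> < Re w \<Longrightarrow> Re w < l \<Longrightarrow> T * cos (Im (\<psi> w)) - e < sinh (Re (\<psi> w))"
   using \<psi>_proper[OF e] by blast
  have "w \<in> closure QS" unfolding QS(4) by (rule wr)
  then have bot: "at w within QS \<noteq> bot" by (rule at_within_ne_bot_of_closure[OF QS(1)])
  have pl: "(\<psi> \<longlongrightarrow> \<Psi> w) (at w within QS)" by (rule tendsto_within_subset[OF \<Psi>_lim(1)[OF wO] QS(2)])
  show "T * cos (Im (\<Psi> w)) \<le> sinh (Re (\<Psi> w)) + e"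
  proof (rule tendsto_le[OF bot])
   show "((\<lambda>u. T * cos (Im (\<psi> u))) \<longlongrightarrow> T * cos (Im (\<Psi> w))) (at w within QS)" by (intro tendsto_intros pl)
   show "((\<lambda>u. sinh (Re (\<psi> u)) + e) \<longlongrightarrow> sinh (Re (\<Psi> w)) + e) (at w within QS)" by (intro tendsto_intros pl)
   have "\<forall>\<^sub>F u in nhds w. u \<in> {u. l - \<eta> < Re u}"
    by (rule eventually_nhds_in_open) (use assms \<eta> in "auto intro!: open_halfspace_Re_gt")
   then show "\<forall>\<^sub>F u in at w within QS. T * cos (Im (\<psi> u)) \<le> sinh (Re (\<psi> u)) + e"
    unfolding eventually_at_filter by eventually_elim (use \<eta>(3) in "force simp: QS_def")
  qed
 qed
qed

lemma DX_face: assumes "Re w = l" "\<bar>Im w\<bar> < eps" obtains c where "0 < c" "DX w = of_real c * cosh (\<Psi> w)"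
proof -
 have wO: "w \<in> \<Omega>" using assms l by (simp add: \<Omega>_def)
 obtain L c where Lc: "0 < c" "(\<psi> \<longlongrightarrow> L) (at w within HS)" "(D \<longlongrightarrow> of_real c * cosh L) (at w within HS)"
  by (rule side_regularity[OF assms]) blast
 have "L = \<Psi> w" "of_real c * cosh L = DX w"
  using tendsto_unique[OF HS_ne_bot[OF wO]] Lc(2,3) \<Psi>_lim[OF wO] by blast+
 then show thesis using that Lc(1) by metis
qed

lemma DX_corner: "DX w0 = 0" "\<Psi> w0 = Complex t0 eps"
proof -
 have wO: "w0 \<in> \<Omega>" using l by (simp add: \<Omega>_def w0_def)
 obtain C r where "(\<psi> \<longlongrightarrow> Complex t0 eps) (at w0 within HS)" "(D \<longlongrightarrow> 0) (at w0 within HS)"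
   "0 < (r::real)" "\<And>w. w \<in> HS \<Longrightarrow> dist w w0 < r \<Longrightarrow> norm (w - w0) powr (2/3) \<le> C * norm (D w)"
   by (rule corner_full) blast
 then show "DX w0 = 0" "\<Psi> w0 = Complex t0 eps"
  using tendsto_unique[OF HS_ne_bot[OF wO]] \<Psi>_lim[OF wO] by blast+
qed

text \<open>On the three straight symmetric sides of the rectangle \<open>D\<close> is real and positive, on the face side it is a positive multiple of
 \<open>cosh \<psi>\<close>, and it vanishes at the corner. So the inequalities hold on the boundary, and the maximum principle for
 \<open>\<i> D\<close>, \<open>- D\<close> and \<open>- \<i> D / cosh \<psi>\<close> carries them inside. The third one says that \<open>Im (D / cosh \<psi>) \<le> 0\<close>.\<close>
lemma DX_key:
 assumes w: "w \<in> Rect"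
 shows "0 \<le> Im (DX w)" "0 \<le> Re (DX w)"
  "Im (DX w) * (cosh (Re (\<Psi> w)) * cos (Im (\<Psi> w))) \<le> Re (DX w) * (sinh (Re (\<Psi> w)) * sin (Im (\<Psi> w)))"
proof -
 define R where "R = Rect"
 have R: "interior R = QS" "closure R = R" "bounded R" by (auto simp: R_def interior_cbox QS(3))
 have fr: "frontier R \<subseteq> R" "\<And>v. v \<in> frontier R \<Longrightarrow> Re v = 0 \<or> Re v = l \<or> Im v = 0 \<or> Im v = eps"
  unfolding frontier_def R(1,2) by (auto simp: R_def rect_iff QS_def)
 have hol: "DX holomorphic_on QS" "\<Psi> holomorphic_on QS"
 proof -
  have "QS \<subseteq> Str" using l by (auto simp: QS_def)
  then have "D holomorphic_on QS" "\<psi> holomorphic_on QS" using D_hol \<psi>_hol holomorphic_on_subset by blast+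
  then show "DX holomorphic_on QS" "\<Psi> holomorphic_on QS"
   using \<Psi>_eq by (auto simp: QS_def cong: holomorphic_cong intro: holomorphic_transform)
 qed
 have Rc: "0 < cos (Im (\<Psi> v))" "0 \<le> sin (Im (\<Psi> v))" "0 < cosh (Re (\<Psi> v))" "0 \<le> sinh (Re (\<Psi> v))" if "v \<in> R" for v
  using \<Psi>_rect[of v] that eps by (auto simp: R_def intro!: cos_gt_zero_pi sin_ge_zero)
 have cne: "cosh (\<Psi> v) \<noteq> 0" if "v \<in> R" for v
  using \<Psi>_rect[of v] that eps by (intro complex_cosh_ne_0) (auto simp: R_def)
 define K where "K v = Im (DX v) * (cosh (Re (\<Psi> v)) * cos (Im (\<Psi> v))) - Re (DX v) * (sinh (Re (\<Psi> v)) * sin (Im (\<Psi> v)))" for v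
 have Kdiv: "Im (DX v / cosh (\<Psi> v)) = K v / (norm (cosh (\<Psi> v)))^2" for v
  unfolding K_def by (subst complex_div_cnj) (simp add: Im_divide_of_real Re_Im_sinh_cosh algebra_simps flip: of_real_power)
 have bdry: "0 \<le> Im (DX v) \<and> 0 \<le> Re (DX v) \<and> K v \<le> 0" if v: "v \<in> frontier R" for v
 proof -
  have vR: "v \<in> R" using v fr by blast
  then have vb: "0 \<le> Re v" "Re v \<le> l" "0 \<le> Im v" "Im v \<le> eps" by (auto simp: R_def rect_iff)
  note rc = Rc[OF vR]
  show ?thesis
  proof (cases "Re v = l")
   case True
   show ?thesis
   proof (cases "Im v < eps")
    case lt: True
    obtain c where c: "0 < c" "DX v = of_real c * cosh (\<Psi> v)" by (rule DX_face[of v]) (use True lt vb in auto)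
    show ?thesis using c rc by (auto simp: K_def Re_Im_sinh_cosh)
   next
    case False
    then have "v = w0" using vb True by (auto simp: w0_def complex_eq_iff)
    then show ?thesis using DX_corner by (simp add: K_def)
   qed
  next
   case False
   then have vl: "\<bar>Re v\<bar> < l" "0 \<le> Re v" "Re v < l" using vb by auto
   have z: "Re v = 0 \<or> Im v = 0 \<or> Im v = eps" using fr(2)[OF v] False by auto
   have "DX v = D v" using \<Psi>_eq vl by simp
   then have "Im (DX v) = 0" "0 < Re (DX v)" using D_real[OF vl(1) z] D_pos[OF vl(1) z] by simp_all
   then show ?thesis using rc by (simp add: K_def)
  qed
 qed
 have cDX: "continuous_on (closure R) DX" "continuous_on (closure R) (\<lambda>v. DX v / cosh (\<Psi> v))"
  unfolding R(2) using cne
  by (auto intro!: continuous_intros \<Psi>_cont_rect[folded R_def] continuous_on_compose2[OF continuous_on_cosh[OF continuous_on_id, of UNIV]])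
 have wR: "w \<in> R" using w by (simp add: R_def)
 have "Re (\<i> * DX w) \<le> 0"
  by (rule maximum_real_frontier[of "\<lambda>v. \<i> * DX v" R, OF _ _ R(3) _ wR])
    (use hol bdry R cDX in "auto intro!: holomorphic_intros continuous_intros")
 then show "0 \<le> Im (DX w)" by simp
 have "Re (- DX w) \<le> 0"
  by (rule maximum_real_frontier[of "\<lambda>v. - DX v" R, OF _ _ R(3) _ wR])
    (use hol bdry R cDX in "auto intro!: holomorphic_intros continuous_intros")
 then show "0 \<le> Re (DX w)" by simp
 have QR: "QS \<subseteq> R" using interior_subset[of R] R by simp
 have hq: "(\<lambda>v. DX v / cosh (\<Psi> v)) holomorphic_on QS"
  using hol cne QR unfolding cosh_field_def[abs_def] by (auto intro!: holomorphic_intros simp: cosh_field_def subset_iff)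
 have Rei: "Re (- \<i> * z) = Im z" for z by simp
 have "Re (- \<i> * (DX w / cosh (\<Psi> w))) \<le> 0"
 proof (rule maximum_real_frontier[of "\<lambda>v. - \<i> * (DX v / cosh (\<Psi> v))" R, OF _ _ R(3) _ wR])
  show "(\<lambda>v. - \<i> * (DX v / cosh (\<Psi> v))) holomorphic_on interior R" unfolding R(1) by (intro holomorphic_intros hq)
  show "continuous_on (closure R) (\<lambda>v. - \<i> * (DX v / cosh (\<Psi> v)))" by (intro continuous_intros cDX)
  fix v assume v: "v \<in> frontier R"
  have "Re (- \<i> * (DX v / cosh (\<Psi> v))) = Im (DX v / cosh (\<Psi> v))" by (rule Rei)
  also have "\<dots> \<le> 0" unfolding Kdiv using bdry[OF v] by (intro divide_nonpos_nonneg) auto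
  finally show "Re (- \<i> * (DX v / cosh (\<Psi> v))) \<le> 0" .
 qed
 then have "Im (DX w / cosh (\<Psi> w)) \<le> 0" unfolding Rei .
 then have "K w \<le> 0" unfolding Kdiv using cne[OF wR] by (simp add: divide_le_0_iff)
 then show "Im (DX w) * (cosh (Re (\<Psi> w)) * cos (Im (\<Psi> w))) \<le> Re (DX w) * (sinh (Re (\<Psi> w)) * sin (Im (\<Psi> w)))"
  by (simp add: K_def)
qed

end

section \<open>The Weierstrass primitives\<close>

context gauss_map begin

definition "rot = cis (2 * eps)"

lemma rot: "rot \<noteq> 1" "rot * cnj rot = 1" "norm rot = 1" "rot \<noteq> 0"
proof -
 have "sin (2 * eps) > 0" using eps pi_gt_zero by (intro sin_gt_zero) linarith+
 then show "rot \<noteq> 1" by (auto simp: rot_def complex_eq_iff)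
 show "rot * cnj rot = 1" "norm rot = 1" "rot \<noteq> 0" by (simp_all add: rot_def cis_cnj cis_mult)
qed

lemma strip_primitive:
 assumes "h holomorphic_on Str"
 obtains F where "\<And>w. \<bar>Re w\<bar> < l \<Longrightarrow> (F has_field_derivative h w) (at w)"
proof -
 obtain F where F: "\<And>x. x \<in> Str \<Longrightarrow> (F has_field_derivative h x) (at x within Str)"
  using holomorphic_convex_primitive'[OF convex_vertical_strip Str_open assms] by blast
 show thesis by (rule that[of F]) (use F Str_open in "metis at_within_open mem_Collect_eq")
qed

lemma strip_constant:
 assumes "\<And>w. \<bar>Re w\<bar> < l \<Longrightarrow> (F has_field_derivative 0) (at w)" "\<bar>Re w\<bar> < l" "\<bar>Re v\<bar> < l"
 shows "F w = F v"
proof -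
 have "\<exists>c. \<forall>x\<in>Str. F x = c"
  by (rule has_field_derivative_zero_constant[OF convex_vertical_strip])
    (use assms(1) in "auto intro: has_field_derivative_at_within")
 then show ?thesis using assms(2,3) by auto
qed

text \<open>The two horizontal coordinates are combinations of primitives of \<open>exp \<psi> / \<psi>'\<close> and \<open>exp (- \<psi>) / \<psi>'\<close>. Translation by the period
 multiplies the integrand by \<open>rot \<noteq> 1\<close>, so a suitable constant of integration removes the translation part.\<close>
lemma P_exists:
 "\<exists>P. (\<forall>w. \<bar>Re w\<bar> < l \<longrightarrow> (P has_field_derivative exp (\<psi> w) / D w) (at w) \<and>
   P (w + per) = rot * P w \<and> P (cnj w) = cnj (P w))"
proof -
 have h: "(\<lambda>w. exp (\<psi> w) / D w) holomorphic_on Str"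
  by (intro holomorphic_intros \<psi>_hol D_hol) (use D_ne in auto)
 obtain P0 where P0: "\<And>w. \<bar>Re w\<bar> < l \<Longrightarrow> (P0 has_field_derivative exp (\<psi> w) / D w) (at w)"
  by (rule strip_primitive[OF h]) blast
 have es: "exp per = rot" by (simp add: rot_def cis_conv_exp mult_ac)
 have d1: "((\<lambda>w. P0 (w + per) - rot * P0 w) has_field_derivative 0) (at w)" if w: "\<bar>Re w\<bar> < l" for w
 proof -
  have "((\<lambda>w. P0 (w + per)) has_field_derivative (exp (\<psi> (w + per)) / D (w + per)) * 1) (at w)"
   by (rule DERIV_chain2[OF P0]) (use w in "auto intro!: derivative_eq_intros")
  then have "((\<lambda>w. P0 (w + per)) has_field_derivative rot * (exp (\<psi> w) / D w)) (at w)"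
   using \<psi>_shift[OF w] D_shift[OF w] es by (simp add: exp_add mult_ac)
  from DERIV_diff[OF this DERIV_cmult[OF P0[OF w], of rot]] show ?thesis by simp
 qed
 define C where "C = P0 per - rot * P0 0"
 have C: "P0 (w + per) = rot * P0 w + C" if "\<bar>Re w\<bar> < l" for w
  using strip_constant[OF d1 that, of 0] l by (simp add: C_def algebra_simps)
 define P where "P w = P0 w - C / (1 - rot)" for w
 have r1: "1 - rot \<noteq> 0" using rot by simp
 have Pd: "(P has_field_derivative exp (\<psi> w) / D w) (at w)" if "\<bar>Re w\<bar> < l" for w
  unfolding P_def using DERIV_diff[OF P0[OF that] DERIV_const] by simp
 have Ps: "P (w + per) = rot * P w" if "\<bar>Re w\<bar> < l" for w
  unfolding P_def C[OF that] using r1 by (simp add: field_simps)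
 have d2: "((\<lambda>w. cnj (P (cnj w)) - P w) has_field_derivative 0) (at w)" if w: "\<bar>Re w\<bar> < l" for w
 proof -
  have "((cnj \<circ> P \<circ> cnj) has_field_derivative cnj (exp (\<psi> (cnj w)) / D (cnj w))) (at (cnj (cnj w)))"
   by (rule has_field_derivative_cnj_cnj) (use Pd w in simp)
  then have "((\<lambda>w. cnj (P (cnj w))) has_field_derivative exp (\<psi> w) / D w) (at w)"
   using \<psi>_cnj[OF w] D_cnj[OF w] by (simp add: o_def exp_cnj)
  from DERIV_diff[OF this Pd[OF w]] show ?thesis by simp
 qed
 define K where "K = cnj (P 0) - P 0"
 have K: "cnj (P (cnj w)) = P w + K" if "\<bar>Re w\<bar> < l" for w
  using strip_constant[OF d2 that, of 0] l by (simp add: K_def algebra_simps)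
 have "K = 0"
 proof -
  have e: "(- per) + per = (0::complex)" by simp
  have "P 0 = rot * P (- per)" using Ps[of "- per"] l unfolding e by simp
  then have "cnj rot * P 0 = P (- per)" using rot(2) by (metis mult.assoc mult.commute mult_1)
  moreover have "cnj per = - per" by simp
  ultimately have "cnj (cnj rot * P 0) = P per + K" using K[of "per"] l by simp
  also have "P per = rot * P 0" using Ps[of 0] l by simp
  finally have "rot * cnj (P 0) = rot * P 0 + K" by simp
  moreover have "rot * cnj (P 0) = rot * P 0 + rot * K" by (simp add: K_def algebra_simps)
  ultimately have "rot * K = K" by simp
  then show ?thesis using rot(1) by (metis mult_cancel_right1 mult.commute)
 qed
 then have Pc: "P (cnj w) = cnj (P w)" if "\<bar>Re w\<bar> < l" for w using K[OF that] by (metis add_0_right complex_cnj_cnj)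
 show ?thesis using Pd Ps Pc by blast
qed

definition "P = (SOME P. (\<forall>w. \<bar>Re w\<bar> < l \<longrightarrow> (P has_field_derivative exp (\<psi> w) / D w) (at w) \<and>
   P (w + per) = rot * P w \<and> P (cnj w) = cnj (P w)))"

lemma P: assumes "\<bar>Re w\<bar> < l"
 shows "(P has_field_derivative exp (\<psi> w) / D w) (at w)"
  "P (w + per) = rot * P w" "P (cnj w) = cnj (P w)"
 using someI_ex[OF P_exists] assms unfolding P_def by blast+

definition "Q w = - P (- w)" for w

lemma Q: assumes w: "\<bar>Re w\<bar> < l"
 shows "(Q has_field_derivative exp (- \<psi> w) / D w) (at w)"
  "Q (w + per) = cnj rot * Q w" "Q (cnj w) = cnj (Q w)"
proof -
 have "((\<lambda>w. P (- w)) has_field_derivative exp (\<psi> (- w)) / D (- w) * (-1)) (at w)"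
  by (rule DERIV_chain2[where f=P and g=uminus]) (use w P(1)[of "- w"] in "auto intro!: derivative_eq_intros")
 from DERIV_minus[OF this] show "(Q has_field_derivative exp (- \<psi> w) / D w) (at w)"
  unfolding Q_def[abs_def] using \<psi>_minus[OF w] D_minus[OF w] by simp
 have "P (- w) = rot * P (- w - per)" using P(2)[of "- w - per"] w by simp
 then have "cnj rot * P (- w) = P (- w - per)" using rot(2) by (metis mult.assoc mult.commute mult_1)
 then show "Q (w + per) = cnj rot * Q w" by (simp add: Q_def)
 show "Q (cnj w) = cnj (Q w)" using P(3)[of "- w"] w by (simp add: Q_def)
qed

text \<open>The primitive of \<open>1 / \<psi>'\<close> that vanishes at \<open>0\<close> is odd and commutes with conjugation. It is therefore imaginary on the
 imaginary axis, and the constant by which translation by the period changes it is imaginary.\<close>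
lemma H_exists:
 "\<exists>H. (\<forall>w. \<bar>Re w\<bar> < l \<longrightarrow> (H has_field_derivative 1 / D w) (at w) \<and>
   Re (H (w + per)) = Re (H w) \<and> H (cnj w) = cnj (H w)) \<and> (\<forall>y. Re (H (\<i> * of_real y)) = 0)"
proof -
 have h: "(\<lambda>w. 1 / D w) holomorphic_on Str"
  by (intro holomorphic_intros D_hol) (use D_ne in auto)
 obtain H0 where H0: "\<And>w. \<bar>Re w\<bar> < l \<Longrightarrow> (H0 has_field_derivative 1 / D w) (at w)"
  by (rule strip_primitive[OF h]) blast
 define H where "H w = H0 w - H0 0" for w
 have Hd: "(H has_field_derivative 1 / D w) (at w)" if "\<bar>Re w\<bar> < l" for w
  unfolding H_def using DERIV_diff[OF H0[OF that] DERIV_const] by simp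
 have H00: "H 0 = 0" by (simp add: H_def)
 have d2: "((\<lambda>w. cnj (H (cnj w)) - H w) has_field_derivative 0) (at w)" if w: "\<bar>Re w\<bar> < l" for w
 proof -
  have "((cnj \<circ> H \<circ> cnj) has_field_derivative cnj (1 / D (cnj w))) (at (cnj (cnj w)))"
   by (rule has_field_derivative_cnj_cnj) (use Hd w in simp)
  then have "((\<lambda>w. cnj (H (cnj w))) has_field_derivative 1 / D w) (at w)"
   using D_cnj[OF w] by (simp add: o_def)
  from DERIV_diff[OF this Hd[OF w]] show ?thesis by simp
 qed
 have Hc: "cnj (H (cnj w)) = H w" if "\<bar>Re w\<bar> < l" for w
  using strip_constant[OF d2 that, of 0] l H00 by simp
 have d3: "((\<lambda>w. H (- w) + H w) has_field_derivative 0) (at w)" if w: "\<bar>Re w\<bar> < l" for w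
 proof -
  have "((\<lambda>w. H (- w)) has_field_derivative 1 / D (- w) * (-1)) (at w)"
   by (rule DERIV_chain2[where f=H and g=uminus]) (use w Hd[of "- w"] in "auto intro!: derivative_eq_intros")
  from DERIV_add[OF this Hd[OF w]] show ?thesis using D_minus[OF w] by simp
 qed
 have Hm: "H (- w) = - H w" if "\<bar>Re w\<bar> < l" for w
  using strip_constant[OF d3 that, of 0] l H00 by (simp add: eq_neg_iff_add_eq_0)
 have Hi: "Re (H (\<i> * of_real y)) = 0" for y
 proof -
  have "cnj (\<i> * of_real y) = - (\<i> * of_real y)" by simp
  then have "cnj (- H (\<i> * of_real y)) = H (\<i> * of_real y)"
   using Hc[of "\<i> * of_real y"] Hm[of "\<i> * of_real y"] l by simp
  then show ?thesis by (simp add: complex_eq_iff)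
 qed
 have d1: "((\<lambda>w. H (w + per) - H w) has_field_derivative 0) (at w)" if w: "\<bar>Re w\<bar> < l" for w
 proof -
  have "((\<lambda>w. H (w + per)) has_field_derivative (1 / D (w + per)) * 1) (at w)"
   by (rule DERIV_chain2[OF Hd]) (use w in "auto intro!: derivative_eq_intros")
  from DERIV_diff[OF this Hd[OF w]] show ?thesis using D_shift[OF w] by simp
 qed
 have Hs: "Re (H (w + per)) = Re (H w)" if "\<bar>Re w\<bar> < l" for w
 proof -
  have "H (w + per) - H w = H (0 + per) - H 0"
   by (rule strip_constant[OF d1 that]) (use l in simp_all)
  then have "Re (H (w + per) - H w) = Re (H (0 + per) - H 0)" by (rule arg_cong)
  moreover have "Re (H per) = 0" using Hi[of "2 * eps"] by (simp add: mult_ac)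
  ultimately show ?thesis using H00 by simp
 qed
 have Hc': "H (cnj w) = cnj (H w)" if "\<bar>Re w\<bar> < l" for w using arg_cong[OF Hc[OF that], of cnj] by (simp only: complex_cnj_cnj)
 show ?thesis
 proof (intro exI[of _ H] conjI allI impI)
  fix w assume w: "\<bar>Re w\<bar> < l"
  show "(H has_field_derivative 1 / D w) (at w)" by (rule Hd[OF w])
  show "Re (H (w + per)) = Re (H w)" by (rule Hs[OF w])
  show "H (cnj w) = cnj (H w)" by (rule Hc'[OF w])
 next
  show "Re (H (\<i> * of_real y)) = 0" for y by (rule Hi)
 qed
qed

definition "H = (SOME H. (\<forall>w. \<bar>Re w\<bar> < l \<longrightarrow> (H has_field_derivative 1 / D w) (at w) \<and>
   Re (H (w + per)) = Re (H w) \<and> H (cnj w) = cnj (H w)) \<and> (\<forall>y. Re (H (\<i> * of_real y)) = 0))"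

lemma H_spec: "(\<forall>w. \<bar>Re w\<bar> < l \<longrightarrow> (H has_field_derivative 1 / D w) (at w) \<and>
   Re (H (w + per)) = Re (H w) \<and> H (cnj w) = cnj (H w)) \<and> (\<forall>y. Re (H (\<i> * of_real y)) = 0)"
 unfolding H_def by (rule someI_ex[OF H_exists])

lemma H: "\<bar>Re w\<bar> < l \<Longrightarrow> (H has_field_derivative 1 / D w) (at w)"
  "\<bar>Re w\<bar> < l \<Longrightarrow> Re (H (w + per)) = Re (H w)" "\<bar>Re w\<bar> < l \<Longrightarrow> H (cnj w) = cnj (H w)"
  "Re (H (\<i> * of_real y)) = 0"
 using H_spec by auto

definition "PX = lext HS P"
definition "QX = lext HS Q"
definition "HX = lext HS H"

text \<open>Away from corners the integrand extends continuously; at a corner the bound on \<open>1 / \<psi>'\<close> from \<open>boundary_point\<close> is integrable by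
 \<open>limit_of_bounded_singular_derivative\<close>.\<close>
lemma primitive_extends:
 assumes F: "\<And>w. \<bar>Re w\<bar> < l \<Longrightarrow> (F has_field_derivative h w / D w) (at w)"
  and h: "\<And>w. w \<in> HS \<Longrightarrow> norm (h w) \<le> B"
  and g: "continuous_on \<Omega> g" "\<And>w. w \<in> HS \<Longrightarrow> h w = g w"
 shows "continuous_on \<Omega> (lext HS F)" "\<And>w. 0 \<le> Re w \<Longrightarrow> Re w < l \<Longrightarrow> lext HS F w = F w"
  "\<And>w. w \<in> \<Omega> \<Longrightarrow> w \<notin> corners \<Longrightarrow> (lext HS F has_field_derivative g w / DX w) (at w within \<Omega>)"
proof -
 have Fc: "isCont F w" if "\<bar>Re w\<bar> < l" for w using DERIV_isCont[OF F[OF that]] .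
 have Flim: "(F \<longlongrightarrow> F w) (at w within HS)" if "0 \<le> Re w" "Re w < l" for w
  using Fc[of w] that by (auto simp: isCont_def intro: tendsto_within_subset)
 have lim: "\<exists>L. (F \<longlongrightarrow> L) (at w within HS)" if w: "w \<in> \<Omega>" for w
 proof (cases "Re w = l")
  case True
  obtain C r where Cr: "0 < r" "\<And>v. v \<in> HS \<Longrightarrow> dist v w < r \<Longrightarrow> norm (v - w) powr (2/3) \<le> C * norm (D v)"
   by (rule boundary_point[OF True]) blast
  have inHS: "v \<in> HS" if "Re v < l" "dist v w < min r l" for v
  proof -
   have "\<bar>Re (v - w)\<bar> < l" using that abs_Re_le_cmod[of "v - w"] by (simp add: dist_norm)
   then show ?thesis using that True by (auto simp: HS_def)
  qed
  have "\<exists>L. (F \<longlongrightarrow> L) (at w within {w. Re w < l})"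
  proof (rule limit_of_bounded_singular_derivative[of "min r l" w l F "\<lambda>w. h w / D w" "\<bar>B\<bar> * C"])
   show "0 < min r l" using Cr l by simp
   show "Re w = l" by fact
   fix v assume v: "Re v < l" "dist v w < min r l"
   have vH: "v \<in> HS" by (rule inHS[OF v])
   then have vl: "\<bar>Re v\<bar> < l" by (auto simp: HS_def)
   show "(F has_field_derivative h v / D v) (at v)" by (rule F[OF vl])
   have "norm (h v / D v) * norm (v - w) powr (2/3) \<le> norm (h v) / norm (D v) * (C * norm (D v))"
    unfolding norm_divide using Cr(2)[OF vH] v by (intro mult_left_mono) auto
   also have "\<dots> = norm (h v) * C" using D_ne[OF vl] by simp
   also have "\<dots> \<le> \<bar>B\<bar> * C"
   proof (rule mult_right_mono)
    show "norm (h v) \<le> \<bar>B\<bar>" using h[OF vH] by linarith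
    have "0 \<le> norm (v - w) powr (2/3)" by simp
    then have "0 \<le> C * norm (D v)" by (rule order_trans[OF _ Cr(2)[OF vH]]) (use v in auto)
    then show "0 \<le> C" using D_ne[OF vl] by (simp add: zero_le_mult_iff)
   qed
   finally show "norm (h v / D v) * norm (v - w) powr (2/3) \<le> \<bar>B\<bar> * C" .
  qed
  then obtain L where L: "(F \<longlongrightarrow> L) (at w within {w. Re w < l})" ..
  have "HS \<subseteq> {w. Re w < l}" by (auto simp: HS_def)
  then have "(F \<longlongrightarrow> L) (at w within HS)" by (rule tendsto_within_subset[OF L])
  then show ?thesis ..
 next
  case False
  then show ?thesis using Flim[of w] w by (auto simp: \<Omega>_def)
 qed
 have cont_HS: "continuous_on HS F" using Fc by (intro continuous_at_imp_continuous_on) (auto simp: HS_def)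
 show c: "continuous_on \<Omega> (lext HS F)" by (rule continuous_on_lext[OF HS(1) cont_HS \<Omega>_closure lim])
 have wO: "w \<in> \<Omega>" if "0 \<le> Re w" "Re w < l" for w using that by (auto simp: \<Omega>_def)
 show e: "lext HS F w = F w" if w: "0 \<le> Re w" "Re w < l" for w
  by (rule lext_eq[OF HS(1) _ Flim[OF w]]) (use wO[OF w] \<Omega>_closure in blast)
 show "(lext HS F has_field_derivative g w / DX w) (at w within \<Omega>)" if w: "w \<in> \<Omega>" "w \<notin> corners" for w
 proof (rule has_field_derivative_extends[OF HS(1,2) _ \<Omega>_closure c _ w(1)])
  show sub: "HS \<subseteq> \<Omega>" by (auto simp: HS_def \<Omega>_def)
  show "(lext HS F has_field_derivative g v / DX v) (at v)" if v: "v \<in> HS" for v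
  proof -
   have "(F has_field_derivative g v / DX v) (at v)"
    using F[of v] g(2)[OF v] \<Psi>_eq(2)[of v] v by (auto simp: HS_def)
   then show ?thesis
    by (rule has_field_derivative_transform_within_open[OF _ HS(1) v]) (use e in "auto simp: HS_def")
  qed
  have "((\<lambda>w. g w / DX w) \<longlongrightarrow> g w / DX w) (at w within \<Omega>)"
   using g(1) \<Psi>_cont(2) w DX_ne[OF w] by (intro tendsto_intros) (auto simp: continuous_on_def)
  then show "((\<lambda>w. g w / DX w) \<longlongrightarrow> g w / DX w) (at w within HS)" by (rule tendsto_within_subset[OF _ sub])
 qed
qed

lemma exp_\<psi>_bound: "w \<in> HS \<Longrightarrow> norm (exp (\<psi> w)) \<le> exp T" "w \<in> HS \<Longrightarrow> norm (exp (- \<psi> w)) \<le> exp T"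
 using \<psi>_range_bound[of w] by (auto simp: HS_def)

lemma HS_\<Psi>: "w \<in> HS \<Longrightarrow> \<Psi> w = \<psi> w" using \<Psi>_eq by (auto simp: HS_def)

lemmas PX_facts = primitive_extends[OF P(1) exp_\<psi>_bound(1), of "\<lambda>w. exp (\<Psi> w)", folded PX_def]
lemmas QX_facts = primitive_extends[OF Q(1) exp_\<psi>_bound(2), of "\<lambda>w. exp (- \<Psi> w)", folded QX_def]
lemmas HX_facts = primitive_extends[where h="\<lambda>_. 1" and g="\<lambda>_. 1" and B=1, OF H(1), folded HX_def]

lemma exp_\<Psi>_cont: "continuous_on \<Omega> (\<lambda>w. exp (\<Psi> w))" "continuous_on \<Omega> (\<lambda>w. exp (- \<Psi> w))"
 by (intro continuous_intros \<Psi>_cont)+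

lemma PX: "continuous_on \<Omega> PX" "0 \<le> Re w \<Longrightarrow> Re w < l \<Longrightarrow> PX w = P w"
  "w \<in> \<Omega> \<Longrightarrow> w \<notin> corners \<Longrightarrow> (PX has_field_derivative exp (\<Psi> w) / DX w) (at w within \<Omega>)"
 using PX_facts exp_\<Psi>_cont HS_\<Psi> by auto
lemma QX: "continuous_on \<Omega> QX" "0 \<le> Re w \<Longrightarrow> Re w < l \<Longrightarrow> QX w = Q w"
  "w \<in> \<Omega> \<Longrightarrow> w \<notin> corners \<Longrightarrow> (QX has_field_derivative exp (- \<Psi> w) / DX w) (at w within \<Omega>)"
 using QX_facts exp_\<Psi>_cont HS_\<Psi> by auto
lemma HX: "continuous_on \<Omega> HX" "0 \<le> Re w \<Longrightarrow> Re w < l \<Longrightarrow> HX w = H w"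
  "w \<in> \<Omega> \<Longrightarrow> w \<notin> corners \<Longrightarrow> (HX has_field_derivative 1 / DX w) (at w within \<Omega>)"
 using HX_facts by auto

lemma \<Psi>_deriv: assumes "w \<in> \<Omega>" shows "(\<Psi> has_field_derivative DX w) (at w within \<Omega>)"
proof (rule has_field_derivative_extends[OF HS(1,2) _ \<Omega>_closure \<Psi>_cont(1) _ assms])
 show sub: "HS \<subseteq> \<Omega>" by (auto simp: HS_def \<Omega>_def)
 show "(\<Psi> has_field_derivative DX v) (at v)" if v: "v \<in> HS" for v
 proof -
  have "(\<psi> has_field_derivative DX v) (at v)" using \<psi>_D[of v] \<Psi>_eq(2)[of v] v by (auto simp: HS_def)
  then show ?thesis
   by (rule has_field_derivative_transform_within_open[OF _ HS(1) v]) (use HS_\<Psi> in auto)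
 qed
 show "(DX \<longlongrightarrow> DX w) (at w within HS)"
  using \<Psi>_cont(2) assms sub by (auto simp: continuous_on_def intro: tendsto_within_subset)
qed

text \<open>The surface before scaling: \<open>f\<close> combines its two horizontal coordinates to a complex number, and \<open>ht\<close> is its
 height.\<close>
definition "f w = (PX w - cnj (QX w)) / 2"
definition "ht w = Re (HX w)"

lemma f_cont: "continuous_on \<Omega> f" "continuous_on \<Omega> ht"
 unfolding f_def[abs_def] ht_def[abs_def] by (intro continuous_intros PX QX HX; simp)+

lemma f_sym:
 assumes w: "w \<in> \<Omega>"
 shows "f (w + per) = rot * f w" "ht (w + per) = ht w"
  "f (cnj w) = cnj (f w)" "ht (cnj w) = ht w"
proof -
 have c1: "continuous_on \<Omega> (\<lambda>w. f (cnj w))" "continuous_on \<Omega> (\<lambda>w. ht (cnj w))"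
  by (rule continuous_on_compose2[OF f_cont(1)] continuous_on_compose2[OF f_cont(2)], auto intro!: continuous_intros simp: \<Omega>_def)+
 have c2: "continuous_on \<Omega> (\<lambda>w. f (w + per))" "continuous_on \<Omega> (\<lambda>w. ht (w + per))"
  by (rule continuous_on_compose2[OF f_cont(1)] continuous_on_compose2[OF f_cont(2)], auto intro!: continuous_intros simp: \<Omega>_def)+
 have e: "PX v = P v" "QX v = Q v" "HX v = H v" if "0 < Re v" "Re v < l" for v using PX(2) QX(2) HX(2) that by auto
 show "f (w + per) = rot * f w"
  by (rule \<Omega>_agree[OF c2(1) _ _ w])
    (use e P Q in "auto intro!: continuous_intros f_cont PX(1) QX(1) HX(1) simp: HS_def f_def algebra_simps")
 show "ht (w + per) = ht w"
  by (rule \<Omega>_agree[OF c2(2) _ _ w]) (use e H in "auto intro!: continuous_intros f_cont PX(1) QX(1) HX(1) simp: HS_def ht_def")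
 show "f (cnj w) = cnj (f w)"
  by (rule \<Omega>_agree[OF c1(1) _ _ w]) (use e P Q in "auto intro!: continuous_intros f_cont PX(1) QX(1) HX(1) simp: HS_def f_def")
 show "ht (cnj w) = ht w"
  by (rule \<Omega>_agree[OF c1(2) _ _ w]) (use e H in "auto intro!: continuous_intros f_cont PX(1) QX(1) HX(1) simp: HS_def ht_def")
qed

lemma ht_base: assumes "Re w = 0" shows "ht w = 0"
proof -
 have "w = \<i> * of_real (Im w)" using assms by (simp add: complex_eq_iff)
 then have "ht w = Re (H (\<i> * of_real (Im w)))" using HX(2)[of w] assms l by (simp add: ht_def)
 then show ?thesis using H(4) by simp
qed

text \<open>\<open>cmp \<phi>\<close> is the horizontal coordinate in the direction \<open>\<phi>\<close>, and \<open>cF \<phi>\<close> is a holomorphic function of which it is the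
 real part.\<close>
definition "cmp \<phi> w = Re (cis (- \<phi>) * f w)" for \<phi>
definition "cF \<phi> w = (cis (- \<phi>) * PX w - cis \<phi> * QX w) / 2" for \<phi>

lemma cmp_cF: "cmp \<phi> w = Re (cF \<phi> w)"
proof -
 have "Re (cis (- \<phi>) * cnj (QX w)) = Re (cis \<phi> * QX w)" by simp
 then show ?thesis by (simp add: cmp_def cF_def f_def right_diff_distrib diff_divide_distrib)
qed

lemma cF_deriv:
 assumes "w \<in> \<Omega>" "w \<notin> corners"
 shows "(cF \<phi> has_field_derivative sinh (\<Psi> w - \<i> * of_real \<phi>) / DX w) (at w within \<Omega>)"
proof -
 have "(cF \<phi> has_field_derivative (cis (- \<phi>) * (exp (\<Psi> w) / DX w) - cis \<phi> * (exp (- \<Psi> w) / DX w)) / 2) (at w within \<Omega>)"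
  unfolding cF_def[abs_def] by (intro DERIV_cdivide DERIV_diff DERIV_cmult PX(3) QX(3) assms)
 moreover have "sinh (\<Psi> w - \<i> * of_real \<phi>) = (cis (- \<phi>) * exp (\<Psi> w) - cis \<phi> * exp (- \<Psi> w)) / 2"
  by (simp add: sinh_field_def cis_conv_exp exp_diff exp_add exp_minus field_simps)
 then have "(cis (- \<phi>) * (exp (\<Psi> w) / DX w) - cis \<phi> * (exp (- \<Psi> w) / DX w)) / 2 = sinh (\<Psi> w - \<i> * of_real \<phi>) / DX w"
  by (simp only: times_divide_eq_right diff_divide_distrib[symmetric] divide_divide_eq_left mult.commute)
 ultimately show ?thesis by simp
qed

lemma Re_i_mult: "Re (\<i> * z) = - Im z" by simp

lemma not_corner: "Re w \<noteq> l \<Longrightarrow> w \<notin> corners" "\<bar>Im w\<bar> < eps \<Longrightarrow> w \<notin> corners"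
proof -
 show "Re w \<noteq> l \<Longrightarrow> w \<notin> corners" by (auto simp: corners_def)
 assume a: "\<bar>Im w\<bar> < eps"
 show "w \<notin> corners"
 proof
  assume "w \<in> corners"
  then obtain k :: int where k: "Im w = (2 * of_int k + 1) * eps" by (auto simp: corners_def)
  have "1 \<le> \<bar>2 * k + 1\<bar>" by presburger
  then have "1 \<le> \<bar>2 * real_of_int k + 1\<bar>" by linarith
  then have "eps \<le> \<bar>(2 * of_int k + 1) * eps\<bar>" using eps by (simp add: abs_mult mult_le_cancel_right1)
  then show False using a k by simp
 qed
qed

lemma vline_deriv:
 assumes d: "(F has_field_derivative g) (at (Complex x y) within \<Omega>)" and x: "0 \<le> x" "x \<le> l"
 shows "((\<lambda>y. F (Complex x y)) has_vector_derivative \<i> * g) (at y)"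
proof -
 have "((F \<circ> (\<lambda>y. Complex x y)) has_vector_derivative \<i> * g) (at y within UNIV)"
 proof (rule field_vector_diff_chain_within)
  have "((\<lambda>y. of_real x + \<i> * of_real y) has_vector_derivative \<i>) (at y within UNIV)"
   by (auto intro!: derivative_eq_intros simp: has_vector_derivative_def scaleR_conv_of_real)
  then show "(Complex x has_vector_derivative \<i>) (at y within UNIV)" by (simp add: Complex_eq[abs_def])
  show "(F has_field_derivative g) (at (Complex x y) within range (Complex x))"
   by (rule DERIV_subset[OF d]) (use x in "auto simp: \<Omega>_def")
 qed
 then show ?thesis by (simp add: o_def)
qed

lemma hline_deriv:
 assumes d: "(F has_field_derivative g) (at (Complex x y) within \<Omega>)" and x: "0 < x" "x < l"
 shows "((\<lambda>x. F (Complex x y)) has_vector_derivative g) (at x)"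
proof -
 have "((F \<circ> (\<lambda>x. Complex x y)) has_vector_derivative 1 * g) (at x within {0..l})"
 proof (rule field_vector_diff_chain_within)
  have "((\<lambda>x. of_real x + \<i> * of_real y) has_vector_derivative 1) (at x within {0..l})"
   by (auto intro!: derivative_eq_intros simp: has_vector_derivative_def scaleR_conv_of_real)
  then show "((\<lambda>x. Complex x y) has_vector_derivative 1) (at x within {0..l})" by (simp add: Complex_eq[abs_def])
  show "(F has_field_derivative g) (at (Complex x y) within (\<lambda>x. Complex x y) ` {0..l})"
   by (rule DERIV_subset[OF d]) (use x in "auto simp: \<Omega>_def")
 qed
 moreover have "at x within {0..l} = at x" using x by (intro at_within_interior) auto
 ultimately show ?thesis by (simp add: o_def)
qed

lemma cmp_dy: assumes "Complex x y \<in> \<Omega>" "Complex x y \<notin> corners"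
 shows "((\<lambda>y. cmp \<phi> (Complex x y)) has_real_derivative - Im (sinh (\<Psi> (Complex x y) - \<i> * of_real \<phi>) / DX (Complex x y))) (at y)"
 using bounded_linear.has_vector_derivative[OF bounded_linear_Re vline_deriv[OF cF_deriv[OF assms]], unfolded Re_i_mult] assms(1)
 by (simp add: cmp_cF has_real_derivative_iff_has_vector_derivative \<Omega>_def)

lemma cmp_dx: assumes "0 < x" "x < l"
 shows "((\<lambda>x. cmp \<phi> (Complex x y)) has_real_derivative Re (sinh (\<Psi> (Complex x y) - \<i> * of_real \<phi>) / DX (Complex x y))) (at x)"
 using bounded_linear.has_vector_derivative[OF bounded_linear_Re hline_deriv[OF cF_deriv[of "Complex x y" \<phi>] assms]] assms
  not_corner(1)[of "Complex x y"]
 by (simp add: cmp_cF has_real_derivative_iff_has_vector_derivative \<Omega>_def)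

lemma ht_dy: assumes "Complex x y \<in> \<Omega>" "Complex x y \<notin> corners"
 shows "((\<lambda>y. ht (Complex x y)) has_real_derivative - Im (1 / DX (Complex x y))) (at y)"
 using bounded_linear.has_vector_derivative[OF bounded_linear_Re vline_deriv[OF HX(3)[OF assms]], unfolded Re_i_mult] assms(1)
 by (simp add: ht_def has_real_derivative_iff_has_vector_derivative \<Omega>_def)

lemma ht_dx: assumes "0 < x" "x < l"
 shows "((\<lambda>x. ht (Complex x y)) has_real_derivative Re (1 / DX (Complex x y))) (at x)"
 using bounded_linear.has_vector_derivative[OF bounded_linear_Re hline_deriv[OF HX(3)[of "Complex x y"] assms]] assms
  not_corner(1)[of "Complex x y"]
 by (simp add: ht_def has_real_derivative_iff_has_vector_derivative \<Omega>_def)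

lemma theta_dy: assumes "Complex x y \<in> \<Omega>"
 shows "((\<lambda>y. Im (\<Psi> (Complex x y))) has_real_derivative Re (DX (Complex x y))) (at y)"
 using bounded_linear.has_vector_derivative[OF bounded_linear_Im vline_deriv[OF \<Psi>_deriv[OF assms]]] assms(1)
 by (simp add: has_real_derivative_iff_has_vector_derivative \<Omega>_def)

lemma cmp_cont: "continuous_on \<Omega> (cmp \<phi>)" unfolding cmp_def[abs_def] by (intro continuous_intros f_cont)

end

section \<open>Monotonicity, injectivity and position relative to the faces\<close>

context gauss_map begin

lemma \<Psi>_Re_pos: assumes "w \<in> Rect" "0 < Re w" shows "0 < Re (\<Psi> w)"
proof (cases "Re w = l")
 case True
 have "0 < cos (Im (\<Psi> w))" using \<Psi>_rect[OF assms(1)] eps by (intro cos_gt_zero_pi) auto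
 then have "0 < sinh (Re (\<Psi> w))" using face_eq[of w] assms True T by (simp add: rect_iff)
 then show ?thesis by simp
next
 case False
 then show ?thesis using \<Psi>_eq[of w] \<psi>_Re_pos[of w] assms by (auto simp: rect_iff)
qed

text \<open>The numbers \<open>s \<phi>\<close> are the derivatives of the coordinates in the directions of the two symmetry lines \<open>\<phi> = 0\<close> and
 \<open>\<phi> = eps\<close> and of their normals; all signs are consequences of \<open>DX_key\<close>.\<close>
lemma sign_facts:
 assumes w: "w \<in> Rect" "w \<notin> corners"
 defines "s \<equiv> (\<lambda>\<phi>. sinh (\<Psi> w - \<i> * of_real \<phi>) / DX w)"
 shows "0 < Re w \<Longrightarrow> 0 < Re (s 0)" "0 \<le> Im (s 0)"
  "0 < Re w \<Longrightarrow> 0 < Re (s eps)" "Im (s eps) \<le> 0"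
  "0 \<le> Re (s (pi/2))" "Im (s (pi/2)) < 0"
  "Re (s (eps + pi/2)) \<le> 0" "Im (s (eps + pi/2)) < 0"
  "0 < Re (1 / DX w)"
proof -
 define t where "t = Re (\<Psi> w)" define \<theta> where "\<theta> = Im (\<Psi> w)" define \<delta> where "\<delta> = eps - \<theta>"
 define a where "a = Re (DX w)" define b where "b = Im (DX w)"
 define N where "N = a^2 + b^2"
 have t: "0 \<le> t" "0 < Re w \<Longrightarrow> 0 < t" and th: "0 \<le> \<theta>" "\<theta> \<le> eps"
  using \<Psi>_rect[OF w(1)] \<Psi>_Re_pos[OF w(1)] by (auto simp: t_def \<theta>_def)
 have ab: "0 \<le> b" "0 \<le> a" and key: "b * (cosh t * cos \<theta>) \<le> a * (sinh t * sin \<theta>)"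
  using DX_key[OF w(1)] by (auto simp: a_def b_def t_def \<theta>_def)
 have c: "0 < cos \<theta>" "0 \<le> sin \<theta>" "0 < cos \<delta>" "0 \<le> sin \<delta>" "0 < cos eps"
  using th eps by (auto simp: \<delta>_def intro!: cos_gt_zero_pi sin_ge_zero)
 have h: "0 < cosh t" "0 \<le> sinh t" "sinh t \<le> cosh t" using t sinh_le_cosh_real[of t] by auto
 have wO: "w \<in> \<Omega>" using w rect_sub by blast
 have D0: "DX w \<noteq> 0" by (rule DX_ne[OF wO w(2)])
 have a: "0 < a"
 proof (rule ccontr)
  assume "\<not> 0 < a"
  then have "a = 0" using ab by simp
  then have "b * (cosh t * cos \<theta>) \<le> 0" using key by simp
  then have "b \<le> 0" using h c by (simp add: mult_le_0_iff)
  then have "DX w = 0" using \<open>a = 0\<close> ab by (simp add: complex_eq_iff a_def b_def)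
  then show False using D0 by simp
 qed
 have N: "0 < N" using a by (simp add: N_def add_pos_nonneg)
 have ce: "cos eps = cos \<delta> * cos \<theta> - sin \<delta> * sin \<theta>" using cos_add[of \<delta> \<theta>] by (simp add: \<delta>_def)
 have re: "Re (s \<phi>) = (sinh t * cos (\<theta> - \<phi>) * a + cosh t * sin (\<theta> - \<phi>) * b) / N"
  and im: "Im (s \<phi>) = (cosh t * sin (\<theta> - \<phi>) * a - sinh t * cos (\<theta> - \<phi>) * b) / N" for \<phi>
  unfolding s_def Re_divide Im_divide by (simp_all add: Re_Im_sinh_cosh t_def \<theta>_def a_def b_def N_def)
 have angles: "cos (\<theta> - eps) = cos \<delta>" "sin (\<theta> - eps) = - sin \<delta>"
   "cos (\<theta> - pi/2) = sin \<theta>" "sin (\<theta> - pi/2) = - cos \<theta>"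
   "cos (\<theta> - (eps + pi/2)) = - sin \<delta>" "sin (\<theta> - (eps + pi/2)) = - cos \<delta>"
 proof -
  have e: "\<theta> - eps = - \<delta>" "\<theta> - (eps + pi/2) = - (\<delta> + pi/2)" by (simp_all add: \<delta>_def)
  show "cos (\<theta> - eps) = cos \<delta>" "sin (\<theta> - eps) = - sin \<delta>"
   "cos (\<theta> - (eps + pi/2)) = - sin \<delta>" "sin (\<theta> - (eps + pi/2)) = - cos \<delta>"
   unfolding e cos_minus sin_minus by (simp_all add: cos_add sin_add)
  show "cos (\<theta> - pi/2) = sin \<theta>" "sin (\<theta> - pi/2) = - cos \<theta>" by (simp_all add: cos_diff sin_diff)
 qed
 show "0 < Re (s 0)" if "0 < Re w"
  unfolding re using t(2)[OF that] c h a ab N by (intro divide_pos_pos add_pos_nonneg mult_pos_pos mult_nonneg_nonneg) auto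
 have "b * (sinh t * cos \<theta>) \<le> b * (cosh t * cos \<theta>)" using h c ab by (intro mult_left_mono mult_right_mono) auto
 also have "\<dots> \<le> a * (sinh t * sin \<theta>)" by (rule key)
 also have "\<dots> \<le> a * (cosh t * sin \<theta>)" using h c ab by (intro mult_left_mono mult_right_mono) auto
 finally have k2: "b * (sinh t * cos \<theta>) \<le> a * (cosh t * sin \<theta>)" .
 then show "0 \<le> Im (s 0)" unfolding im using N by (simp add: mult_ac)
 show "0 < Re (s eps)" if "0 < Re w"
 proof -
  have "0 < a * (sinh t * cos eps)" using a t(2)[OF that] c by simp
  also have "\<dots> = cos \<theta> * (sinh t * cos \<delta> * a) - sin \<delta> * (a * (sinh t * sin \<theta>))" unfolding ce by (simp add: algebra_simps)
  also have "\<dots> \<le> cos \<theta> * (sinh t * cos \<delta> * a) - sin \<delta> * (b * (cosh t * cos \<theta>))"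
   using key c by (intro diff_left_mono mult_left_mono) auto
  also have "\<dots> = cos \<theta> * (sinh t * cos \<delta> * a + cosh t * (- sin \<delta>) * b)" by (simp add: algebra_simps)
  finally show ?thesis unfolding re angles using N c by (simp add: zero_less_mult_iff)
 qed
 have "0 \<le> cosh t * sin \<delta> * a + sinh t * cos \<delta> * b" using h c ab by simp
 then show "Im (s eps) \<le> 0" unfolding im angles using N by (simp add: divide_le_0_iff)
 show "0 \<le> Re (s (pi/2))" unfolding re angles using key N by (simp add: algebra_simps)
 have "0 < cosh t * cos \<theta> * a + sinh t * sin \<theta> * b" using h c ab a by (intro add_pos_nonneg) auto
 then show "Im (s (pi/2)) < 0" unfolding im angles using N by (simp add: divide_less_0_iff)
 have "0 \<le> sinh t * sin \<delta> * a + cosh t * cos \<delta> * b" using h c ab by simp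
 then show "Re (s (eps + pi/2)) \<le> 0" unfolding re angles using N by (simp add: divide_le_0_iff)
 have "0 < a * (cosh t * cos eps)" using a h c by simp
 also have "\<dots> = cos \<theta> * (cosh t * cos \<delta> * a) - sin \<delta> * (a * (cosh t * sin \<theta>))" unfolding ce by (simp add: algebra_simps)
 also have "\<dots> \<le> cos \<theta> * (cosh t * cos \<delta> * a) - sin \<delta> * (b * (sinh t * cos \<theta>))"
  using k2 c by (intro diff_left_mono mult_left_mono) auto
 also have "\<dots> = cos \<theta> * (cosh t * cos \<delta> * a - sinh t * sin \<delta> * b)" by (simp add: algebra_simps)
 finally have "0 < cosh t * cos \<delta> * a - sinh t * sin \<delta> * b" using c by (simp add: zero_less_mult_iff)
 then show "Im (s (eps + pi/2)) < 0" unfolding im angles using N by (simp add: divide_less_0_iff)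
 show "0 < Re (1 / DX w)" unfolding Re_divide using a N by (simp add: a_def b_def N_def)
qed

lemma cont_hline: "continuous_on \<Omega> (g :: complex \<Rightarrow> real) \<Longrightarrow> 0 \<le> x1 \<Longrightarrow> x2 \<le> l \<Longrightarrow> continuous_on {x1..x2} (\<lambda>x. g (Complex x y))"
 unfolding Complex_eq by (rule continuous_on_compose2[where t=\<Omega>]) (auto intro!: continuous_intros simp: \<Omega>_def)

lemma cont_vline: "continuous_on \<Omega> (g :: complex \<Rightarrow> real) \<Longrightarrow> 0 \<le> x \<Longrightarrow> x \<le> l \<Longrightarrow> continuous_on A (\<lambda>y. g (Complex x y))"
 unfolding Complex_eq by (rule continuous_on_compose2[where t=\<Omega>]) (auto intro!: continuous_intros simp: \<Omega>_def)

lemma mono_x: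
 assumes x: "0 \<le> x1" "x1 < x2" "x2 \<le> l" and y: "0 \<le> y" "y \<le> eps"
 shows "cmp 0 (Complex x1 y) < cmp 0 (Complex x2 y)" "cmp eps (Complex x1 y) < cmp eps (Complex x2 y)"
  "ht (Complex x1 y) < ht (Complex x2 y)" "cmp (pi/2) (Complex x1 y) \<le> cmp (pi/2) (Complex x2 y)"
  "cmp (eps + pi/2) (Complex x2 y) \<le> cmp (eps + pi/2) (Complex x1 y)"
proof -
 have r: "Complex x y \<in> Rect" "Complex x y \<notin> corners" "0 < x" "x < l" if "x1 < x" "x < x2" for x
  using that x y not_corner(1)[of "Complex x y"] by (auto simp: rect_iff)
 note sg = sign_facts[OF r(1,2)]
 show "cmp 0 (Complex x1 y) < cmp 0 (Complex x2 y)"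
  by (rule DERIV_pos_imp_increasing_open[OF x(2) _ cont_hline[OF cmp_cont x(1,3)]])
    (use cmp_dx[OF r(3,4)] sg(1) r(3) in fastforce)
 show "cmp eps (Complex x1 y) < cmp eps (Complex x2 y)"
  by (rule DERIV_pos_imp_increasing_open[OF x(2) _ cont_hline[OF cmp_cont x(1,3)]])
    (use cmp_dx[OF r(3,4)] sg(3) r(3) in fastforce)
 show "ht (Complex x1 y) < ht (Complex x2 y)"
  by (rule DERIV_pos_imp_increasing_open[OF x(2) _ cont_hline[OF f_cont(2) x(1,3)]])
    (use ht_dx[OF r(3,4)] sg(9) in fastforce)
 show "cmp (pi/2) (Complex x1 y) \<le> cmp (pi/2) (Complex x2 y)"
  by (rule DERIV_nonneg_imp_increasing_open[OF less_imp_le[OF x(2)] _ cont_hline[OF cmp_cont x(1,3)]])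
    (use cmp_dx[OF r(3,4)] sg(5) in fastforce)
 have "- cmp (eps + pi/2) (Complex x1 y) \<le> - cmp (eps + pi/2) (Complex x2 y)"
  by (rule DERIV_nonneg_imp_increasing_open[OF less_imp_le[OF x(2)] _ continuous_on_minus[OF cont_hline[OF cmp_cont x(1,3)]]])
    (use DERIV_minus[OF cmp_dx[OF r(3,4)]] sg(7) in "metis neg_0_le_iff_le")
 then show "cmp (eps + pi/2) (Complex x2 y) \<le> cmp (eps + pi/2) (Complex x1 y)" by simp
qed

lemma mono_y:
 assumes y: "0 \<le> y1" "y1 < y2" "y2 \<le> eps" and x: "0 \<le> x" "x \<le> l"
 shows "cmp 0 (Complex x y2) \<le> cmp 0 (Complex x y1)" "cmp eps (Complex x y1) \<le> cmp eps (Complex x y2)"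
  "cmp (pi/2) (Complex x y1) < cmp (pi/2) (Complex x y2)"
  "cmp (eps + pi/2) (Complex x y1) < cmp (eps + pi/2) (Complex x y2)"
proof -
 have r: "Complex x y \<in> Rect" "Complex x y \<notin> corners" "Complex x y \<in> \<Omega>" if "y1 < y" "y < y2" for y
  using that x y not_corner(2)[of "Complex x y"] by (auto simp: rect_iff \<Omega>_def)
 note sg = sign_facts[OF r(1,2)]
 have "- cmp 0 (Complex x y1) \<le> - cmp 0 (Complex x y2)"
  by (rule DERIV_nonneg_imp_increasing_open[OF less_imp_le[OF y(2)] _ continuous_on_minus[OF cont_vline[OF cmp_cont x]]])
    (use DERIV_minus[OF cmp_dy[OF r(3,2)]] sg(2) in "metis minus_minus")
 then show "cmp 0 (Complex x y2) \<le> cmp 0 (Complex x y1)" by simp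
 show "cmp eps (Complex x y1) \<le> cmp eps (Complex x y2)"
  by (rule DERIV_nonneg_imp_increasing_open[OF less_imp_le[OF y(2)] _ cont_vline[OF cmp_cont x]])
    (use cmp_dy[OF r(3,2)] sg(4) in "metis neg_0_le_iff_le")
 show "cmp (pi/2) (Complex x y1) < cmp (pi/2) (Complex x y2)"
  by (rule DERIV_pos_imp_increasing_open[OF y(2) _ cont_vline[OF cmp_cont x]])
    (use cmp_dy[OF r(3,2)] sg(6) in "metis neg_0_less_iff_less")
 show "cmp (eps + pi/2) (Complex x y1) < cmp (eps + pi/2) (Complex x y2)"
  by (rule DERIV_pos_imp_increasing_open[OF y(2) _ cont_vline[OF cmp_cont x]])
    (use cmp_dy[OF r(3,2)] sg(8) in "metis neg_0_less_iff_less")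
qed

text \<open>Go from the left to the right point along a horizontal and then a vertical segment. If the second one goes up, the coordinate in the direction
 \<open>pi/2\<close> grows; if it goes down, the one in the direction \<open>eps + pi/2\<close> falls.\<close>
lemma f_inj_rect:
 assumes w: "w \<in> Rect" "w' \<in> Rect" and e: "f w = f w'"
 shows "w = w'"
proof -
 have wl: "f v = f v' \<Longrightarrow> v = v'" if v: "v \<in> Rect" "v' \<in> Rect" "Re v \<le> Re v'" for v v'
 proof -
  assume ef: "f v = f v'"
  have c: "cmp \<phi> v = cmp \<phi> v'" for \<phi> using ef by (simp add: cmp_def)
  define x x' y y' where xy: "x = Re v" "x' = Re v'" "y = Im v" "y' = Im v'"
  have V: "v = Complex x y" "v' = Complex x' y'" by (simp_all add: xy complex_eq_iff)
  have b: "0 \<le> x" "x \<le> x'" "x' \<le> l" "0 \<le> y" "y \<le> eps" "0 \<le> y'" "y' \<le> eps" using v by (auto simp: rect_iff xy)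
  have mx: "cmp 0 (Complex x z) \<le> cmp 0 (Complex x' z) \<and> cmp eps (Complex x z) \<le> cmp eps (Complex x' z)
    \<and> cmp (pi/2) (Complex x z) \<le> cmp (pi/2) (Complex x' z) \<and> cmp (eps + pi/2) (Complex x' z) \<le> cmp (eps + pi/2) (Complex x z)"
   if "0 \<le> z" "z \<le> eps" for z
   using mono_x[of x x' z] b that by (cases "x = x'") auto
  have "y = y'"
  proof (rule ccontr)
   assume "y \<noteq> y'"
   then consider "y < y'" | "y' < y" by linarith
   then show False
   proof cases
    case 1
    then have "cmp (pi/2) (Complex x' y) < cmp (pi/2) (Complex x' y')" using mono_y(3)[of y y' x'] b by auto
    then show False using mx[of y] c[of "pi/2"] b unfolding V by auto
   next
    case 2
    then have "cmp (eps + pi/2) (Complex x' y') < cmp (eps + pi/2) (Complex x' y)" using mono_y(4)[of y' y x'] b by auto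
    then show False using mx[of y] c[of "eps + pi/2"] b unfolding V by auto
   qed
  qed
  moreover have "x = x'"
  proof (rule ccontr)
   assume "x \<noteq> x'"
   then have "cmp 0 (Complex x y) < cmp 0 (Complex x' y)" using mono_x(1)[of x x' y] b by auto
   then show False using c[of 0] \<open>y = y'\<close> unfolding V by simp
  qed
  ultimately show "v = v'" using V by simp
 qed
 show ?thesis using wl[of w w'] wl[of w' w] w e by fastforce
qed

lemma cmp_special: "cmp 0 w = Re (f w)" "cmp (pi/2) w = Im (f w)" "cmp (eps + pi/2) w = Im (cis (- eps) * f w)"
proof -
 show "cmp 0 w = Re (f w)" by (simp add: cmp_def)
 show "cmp (pi/2) w = Im (f w)" by (simp add: cmp_def)
 have "cis (- (pi/2)) = - \<i>" by (simp add: complex_eq_iff)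
 then have "cis (- (eps + pi/2)) = - \<i> * cis (- eps)" using cis_mult[of "- eps" "- (pi/2)"] by (simp add: mult.commute)
 then show "cmp (eps + pi/2) w = Im (cis (- eps) * f w)" unfolding cmp_def by (simp add: mult.assoc)
qed

lemma f_real_axis: "w \<in> \<Omega> \<Longrightarrow> Im w = 0 \<Longrightarrow> Im (f w) = 0"
 using f_sym(3)[of w] by (metis complex_cnj_cancel_iff complex_eq_iff complex_cnj cnj.sel complex_is_Real_iff Reals_cnj_iff)

lemma f_eps_axis: assumes "w \<in> \<Omega>" "Im w = eps" shows "Im (cis (- eps) * f w) = 0"
proof -
 have "w = cnj w + per" using assms by (simp add: complex_eq_iff)
 then have "f w = rot * cnj (f w)" using f_sym(1)[of "cnj w"] f_sym(3)[of w] \<Omega>_sym(1)[of w] assms by simp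
 then have "cis (- eps) * f w = cis (- eps) * (rot * cnj (f w))" by simp
 also have "\<dots> = cnj (cis (- eps) * f w)" by (simp add: rot_def cis_cnj cis_mult flip: mult.assoc)
 finally show ?thesis by (simp add: complex_eq_iff)
qed

text \<open>By monotonicity the rectangle is mapped into the sector between the two symmetry lines.\<close>
lemma f_sector:
 assumes w: "w \<in> Rect"
 shows "0 < Re (f w)" "0 \<le> Im (f w)" "Im (f w) = 0 \<longleftrightarrow> Im w = 0"
  "Im (cis (- eps) * f w) \<le> 0" "Im (cis (- eps) * f w) = 0 \<longleftrightarrow> Im w = eps"
proof -
 define x y where xy: "x = Re w" "y = Im w"
 have W: "w = Complex x y" by (simp add: xy complex_eq_iff)
 have b: "0 \<le> x" "x \<le> l" "0 \<le> y" "y \<le> eps" using w by (auto simp: rect_iff xy)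
 have O: "Complex x y \<in> \<Omega>" if "0 \<le> x" "x \<le> l" for x y using that by (simp add: \<Omega>_def)
 have im: "0 < Im (f (Complex x y))" if "0 < y" "y \<le> eps" "0 \<le> x" "x \<le> l" for x y
  using mono_y(3)[of 0 y x] that f_real_axis[OF O[of x 0]] eps unfolding cmp_special by simp
 have ime: "Im (cis (- eps) * f (Complex x y)) < 0" if "0 \<le> y" "y < eps" "0 \<le> x" "x \<le> l" for x y
  using mono_y(4)[of y eps x] that f_eps_axis[OF O[of x eps]] unfolding cmp_special by simp
 show "0 \<le> Im (f w)" "Im (f w) = 0 \<longleftrightarrow> Im w = 0"
  using im[of y x] b f_real_axis[OF O[of x 0]] unfolding W by (cases "y = 0"; force)+
 show "Im (cis (- eps) * f w) \<le> 0" "Im (cis (- eps) * f w) = 0 \<longleftrightarrow> Im w = eps"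
  using ime[of y x] b f_eps_axis[OF O[of x eps]] unfolding W by (cases "y = eps"; force)+
 have "0 < Re (f (Complex 0 eps))"
 proof -
  define z where "z = cis (- eps) * f (Complex 0 eps)"
  have z: "Im z = 0" using f_eps_axis[of "Complex 0 eps"] l by (simp add: z_def \<Omega>_def)
  have fz: "f (Complex 0 eps) = cis eps * z" by (simp add: z_def cis_mult flip: mult.assoc)
  have "0 < Im (f (Complex 0 eps))" using im[of eps 0] eps l by simp
  then have "0 < sin eps * Re z" unfolding fz using z by simp
  moreover have "0 < sin eps" using eps by (intro sin_gt_zero) auto
  ultimately have "0 < Re z" by (simp add: zero_less_mult_iff)
  moreover have "0 < cos eps" using eps by (intro cos_gt_zero_pi) auto
  ultimately show ?thesis unfolding fz using z by simp
 qed
 also have "Re (f (Complex 0 eps)) \<le> Re (f (Complex 0 y))"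
  using mono_y(1)[of y eps 0] b l unfolding cmp_special by (cases "y = eps") auto
 also have "\<dots> \<le> Re (f (Complex x y))"
  using mono_x(1)[of 0 x y] b unfolding cmp_special by (cases "x = 0") auto
 finally show "0 < Re (f w)" unfolding W .
qed

definition "al w = Arg (f w)"

lemma al_rect:
 assumes w: "w \<in> Rect"
 shows "0 \<le> al w" "al w \<le> eps" "al w = eps \<longleftrightarrow> Im w = eps" "al w = 0 \<longleftrightarrow> Im w = 0" "f w \<noteq> 0"
proof -
 note s = f_sector[OF w]
 show f0: "f w \<noteq> 0" using s(1) by auto
 have fp: "f w = of_real (norm (f w)) * cis (al w)" unfolding al_def by (metis rcis_cmod_Arg rcis_def)
 have nf: "0 < norm (f w)" using f0 by simp
 have r: "Re (f w) = norm (f w) * cos (al w)" "Im (f w) = norm (f w) * sin (al w)"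
  by (subst fp, simp)+
 have "cis (- eps) * f w = of_real (norm (f w)) * cis (al w - eps)"
  by (subst fp) (simp add: cis_mult mult.left_commute)
 then have r3: "Im (cis (- eps) * f w) = norm (f w) * sin (al w - eps)" by simp
 have c: "0 < cos (al w)" "0 \<le> sin (al w)" using s(1,2) nf unfolding r by (auto simp: zero_less_mult_iff zero_le_mult_iff)
 have ab: "- pi < al w" "al w \<le> pi" unfolding al_def using Arg_bounded by auto
 have l2: "\<bar>al w\<bar> < pi/2"
  unfolding al_def using s(1) f0 Re_Ln_pos_lt[of "f w"] by (simp add: Arg_eq_Im_Ln)
 show a0: "0 \<le> al w"
 proof (rule ccontr)
  assume "\<not> 0 \<le> al w"
  then have "0 < sin (- al w)" using l2 by (intro sin_gt_zero) auto
  then show False using c by simp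
 qed
 have s0: "sin (al w - eps) \<le> 0" using s(4) nf unfolding r3 by (simp add: mult_le_0_iff)
 show a1: "al w \<le> eps"
 proof (rule ccontr)
  assume "\<not> al w \<le> eps"
  then have "0 < sin (al w - eps)" using l2 eps by (intro sin_gt_zero) auto
  then show False using s0 by simp
 qed
 show "al w = eps \<longleftrightarrow> Im w = eps"
 proof -
  have "Im w = eps \<longleftrightarrow> sin (al w - eps) = 0" unfolding s(5)[symmetric] r3 using nf by simp
  also have "\<dots> \<longleftrightarrow> al w = eps"
  proof
   assume "sin (al w - eps) = 0"
   then have "sin (eps - al w) = 0" using sin_minus[of "eps - al w"] by simp
   then show "al w = eps" using a0 a1 eps sin_gt_zero[of "eps - al w"] by (cases "al w = eps") auto
  qed simp
  finally show ?thesis by simp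
 qed
 show "al w = 0 \<longleftrightarrow> Im w = 0"
 proof -
  have "Im w = 0 \<longleftrightarrow> sin (al w) = 0" unfolding s(3)[symmetric] r using nf by simp
  also have "\<dots> \<longleftrightarrow> al w = 0" using a0 l2 sin_gt_zero[of "al w"] by (cases "al w = 0") auto
  finally show ?thesis by simp
 qed
qed

lemma al_cnj: "w \<in> Rect \<Longrightarrow> al (cnj w) = - al w"
proof -
 assume w: "w \<in> Rect"
 have "w \<in> \<Omega>" using w rect_sub by blast
 then have "al (cnj w) = Arg (cnj (f w))" by (simp add: al_def f_sym)
 moreover have "f w \<notin> \<real>\<^sub>\<le>\<^sub>0" using f_sector(1)[OF w] by (auto simp: complex_nonpos_Reals_iff)
 then have "Ln (cnj (f w)) = cnj (Ln (f w))" by (rule cnj_Ln[symmetric])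
 ultimately show ?thesis using al_rect(5)[OF w] by (simp add: al_def Arg_eq_Im_Ln)
qed

lemma rect_or_cnj: assumes "w \<in> \<Omega>" "\<bar>Im w\<bar> \<le> eps"
 shows "w \<in> Rect \<or> cnj w \<in> Rect"
 using assms by (auto simp: rect_iff \<Omega>_def abs_if split: if_splits)

lemma al_strip:
 assumes w: "w \<in> \<Omega>" "- eps < Im w" "Im w \<le> eps"
 shows "- eps < al w" "al w \<le> eps" "0 \<le> al w \<longleftrightarrow> 0 \<le> Im w" "al w = eps \<longleftrightarrow> Im w = eps" "f w \<noteq> 0"
  "f w = of_real (norm (f w)) * cis (al w)"
proof -
 show fp: "f w = of_real (norm (f w)) * cis (al w)" unfolding al_def by (metis rcis_cmod_Arg rcis_def)
 have "- eps < al w \<and> al w \<le> eps \<and> (0 \<le> al w \<longleftrightarrow> 0 \<le> Im w) \<and> (al w = eps \<longleftrightarrow> Im w = eps) \<and> f w \<noteq> 0"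
 proof (cases "0 \<le> Im w")
  case True
  then have r: "w \<in> Rect" using w by (simp add: rect_iff \<Omega>_def)
  show ?thesis using al_rect[OF r] True eps by auto
 next
  case False
  then have r: "cnj w \<in> Rect" using w by (simp add: rect_iff \<Omega>_def)
  have "al w = - al (cnj w)" using al_cnj[OF r] by simp
  moreover have "f w \<noteq> 0" using al_rect(5)[OF r] f_sym(3)[OF w(1)] by simp
  ultimately show ?thesis using al_rect[OF r] False eps w by auto
 qed
 then show "- eps < al w" "al w \<le> eps" "0 \<le> al w \<longleftrightarrow> 0 \<le> Im w" "al w = eps \<longleftrightarrow> Im w = eps" "f w \<noteq> 0" by auto
qed

lemma f_shift_int: "w \<in> \<Omega> \<Longrightarrow> f (w + turn k) = cis (of_int (2 * k) * eps) * f w \<and> ht (w + turn k) = ht w"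
proof (induction k rule: int_induct[where k=0])
 case (step1 i)
 have e: "w + turn (i + 1) = (w + turn i) + per"
  by (simp add: algebra_simps)
 have c: "cis (of_int (2 * (i + 1)) * eps) = rot * cis (of_int (2 * i) * eps)" by (simp add: rot_def cis_mult algebra_simps)
 have "w + turn i \<in> \<Omega>" using step1 by (simp add: \<Omega>_def)
 then show ?case unfolding e c using step1 f_sym by simp
next
 case (step2 i)
 have e: "w + turn i = (w + turn (i - 1)) + per"
  by (simp add: algebra_simps)
 have c: "cis (of_int (2 * i) * eps) = rot * cis (of_int (2 * (i - 1)) * eps)" by (simp add: rot_def cis_mult algebra_simps)
 have O: "w + turn (i - 1) \<in> \<Omega>" using step2 by (simp add: \<Omega>_def)
 have "rot * f (w + turn (i - 1)) = rot * (cis (of_int (2 * (i - 1)) * eps) * f w)"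
 proof -
  have "rot * f (w + turn (i - 1)) = f (w + turn i)"
   unfolding e by (rule f_sym(1)[OF O, symmetric])
  also have "\<dots> = cis (of_int (2 * i) * eps) * f w" using step2 by blast
  finally show ?thesis unfolding c mult.assoc .
 qed
 then have "f (w + turn (i - 1)) = cis (of_int (2 * (i - 1)) * eps) * f w"
  using rot(4) by (simp only: mult_cancel_left) blast
 moreover have "ht (w + turn (i - 1)) = ht w"
  using step2 f_sym(2)[OF O] unfolding e[symmetric] by simp
 ultimately show ?case by blast
qed simp

lemma reduce_strip:
 assumes "w \<in> \<Omega>"
 obtains v and k :: int where "v \<in> \<Omega>" "- eps < Im v" "Im v \<le> eps" "w = v + turn k"
proof -
 obtain k :: int where k: "- eps < Im w - of_int (2 * k) * eps" "Im w - of_int (2 * k) * eps \<le> eps" by (rule reduce_Im)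
 show thesis by (rule that[of "w - turn k" k]) (use k assms in "auto simp: \<Omega>_def")
qed

text \<open>The images of the translates of the strip \<open>\<bar>Im w\<bar> \<le> eps\<close> lie in the \<open>n\<close> sectors of angle \<open>2 * eps\<close>, which
 overlap only on their boundary rays; inside one sector the argument reduces to \<open>f_inj_rect\<close>.\<close>
lemma f_inj_mod:
 assumes w: "w1 \<in> \<Omega>" "w2 \<in> \<Omega>" and e: "f w1 = f w2"
 shows "\<exists>m::int. w1 = w2 + full_turn m"
proof -
 obtain v1 k1 where v1: "v1 \<in> \<Omega>" "- eps < Im v1" "Im v1 \<le> eps" "w1 = v1 + turn k1"
  by (rule reduce_strip[OF w(1)])
 obtain v2 k2 where v2: "v2 \<in> \<Omega>" "- eps < Im v2" "Im v2 \<le> eps" "w2 = v2 + turn k2"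
  by (rule reduce_strip[OF w(2)])
 note a1 = al_strip[OF v1(1-3)] and a2 = al_strip[OF v2(1-3)]
 have E: "cis (of_int (2 * k1) * eps) * f v1 = cis (of_int (2 * k2) * eps) * f v2"
  using f_shift_int[OF v1(1), of k1] f_shift_int[OF v2(1), of k2] e v1(4) v2(4) by simp
 have nn: "norm (f v1) = norm (f v2)"
 proof -
  have "norm (cis (of_int (2 * k1) * eps) * f v1) = norm (cis (of_int (2 * k2) * eps) * f v2)" using E by simp
  then show ?thesis by (simp add: norm_mult)
 qed
 have "of_real (norm (f v1)) * cis (of_int (2 * k1) * eps + al v1) = cis (of_int (2 * k1) * eps) * f v1"
  by (subst (2) a1(6)) (simp add: cis_mult mult.left_commute)
 also have "\<dots> = of_real (norm (f v2)) * cis (of_int (2 * k2) * eps + al v2)"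
  unfolding E by (subst a2(6)) (simp add: cis_mult mult.left_commute)
 finally have "cis (of_int (2 * k1) * eps + al v1) = cis (of_int (2 * k2) * eps + al v2)" using nn a1(5) a2(5) by simp
 then have "cos (of_int (2 * k1) * eps + al v1) = cos (of_int (2 * k2) * eps + al v2) \<and>
  sin (of_int (2 * k1) * eps + al v1) = sin (of_int (2 * k2) * eps + al v2)" by (simp add: complex_eq_iff)
 then obtain m :: int where m: "of_int (2 * k1) * eps + al v1 = of_int (2 * k2) * eps + al v2 + 2 * pi * of_int m"
  using sin_cos_eq_iff[of "of_int (2 * k1) * eps + al v1"] by blast
 have pe: "pi = real n * eps" using eps(4) by simp
 define j where "j = k2 - k1 + int n * m"
 have aj: "al v1 - al v2 = 2 * eps * of_int j" using m unfolding j_def by (simp add: pe algebra_simps)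
 have "j = 0"
 proof -
  have "\<bar>al v1 - al v2\<bar> < 2 * eps" using a1 a2 by auto
  then have "\<bar>real_of_int j\<bar> < 1" unfolding aj using eps by (simp add: abs_mult)
  then show ?thesis by linarith
 qed
 then have al: "al v1 = al v2" "k1 - k2 = int n * m" using aj by (auto simp: j_def)
 have fv: "f v1 = f v2" by (subst a1(6), subst a2(6)) (simp add: nn al)
 have "v1 = v2"
 proof (cases "0 \<le> Im v1")
  case True
  then have "0 \<le> Im v2" using a1(3) a2(3) al by simp
  then show ?thesis using f_inj_rect[of v1 v2] fv True v1 v2 by (simp add: rect_iff \<Omega>_def)
 next
  case False
  then have "Im v2 < 0" using a1(3) a2(3) al by simp
  then have "cnj v1 = cnj v2" using f_inj_rect[of "cnj v1" "cnj v2"] fv False v1 v2 f_sym(3)[of v1] f_sym(3)[of v2] by (simp add: rect_iff \<Omega>_def)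
  then show ?thesis by simp
 qed
 then have "w1 = w2 + turn (k1 - k2)" using v1(4) v2(4) by (simp add: algebra_simps)
 also have "turn (k1 - k2) = full_turn m"
  unfolding al pe by (simp add: algebra_simps)
 finally show ?thesis by blast
qed

lemma ht_pos: assumes w: "w \<in> \<Omega>" shows "0 \<le> ht w" "ht w = 0 \<longleftrightarrow> Re w = 0"
proof -
 have r: "0 < ht v" if v: "v \<in> Rect" "0 < Re v" for v
  using mono_x(3)[of 0 "Re v" "Im v"] v ht_base[of "Complex 0 (Im v)"] by (simp add: rect_iff)
 have "0 < ht w" if "0 < Re w"
 proof -
  obtain v k where v: "v \<in> \<Omega>" "- eps < Im v" "Im v \<le> eps" "w = v + turn k"
   by (rule reduce_strip[OF w])
  have "ht w = ht v" "Re v = Re w" using f_shift_int[OF v(1), of k] v(4) by auto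
  moreover have "0 < ht v"
  proof -
   have rv: "0 < Re v" using that \<open>Re v = Re w\<close> by simp
   have "v \<in> Rect \<or> cnj v \<in> Rect" by (rule rect_or_cnj) (use v in auto)
   then show ?thesis
   proof
    assume "cnj v \<in> Rect"
    then have "0 < ht (cnj v)" by (rule r) (use rv in simp)
    then show ?thesis unfolding f_sym(4)[OF v(1)] .
   qed (rule r[OF _ rv])
  qed
  ultimately show ?thesis by simp
 qed
 then show "0 \<le> ht w" "ht w = 0 \<longleftrightarrow> Re w = 0" using ht_base[of w] w by (auto simp: \<Omega>_def less_eq_real_def)
qed

text \<open>The height at which the plane of the face \<open>k = 0\<close> meets the axis.\<close>
definition "dd = T * Re (f (of_real l)) + ht (of_real l)"

text \<open>By \<open>DX_face\<close> the derivative of the surface along the side is orthogonal to the normal of the face.\<close>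
lemma face_const:
 assumes y: "0 \<le> y" "y \<le> eps" shows "T * Re (f (Complex l y)) + ht (Complex l y) = dd"
proof (cases "y = 0")
 case True
 then show ?thesis by (simp add: dd_def complex_of_real_def)
next
 case False
 define g where "g y = T * cmp 0 (Complex l y) + ht (Complex l y)" for y
 have "g y = g 0"
 proof (rule DERIV_isconst2[of 0 y g])
  show "0 < y" using False y by simp
  show "continuous_on {0..y} g" unfolding g_def[abs_def]
   by (intro continuous_intros cont_vline[OF cmp_cont] cont_vline[OF f_cont(2)]) (use l in auto)
  fix z assume z: "0 < z" "z < y"
  define w where "w = Complex l z"
  have wr: "w \<in> Rect" "w \<notin> corners" "w \<in> \<Omega>"
   using z y l not_corner(2)[of w] by (auto simp: w_def rect_iff \<Omega>_def)
  obtain c where c: "0 < c" "DX w = of_real c * cosh (\<Psi> w)" by (rule DX_face[of w]) (use z y in "auto simp: w_def")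
  have fe: "sinh (Re (\<Psi> w)) = T * cos (Im (\<Psi> w))" using face_eq[of w] z y by (simp add: w_def)
  have d: "(g has_real_derivative T * (- Im (sinh (\<Psi> w - \<i> * of_real 0) / DX w)) + (- Im (1 / DX w))) (at z)"
   unfolding g_def[abs_def] w_def by (intro DERIV_add DERIV_cmult cmp_dy ht_dy) (use wr in "auto simp: w_def")
  define t where "t = Re (\<Psi> w)" define \<theta> where "\<theta> = Im (\<Psi> w)"
  define N where "N = (Re (DX w))^2 + (Im (DX w))^2"
  have "T * (cosh t * sin \<theta> * (cosh t * cos \<theta>) - sinh t * cos \<theta> * (sinh t * sin \<theta>)) - sinh t * sin \<theta>
   = T * (sin \<theta> * cos \<theta> * ((cosh t)^2 - (sinh t)^2)) - sinh t * sin \<theta>" by (simp add: power2_eq_square algebra_simps)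
  also have "\<dots> = 0" unfolding hyperbolic_pythagoras using fe by (simp add: t_def \<theta>_def)
  finally have z0: "T * (cosh t * sin \<theta> * (cosh t * cos \<theta>) - sinh t * cos \<theta> * (sinh t * sin \<theta>)) - sinh t * sin \<theta> = 0" .
  have "T * (- Im (sinh (\<Psi> w - \<i> * of_real 0) / DX w)) + (- Im (1 / DX w))
   = - c * (T * (cosh t * sin \<theta> * (cosh t * cos \<theta>) - sinh t * cos \<theta> * (sinh t * sin \<theta>)) - sinh t * sin \<theta>) / N"
   unfolding Im_divide N_def[symmetric] by (simp add: c Re_Im_sinh_cosh t_def[symmetric] \<theta>_def[symmetric] diff_divide_distrib add_divide_distrib algebra_simps)
  then show "(g has_real_derivative 0) (at z)" using d z0 by simp
 qed (use y False in auto)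
 then show ?thesis by (simp add: g_def cmp_special dd_def complex_of_real_def)
qed

lemma face_ineq_rect:
 assumes w: "w \<in> Rect"
 shows "T * Re (f w) + ht w \<le> dd" "T * Re (f w) + ht w = dd \<longleftrightarrow> Re w = l"
proof -
 have W: "w = Complex (Re w) (Im w)" by simp
 have b: "0 \<le> Re w" "Re w \<le> l" "0 \<le> Im w" "Im w \<le> eps" using w by (auto simp: rect_iff)
 have "T * Re (f w) + ht w < dd" if "Re w < l"
 proof -
  have "Re (f w) < Re (f (Complex l (Im w)))" "ht w < ht (Complex l (Im w))"
   using mono_x(1,3)[of "Re w" l "Im w"] b that unfolding cmp_special by auto
  then have "T * Re (f w) + ht w < T * Re (f (Complex l (Im w))) + ht (Complex l (Im w))" using T by (intro add_strict_mono) auto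
  then show ?thesis using face_const[of "Im w"] b by simp
 qed
 moreover have "T * Re (f w) + ht w = dd" if "Re w = l" using face_const[of "Im w"] b that W by metis
 ultimately show "T * Re (f w) + ht w \<le> dd" "T * Re (f w) + ht w = dd \<longleftrightarrow> Re w = l" using b by force+
qed

lemma dd_pos: "0 < dd"
proof -
 have r: "complex_of_real l \<in> Rect" using l eps by (simp add: rect_iff)
 have "0 < Re (f (of_real l))" "0 \<le> ht (of_real l)" using f_sector(1)[OF r] ht_pos(1)[of "of_real l"] l by (auto simp: \<Omega>_def)
 then show ?thesis using T by (simp add: dd_def add_pos_nonneg)
qed

text \<open>On the sector of the face itself this is monotonicity in \<open>x\<close>. In the other sectors the first coordinate is smaller than that of
 the rotated point in the sector of the face.\<close>
lemma face_ineq: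
 assumes w: "w \<in> \<Omega>"
 shows "T * Re (f w) + ht w \<le> dd"
  "T * Re (f w) + ht w = dd \<longleftrightarrow> Re w = l \<and> (\<exists>m::int. \<bar>Im w - 2 * pi * of_int m\<bar> \<le> eps)"
proof -
 have strip: "T * Re (f v) + ht v \<le> dd \<and> (T * Re (f v) + ht v = dd \<longleftrightarrow> Re v = l)" if "v \<in> \<Omega>" "\<bar>Im v\<bar> \<le> eps" for v
  using rect_or_cnj[OF that]
 proof
  assume "v \<in> Rect"
  then show ?thesis using face_ineq_rect[of v] by blast
 next
  assume "cnj v \<in> Rect"
  then show ?thesis using face_ineq_rect[of "cnj v"] unfolding f_sym(3,4)[OF that(1)] by simp
 qed
 obtain v k where v: "v \<in> \<Omega>" "- eps < Im v" "Im v \<le> eps" "w = v + turn k"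
  by (rule reduce_strip[OF w])
 note a = al_strip[OF v(1-3)]
 have ht: "ht w = ht v" and Rw: "Re w = Re v" using f_shift_int[OF v(1), of k] v(4) by auto
 define j where "j = k mod int n"
 define q where "q = k div int n"
 have kj: "k = j + int n * q" by (simp add: j_def q_def)
 have jb: "0 \<le> j" "j < int n" using n3 by (auto simp: j_def)
 have pe: "pi = real n * eps" using eps(4) by simp
 have ang: "of_int (2 * k) * eps + al v = (2 * of_int j * eps + al v) + 2 * pi * of_int q"
  unfolding kj by (simp add: pe algebra_simps)
 have "f w = of_real (norm (f v)) * cis (of_int (2 * k) * eps + al v)"
 proof -
  have "f w = cis (of_int (2 * k) * eps) * f v" using f_shift_int[OF v(1), of k] v(4) by simp
  also have "\<dots> = cis (of_int (2 * k) * eps) * (of_real (norm (f v)) * cis (al v))" by (rule arg_cong[OF a(6)])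
  finally show ?thesis by (simp add: cis_mult mult.left_commute)
 qed
 then have "Re (f w) = norm (f v) * cos ((2 * of_int j * eps + al v) + 2 * pi * of_int q)" unfolding ang by simp
 also have "cos ((2 * of_int j * eps + al v) + 2 * pi * of_int q) = cos (2 * of_int j * eps + al v)"
  using sin_cos_eq_iff[of "(2 * of_int j * eps + al v) + 2 * pi * of_int q" "2 * of_int j * eps + al v"] by auto
 finally have Rf: "Re (f w) = norm (f v) * cos (2 * of_int j * eps + al v)" .
 have Rv: "Re (f v) = norm (f v) * cos (al v)" by (subst a(6)) simp
 have nf: "0 < norm (f v)" using a(5) by simp
 have Imw: "Im w = Im v + 2 * of_int j * eps + 2 * pi * of_int q" using v(4) unfolding kj by (simp add: pe algebra_simps)
 have "T * Re (f w) + ht w \<le> dd \<and> (T * Re (f w) + ht w = dd \<longleftrightarrow> Re w = l \<and> (\<exists>m::int. \<bar>Im w - 2 * pi * of_int m\<bar> \<le> eps))"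
 proof (cases "j = 0")
  case True
  then have "Re (f w) = Re (f v)" using Rf Rv by simp
  moreover have "\<exists>m::int. \<bar>Im w - 2 * pi * of_int m\<bar> \<le> eps" by (rule exI[of _ q]) (use Imw True v in auto)
  ultimately show ?thesis using strip[of v] v ht Rw by auto
 next
  case False
  then have j1: "1 \<le> j" "j \<le> int n - 1" using jb by auto
  define J where "J = of_int j * eps"
  have J: "eps \<le> J" "J \<le> pi - eps"
  proof -
   have "1 * eps \<le> of_int j * eps" using j1 eps by (intro mult_right_mono) auto
   then show "eps \<le> J" by (simp add: J_def)
   have "of_int j \<le> real n - 1" using j1 by linarith
   then have "of_int j * eps \<le> (real n - 1) * eps" using eps by (intro mult_right_mono) auto
   then show "J \<le> pi - eps" by (simp add: J_def pe algebra_simps)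
  qed
  have sJ: "0 < sin J" using J eps by (intro sin_gt_zero) auto
  have "cos (al v) - cos (2 * J + al v) = 2 * sin (J + al v) * sin J"
  proof -
   have "cos (al v) = cos ((J + al v) - J)" "cos (2 * J + al v) = cos ((J + al v) + J)" by (simp_all add: algebra_simps)
   then show ?thesis by (simp only: cos_diff cos_add)
  qed
  moreover have sg: "0 \<le> sin (J + al v)" using J a by (intro sin_ge_zero) auto
  ultimately have cle: "cos (2 * J + al v) \<le> cos (al v)" using sJ by (smt (verit) mult_nonneg_nonneg)
  have RJ: "Re (f w) = norm (f v) * cos (2 * J + al v)" using Rf by (simp add: J_def mult.assoc)
  have le: "Re (f w) \<le> Re (f v)" unfolding RJ Rv using cle nf by simp
  have sv: "T * Re (f v) + ht v \<le> dd" "T * Re (f v) + ht v = dd \<longleftrightarrow> Re v = l" using strip[of v] v by auto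
  have ub: "T * Re (f w) + ht w \<le> T * Re (f v) + ht v" using le T ht by simp
  show ?thesis
  proof (intro conjI iffI)
   show "T * Re (f w) + ht w \<le> dd" using ub sv by simp
  next
   assume eq: "T * Re (f w) + ht w = dd"
   then have "T * Re (f v) + ht v = dd" using ub sv by simp
   then show "Re w = l" using sv Rw by simp
   have "T * Re (f w) = T * Re (f v)" using eq \<open>T * Re (f v) + ht v = dd\<close> ht by linarith
   then have "cos (2 * J + al v) = cos (al v)" using T nf unfolding RJ Rv by simp
   then have "sin (J + al v) = 0" using \<open>cos (al v) - cos (2 * J + al v) = 2 * sin (J + al v) * sin J\<close> sJ by simp
   then have "\<not> (0 < J + al v \<and> J + al v < pi)" using sin_gt_zero[of "J + al v"] by auto
   then have "J = pi - eps" "al v = eps" using J a by auto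
   then have "Im v = eps" "2 * of_int j * eps = 2 * pi - 2 * eps" using a(4) by (auto simp: J_def)
   then have "Im w = - eps + 2 * pi * of_int (q + 1)" using Imw by (simp add: algebra_simps)
   then show "\<exists>m::int. \<bar>Im w - 2 * pi * of_int m\<bar> \<le> eps" using eps by (intro exI[of _ "q + 1"]) auto
  next
   assume as: "Re w = l \<and> (\<exists>m::int. \<bar>Im w - 2 * pi * of_int m\<bar> \<le> eps)"
   then obtain m :: int where m: "\<bar>Im w - 2 * pi * of_int m\<bar> \<le> eps" by blast
   define u where "u = w + turn (- int n * m)"
   have u: "u \<in> \<Omega>" "\<bar>Im u\<bar> \<le> eps" "Re u = l" using w m as by (auto simp: u_def \<Omega>_def pe algebra_simps)
   have c1: "cis (of_int (2 * (- int n * m)) * eps) = 1"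
   proof -
    have "of_int (2 * (- int n * m)) * eps = 2 * pi * of_int (- m)" by (simp add: pe algebra_simps)
    then show ?thesis using cis_multiple_2pi[of "of_int (- m)"] by (metis Ints_of_int)
   qed
   have "f u = f w" "ht u = ht w" using f_shift_int[OF w, of "- int n * m"] c1 unfolding u_def by simp_all
   then show "T * Re (f w) + ht w = dd" using strip[OF u(1,2)] u(3) by simp
  qed
 qed
 then show "T * Re (f w) + ht w \<le> dd"
  "T * Re (f w) + ht w = dd \<longleftrightarrow> Re w = l \<and> (\<exists>m::int. \<bar>Im w - 2 * pi * of_int m\<bar> \<le> eps)" by auto
qed

end

section \<open>Convexity of the boundary curves\<close>

context gauss_map begin

lemma f_period: "w \<in> \<Omega> \<Longrightarrow> f (w + full_turn m) = f w \<and> ht (w + full_turn m) = ht w"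
proof -
 assume w: "w \<in> \<Omega>"
 have pe: "pi = real n * eps" using eps(4) by simp
 have c1: "cis (of_int (2 * (int n * m)) * eps) = 1"
 proof -
  have "of_int (2 * (int n * m)) * eps = 2 * pi * of_int m" by (simp add: pe algebra_simps)
  then show ?thesis using cis_multiple_2pi[of "of_int m"] by (metis Ints_of_int)
 qed
 have "full_turn m = turn (int n * m)" by (simp add: pe algebra_simps)
 then show ?thesis using f_shift_int[OF w, of "int n * m"] c1 by (simp only: mult_1_left)
qed

lemma strict_mono_vline:
 fixes g :: "real \<Rightarrow> real"
 assumes "a < b" "continuous_on {a..b} g" "\<And>y. a < y \<Longrightarrow> y < b \<Longrightarrow> \<exists>d. (g has_real_derivative d) (at y) \<and> 0 < d"
 shows "g a < g b"
 by (rule DERIV_pos_imp_increasing_open[OF assms(1) _ assms(2)]) (use assms(3) in blast)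

lemma base_D: assumes "w = Complex 0 y"
 shows "w \<in> \<Omega>" "w \<notin> corners" "DX w = of_real (Re (DX w))" "0 < Re (DX w)" "\<Psi> w = \<i> * of_real (Im (\<Psi> w))"
proof -
 have w: "\<bar>Re w\<bar> < l" "Re w = 0" using assms l by auto
 show "w \<in> \<Omega>" "w \<notin> corners" using w l not_corner(1)[of w] by (auto simp: \<Omega>_def)
 have e: "\<Psi> w = \<psi> w" "DX w = D w" using \<Psi>_eq[of w] w l by auto
 show "DX w = of_real (Re (DX w))" "0 < Re (DX w)" unfolding e using D_real[OF w(1)] D_pos[OF w(1)] w(2) by (auto simp: complex_eq_iff)
 show "\<Psi> w = \<i> * of_real (Im (\<Psi> w))" unfolding e using \<psi>_Re_zero_iff[OF w(1)] w(2) by (auto simp: complex_eq_iff)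
qed

lemma base_theta_mono: assumes "y1 < y2" shows "Im (\<Psi> (Complex 0 y1)) < Im (\<Psi> (Complex 0 y2))"
proof (rule strict_mono_vline[OF assms])
 show "continuous_on {y1..y2} (\<lambda>y. Im (\<Psi> (Complex 0 y)))"
  by (rule cont_vline) (use l in "auto intro!: continuous_intros \<Psi>_cont")
 show "\<exists>d. ((\<lambda>y. Im (\<Psi> (Complex 0 y))) has_real_derivative d) (at y) \<and> 0 < d" for y
  using theta_dy[of 0 y] base_D[OF refl, of y] by blast
qed

lemma base_theta_period: "Im (\<Psi> (Complex 0 (y - 2 * pi))) = Im (\<Psi> (Complex 0 y)) - 2 * pi"
proof -
 define w where "w = Complex 0 (y - 2 * pi)"
 have w: "\<bar>Re w\<bar> < l" "Re w = 0" using l by (auto simp: w_def)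
 have pe: "pi = real n * eps" using eps(4) by simp
 have e: "of_int (2 * int n) * (\<i> * complex_of_real eps) = 2 * of_real pi * \<i>" by (simp add: pe)
 have s: "\<psi> (w + 2 * of_real pi * \<i>) = \<psi> w + 2 * of_real pi * \<i>" using shift_int[OF w(1), of "int n"] unfolding e by blast
 have "w + 2 * of_real pi * \<i> = Complex 0 y" by (simp add: w_def complex_eq_iff)
 then have "\<psi> (Complex 0 y) = \<psi> w + 2 * of_real pi * \<i>" using s by simp
 then have "\<Psi> (Complex 0 y) = \<Psi> w + 2 * of_real pi * \<i>" using \<Psi>_eq(1)[of w] \<Psi>_eq(1)[of "Complex 0 y"] w l by simp
 then show ?thesis by (simp add: w_def)
qed

text \<open>On the base curve the derivative of \<open>cmp \<phi>\<close> is \<open>sin (\<phi> - \<theta>)\<close> times a positive factor, and \<open>\<theta>\<close> increases with period \<open>2 * pi\<close>.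
 So within half a period on either side \<open>cmp \<phi>\<close> has its maximum at \<open>y0\<close>.\<close>
lemma base_support:
 fixes y0 y :: real
 defines "\<phi> \<equiv> Im (\<Psi> (Complex 0 y0))"
 assumes ne: "f (Complex 0 y) \<noteq> f (Complex 0 y0)"
 shows "cmp \<phi> (Complex 0 y) < cmp \<phi> (Complex 0 y0)"
proof -
 define th where "th y = Im (\<Psi> (Complex 0 y))" for y
 define g where "g y = cmp \<phi> (Complex 0 y)" for y
 have gd: "(g has_real_derivative - sin (th y - \<phi>) / Re (DX (Complex 0 y))) (at y)" for y
 proof -
  define w where "w = Complex 0 y"
  note b = base_D[OF w_def]
  have "\<Psi> w - \<i> * of_real \<phi> = \<i> * of_real (th y - \<phi>)" by (subst b(5)) (simp add: th_def w_def algebra_simps)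
  then have "sinh (\<Psi> w - \<i> * of_real \<phi>) = sinh (\<i> * of_real (th y - \<phi>))" by simp
  also have "\<dots> = \<i> * of_real (sin (th y - \<phi>))" by (simp add: complex_eq_iff Re_Im_sinh_cosh)
  finally have s: "sinh (\<Psi> w - \<i> * of_real \<phi>) = \<i> * of_real (sin (th y - \<phi>))" .
  have "Im (sinh (\<Psi> w - \<i> * of_real \<phi>) / DX w) = Im (\<i> * of_real (sin (th y - \<phi>)) / of_real (Re (DX w)))"
   unfolding s by (subst b(3)) simp
  also have "\<dots> = sin (th y - \<phi>) / Re (DX w)" unfolding Im_divide_of_real by simp
  finally show ?thesis using cmp_dy[of 0 y \<phi>] b unfolding g_def[abs_def] w_def by simp
 qed
 have gc: "continuous_on A g" for A using gd by (intro continuous_at_imp_continuous_on ballI DERIV_isCont) blast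
 have mono: "th a < th b" if "a < b" for a b unfolding th_def by (rule base_theta_mono[OF that])
 have per: "th (y - 2 * pi) = th y - 2 * pi" for y unfolding th_def by (rule base_theta_period)
 have phi: "\<phi> = th y0" by (simp add: \<phi>_def th_def)
 have gp: "g (y + 2 * pi * of_int m) = g y \<and> f (Complex 0 (y + 2 * pi * of_int m)) = f (Complex 0 y)" for y and m :: int
 proof -
  have "Complex 0 (y + 2 * pi * of_int m) = Complex 0 y + full_turn m" by (simp add: complex_eq_iff)
  then have "f (Complex 0 (y + 2 * pi * of_int m)) = f (Complex 0 y)"
   using f_period[of "Complex 0 y" m] base_D(1)[OF refl] by simp
  then show ?thesis by (simp add: g_def cmp_def)
 qed
 define m where "m = \<lfloor>(y0 - y) / (2 * pi)\<rfloor>"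
 define z where "z = y + 2 * pi * of_int m"
 have m: "of_int m \<le> (y0 - y) / (2 * pi)" "(y0 - y) / (2 * pi) < of_int m + 1" unfolding m_def by linarith+
 have z: "y0 - 2 * pi < z" "z \<le> y0" using m by (auto simp: z_def field_simps)
 have zne: "z \<noteq> y0" using ne gp[of y m] by (auto simp: z_def)
 then have z2: "z < y0" using z by simp
 have rb: "0 < Re (DX (Complex 0 y))" for y using base_D[OF refl] by blast
 have "g z < g y0"
 proof (cases "\<phi> - pi \<le> th z")
  case True
  show ?thesis
  proof (rule strict_mono_vline[OF z2 gc])
   fix u assume u: "z < u" "u < y0"
   have "0 < sin (\<phi> - th u)" using mono[OF u(1)] mono[OF u(2)] True phi by (intro sin_gt_zero) auto
   then have "0 < - sin (th u - \<phi>)" using sin_minus[of "th u - \<phi>"] by simp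
   then show "\<exists>d. (g has_real_derivative d) (at u) \<and> 0 < d" using gd[of u] rb[of u] by (meson divide_pos_pos)
  qed
 next
  case False
  have "- g (y0 - 2 * pi) < - g z"
  proof (rule strict_mono_vline[OF z(1) continuous_on_minus[OF gc]])
   fix u assume u: "y0 - 2 * pi < u" "u < z"
   have "0 < sin (th u - \<phi> + 2 * pi)" using mono[OF u(1)] mono[OF u(2)] per[of y0] False phi by (intro sin_gt_zero) auto
   then have "0 < sin (th u - \<phi>)" by simp
   then have "0 < - (- sin (th u - \<phi>) / Re (DX (Complex 0 u)))" using rb[of u] by simp
   then show "\<exists>d. ((\<lambda>x. - g x) has_real_derivative d) (at u) \<and> 0 < d" using DERIV_minus[OF gd[of u]] by blast
  qed
  moreover have "g (y0 - 2 * pi) = g y0" using gp[of y0 "-1"] by simp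
  ultimately show ?thesis by simp
 qed
 then show ?thesis using gp[of y m] by (simp add: z_def g_def)
qed

lemma face_eq': assumes "Re w = l" "\<bar>Im w\<bar> \<le> eps" shows "sinh (Re (\<Psi> w)) = T * cos (Im (\<Psi> w))" "\<bar>Im (\<Psi> w)\<bar> \<le> eps"
proof -
 have wO: "w \<in> \<Omega>" using assms l by (simp add: \<Omega>_def)
 have "sinh (Re (\<Psi> w)) = T * cos (Im (\<Psi> w)) \<and> \<bar>Im (\<Psi> w)\<bar> \<le> eps"
 proof (cases "0 \<le> Im w")
  case True
  then show ?thesis using face_eq[of w] \<Psi>_rect[of w] assms l by (simp add: rect_iff)
 next
  case False
  then show ?thesis using face_eq[of "cnj w"] \<Psi>_rect[of "cnj w"] assms l \<Psi>_sym(1)[OF wO] by (simp add: rect_iff)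
 qed
 then show "sinh (Re (\<Psi> w)) = T * cos (Im (\<Psi> w))" "\<bar>Im (\<Psi> w)\<bar> \<le> eps" by auto
qed

lemma face_point:
 assumes "\<bar>y\<bar> < eps"
 shows "Complex l y \<in> \<Omega>" "Complex l y \<notin> corners" "0 < cos (Im (\<Psi> (Complex l y)))" "0 < Re (DX (Complex l y))"
proof -
 define w where "w = Complex l y"
 show "Complex l y \<in> \<Omega>" "Complex l y \<notin> corners" using assms l not_corner(2)[of "Complex l y"] by (auto simp: \<Omega>_def)
 have b: "\<bar>Im (\<Psi> w)\<bar> \<le> eps" using face_eq'(2)[of w] assms by (simp add: w_def)
 then have c: "0 < cos (Im (\<Psi> w))" using eps by (intro cos_gt_zero_pi) auto
 then show "0 < cos (Im (\<Psi> (Complex l y)))" by (simp add: w_def)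
 obtain c where "0 < c" "DX w = of_real c * cosh (\<Psi> w)" by (rule DX_face[of w]) (use assms in "auto simp: w_def")
 then show "0 < Re (DX (Complex l y))" using c by (simp add: Re_Im_sinh_cosh w_def)
qed

lemma face_theta_mono: assumes "- eps \<le> y1" "y1 < y2" "y2 \<le> eps" shows "Im (\<Psi> (Complex l y1)) < Im (\<Psi> (Complex l y2))"
proof (rule strict_mono_vline[OF assms(2)])
 show "continuous_on {y1..y2} (\<lambda>y. Im (\<Psi> (Complex l y)))"
  by (rule cont_vline) (use l in "auto intro!: continuous_intros \<Psi>_cont")
 fix y assume "y1 < y" "y < y2"
 then have "\<bar>y\<bar> < eps" using assms by auto
 then show "\<exists>d. ((\<lambda>y. Im (\<Psi> (Complex l y))) has_real_derivative d) (at y) \<and> 0 < d"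
  using theta_dy[of l y] face_point by blast
qed

text \<open>As \<open>sinh t = T * cos \<phi>\<close> at \<open>y0\<close>, the functional is the inner product with a multiple of the normal of the surface there, which is
 parallel to the face and orthogonal to the curve. With \<open>sinh t = T * cos \<theta>\<close> its derivative along the curve
 simplifies to a positive multiple of \<open>sin (\<phi> - \<theta>)\<close>.\<close>
lemma face_support:
 fixes y0 y :: real
 defines "\<phi> \<equiv> Im (\<Psi> (Complex l y0))"
 assumes y0: "\<bar>y0\<bar> \<le> eps" and y: "\<bar>y\<bar> \<le> eps" and ne: "y \<noteq> y0"
 shows "cmp \<phi> (Complex l y) - T * cos \<phi> * ht (Complex l y) < cmp \<phi> (Complex l y0) - T * cos \<phi> * ht (Complex l y0)"
proof -
 define th where "th y = Im (\<Psi> (Complex l y))" for y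
 define g where "g y = cmp \<phi> (Complex l y) - T * cos \<phi> * ht (Complex l y)" for y
 have phi: "\<phi> = th y0" by (simp add: \<phi>_def th_def)
 have thb: "\<bar>th y\<bar> \<le> eps" if "\<bar>y\<bar> \<le> eps" for y using face_eq'(2)[of "Complex l y"] that by (simp add: th_def)
 have gd: "\<exists>K>0. (g has_real_derivative K * sin (\<phi> - th y)) (at y)" if yb: "\<bar>y\<bar> < eps" for y
 proof -
  define w where "w = Complex l y"
  note fp = face_point[OF yb, folded w_def]
  have fe: "sinh (Re (\<Psi> w)) = T * cos (Im (\<Psi> w))" using face_eq'(1)[of w] yb by (simp add: w_def)
  obtain c where c: "0 < c" "DX w = of_real c * cosh (\<Psi> w)" by (rule DX_face[of w]) (use yb in "auto simp: w_def")
  define t where "t = Re (\<Psi> w)" define \<theta> where "\<theta> = Im (\<Psi> w)"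
  define N where "N = (Re (DX w))^2 + (Im (DX w))^2"
  have N: "0 < N" using fp(4) by (simp add: N_def add_pos_nonneg)
  have s: "sinh t = T * cos \<theta>" using fe by (simp add: t_def \<theta>_def)
  have ch: "cosh t * cosh t = 1 + T * cos \<theta> * (T * cos \<theta>)" using cosh_square_eq[of t] s by (simp add: power2_eq_square)
  have d: "(g has_real_derivative - Im (sinh (\<Psi> w - \<i> * of_real \<phi>) / DX w) - T * cos \<phi> * (- Im (1 / DX w))) (at y)"
   unfolding g_def[abs_def] w_def by (intro DERIV_diff DERIV_cmult cmp_dy ht_dy) (use fp in "auto simp: w_def")
  have "cos \<theta> * (cos \<theta> * sin (\<theta> - \<phi>) - sin \<theta> * cos (\<theta> - \<phi>)) + cos \<phi> * sin \<theta> = sin (\<theta> - \<phi>)"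
  proof -
   have "cos \<theta> * sin (\<theta> - \<phi>) - sin \<theta> * cos (\<theta> - \<phi>) = sin ((\<theta> - \<phi>) - \<theta>)" unfolding sin_diff[of "\<theta> - \<phi>" \<theta>] by (simp add: mult.commute)
   also have "\<dots> = - sin \<phi>" by simp
   finally show ?thesis by (simp add: sin_diff)
  qed
  then have br: "cos \<theta> * cos \<theta> * sin (\<theta> - \<phi>) - cos \<theta> * sin \<theta> * cos (\<theta> - \<phi>) = sin (\<theta> - \<phi>) - cos \<phi> * sin \<theta>" by (simp add: algebra_simps)
  have "cosh t * sin (\<theta> - \<phi>) * (cosh t * cos \<theta>) - sinh t * cos (\<theta> - \<phi>) * (sinh t * sin \<theta>) + T * cos \<phi> * (sinh t * sin \<theta>)
   = (cosh t * cosh t) * sin (\<theta> - \<phi>) * cos \<theta> - sinh t * sinh t * cos (\<theta> - \<phi>) * sin \<theta> + T * cos \<phi> * (sinh t * sin \<theta>)"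
   by (simp add: algebra_simps)
  also have "\<dots> = sin (\<theta> - \<phi>) * cos \<theta> + T * T * cos \<theta> * ((cos \<theta> * cos \<theta> * sin (\<theta> - \<phi>) - cos \<theta> * sin \<theta> * cos (\<theta> - \<phi>)) + cos \<phi> * sin \<theta>)"
   unfolding ch s by (simp add: algebra_simps)
  also have "\<dots> = (1 + T * T) * cos \<theta> * sin (\<theta> - \<phi>)" unfolding br by (simp add: algebra_simps)
  finally have id: "cosh t * sin (\<theta> - \<phi>) * (cosh t * cos \<theta>) - sinh t * cos (\<theta> - \<phi>) * (sinh t * sin \<theta>) + T * cos \<phi> * (sinh t * sin \<theta>) = (1 + T * T) * cos \<theta> * sin (\<theta> - \<phi>)" .
  have "- Im (sinh (\<Psi> w - \<i> * of_real \<phi>) / DX w) - T * cos \<phi> * (- Im (1 / DX w))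
   = - (c * (cosh t * sin (\<theta> - \<phi>) * (cosh t * cos \<theta>) - sinh t * cos (\<theta> - \<phi>) * (sinh t * sin \<theta>) + T * cos \<phi> * (sinh t * sin \<theta>)) / N)"
   unfolding Im_divide N_def[symmetric]
   by (simp add: c Re_Im_sinh_cosh t_def[symmetric] \<theta>_def[symmetric] diff_divide_distrib add_divide_distrib algebra_simps)
  also have "\<dots> = (c * ((1 + T * T) * cos \<theta>) / N) * sin (\<phi> - \<theta>)"
   unfolding id using sin_minus[of "\<theta> - \<phi>"] by simp
  finally have "(g has_real_derivative (c * ((1 + T * T) * cos \<theta>) / N) * sin (\<phi> - th y)) (at y)" using d by (simp add: th_def w_def \<theta>_def)
  moreover have "0 < c * ((1 + T * T) * cos \<theta>) / N" using c N fp(3) T by (simp add: \<theta>_def add_pos_pos)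
  ultimately show ?thesis by blast
 qed
 have gc: "continuous_on A g" for A unfolding g_def[abs_def]
  by (intro continuous_intros cont_vline[OF cmp_cont] cont_vline[OF f_cont(2)]) (use l in auto)
 have mono: "th a < th b" if "- eps \<le> a" "a < b" "b \<le> eps" for a b unfolding th_def by (rule face_theta_mono[OF that])
 consider "y < y0" | "y0 < y" using ne by linarith
 then have "g y < g y0"
 proof cases
  case 1
  show ?thesis
  proof (rule strict_mono_vline[OF 1 gc])
   fix u assume u: "y < u" "u < y0"
   have ub: "\<bar>u\<bar> < eps" using u y y0 by auto
   have "th u < \<phi>" unfolding phi by (rule mono) (use u y y0 in auto)
   then have "0 < sin (\<phi> - th u)" using thb[of u] thb[of y0] ub y0 eps unfolding phi by (intro sin_gt_zero) auto
   then show "\<exists>d. (g has_real_derivative d) (at u) \<and> 0 < d" using gd[OF ub] by (meson mult_pos_pos)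
  qed
 next
  case 2
  have "- g y0 < - g y"
  proof (rule strict_mono_vline[OF 2 continuous_on_minus[OF gc]])
   fix u assume u: "y0 < u" "u < y"
   have ub: "\<bar>u\<bar> < eps" using u y y0 by auto
   have "\<phi> < th u" unfolding phi by (rule mono) (use u y y0 in auto)
   then have "0 < sin (th u - \<phi>)" using thb[of u] thb[of y0] ub y0 eps unfolding phi by (intro sin_gt_zero) auto
   then have sn: "0 < - sin (\<phi> - th u)" using sin_minus[of "th u - \<phi>"] by simp
   obtain K where K: "K > 0" "(g has_real_derivative K * sin (\<phi> - th u)) (at u)" using gd[OF ub] by blast
   have "0 < - (K * sin (\<phi> - th u))" using mult_pos_pos[OF K(1) sn] by simp
   then show "\<exists>d. ((\<lambda>x. - g x) has_real_derivative d) (at u) \<and> 0 < d" using DERIV_minus[OF K(2)] by blast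
  qed
  then show ?thesis by simp
 qed
 then show ?thesis by (simp add: g_def)
qed

end

section \<open>The pyramid in adapted coordinates\<close>

lemma mem_convex_3:
 assumes "convex S" "x \<in> S" "y \<in> S" "z \<in> S" "0 \<le> a" "0 \<le> b" "0 \<le> c" "a + b + c = 1"
 shows "a *\<^sub>R x + b *\<^sub>R y + c *\<^sub>R z \<in> S"
proof (cases "c = 1")
 case True
 then have "a = 0" "b = 0" using assms by linarith+
 then show ?thesis using True assms(4) by simp
next
 case False
 then have ab: "0 < a + b" "1 - c = a + b" using assms by linarith+
 have "(a / (a + b)) *\<^sub>R x + (b / (a + b)) *\<^sub>R y \<in> S"
  using assms(5,6) ab by (intro convexD[OF assms(1-3)]) (auto simp flip: add_divide_distrib)
 then have "(a + b) *\<^sub>R ((a / (a + b)) *\<^sub>R x + (b / (a + b)) *\<^sub>R y) + c *\<^sub>R z \<in> S"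
  by (rule convexD[OF assms(1) _ assms(4)]) (use assms ab in auto)
 then show ?thesis using ab(1) by (simp add: scaleR_right_distrib)
qed

lemma cos_odd_multiple_le:
 fixes i :: int
 assumes n: "0 < n" and e: "e = pi / real n" and i: "- int n < i" "i \<le> int n"
 shows "cos ((2 * of_int i - 1) * e) \<le> cos e"
proof -
 have ep: "0 < e" "real n * e = pi" using n by (auto simp: e)
 have "cos e - cos ((2 * of_int i - 1) * e) = 2 * (sin (of_int i * e) * sin ((of_int i - 1) * e))"
 proof -
  have "cos e = cos (of_int i * e - (of_int i - 1) * e)" by (simp add: algebra_simps)
  moreover have "cos ((2 * of_int i - 1) * e) = cos (of_int i * e + (of_int i - 1) * e)" by (simp add: algebra_simps)
  ultimately show ?thesis by (simp only: cos_diff cos_add)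
 qed
 moreover have "0 \<le> sin (of_int i * e) * sin ((of_int i - 1) * e)"
 proof -
  have r: "0 \<le> sin (of_int j * e)" if "0 \<le> j" "j \<le> int n" for j :: int
  proof (rule sin_ge_zero)
   have "of_int j * e \<le> real n * e" using that ep by (intro mult_right_mono) auto
   then show "of_int j * e \<le> pi" using ep by simp
  qed (use that ep in auto)
  have r2: "sin (of_int j * e) \<le> 0" if "j \<le> 0" "- int n \<le> j" for j :: int using r[of "- j"] that by simp
  consider "i = 0" | "1 \<le> i" | "i \<le> -1" by linarith
  then show ?thesis
  proof cases
   case 2
   then show ?thesis using r[of i] r[of "i - 1"] i by simp
  next
   case 3
   then have "sin (of_int i * e) \<le> 0" "sin (of_int (i - 1) * e) \<le> 0" using i by (intro r2; simp)+
   then have "0 \<le> sin (of_int i * e) * sin (of_int (i - 1) * e)" by (rule mult_nonpos_nonpos)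
   then show ?thesis by simp
  qed simp
 qed
 ultimately show ?thesis by linarith
qed

lemma cos_even_multiple_le:
 fixes i :: int
 assumes n: "2 \<le> n" and e: "e = pi / real n" and i: "\<bar>i\<bar> < int n" "i \<noteq> 0"
 shows "cos (2 * of_int i * e) \<le> cos (2 * e)"
proof -
 have ep: "0 < e" "real n * e = pi" using n by (auto simp: e)
 define j where "j = \<bar>i\<bar>"
 have j: "1 \<le> j" "j + 1 \<le> int n" using i by (auto simp: j_def)
 have "cos (2 * of_int i * e) = cos (2 * of_int j * e)" by (cases "0 \<le> i") (auto simp: j_def)
 moreover have "cos (2 * e) - cos (2 * of_int j * e) = 2 * (sin ((of_int j + 1) * e) * sin ((of_int j - 1) * e))"
 proof -
  have "cos (2 * e) = cos ((of_int j + 1) * e - (of_int j - 1) * e)" by (simp add: algebra_simps)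
  moreover have "cos (2 * of_int j * e) = cos ((of_int j + 1) * e + (of_int j - 1) * e)" by (simp add: algebra_simps)
  ultimately show ?thesis by (simp only: cos_diff cos_add)
 qed
 moreover have "0 \<le> sin ((of_int j + 1) * e) * sin ((of_int j - 1) * e)"
 proof -
  have "of_int (j + 1) \<le> real n" using j by linarith
  then have b1: "(of_int j + 1) * e \<le> real n * e" using ep by (intro mult_right_mono) auto
  have b2: "(of_int j - 1) * e \<le> (of_int j + 1) * e" using ep by (intro mult_right_mono) auto
  have "0 \<le> sin ((of_int j + 1) * e)" by (rule sin_ge_zero) (use j ep b1 in auto)
  moreover have "0 \<le> sin ((of_int j - 1) * e)"
  proof (rule sin_ge_zero)
   show "(of_int j - 1) * e \<le> pi" using b1 b2 ep(2) by linarith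
  qed (use j ep in auto)
  ultimately show ?thesis by simp
 qed
 ultimately show ?thesis by linarith
qed

text \<open>Rotating by a multiple of \<open>2 * e\<close> brings every vector into the sector of half angle \<open>e\<close> about the real axis.\<close>
lemma sector_exists:
 assumes n: "3 \<le> n" and e: "e = pi / real n"
 obtains k where "k < n" "\<bar>Im (v * cis (- (2 * real k * e)))\<bar> * cos e \<le> Re (v * cis (- (2 * real k * e))) * sin e"
   "norm v * cos e \<le> Re (v * cis (- (2 * real k * e)))"
proof -
 have ep: "0 < e" "real n * e = pi" "e < pi/2" using n by (auto simp: e field_simps)
 define \<phi> where "\<phi> = Arg v"
 define k' where "k' = \<lceil>(\<phi> - e) / (2 * e)\<rceil>"
 define \<delta> where "\<delta> = \<phi> - 2 * of_int k' * e"
 have "of_int k' - 1 < (\<phi> - e) / (2 * e)" "(\<phi> - e) / (2 * e) \<le> of_int k'" unfolding k'_def by linarith+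
 then have d: "- e \<le> \<delta>" "\<delta> \<le> e" using ep by (auto simp: \<delta>_def field_simps)
 define k where "k = nat (k' mod int n)"
 have kn: "k < n" using n by (simp add: k_def nat_less_iff)
 have kk: "k' = int k + int n * (k' div int n)" using n by (simp add: k_def)
 have "cis (- (2 * real k * e)) = cis (- (2 * of_int k' * e))"
 proof -
  have "- (2 * real k * e) = - (2 * of_int k' * e) + 2 * pi * of_int (k' div int n)"
   by (subst kk) (simp add: algebra_simps flip: ep(2))
  then have "cis (- (2 * real k * e)) = cis (- (2 * of_int k' * e)) * cis (2 * pi * of_int (k' div int n))" by (simp only: cis_mult)
  also have "cis (2 * pi * of_int (k' div int n)) = 1" by (rule cis_multiple_2pi) auto
  finally show ?thesis by simp
 qed
 moreover have "v = of_real (norm v) * cis \<phi>" unfolding \<phi>_def by (metis rcis_cmod_Arg rcis_def)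
 ultimately have "v * cis (- (2 * real k * e)) = of_real (norm v) * cis \<phi> * cis (- (2 * of_int k' * e))" by simp
 also have "\<dots> = of_real (norm v) * cis \<delta>" by (simp add: cis_mult \<delta>_def mult.assoc)
 finally have z: "v * cis (- (2 * real k * e)) = of_real (norm v) * cis \<delta>" .
 have "0 \<le> sin (e - \<delta>)" "0 \<le> sin (e + \<delta>)" using d ep by (intro sin_ge_zero; auto)+
 then have s: "\<bar>sin \<delta>\<bar> * cos e \<le> cos \<delta> * sin e" by (auto simp: sin_diff sin_add abs_if mult_ac)
 have "norm v * (\<bar>sin \<delta>\<bar> * cos e) \<le> norm v * (cos \<delta> * sin e)" using s by (intro mult_left_mono) auto
 then have 1: "\<bar>Im (v * cis (- (2 * real k * e)))\<bar> * cos e \<le> Re (v * cis (- (2 * real k * e))) * sin e"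
  unfolding z by (simp add: abs_mult mult_ac)
 have "cos e \<le> cos \<bar>\<delta>\<bar>" using d ep by (intro cos_monotone_0_pi_le) auto
 then have "cos e \<le> cos \<delta>" by (simp add: abs_if split: if_splits)
 then have 2: "norm v * cos e \<le> Re (v * cis (- (2 * real k * e)))" unfolding z by (simp add: mult_left_mono)
 show thesis by (rule that[OF kn 1 2])
qed

text \<open>A point of the right-hand side lies in some sector, where it is a convex combination of two adjacent vertices and the centre;
 the centre is the mean of the vertices.\<close>
lemma regular_polygon_halfplanes:
 assumes n: "3 \<le> n" and e: "e = pi / real n" and \<rho>: "0 < \<rho>"
 shows "convex hull ((\<lambda>k. of_real \<rho> * cis ((2 * real k - 1) * e)) ` {..<n})
   = {v. \<forall>k<n. Re (v * cis (- (2 * real k * e))) \<le> \<rho> * cos e}" (is "?L = ?R")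
proof
 have ep: "0 < e" "real n * e = pi" "e < pi/2" using n by (auto simp: e field_simps)
 have ce: "0 < cos e" "0 < sin e" using ep by (auto intro!: cos_gt_zero_pi sin_gt_zero)
 show "?L \<subseteq> ?R"
 proof (rule hull_minimal)
  show "convex ?R"
  proof (rule convexI)
   fix x y :: complex and s t :: real
   assume as: "x \<in> ?R" "y \<in> ?R" "0 \<le> s" "0 \<le> t" "s + t = 1"
   show "s *\<^sub>R x + t *\<^sub>R y \<in> ?R"
   proof (intro CollectI allI impI)
    fix k assume k: "k < n"
    have "Re ((s *\<^sub>R x + t *\<^sub>R y) * cis (- (2 * real k * e))) = s * Re (x * cis (- (2 * real k * e))) + t * Re (y * cis (- (2 * real k * e)))"
     by (simp add: algebra_simps)
    also have "\<dots> \<le> s * (\<rho> * cos e) + t * (\<rho> * cos e)" using as k by (intro add_mono mult_left_mono) auto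
    also have "\<dots> = \<rho> * cos e" using as(5) by (simp flip: distrib_right)
    finally show "Re ((s *\<^sub>R x + t *\<^sub>R y) * cis (- (2 * real k * e))) \<le> \<rho> * cos e" .
   qed
  qed
  show "(\<lambda>k. of_real \<rho> * cis ((2 * real k - 1) * e)) ` {..<n} \<subseteq> ?R"
  proof (intro image_subsetI CollectI allI impI)
   fix j k assume jk: "j \<in> {..<n}" "k < n"
   have "complex_of_real \<rho> * cis ((2 * real j - 1) * e) * cis (- (2 * real k * e)) = of_real \<rho> * cis ((2 * of_int (int j - int k) - 1) * e)"
    by (simp add: mult.assoc cis_mult algebra_simps)
   then have "Re (complex_of_real \<rho> * cis ((2 * real j - 1) * e) * cis (- (2 * real k * e))) = Re (of_real \<rho> * cis ((2 * of_int (int j - int k) - 1) * e))" by (rule arg_cong)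
   also have "\<dots> = \<rho> * cos ((2 * of_int (int j - int k) - 1) * e)" by simp
   also have "\<dots> \<le> \<rho> * cos e" by (intro mult_left_mono cos_odd_multiple_le[of n]) (use n e \<rho> jk in auto)
   finally show "Re (complex_of_real \<rho> * cis ((2 * real j - 1) * e) * cis (- (2 * real k * e))) \<le> \<rho> * cos e" .
  qed
 qed
 define V where "V = (\<lambda>k. of_real \<rho> * cis ((2 * real k - 1) * e)) ` {..<n}"
 have zero: "0 \<in> convex hull V"
 proof -
  have r1: "cis (2 * e) \<noteq> 1"
  proof -
   have "0 < sin (2 * e)" using ep by (intro sin_gt_zero) auto
   then show ?thesis by (auto simp: complex_eq_iff)
  qed
  have nm: "real n * (2 * e) = 2 * pi" using ep(2) by (simp add: mult.left_commute)
  have "cis (2 * e) ^ n = cis (2 * pi)" unfolding Complex.DeMoivre nm ..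
  then have rn: "cis (2 * e) ^ n = 1" by simp
  have "(\<Sum>k<n. cis (2 * e) ^ k) = 0" using geometric_sum[OF r1, of n] rn by simp
  then have "(\<Sum>k<n. of_real \<rho> * cis ((2 * real k - 1) * e)) = 0"
  proof -
   have "of_real \<rho> * cis ((2 * real k - 1) * e) = of_real \<rho> * cis (- e) * cis (2 * e) ^ k" for k
    by (simp add: Complex.DeMoivre mult.assoc cis_mult algebra_simps)
   then have "(\<Sum>k<n. of_real \<rho> * cis ((2 * real k - 1) * e)) = of_real \<rho> * cis (- e) * (\<Sum>k<n. cis (2 * e) ^ k)"
    by (simp only: sum_distrib_left)
   then show ?thesis using \<open>(\<Sum>k<n. cis (2 * e) ^ k) = 0\<close> by simp
  qed
  then have "0 = (\<Sum>k\<in>{..<n}. (1 / real n) *\<^sub>R (of_real \<rho> * cis ((2 * real k - 1) * e)))"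
   by (simp flip: scaleR_right.sum)
  also have "\<dots> \<in> convex hull V"
   by (rule convex_sum) (use n in "auto simp: V_def intro: hull_inc")
  finally show ?thesis .
 qed
 show "?R \<subseteq> ?L"
 proof
  fix v assume v: "v \<in> ?R"
  obtain k where k: "k < n" "\<bar>Im (v * cis (- (2 * real k * e)))\<bar> * cos e \<le> Re (v * cis (- (2 * real k * e))) * sin e"
   by (rule sector_exists[OF n e, of v]) blast
  define z where "z = v * cis (- (2 * real k * e))"
  have vz: "v = z * cis (2 * real k * e)" by (simp add: z_def mult.assoc cis_mult)
  have z: "\<bar>Im z\<bar> * cos e \<le> Re z * sin e" "Re z \<le> \<rho> * cos e" using k v by (auto simp: z_def)
  define p where "p = Re z / (\<rho> * cos e)" define q where "q = Im z / (\<rho> * sin e)"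
  have "\<bar>q\<bar> \<le> p"
  proof -
   have "\<bar>q\<bar> = \<bar>Im z\<bar> * cos e / (\<rho> * sin e * cos e)" using ce \<rho> by (simp add: q_def abs_divide abs_mult)
   also have "\<dots> \<le> Re z * sin e / (\<rho> * sin e * cos e)" using z(1) ce \<rho> by (intro divide_right_mono) auto
   also have "\<dots> = p" using ce by (simp add: p_def)
   finally show ?thesis .
  qed
  then have "q \<le> p" "- q \<le> p" unfolding abs_le_iff by blast+
  then have lam: "0 \<le> (p - q)/2" "0 \<le> (p + q)/2" by simp_all
  have p1: "p \<le> 1" using z(2) ce \<rho> by (simp add: p_def)
  have v1: "of_real \<rho> * cis ((2 * real k - 1) * e) \<in> convex hull V" using k by (intro hull_inc) (auto simp: V_def)
  have v2: "of_real \<rho> * cis ((2 * real k + 1) * e) \<in> convex hull V"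
  proof (cases "k + 1 < n")
   case True
   have "of_real \<rho> * cis ((2 * real (k + 1) - 1) * e) \<in> V" unfolding V_def by (rule imageI) (use True in auto)
   then show ?thesis by (intro hull_inc) (simp add: algebra_simps)
  next
   case False
   then have kn: "real k + 1 = real n" using k by simp
   have "(2 * real k + 1) * e = (2 * real 0 - 1) * e + 2 * pi"
   proof -
    have "2 * pi = 2 * ((real k + 1) * e)" using ep(2) kn by simp
    then show ?thesis by (simp add: algebra_simps)
   qed
   then have "cis ((2 * real k + 1) * e) = cis ((2 * real 0 - 1) * e)" by (simp add: complex_eq_iff)
   moreover have "of_real \<rho> * cis ((2 * real 0 - 1) * e) \<in> V" unfolding V_def by (rule imageI) (use n in auto)
   ultimately show ?thesis by (metis hull_inc)
  qed
  have "z = ((p - q)/2) *\<^sub>R (of_real \<rho> * cis (- e)) + ((p + q)/2) *\<^sub>R (of_real \<rho> * cis e)"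
   using ce \<rho> by (simp add: complex_eq_iff p_def q_def field_simps)
  then have "v = ((p - q)/2) *\<^sub>R (of_real \<rho> * cis (- e)) * cis (2 * real k * e) + ((p + q)/2) *\<^sub>R (of_real \<rho> * cis e) * cis (2 * real k * e)"
   using vz by (simp add: distrib_right)
  also have "\<dots> = ((p - q)/2) *\<^sub>R (of_real \<rho> * cis ((2 * real k - 1) * e)) + ((p + q)/2) *\<^sub>R (of_real \<rho> * cis ((2 * real k + 1) * e))"
   by (simp add: mult.assoc cis_mult algebra_simps)
  finally have vc: "v = ((p - q)/2) *\<^sub>R (of_real \<rho> * cis ((2 * real k - 1) * e)) + ((p + q)/2) *\<^sub>R (of_real \<rho> * cis ((2 * real k + 1) * e)) + (1 - p) *\<^sub>R 0" by simp
  have "v \<in> convex hull V"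
   unfolding vc by (rule mem_convex_3[OF convex_convex_hull v1 v2 zero lam]) (use p1 in "auto simp: field_simps")
  then show "v \<in> ?L" by (simp add: V_def)
 qed
qed

text \<open>Positively oriented orthonormal coordinates with origin \<open>c\<close>; horizontal vectors are written as complex numbers.\<close>
locale ortho_frame =
 fixes c a b u :: "real^3"
 assumes on: "norm a = 1" "norm b = 1" "norm u = 1" "orthogonal a b" "orthogonal a u" "orthogonal b u"
  and cr: "cross3 a b = u"
begin

definition "E v z = c + Re v *\<^sub>R a + Im v *\<^sub>R b + z *\<^sub>R u"

lemma dots: "a \<bullet> a = 1" "b \<bullet> b = 1" "u \<bullet> u = 1" "a \<bullet> b = 0" "a \<bullet> u = 0" "b \<bullet> u = 0" "b \<bullet> a = 0" "u \<bullet> a = 0" "u \<bullet> b = 0"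
 using on by (auto simp: orthogonal_def norm_eq_1 inner_commute)

lemma expand: "x = (x \<bullet> a) *\<^sub>R a + (x \<bullet> b) *\<^sub>R b + (x \<bullet> u) *\<^sub>R u"
proof -
 have ne: "a \<noteq> b" "a \<noteq> u" "b \<noteq> u" "a \<noteq> 0" "b \<noteq> 0" "u \<noteq> 0" using dots by auto
 have "independent {a, b, u}"
  by (rule pairwise_orthogonal_independent) (use on ne in "auto simp: pairwise_def orthogonal_commute")
 then have "dim {a, b, u} = 3" using ne by (simp add: dim_eq_card_independent)
 then have "span {a, b, u} = UNIV" using dim_eq_full[of "{a, b, u}"] by simp
 moreover define y where "y = x - ((x \<bullet> a) *\<^sub>R a + (x \<bullet> b) *\<^sub>R b + (x \<bullet> u) *\<^sub>R u)"
 ultimately have "y \<in> span {a, b, u}" by simp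
 moreover have "orthogonal y z" if "z \<in> {a, b, u}" for z
  using that dots by (auto simp: y_def orthogonal_def inner_diff_left inner_add_left)
 ultimately have "orthogonal y y" by (metis orthogonal_to_span)
 then show ?thesis by (simp add: y_def orthogonal_def)
qed

lemma E_coords: "(E v z - c) \<bullet> a = Re v" "(E v z - c) \<bullet> b = Im v" "(E v z - c) \<bullet> u = z"
 by (simp_all add: E_def inner_add_left dots)

lemma E_inj: "E v z = E v' z' \<longleftrightarrow> v = v' \<and> z = z'"
proof
 assume "E v z = E v' z'"
 then show "v = v' \<and> z = z'" using E_coords[of v z] E_coords[of v' z'] by (simp add: complex_eq_iff)
qed simp

lemma E_surj: "x = E (Complex ((x - c) \<bullet> a) ((x - c) \<bullet> b)) ((x - c) \<bullet> u)"
 using expand[of "x - c"] by (simp add: E_def algebra_simps)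

lemma E_linear: "(1 - t) *\<^sub>R E v z + t *\<^sub>R E v' z' = E ((1 - t) *\<^sub>R v + t *\<^sub>R v') ((1 - t) * z + t * z')"
 by (simp add: E_def algebra_simps)

lemma E_hull: "(\<lambda>v. E v 0) ` (convex hull X) = convex hull ((\<lambda>v. E v 0) ` X)"
proof -
 have lin: "linear (\<lambda>v::complex. Re v *\<^sub>R a + Im v *\<^sub>R b)" by (rule linearI) (simp_all add: algebra_simps)
 have "(\<lambda>v. E v 0) ` Y = (\<lambda>x. c + x) ` ((\<lambda>v. Re v *\<^sub>R a + Im v *\<^sub>R b) ` Y)" for Y
  by (auto simp: E_def image_image add.assoc)
 then show ?thesis by (simp add: convex_hull_linear_image[OF lin] convex_hull_translation)
qed

lemma continuous_on_E: "continuous_on A g \<Longrightarrow> continuous_on A h \<Longrightarrow> continuous_on A (\<lambda>x. E (g x) (h x))"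
 unfolding E_def by (intro continuous_intros)

end

text \<open>The pyramid of height \<open>H\<close> whose lateral faces have slope \<open>T\<close>. The direction of \<open>a\<close> points to the midpoint of a side of the base, so that
 face \<open>k\<close> is symmetric about the angle \<open>2 * k * e\<close>.\<close>
locale pyramid_frame = ortho_frame +
 fixes n :: nat and H T :: real
 assumes n3: "3 \<le> n" and H: "0 < H" and T: "0 < T"
begin

definition "e = pi / real n"
abbreviation "back k \<equiv> cis (- (2 * real k * e))"
definition "Pol = {v. \<forall>k<n. Re (v * back k) \<le> H / T}"
definition "B0 = (\<lambda>v. E v 0) ` Pol"
definition "P0 = {E v z | v z. 0 \<le> z \<and> (\<forall>k<n. T * Re (v * back k) + z \<le> H)}"
definition "FF k = {E v z | v z. E v z \<in> P0 \<and> T * Re (v * back k) + z = H}"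

lemma e: "0 < e" "real n * e = pi" "e < pi/2" "0 < cos e" "0 < sin e"
proof -
 show 1: "0 < e" "real n * e = pi" "e < pi/2" using n3 by (auto simp: e_def field_simps)
 show "0 < cos e" "0 < sin e" using 1 by (auto intro!: cos_gt_zero_pi sin_gt_zero)
qed

lemma in_P0: "E v z \<in> P0 \<longleftrightarrow> 0 \<le> z \<and> (\<forall>k<n. T * Re (v * back k) + z \<le> H)"
 unfolding P0_def by (auto simp: E_inj)

lemma in_FF: "E v z \<in> FF k \<longleftrightarrow> E v z \<in> P0 \<and> T * Re (v * back k) + z = H"
 unfolding FF_def by (auto simp: E_inj)

lemma in_B0: "E v z \<in> B0 \<longleftrightarrow> z = 0 \<and> v \<in> Pol" unfolding B0_def by (auto simp: E_inj)

lemma B0_alt: "E v z \<in> B0 \<longleftrightarrow> E v z \<in> P0 \<and> z = 0"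
 unfolding in_B0 in_P0 Pol_def using T by (auto simp: field_simps)

lemma Re_cis_le: "Re (v * cis x) \<le> norm v"
 using complex_Re_le_cmod[of "v * cis x"] by (simp add: norm_mult)

text \<open>A point at height \<open>z\<close> lies on the segment from the apex with parameter \<open>1 - z / H\<close>.\<close>
lemma cone_eq: "P0 = (\<Union>q\<in>B0. closed_segment (E 0 H) q)"
proof
 show "(\<Union>q\<in>B0. closed_segment (E 0 H) q) \<subseteq> P0"
 proof
  fix x assume "x \<in> (\<Union>q\<in>B0. closed_segment (E 0 H) q)"
  then obtain v t where v: "v \<in> Pol" "0 \<le> t" "t \<le> 1" "x = (1 - t) *\<^sub>R E 0 H + t *\<^sub>R E v 0"
   by (auto simp: B0_def closed_segment_def)
  have x: "x = E (t *\<^sub>R v) ((1 - t) * H)" unfolding v(4) E_linear by simp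
  show "x \<in> P0" unfolding x in_P0
  proof (intro conjI allI impI)
   show "0 \<le> (1 - t) * H" using v H by simp
   fix k assume k: "k < n"
   have "T * Re (t *\<^sub>R v * back k) = t * (T * Re (v * back k))" by (simp add: algebra_simps)
   also have "\<dots> \<le> t * H" using v k T by (intro mult_left_mono) (auto simp: Pol_def field_simps)
   finally show "T * Re (t *\<^sub>R v * back k) + (1 - t) * H \<le> H" by (simp add: algebra_simps)
  qed
 qed
 show "P0 \<subseteq> (\<Union>q\<in>B0. closed_segment (E 0 H) q)"
 proof
  fix x assume "x \<in> P0"
  then obtain v z where x: "x = E v z" "0 \<le> z" "\<And>k. k < n \<Longrightarrow> T * Re (v * back k) + z \<le> H"
   unfolding P0_def by blast
  obtain k where k: "k < n" "norm v * cos e \<le> Re (v * back k)"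
   by (rule sector_exists[OF n3 e_def, of v]) blast
  have "T * (norm v * cos e) \<le> T * Re (v * back k)" using k(2) T by (intro mult_left_mono) auto
  then have nv: "T * (norm v * cos e) + z \<le> H" using x(3)[OF k(1)] by linarith
  have "0 \<le> T * (norm v * cos e)" using T e by simp
  then have zH: "z \<le> H" using nv by linarith
  define t where "t = 1 - z / H"
  have t: "0 \<le> t" "t \<le> 1" "(1 - t) * H = z" "t * H = H - z" using zH x(2) H by (auto simp: t_def field_simps)
  show "x \<in> (\<Union>q\<in>B0. closed_segment (E 0 H) q)"
  proof (cases "t = 0")
   case True
   then have "z = H" using t by simp
   then have "T * (norm v * cos e) \<le> 0" using nv by simp
   then have "v = 0" using T e by (simp add: mult_le_0_iff)
   then have "x = E 0 H" using x \<open>z = H\<close> by simp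
   moreover have "E 0 0 \<in> B0" using H T by (simp add: in_B0 Pol_def)
   ultimately show ?thesis by force
  next
   case False
   then have tp: "0 < t" using t by simp
   have "v /\<^sub>R t \<in> Pol" unfolding Pol_def
   proof (intro CollectI allI impI)
    fix k assume k: "k < n"
    have "t * (T * Re (v /\<^sub>R t * back k)) = T * Re (v * back k)" using tp by (simp add: field_simps)
    also have "\<dots> \<le> t * H" using x(3)[OF k] t(4) by linarith
    finally have "T * Re (v /\<^sub>R t * back k) \<le> H" by (rule mult_left_le_imp_le[OF _ tp])
    then show "Re (v /\<^sub>R t * back k) \<le> H / T" using T by (simp only: pos_le_divide_eq mult.commute)
   qed
   then have "E (v /\<^sub>R t) 0 \<in> B0" by (simp add: in_B0)
   moreover have "x = (1 - t) *\<^sub>R E 0 H + t *\<^sub>R E (v /\<^sub>R t) 0" unfolding E_linear using tp t x by simp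
   ultimately show ?thesis using t unfolding closed_segment_def by blast
  qed
 qed
qed

text \<open>Outer normals and half-spaces; the index \<open>n\<close> stands for the base.\<close>
definition "dir k = cos (2 * real k * e) *\<^sub>R a + sin (2 * real k * e) *\<^sub>R b"
definition "Nv i = (if i < n then T *\<^sub>R dir i + u else - u)"
definition "bb i = (if i < n then Nv i \<bullet> c + H else Nv i \<bullet> c)"
definition "hs i = {x. Nv i \<bullet> x \<le> bb i}"

lemma Nv_E: "i < n \<Longrightarrow> Nv i \<bullet> E v z = Nv i \<bullet> c + (T * Re (v * cis (- (2 * real i * e))) + z)"
  "\<not> i < n \<Longrightarrow> Nv i \<bullet> E v z = Nv i \<bullet> c - z"
 by (simp_all add: Nv_def dir_def E_def inner_add_left inner_add_right dots algebra_simps)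

lemma hs_E: "i < n \<Longrightarrow> E v z \<in> hs i \<longleftrightarrow> T * Re (v * cis (- (2 * real i * e))) + z \<le> H"
  "\<not> i < n \<Longrightarrow> E v z \<in> hs i \<longleftrightarrow> 0 \<le> z"
 by (simp_all add: hs_def bb_def Nv_E)

lemma P0_hs: "P0 = \<Inter> (hs ` {..n})"
proof -
 have "E v z \<in> P0 \<longleftrightarrow> E v z \<in> \<Inter> (hs ` {..n})" for v z
 proof -
  have "E v z \<in> \<Inter> (hs ` {..n}) \<longleftrightarrow> (\<forall>i<n. E v z \<in> hs i) \<and> E v z \<in> hs n" by (auto simp: le_less)
  then show ?thesis unfolding in_P0 by (auto simp: hs_E)
 qed
 then have "x \<in> P0 \<longleftrightarrow> x \<in> \<Inter> (hs ` {..n})" for x using E_surj[of x] by metis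
 then show ?thesis by blast
qed

lemma Nv_ne: "Nv i \<noteq> 0"
proof -
 have "Nv i \<bullet> u \<noteq> 0" by (simp add: Nv_def dir_def inner_add_left dots)
 then show ?thesis by auto
qed

text \<open>No half-space is redundant. For a lateral face the witness lies in the plane of the base, on the normal direction of the face, beyond the face by a
 factor \<open>s\<close> that is too small to leave the neighbouring half-spaces.\<close>
lemma witness: assumes "i \<le> n" shows "\<exists>x. x \<notin> hs i \<and> (\<forall>j\<le>n. j \<noteq> i \<longrightarrow> x \<in> hs j)"
proof (cases "i < n")
 case True
 define \<kappa> where "\<kappa> = cos (2 * e)"
 have e3: "e \<le> pi/3" unfolding e_def using n3 by (intro divide_left_mono) auto
 have "cos (2 * (pi/3)) \<le> \<kappa>" unfolding \<kappa>_def using e e3 by (intro cos_monotone_0_pi_le) auto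
 moreover have "cos (2 * (pi/3)) = - 1/2" using cos_120 by simp
 ultimately have k1: "- 1/2 \<le> \<kappa>" by simp
 have "cos (2 * e) < cos 0" using e by (intro cos_monotone_0_pi) auto
 then have k2: "\<kappa> < 1" by (simp add: \<kappa>_def)
 define s where "s = 2 / (1 + \<kappa>)"
 have s: "1 < s" "s * \<kappa> \<le> 1" using k1 k2 by (auto simp: s_def field_simps)
 define v where "v = of_real (s * H / T) * cis (2 * real i * e)"
 have R: "T * Re (v * back j) = s * H * cos (2 * of_int (int i - int j) * e)" for j
 proof -
  have "v * back j = of_real (s * H / T) * cis (2 * of_int (int i - int j) * e)"
   unfolding v_def mult.assoc cis_mult by (simp add: algebra_simps)
  then have "Re (v * back j) = Re (of_real (s * H / T) * cis (2 * of_int (int i - int j) * e))" by (rule arg_cong)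
  then show ?thesis using T by simp
 qed
 show ?thesis
 proof (intro exI[of _ "E v 0"] conjI allI impI)
  show "E v 0 \<notin> hs i" using True R[of i] s H by (simp add: hs_E)
  fix j assume j: "j \<le> n" "j \<noteq> i"
  show "E v 0 \<in> hs j"
  proof (cases "j < n")
   case jn: True
   have "cos (2 * of_int (int i - int j) * e) \<le> \<kappa>" unfolding \<kappa>_def
    by (rule cos_even_multiple_le[of n]) (use n3 True jn j e in "auto simp: e_def")
   then have "s * H * cos (2 * of_int (int i - int j) * e) \<le> s * H * \<kappa>" using s H by (intro mult_left_mono) auto
   also have "\<dots> \<le> 1 * H" using s H mult_right_mono[of "s * \<kappa>" 1 H] by (simp add: mult_ac)
   finally show ?thesis using jn R[of j] by (simp add: hs_E)
  qed (simp add: hs_E)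
 qed
next
 case False
 then show ?thesis using assms H by (intro exI[of _ "E 0 (- 1)"]) (auto simp: hs_E)
qed

lemma hs_inj: "i \<le> n \<Longrightarrow> j \<le> n \<Longrightarrow> hs i = hs j \<Longrightarrow> i = j"
 using witness[of i] by blast

lemma P0_affine: "affine hull P0 = UNIV" "interior P0 \<noteq> {}"
proof -
 define U where "U = (\<lambda>x. (x - c) \<bullet> u) -` {0<..} \<inter> (\<lambda>x. T * (norm ((x - c) \<bullet> a) + norm ((x - c) \<bullet> b)) + (x - c) \<bullet> u) -` {..<H}"
 have "open U" unfolding U_def
  by (intro open_Int open_vimage open_greaterThan open_lessThan continuous_intros)
 moreover have "U \<subseteq> P0"
 proof
  fix x assume x: "x \<in> U"
  define v where "v = Complex ((x - c) \<bullet> a) ((x - c) \<bullet> b)"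
  define z where "z = (x - c) \<bullet> u"
  have xe: "x = E v z" using E_surj[of x] by (simp add: v_def z_def)
  have nv: "norm v \<le> norm ((x - c) \<bullet> a) + norm ((x - c) \<bullet> b)" using cmod_le[of v] by (simp add: v_def)
  show "x \<in> P0" unfolding xe in_P0
  proof (intro conjI allI impI)
   show "0 \<le> z" using x by (simp add: U_def z_def)
   fix k
   have "T * Re (v * back k) \<le> T * (norm ((x - c) \<bullet> a) + norm ((x - c) \<bullet> b))"
    using Re_cis_le[of v "- (2 * real k * e)"] nv T by (intro mult_left_mono) linarith+
   then show "T * Re (v * back k) + z \<le> H" using x by (simp add: U_def z_def)
  qed
 qed
 moreover have "E 0 (H/2) \<in> U" using H by (simp add: U_def E_coords)
 ultimately show i: "interior P0 \<noteq> {}" by (metis interior_maximal subsetD empty_iff)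
 show "affine hull P0 = UNIV" using affine_hull_nonempty_interior[OF i] .
qed

lemma facets: "F facet_of P0 \<longleftrightarrow> (\<exists>i\<le>n. F = P0 \<inter> {x. Nv i \<bullet> x = bb i})"
proof -
 define inv_hs where "inv_hs h = (THE i. i \<le> n \<and> hs i = h)" for h
 have iv: "inv_hs (hs i) = i" if "i \<le> n" for i unfolding inv_hs_def using that hs_inj by (intro the_equality) auto
 have "F facet_of P0 \<longleftrightarrow> (\<exists>h. h \<in> hs ` {..n} \<and> F = P0 \<inter> {x. Nv (inv_hs h) \<bullet> x = bb (inv_hs h)})"
 proof (rule facet_of_polyhedron_explicit)
  show "finite (hs ` {..n})" by simp
  show "P0 = affine hull P0 \<inter> \<Inter> (hs ` {..n})" by (simp only: P0_affine(1) Int_UNIV_left) (rule P0_hs)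
  show "Nv (inv_hs h) \<noteq> 0 \<and> h = {x. Nv (inv_hs h) \<bullet> x \<le> bb (inv_hs h)}" if "h \<in> hs ` {..n}" for h
   using that Nv_ne iv by (auto simp: hs_def)
  show "P0 \<subset> affine hull P0 \<inter> \<Inter> F'" if F': "F' \<subset> hs ` {..n}" for F'
  proof
   show "P0 \<subseteq> affine hull P0 \<inter> \<Inter> F'" unfolding P0_affine using F' P0_hs by auto
   obtain i where i: "i \<le> n" "hs i \<notin> F'" using F' by blast
   obtain x where x: "x \<notin> hs i" "\<And>j. j \<le> n \<Longrightarrow> j \<noteq> i \<Longrightarrow> x \<in> hs j" using witness[OF i(1)] by blast
   have "x \<in> \<Inter> F'"
   proof
    fix h assume h: "h \<in> F'"
    then obtain j where "j \<le> n" "h = hs j" using F' by auto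
    then show "x \<in> h" using x(2)[of j] i h by auto
   qed
   moreover have "x \<notin> P0" using x(1) i(1) P0_hs by auto
   ultimately show "P0 \<noteq> affine hull P0 \<inter> \<Inter> F'" unfolding P0_affine by blast
  qed
 qed
 also have "\<dots> \<longleftrightarrow> (\<exists>i\<le>n. F = P0 \<inter> {x. Nv i \<bullet> x = bb i})" using iv by auto
 finally show ?thesis .
qed

lemma facets': "F facet_of P0 \<longleftrightarrow> F = B0 \<or> (\<exists>k<n. F = FF k)"
proof -
 have 1: "P0 \<inter> {x. Nv k \<bullet> x = bb k} = FF k" if "k < n" for k
 proof (rule set_eqI)
  fix x show "x \<in> P0 \<inter> {x. Nv k \<bullet> x = bb k} \<longleftrightarrow> x \<in> FF k"
   by (subst (1 2) E_surj[of x]) (use that in "simp add: in_FF Nv_E bb_def")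
 qed
 have 2: "P0 \<inter> {x. Nv n \<bullet> x = bb n} = B0"
 proof (rule set_eqI)
  fix x show "x \<in> P0 \<inter> {x. Nv n \<bullet> x = bb n} \<longleftrightarrow> x \<in> B0"
   by (subst (1 2) E_surj[of x]) (simp add: B0_alt Nv_E bb_def)
 qed
 show ?thesis unfolding facets using 1 2 by (auto simp: le_less)
qed

lemma frontier_P0: "F facet_of P0 \<Longrightarrow> F \<subseteq> frontier P0"
proof -
 assume F: "F facet_of P0"
 have "polyhedron P0" unfolding P0_hs
  by (rule polyhedron_Inter) (auto simp: hs_def intro: polyhedron_halfspace_le)
 then have "rel_frontier P0 = \<Union> {F. F facet_of P0}" by (rule rel_frontier_of_polyhedron)
 moreover have "rel_frontier P0 = frontier P0" by (rule rel_frontier_frontier[OF P0_affine(1)])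
 ultimately show ?thesis using F by blast
qed

lemma apex_FF: "k < n \<Longrightarrow> E 0 H \<in> FF k" unfolding in_FF in_P0 using H by simp

lemma mid_FF: assumes "k < n" shows "E (of_real (H/T) * cis (2 * real k * e)) 0 \<in> FF k"
  "E (of_real (H/T / cos e) * cis (2 * real k * e + e)) 0 \<in> FF k"
proof -
 have R: "T * Re (of_real (H/T) * cis (2 * real k * e) * back j) = H * cos (2 * of_int (int k - int j) * e)" for j
 proof -
  have "complex_of_real (H/T) * cis (2 * real k * e) * back j = of_real (H/T) * cis (2 * of_int (int k - int j) * e)"
   unfolding mult.assoc cis_mult by (simp add: algebra_simps)
  then have "Re (complex_of_real (H/T) * cis (2 * real k * e) * back j) = Re (of_real (H/T) * cis (2 * of_int (int k - int j) * e))" by (rule arg_cong)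
  then show ?thesis using T by simp
 qed
 have "T * Re (of_real (H/T) * cis (2 * real k * e) * back j) \<le> H" for j
  unfolding R using H cos_le_one mult_left_mono[of "cos (2 * of_int (int k - int j) * e)" 1 H] by simp
 then show "E (of_real (H/T) * cis (2 * real k * e)) 0 \<in> FF k"
  unfolding in_FF in_P0 using R[of k] by simp
 have R2: "T * Re (of_real (H/T / cos e) * cis (2 * real k * e + e) * back j) = H / cos e * cos ((2 * of_int (int k - int j + 1) - 1) * e)" for j
 proof -
  have "complex_of_real (H/T / cos e) * cis (2 * real k * e + e) * back j = of_real (H/T / cos e) * cis ((2 * of_int (int k - int j + 1) - 1) * e)"
   unfolding mult.assoc cis_mult by (simp add: algebra_simps)
  then have "Re (complex_of_real (H/T / cos e) * cis (2 * real k * e + e) * back j) = Re (of_real (H/T / cos e) * cis ((2 * of_int (int k - int j + 1) - 1) * e))" by (rule arg_cong)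
  then show ?thesis using T by simp
 qed
 have "T * Re (of_real (H/T / cos e) * cis (2 * real k * e + e) * back j) \<le> H" if "j < n" for j
 proof -
  have "H / cos e * cos ((2 * of_int (int k - int j + 1) - 1) * e) \<le> H / cos e * cos e"
   by (intro mult_left_mono cos_odd_multiple_le[of n]) (use that assms n3 H e in "auto simp: e_def")
  then show ?thesis unfolding R2 using e by simp
 qed
 then show "E (of_real (H/T / cos e) * cis (2 * real k * e + e)) 0 \<in> FF k"
  unfolding in_FF in_P0 using R2[of k] e by (simp add: algebra_simps)
qed

lemma normal_FF:
 assumes k: "k < n" and w: "normal_to (FF k) w" and N: "N \<bullet> (T *\<^sub>R dir k + u) = 0"
 shows "orthogonal N w"
proof -
 define tk where "tk = - sin (2 * real k * e) *\<^sub>R a + cos (2 * real k * e) *\<^sub>R b"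
 have d: "E (of_real r * cis (2 * real k * e + \<delta>)) 0 - E 0 0 = (r * cos \<delta>) *\<^sub>R dir k + (r * sin \<delta>) *\<^sub>R tk" for r \<delta>
  by (simp add: E_def dir_def tk_def cos_add sin_add algebra_simps)
 \<comment> \<open>Three points of the face that determine its plane: on the midline, on an edge, and the apex.\<close>
 define x1 where "x1 = E (of_real (H/T) * cis (2 * real k * e)) 0"
 define x2 where "x2 = E (of_real (H/T / cos e) * cis (2 * real k * e + e)) 0"
 define x3 where "x3 = E 0 H"
 have X: "x1 \<in> FF k" "x2 \<in> FF k" "x3 \<in> FF k" using mid_FF[OF k] apex_FF[OF k] by (auto simp: x1_def x2_def x3_def)
 have e1: "x1 - E 0 0 = (H/T) *\<^sub>R dir k" using d[of "H/T" 0] by (simp add: x1_def)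
 have e2: "x2 - E 0 0 = (H/T) *\<^sub>R dir k + (H/T / cos e * sin e) *\<^sub>R tk" using d[of "H/T / cos e" e] e by (simp add: x2_def)
 have e3: "x3 - E 0 0 = H *\<^sub>R u" by (simp add: x3_def E_def)
 have "w \<bullet> ((x2 - E 0 0) - (x1 - E 0 0)) = 0" using w X unfolding normal_to_def orthogonal_def by simp
 then have "(H/T / cos e * sin e) * (w \<bullet> tk) = 0" unfolding e1 e2 by simp
 then have wt: "w \<bullet> tk = 0" using H T e by simp
 have "w \<bullet> ((x1 - E 0 0) - (x3 - E 0 0)) = 0" using w X unfolding normal_to_def orthogonal_def by simp
 then have "H / T * (w \<bullet> dir k) = H * (w \<bullet> u)" unfolding e1 e3 by (simp add: inner_diff_right)
 then have wd: "w \<bullet> dir k = T * (w \<bullet> u)" using H T by (simp add: field_simps)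
 have Nu: "N \<bullet> u = - T * (N \<bullet> dir k)" using N by (simp add: inner_add_right)
 define Cc where "Cc = cos (2 * real k * e)" define Sc where "Sc = sin (2 * real k * e)"
 have cs: "Cc * Cc + Sc * Sc = 1" by (simp add: Cc_def Sc_def)
 have exp: "w = (w \<bullet> dir k) *\<^sub>R dir k + (w \<bullet> tk) *\<^sub>R tk + (w \<bullet> u) *\<^sub>R u"
 proof -
  have "(w \<bullet> dir k) *\<^sub>R dir k + (w \<bullet> tk) *\<^sub>R tk = ((Cc * Cc + Sc * Sc) * (w \<bullet> a)) *\<^sub>R a + ((Cc * Cc + Sc * Sc) * (w \<bullet> b)) *\<^sub>R b"
   unfolding dir_def tk_def Cc_def[symmetric] Sc_def[symmetric] by (simp add: inner_add_right algebra_simps)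
  then show ?thesis using expand[of w] cs by simp
 qed
 have "N \<bullet> w = (w \<bullet> dir k) * (N \<bullet> dir k) + (w \<bullet> u) * (N \<bullet> u)"
  by (subst exp) (simp add: inner_add_right wt)
 then show ?thesis unfolding orthogonal_def wd Nu by simp
qed

lemma normal_B0:
 assumes w: "normal_to B0 w" and N: "N \<bullet> u = 0" shows "orthogonal N w"
proof -
 have inB: "E v 0 \<in> B0" if "norm v \<le> H / T" for v
  unfolding in_B0 Pol_def using that Re_cis_le[of v] order_trans by blast
 have X: "E 0 0 \<in> B0" "E (of_real (H/T)) 0 \<in> B0" "E (\<i> * of_real (H/T)) 0 \<in> B0"
  by (rule inB, use H T in "simp add: norm_mult norm_divide")+
 have "w \<bullet> (E (of_real (H/T)) 0 - E 0 0) = 0" "w \<bullet> (E (\<i> * of_real (H/T)) 0 - E 0 0) = 0"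
  using w X unfolding normal_to_def orthogonal_def by blast+
 then have "w \<bullet> a = 0" "w \<bullet> b = 0" using H T by (auto simp: E_def)
 then have "w = (w \<bullet> u) *\<^sub>R u" using expand[of w] by simp
 then have "N \<bullet> w = (w \<bullet> u) * (N \<bullet> u)" by (metis inner_scaleR_right)
 then show ?thesis using N by (simp add: orthogonal_def)
qed

lemma u_normal: "normal_to B0 u"
 unfolding normal_to_def B0_def orthogonal_def by (auto simp: E_def inner_diff_right inner_add_right dots)

end

lemma cross_frame:
 assumes on: "norm a = 1" "norm b = 1" "norm u = 1" "orthogonal a b" "orthogonal a u" "orthogonal b u"
 shows "cross3 a b = u \<or> cross3 a b = - u"
proof -
 define x where "x = cross3 a b"
 have ab: "a \<bullet> b = 0" "a \<bullet> a = 1" "b \<bullet> b = 1" "u \<bullet> u = 1" "u \<bullet> a = 0" "u \<bullet> b = 0"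
  using on by (auto simp: orthogonal_def norm_eq_1 inner_commute)
 have "(norm x)^2 = 1" unfolding x_def using norm_cross_dot[of a b] on ab by simp
 then have nx: "norm x = 1" using norm_ge_zero[of x] by (auto simp: power2_eq_1_iff)
 have nu: "norm u = 1" by (rule on(3))
 interpret ortho_frame 0 a b x
  by unfold_locales (use on nx in "auto simp: x_def orthogonal_def dot_cross_self inner_commute")
 have "u = (u \<bullet> x) *\<^sub>R x" using expand[of u] ab by (simp add: inner_commute)
 then have "norm u = norm ((u \<bullet> x) *\<^sub>R x)" by (rule arg_cong)
 then have "\<bar>u \<bullet> x\<bar> = 1" using nu nx by simp
 then have "u \<bullet> x = 1 \<or> u \<bullet> x = - 1" by linarith
 then show ?thesis
 proof
  assume "u \<bullet> x = 1"
  then have "u = x" using \<open>u = (u \<bullet> x) *\<^sub>R x\<close> by (simp only: scaleR_one)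
  then show ?thesis by (simp add: x_def)
 next
  assume "u \<bullet> x = - 1"
  then have "u = - x" using \<open>u = (u \<bullet> x) *\<^sub>R x\<close> by (simp only: scaleR_minus_left scaleR_one)
  then show ?thesis by (simp add: x_def)
 qed
qed

text \<open>The plane of the polygon determines the axis. The frame is rotated by \<open>e\<close> against the given vertices; if their
 orientation does not match the apex, the second vector is reversed, which permutes the vertices.\<close>
lemma right_pyramid_frame:
 assumes rp: "regular_polygon n c B" and py: "right_pyramid P B c p"
 shows "\<exists>a b u H T. pyramid_frame a b u n H T \<and> p - c = H *\<^sub>R u \<and>
  B = pyramid_frame.B0 c a b u n H T \<and> P = pyramid_frame.P0 c a b u n H T"
proof -
 obtain e1 e2 \<rho> where n3: "3 \<le> n" and e12: "norm e1 = 1" "norm e2 = 1" "orthogonal e1 e2" and \<rho>: "0 < \<rho>"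
  and B: "B = convex hull ((\<lambda>k. c + \<rho> *\<^sub>R (cos (2 * pi * real k / real n) *\<^sub>R e1 + sin (2 * pi * real k / real n) *\<^sub>R e2)) ` {..<n})"
  using rp unfolding regular_polygon_def by blast
 define e where e_eq: "e = pi / real n"
 have e: "0 < e" "real n * e = pi" "e < pi/2" using n3 by (auto simp: e_eq field_simps)
 have ce: "0 < cos e" using e by (intro cos_gt_zero_pi) auto
 define vt where "vt e2 k = c + \<rho> *\<^sub>R (cos (2 * real k * e) *\<^sub>R e1 + sin (2 * real k * e) *\<^sub>R e2)" for e2 and k :: nat
 have B: "B = convex hull (vt e2 ` {..<n})" unfolding B vt_def e_eq by (simp add: mult_ac)
 have pc: "p \<noteq> c" "normal_to B (p - c)" "P = (\<Union>b\<in>B. closed_segment p b)" using py by (auto simp: right_pyramid_def)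
 define H where "H = norm (p - c)"
 define u where "u = sgn (p - c)"
 have H: "0 < H" using pc by (simp add: H_def)
 have pu: "p - c = H *\<^sub>R u" using pc by (simp add: H_def u_def sgn_div_norm)
 have nu: "norm u = 1" using pc by (simp add: u_def norm_sgn)
 have per: "w \<bullet> (x - y) = 0 \<Longrightarrow> w \<bullet> (x' - y) = 0 \<Longrightarrow> w \<bullet> (x' - x) = 0" for w x y x' :: "real^3" by (simp add: inner_diff_right)
 have vB: "vt e2 k \<in> B" if "k < n" for k unfolding B using that by (intro hull_inc) auto
 have orth: "(p - c) \<bullet> (vt e2 j - vt e2 k) = 0" if "j < n" "k < n" for j k
  using pc(2) vB that unfolding normal_to_def orthogonal_def by blast
 have last: "vt e2 (n - 1) = c + \<rho> *\<^sub>R (cos (2 * e) *\<^sub>R e1 - sin (2 * e) *\<^sub>R e2)"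
 proof -
  have "2 * real (n - 1) * e = 2 * pi - 2 * e" using n3 e(2) by (simp add: of_nat_diff algebra_simps)
  then show ?thesis by (simp add: vt_def)
 qed
 have s2: "0 < sin (2 * e)" using e by (intro sin_gt_zero) auto
 have c2: "cos (2 * e) < 1"
 proof -
  have "cos (2 * e) < cos 0" using e by (intro cos_monotone_0_pi) auto
  then show ?thesis by simp
 qed
 have ue: "u \<bullet> e1 = 0" "u \<bullet> e2 = 0"
 proof -
  have v0: "vt e2 0 = c + \<rho> *\<^sub>R e1" by (simp add: vt_def)
  have v1: "vt e2 1 = c + \<rho> *\<^sub>R (cos (2 * e) *\<^sub>R e1 + sin (2 * e) *\<^sub>R e2)" by (simp add: vt_def)
  have "(p - c) \<bullet> (vt e2 1 - vt e2 (n - 1)) = 0" using orth n3 by simp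
  moreover have "vt e2 1 - vt e2 (n - 1) = (2 * \<rho> * sin (2 * e)) *\<^sub>R e2" unfolding v1 last by (simp add: algebra_simps flip: scaleR_2)
  ultimately have "H * (2 * \<rho> * sin (2 * e) * (u \<bullet> e2)) = 0" unfolding pu by simp
  then show u2: "u \<bullet> e2 = 0" using H \<rho> s2 by simp
  have "(p - c) \<bullet> (vt e2 0 - vt e2 1) = 0" using orth n3 by simp
  moreover have "vt e2 0 - vt e2 1 = (\<rho> * (1 - cos (2 * e))) *\<^sub>R e1 - (\<rho> * sin (2 * e)) *\<^sub>R e2" unfolding v0 v1 by (simp add: algebra_simps)
  ultimately have "(H *\<^sub>R u) \<bullet> ((\<rho> * (1 - cos (2 * e))) *\<^sub>R e1 - (\<rho> * sin (2 * e)) *\<^sub>R e2) = 0" unfolding pu by (simp only:)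
  then have "H * (\<rho> * (1 - cos (2 * e)) * (u \<bullet> e1)) = 0" using u2 by (auto simp add: inner_diff_right)
  then show "u \<bullet> e1 = 0" using H \<rho> c2 by simp
 qed
 have "cross3 e1 e2 = u \<or> cross3 e1 e2 = - u"
  by (rule cross_frame) (use e12 nu ue in "auto simp: orthogonal_def inner_commute")
 then obtain f2 where f2: "norm f2 = 1" "orthogonal e1 f2" "u \<bullet> f2 = 0" "cross3 e1 f2 = u" "vt f2 ` {..<n} = vt e2 ` {..<n}"
 proof
  assume "cross3 e1 e2 = u"
  then show thesis using that[of e2] e12 ue by blast
 next
  assume c: "cross3 e1 e2 = - u"
  have refl: "vt (- e2) ` {..<n} \<subseteq> vt e2 ` {..<n}" for e2
  proof
   fix x assume "x \<in> vt (- e2) ` {..<n}"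
   then obtain k where k: "k < n" "x = vt (- e2) k" by auto
   show "x \<in> vt e2 ` {..<n}"
   proof (cases "k = 0")
    case True
    then have "x = vt e2 0" using k by (simp add: vt_def)
    then show ?thesis using n3 by auto
   next
    case False
    have "2 * real (n - k) * e = 2 * pi - 2 * real k * e" using k e(2) by (simp add: of_nat_diff algebra_simps)
    then have "x = vt e2 (n - k)" using k by (simp add: vt_def)
    then show ?thesis using False k by auto
   qed
  qed
  have "vt (- e2) ` {..<n} = vt e2 ` {..<n}" using refl[of e2] refl[of "- e2"] by auto
  then show thesis using that[of "- e2"] e12 ue c by (simp add: orthogonal_clauses cross_minus_right)
 qed
 define a where "a = cos e *\<^sub>R e1 + sin e *\<^sub>R f2"
 define b where "b = - sin e *\<^sub>R e1 + cos e *\<^sub>R f2"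
 have d: "e1 \<bullet> e1 = 1" "f2 \<bullet> f2 = 1" "e1 \<bullet> f2 = 0" "f2 \<bullet> e1 = 0" "e1 \<bullet> u = 0" "f2 \<bullet> u = 0"
  using e12 f2 ue by (auto simp: orthogonal_def norm_eq_1 inner_commute)
 have cs: "cos e * cos e + sin e * sin e = 1" by simp
 have "cross3 a b = (cos e * cos e + sin e * sin e) *\<^sub>R cross3 e1 f2"
  using cross_skew[of f2 e1]
  by (simp add: a_def b_def cross_add_left cross_add_right cross_mult_left cross_mult_right cross_refl cross_minus_right Cross3.right_diff_distrib algebra_simps del: sin_cos_squared_add3)
 then have cab: "cross3 a b = u" using f2(4) by simp
 interpret ortho_frame c a b u
  by unfold_locales (use d cs nu cab in "auto simp: a_def b_def norm_eq_1 orthogonal_def inner_add_left inner_add_right algebra_simps")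
 define T where "T = H / (\<rho> * cos e)"
 have T: "0 < T" using H \<rho> ce by (simp add: T_def)
 interpret pyramid_frame c a b u n H T by unfold_locales (use n3 H T in auto)
 have ee: "local.e = e" by (simp add: local.e_def e_eq)
 have HT: "H / T = \<rho> * cos e" using H by (simp add: T_def)
 have vE: "vt f2 k = E (of_real \<rho> * cis ((2 * real k - 1) * e)) 0" for k
 proof -
  define x y where "x = cos (2 * real k * e)" "y = sin (2 * real k * e)"
  note xy = this
  have co: "cos ((2 * real k - 1) * e) = x * cos e + y * sin e" "sin ((2 * real k - 1) * e) = y * cos e - x * sin e"
   by (simp_all only: left_diff_distrib cos_diff sin_diff mult_1 xy)
  have "E (of_real \<rho> * cis ((2 * real k - 1) * e)) 0
   = c + (\<rho> * (x * cos e + y * sin e)) *\<^sub>R a + (\<rho> * (y * cos e - x * sin e)) *\<^sub>R b"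
   unfolding co[symmetric] by (simp add: E_def)
  also have "\<dots> = c + (\<rho> * ((cos e * cos e + sin e * sin e) * x)) *\<^sub>R e1 + (\<rho> * ((cos e * cos e + sin e * sin e) * y)) *\<^sub>R f2"
   unfolding a_def b_def by (simp add: algebra_simps del: sin_cos_squared_add3)
  finally have "E (of_real \<rho> * cis ((2 * real k - 1) * e)) 0
   = c + (\<rho> * ((cos e * cos e + sin e * sin e) * x)) *\<^sub>R e1 + (\<rho> * ((cos e * cos e + sin e * sin e) * y)) *\<^sub>R f2" .
  then show ?thesis unfolding cs by (simp add: vt_def xy algebra_simps)
 qed
 have Bp: "B = B0"
 proof -
  have "B = convex hull (vt f2 ` {..<n})" unfolding B f2(5) ..
  also have "vt f2 ` {..<n} = (\<lambda>v. E v 0) ` ((\<lambda>k. of_real \<rho> * cis ((2 * real k - 1) * e)) ` {..<n})"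
   by (simp add: image_image vE)
  also have "convex hull \<dots> = (\<lambda>v. E v 0) ` (convex hull ((\<lambda>k. of_real \<rho> * cis ((2 * real k - 1) * e)) ` {..<n}))" by (rule E_hull[symmetric])
  also have "convex hull ((\<lambda>k. of_real \<rho> * cis ((2 * real k - 1) * e)) ` {..<n}) = Pol"
   unfolding regular_polygon_halfplanes[OF n3 e_eq \<rho>] Pol_def HT ee ..
  finally show ?thesis by (simp add: B0_def)
 qed
 have "p = E 0 H" using pu by (simp add: E_def algebra_simps)
 then have "P = P0" unfolding cone_eq pc(3) Bp by simp
 then show ?thesis using pu Bp pyramid_frame_axioms by blast
qed

section \<open>From the strip to the annulus\<close>

text \<open>Near each point the principal logarithm differs from a holomorphic branch by multiples of the period, so that periodic functions of \<open>Ln z\<close> are as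
 regular as functions of a branch. On the cut \<open>Ln (- z) + \<i> pi\<close> serves as the branch.\<close>
lemma Ln_local:
 assumes z0: "z0 \<noteq> 0"
 obtains U g where "open U" "z0 \<in> U" "0 \<notin> U" "g z0 = Ln z0"
  "\<And>z. z \<in> U \<Longrightarrow> (g has_field_derivative 1 / z) (at z)"
  "\<And>z. z \<in> U \<Longrightarrow> Re (g z) = ln (norm z)"
  "\<And>z. z \<in> U \<Longrightarrow> \<exists>m::int. Ln z = g z + full_turn m"
proof (cases "z0 \<in> \<real>\<^sub>\<le>\<^sub>0")
 case False
 show thesis
 proof (rule that[of "- \<real>\<^sub>\<le>\<^sub>0" Ln])
  show "open (- \<real>\<^sub>\<le>\<^sub>0 :: complex set)" using closed_nonpos_Reals_complex by blast
  fix z :: complex assume z: "z \<in> - \<real>\<^sub>\<le>\<^sub>0"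
  then have "z \<noteq> 0" by auto
  then show "Re (Ln z) = ln (norm z)" by simp
  show "(Ln has_field_derivative 1 / z) (at z)" using has_field_derivative_Ln[of z] z by (simp add: inverse_eq_divide)
  show "\<exists>m::int. Ln z = Ln z + full_turn m" by (rule exI[of _ 0]) simp
 qed (use False in auto)
next
 case True
 have neg: "Ln w + \<i> * of_real pi = Ln (- w) \<or> Ln w + \<i> * of_real pi = Ln (- w) + 2 * of_real pi * \<i>" if "w \<noteq> 0" for w
  using Ln_minus[OF that] by (auto split: if_splits)
 define U where "U = {z::complex. - z \<in> - \<real>\<^sub>\<le>\<^sub>0}"
 have r: "z0 = complex_of_real (Re z0)" "Re z0 < 0" using True z0 by (auto elim!: nonpos_Reals_cases)
 have "- z0 \<notin> \<real>\<^sub>\<le>\<^sub>0" using r(2) unfolding complex_nonpos_Reals_iff by simp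
 then have "- z0 \<in> - \<real>\<^sub>\<le>\<^sub>0" by blast
 show thesis
 proof (rule that[of U "\<lambda>z. Ln (- z) + \<i> * of_real pi"])
  have "open (uminus -` (- \<real>\<^sub>\<le>\<^sub>0) :: complex set)"
   by (intro open_vimage continuous_intros) (use closed_nonpos_Reals_complex in blast)
  then show "open U" by (simp add: U_def vimage_def)
  show "z0 \<in> U" using \<open>- z0 \<in> - \<real>\<^sub>\<le>\<^sub>0\<close> by (simp add: U_def)
  show "0 \<notin> U" by (simp add: U_def)
  have "Ln (- (- z0)) = Ln (- z0) + \<i> * of_real pi" using Ln_minus[of "- z0"] z0 r by (auto split: if_splits simp: complex_eq_iff)
  then show "Ln (- z0) + \<i> * of_real pi = Ln z0" by simp
  fix z assume z: "z \<in> U"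
  then have zz: "z \<noteq> 0" "- z \<notin> \<real>\<^sub>\<le>\<^sub>0" by (auto simp: U_def)
  show "((\<lambda>z. Ln (- z) + \<i> * of_real pi) has_field_derivative 1 / z) (at z)"
   using zz by (auto intro!: derivative_eq_intros simp: field_simps)
  show "Re (Ln (- z) + \<i> * of_real pi) = ln (norm z)" using zz by simp
  consider "Ln (- z) + \<i> * of_real pi = Ln z" | "Ln (- z) + \<i> * of_real pi = Ln z + 2 * of_real pi * \<i>"
   using neg[of "- z"] zz by auto
  then show "\<exists>m::int. Ln z = (Ln (- z) + \<i> * of_real pi) + full_turn m"
  proof cases
   case 1 then show ?thesis by (intro exI[of _ 0]) simp
  next
   case 2 show ?thesis unfolding 2 by (intro exI[of _ "-1"]) simp
  qed
 qed
qed

definition "periodic_strip F a b \<longleftrightarrow>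
 (\<forall>w (m::int). a \<le> Re w \<longrightarrow> Re w \<le> b \<longrightarrow> F (w + full_turn m) = F w)"

lemma annulus_ln:
 assumes "z \<in> closed_annulus (exp a) (exp b)"
 shows "z \<noteq> 0" "a \<le> ln (norm z)" "ln (norm z) \<le> b" "a \<le> Re (Ln z)" "Re (Ln z) \<le> b"
proof -
 have nz: "0 < norm z" using assms exp_gt_zero[of a] unfolding closed_annulus_def by (auto intro: less_le_trans)
 then show z: "z \<noteq> 0" by auto
 have "ln (exp a) \<le> ln (norm z)" "ln (norm z) \<le> ln (exp b)"
  using assms nz unfolding closed_annulus_def by (auto simp del: ln_exp)
 then show "a \<le> ln (norm z)" "ln (norm z) \<le> b" by auto
 then show "a \<le> Re (Ln z)" "Re (Ln z) \<le> b" using z by auto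
qed

lemma open_annulus_ln:
 assumes "z \<in> open_annulus (exp a) (exp b)"
 shows "z \<in> closed_annulus (exp a) (exp b)" "a < ln (norm z)" "ln (norm z) < b" "a < Re (Ln z)" "Re (Ln z) < b"
proof -
 show c: "z \<in> closed_annulus (exp a) (exp b)" using assms unfolding open_annulus_def closed_annulus_def by auto
 have nz: "0 < norm z" using annulus_ln(1)[OF c] by simp
 have "ln (exp a) < ln (norm z)" "ln (norm z) < ln (exp b)"
  using assms nz unfolding open_annulus_def by (auto simp del: ln_exp)
 then show "a < ln (norm z)" "ln (norm z) < b" by auto
 then show "a < Re (Ln z)" "Re (Ln z) < b" using annulus_ln(1)[OF c] by auto
qed

lemma open_open_annulus: "open (open_annulus r R)"
proof -
 have "open_annulus r R = norm -` {r<..} \<inter> norm -` {..<R}" unfolding open_annulus_def by auto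
 then show ?thesis by (auto intro!: open_Int open_vimage continuous_intros)
qed

lemma descend_eq:
 assumes "periodic_strip F a b" "a \<le> Re w" "Re w \<le> b" "\<exists>m::int. w' = w + full_turn m"
 shows "F w' = F w"
 using assms unfolding periodic_strip_def by blast

lemma descend_continuous:
 assumes per: "periodic_strip F a b" and co: "continuous_on S F"
  and S: "\<And>z. z \<in> A \<Longrightarrow> Ln z \<in> S" "\<And>w (m::int). w + full_turn m \<in> S \<Longrightarrow> w \<in> S"
  and A: "A \<subseteq> closed_annulus (exp a) (exp b)"
 shows "continuous_on A (\<lambda>z. F (Ln z))"
 unfolding continuous_on_def
proof
 fix z0 assume z0: "z0 \<in> A"
 obtain U g where U: "open U" "z0 \<in> U" "0 \<notin> U" "g z0 = Ln z0"
  "\<And>z. z \<in> U \<Longrightarrow> (g has_field_derivative 1 / z) (at z)"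
  "\<And>z. z \<in> U \<Longrightarrow> Re (g z) = ln (norm z)"
  "\<And>z. z \<in> U \<Longrightarrow> \<exists>m::int. Ln z = g z + full_turn m"
 proof (rule Ln_local[of z0])
  show "z0 \<noteq> 0" using annulus_ln(1) A z0 by blast
 qed blast
 have gS: "g z \<in> S" if z: "z \<in> A \<inter> U" for z
 proof -
  obtain m :: int where "Ln z = g z + full_turn m" using U(7) z by blast
  then show ?thesis using S(2)[of "g z" m] S(1)[of z] z by simp
 qed
 have "continuous_on (A \<inter> U) (\<lambda>z. F (g z))"
 proof (rule continuous_on_compose2[OF co])
  show "continuous_on (A \<inter> U) g"
   using U(5) by (meson DERIV_isCont Int_iff continuous_at_imp_continuous_on)
  show "g ` (A \<inter> U) \<subseteq> S" using gS by blast
 qed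
 then have "((\<lambda>z. F (g z)) \<longlongrightarrow> F (g z0)) (at z0 within (A \<inter> U))"
  using z0 U unfolding continuous_on_def by blast
 moreover have e: "F (Ln z) = F (g z)" if "z \<in> A \<inter> U" for z
 proof -
  have "z \<in> closed_annulus (exp a) (exp b)" "Re (g z) = ln (norm z)" using that A U(6) by auto
  then show ?thesis using annulus_ln(2,3)[of z a b] by (intro descend_eq[OF per _ _ U(7)]) (use that in auto)
 qed
 then have "\<forall>\<^sub>F z in at z0 within (A \<inter> U). F (g z) = F (Ln z)"
  unfolding eventually_at_filter by (intro always_eventually) simp
 ultimately have "((\<lambda>z. F (Ln z)) \<longlongrightarrow> F (Ln z0)) (at z0 within (A \<inter> U))"
  unfolding U(4) by (simp only: tendsto_cong)
 moreover have "at z0 within (A \<inter> U) = at z0 within A"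
  by (rule at_within_nhd[OF U(2,1)]) auto
 ultimately show "((\<lambda>z. F (Ln z)) \<longlongrightarrow> F (Ln z0)) (at z0 within A)" by simp
qed

lemma descend_has_derivative:
 fixes F :: "complex \<Rightarrow> 'a::real_normed_vector"
 assumes per: "periodic_strip F a b" and z0: "z0 \<in> open_annulus (exp a) (exp b)"
  and d: "(F has_derivative D) (at (Ln z0))"
 shows "((\<lambda>z. F (Ln z)) has_derivative (\<lambda>h. D (h / z0))) (at z0)"
proof -
 have nz: "z0 \<noteq> 0" using open_annulus_ln(1)[OF z0] annulus_ln(1) by blast
 obtain U g where U: "open U" "z0 \<in> U" "0 \<notin> U" "g z0 = Ln z0"
  "\<And>z. z \<in> U \<Longrightarrow> (g has_field_derivative 1 / z) (at z)"
  "\<And>z. z \<in> U \<Longrightarrow> Re (g z) = ln (norm z)"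
  "\<And>z. z \<in> U \<Longrightarrow> \<exists>m::int. Ln z = g z + full_turn m"
  by (rule Ln_local[OF nz]) blast
 have g': "(g has_derivative (\<lambda>h. h / z0)) (at z0)"
  using U(5)[OF U(2)] unfolding has_field_derivative_def by (rule has_derivative_eq_rhs) auto
 have "((\<lambda>z. F (g z)) has_derivative (\<lambda>h. D (h / z0))) (at z0)"
  by (rule has_derivative_compose[OF g']) (use d U(4) in simp)
 then show ?thesis
 proof (rule has_derivative_transform_within_open[of _ _ _ _ "U \<inter> open_annulus (exp a) (exp b)"])
  show "open (U \<inter> open_annulus (exp a) (exp b))" using U(1) open_open_annulus by blast
  show "z0 \<in> U \<inter> open_annulus (exp a) (exp b)" using U z0 by blast
  fix z assume z: "z \<in> U \<inter> open_annulus (exp a) (exp b)"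
  have "Re (g z) = ln (norm z)" using z U(6) by auto
  then have "F (Ln z) = F (g z)"
   using open_annulus_ln(2,3)[of z a b] z by (intro descend_eq[OF per _ _ U(7)]) auto
  then show "F (g z) = F (Ln z)" by simp
 qed
qed

lemma descend_holomorphic:
 assumes per: "periodic_strip F a b" and h: "F holomorphic_on {w. a < Re w \<and> Re w < b}"
 shows "(\<lambda>z. F (Ln z)) holomorphic_on (open_annulus (exp a) (exp b))"
proof -
 have "open {w::complex. a < Re w \<and> Re w < b}"
  using open_halfspace_Re_gt[of a] open_halfspace_Re_lt[of b] by (simp add: Collect_conj_eq open_Int)
 note op = this
 show ?thesis unfolding holomorphic_on_open[OF open_open_annulus]
 proof (intro ballI)
  fix z assume z: "z \<in> open_annulus (exp a) (exp b)"
  have "(F has_field_derivative deriv F (Ln z)) (at (Ln z))"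
   by (rule holomorphic_derivI[OF h op]) (use open_annulus_ln[OF z] in auto)
  then have "(F has_derivative (\<lambda>h. deriv F (Ln z) * h)) (at (Ln z))" by (simp add: has_field_derivative_def)
  from descend_has_derivative[OF per z this]
  have "((\<lambda>z. F (Ln z)) has_derivative (\<lambda>h. deriv F (Ln z) * (h / z))) (at z)" .
  then have "((\<lambda>z. F (Ln z)) has_field_derivative (deriv F (Ln z) / z)) (at z)"
   unfolding has_field_derivative_def by (rule has_derivative_eq_rhs) auto
  then show "\<exists>f'. ((\<lambda>z. F (Ln z)) has_field_derivative f') (at z)" by blast
 qed
qed

context ortho_frame begin

text \<open>The real part of a complex vector in the frame.\<close>
definition "R3 x y z = Re x *\<^sub>R a + Re y *\<^sub>R b + Re z *\<^sub>R u"

lemma R3_inner: "R3 x y z \<bullet> R3 x' y' z' = Re x * Re x' + Re y * Re y' + Re z * Re z'"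
 by (simp add: R3_def inner_add_left inner_add_right dots)

lemma cross_bu: "cross3 b u = a" "cross3 u a = b"
proof -
 have t: "cross3 x y \<bullet> z = cross3 y z \<bullet> x" for x y z :: "real^3" by (simp add: cross3_simps)
 have "cross3 b u \<bullet> a = 1" using t[of a b u] cr dots by simp
 moreover have "cross3 b u \<bullet> b = 0" "cross3 b u \<bullet> u = 0" by (simp_all add: dot_cross_self)
 ultimately show "cross3 b u = a" using expand[of "cross3 b u"] by simp
 have "cross3 u a \<bullet> b = 1" using t[of u a b] cr dots by simp
 moreover have "cross3 u a \<bullet> a = 0" "cross3 u a \<bullet> u = 0" by (simp_all add: dot_cross_self)
 ultimately show "cross3 u a = b" using expand[of "cross3 u a"] by simp
qed

lemma cross_frame_coords:
 "cross3 (x1 *\<^sub>R a + x2 *\<^sub>R b + x3 *\<^sub>R u) (y1 *\<^sub>R a + y2 *\<^sub>R b + y3 *\<^sub>R u)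
  = (x2 * y3 - x3 * y2) *\<^sub>R a + (x3 * y1 - x1 * y3) *\<^sub>R b + (x1 * y2 - x2 * y1) *\<^sub>R u"
proof -
 have "cross3 b a = - u" "cross3 u b = - a" "cross3 a u = - b"
  using cr cross_bu cross_skew by metis+
 then show ?thesis
  by (simp add: cross_add_left cross_add_right cross_mult_left cross_mult_right cr cross_bu algebra_simps)
qed

lemma R3_has_derivative:
 assumes "(f1 has_field_derivative d1) (at z)" "(f2 has_field_derivative d2) (at z)" "(f3 has_field_derivative d3) (at z)"
 shows "((\<lambda>z. R3 (f1 z) (f2 z) (f3 z)) has_derivative (\<lambda>h. R3 (d1 * h) (d2 * h) (d3 * h))) (at z)"
proof -
 have R: "((\<lambda>z. Re (f z)) has_derivative (\<lambda>h. Re (d * h))) (at z)" if "(f has_field_derivative d) (at z)" for f d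
  using bounded_linear.has_derivative[OF bounded_linear_Re] that unfolding has_field_derivative_def by blast
 show ?thesis unfolding R3_def
  by (intro has_derivative_add has_derivative_scaleR_left R assms)
qed

lemma pderiv_R3:
 assumes "(Y has_derivative (\<lambda>h. R3 (x * h) (y * h) (w * h))) (at z)"
 shows "pderiv_dir v Y z = R3 (x * v) (y * v) (w * v)"
 unfolding pderiv_dir_def using frechet_derivative_at[OF assms] by metis

lemma pderiv_has_derivative:
 assumes S: "open S" "z \<in> S"
  and h: "\<Phi>1 holomorphic_on S" "\<Phi>2 holomorphic_on S" "\<Phi>3 holomorphic_on S"
  and d: "\<And>z. z \<in> S \<Longrightarrow> (Y has_derivative (\<lambda>h. R3 (\<Phi>1 z * h) (\<Phi>2 z * h) (\<Phi>3 z * h))) (at z)"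
 shows "(pderiv_dir v Y has_derivative (\<lambda>h. R3 (deriv \<Phi>1 z * v * h) (deriv \<Phi>2 z * v * h) (deriv \<Phi>3 z * v * h))) (at z)"
proof -
 have "((\<lambda>z. R3 (\<Phi>1 z * v) (\<Phi>2 z * v) (\<Phi>3 z * v)) has_derivative (\<lambda>h. R3 (deriv \<Phi>1 z * v * h) (deriv \<Phi>2 z * v * h) (deriv \<Phi>3 z * v * h))) (at z)"
  by (intro R3_has_derivative DERIV_cmult_right holomorphic_derivI[OF _ S] h)
 then show ?thesis
  by (rule has_derivative_transform_within_open[OF _ S]) (simp add: pderiv_R3[OF d])
qed

lemma real_part_smooth:
 assumes S: "open S"
  and h: "\<Phi>1 holomorphic_on S" "\<Phi>2 holomorphic_on S" "\<Phi>3 holomorphic_on S"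
  and d: "\<And>z. z \<in> S \<Longrightarrow> (Y has_derivative (\<lambda>h. R3 (\<Phi>1 z * h) (\<Phi>2 z * h) (\<Phi>3 z * h))) (at z)"
 shows "C_on k Y S"
 using h d
proof (induction k arbitrary: Y \<Phi>1 \<Phi>2 \<Phi>3)
 case 0
 have "isCont Y z" if "z \<in> S" for z using has_derivative_continuous[OF 0(4)[OF that]] .
 then show ?case by (simp add: continuous_at_imp_continuous_on)
next
 case (Suc k)
 have "C_on k (pderiv_dir v Y) S" for v
 proof (rule Suc.IH)
  show "(\<lambda>z. deriv \<Phi>1 z * v) holomorphic_on S" "(\<lambda>z. deriv \<Phi>2 z * v) holomorphic_on S" "(\<lambda>z. deriv \<Phi>3 z * v) holomorphic_on S"
   by (intro holomorphic_intros holomorphic_deriv Suc.prems S)+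
  fix z assume z: "z \<in> S"
  show "(pderiv_dir v Y has_derivative (\<lambda>h. R3 (deriv \<Phi>1 z * v * h) (deriv \<Phi>2 z * v * h) (deriv \<Phi>3 z * v * h))) (at z)"
   by (rule pderiv_has_derivative[OF S z Suc.prems])
 qed
 moreover have "Y differentiable (at z)" if "z \<in> S" for z
  using Suc.prems(4)[OF that] by (rule differentiableI)
 ultimately show ?case by simp
qed

text \<open>For the real part of a null curve the coordinates are isothermal, \<open>E = G\<close> and \<open>F = 0\<close>, and its second derivatives satisfy
 \<open>X\<^sub>v\<^sub>v = - X\<^sub>u\<^sub>u\<close>.\<close>
lemma null_curve_minimal:
 assumes S: "open S"
  and h: "\<Phi>1 holomorphic_on S" "\<Phi>2 holomorphic_on S" "\<Phi>3 holomorphic_on S"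
  and d: "\<And>z. z \<in> S \<Longrightarrow> (Y has_derivative (\<lambda>h. R3 (\<Phi>1 z * h) (\<Phi>2 z * h) (\<Phi>3 z * h))) (at z)"
  and null: "\<And>z. z \<in> S \<Longrightarrow> (\<Phi>1 z)\<^sup>2 + (\<Phi>2 z)\<^sup>2 + (\<Phi>3 z)\<^sup>2 = 0"
  and ne: "\<And>z. z \<in> S \<Longrightarrow> cross3 (pderiv_dir 1 Y z) (pderiv_dir \<i> Y z) \<noteq> 0"
 shows "minimal_immersion_on S Y"
 unfolding minimal_immersion_on_def
proof (intro conjI allI ballI)
 show "C_on k Y S" for k by (rule real_part_smooth[OF S h d])
 fix z assume z: "z \<in> S"
 show "cross3 (pderiv_dir 1 Y z) (pderiv_dir \<i> Y z) \<noteq> 0" using ne z .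
 have p1: "pderiv_dir v Y z = R3 (\<Phi>1 z * v) (\<Phi>2 z * v) (\<Phi>3 z * v)" for v by (rule pderiv_R3[OF d[OF z]])
 have p2: "pderiv_dir w (pderiv_dir v Y) z = R3 (deriv \<Phi>1 z * v * w) (deriv \<Phi>2 z * v * w) (deriv \<Phi>3 z * v * w)" for v w
  by (rule pderiv_R3[OF pderiv_has_derivative[OF S z h d]])
 have p3: "pderiv_dir \<i> (pderiv_dir \<i> Y) z = - pderiv_dir 1 (pderiv_dir 1 Y) z" unfolding p2 by (simp add: R3_def)
 have "Re ((\<Phi>1 z)\<^sup>2 + (\<Phi>2 z)\<^sup>2 + (\<Phi>3 z)\<^sup>2) = 0" "Im ((\<Phi>1 z)\<^sup>2 + (\<Phi>2 z)\<^sup>2 + (\<Phi>3 z)\<^sup>2) = 0" unfolding null[OF z] by auto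
 then have EG: "pderiv_dir 1 Y z \<bullet> pderiv_dir 1 Y z = pderiv_dir \<i> Y z \<bullet> pderiv_dir \<i> Y z"
  and F: "pderiv_dir 1 Y z \<bullet> pderiv_dir \<i> Y z = 0" unfolding p1 R3_inner by (auto simp: power2_eq_square algebra_simps)
 show "mean_curvature Y z = 0"
  unfolding mean_curvature_def Let_def EG F p3 by simp
qed

text \<open>The normal depends only on \<open>\<Psi>\<close>: the factor \<open>q\<close> rotates and scales the tangent vectors in their plane.\<close>
lemma cross_weierstrass:
 shows "cross3 (R3 (q * sinh \<Psi>) (q * (- \<i> * cosh \<Psi>)) q) (R3 (q * sinh \<Psi> * \<i>) (q * (- \<i> * cosh \<Psi>) * \<i>) (q * \<i>))
   = - (((norm q)\<^sup>2 * cosh (Re \<Psi>)) *\<^sub>R (cos (Im \<Psi>) *\<^sub>R a + sin (Im \<Psi>) *\<^sub>R b - sinh (Re \<Psi>) *\<^sub>R u))"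
proof -
 have sc: "Re (sinh \<Psi>) = sinh (Re \<Psi>) * cos (Im \<Psi>)" "Im (sinh \<Psi>) = cosh (Re \<Psi>) * sin (Im \<Psi>)"
   "Re (cosh \<Psi>) = cosh (Re \<Psi>) * cos (Im \<Psi>)" "Im (cosh \<Psi>) = sinh (Re \<Psi>) * sin (Im \<Psi>)"
  by (simp_all add: Re_Im_sinh_cosh)
 define s ch co si x y where "s = sinh (Re \<Psi>)" "ch = cosh (Re \<Psi>)" "co = cos (Im \<Psi>)" "si = sin (Im \<Psi>)" "x = Re q" "y = Im q"
 note df = this
 have n: "(norm q)\<^sup>2 = x\<^sup>2 + y\<^sup>2" by (simp add: df cmod_power2)
 have "co\<^sup>2 + si\<^sup>2 = 1" by (simp add: df)
 then have c1: "co\<^sup>2 = 1 - si\<^sup>2" by simp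
 let ?L1 = "Re (q * (- \<i> * cosh \<Psi>)) * Re (q * \<i>) - Re q * Re (q * (- \<i> * cosh \<Psi>) * \<i>)"
 let ?L2 = "Re q * Re (q * sinh \<Psi> * \<i>) - Re (q * sinh \<Psi>) * Re (q * \<i>)"
 let ?L3 = "Re (q * sinh \<Psi>) * Re (q * (- \<i> * cosh \<Psi>) * \<i>) - Re (q * (- \<i> * cosh \<Psi>)) * Re (q * sinh \<Psi> * \<i>)"
 have 1: "?L1 = - ((x\<^sup>2 + y\<^sup>2) * ch * co)" by (simp add: sc df[symmetric] algebra_simps power2_eq_square)
 have 2: "?L2 = - ((x\<^sup>2 + y\<^sup>2) * ch * si)" by (simp add: sc df[symmetric] algebra_simps power2_eq_square)
 have "?L3 = (x\<^sup>2 + y\<^sup>2) * ch * s * (co\<^sup>2 + si\<^sup>2)" by (simp add: sc df[symmetric] algebra_simps power2_eq_square)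
 then have 3: "?L3 = (x\<^sup>2 + y\<^sup>2) * ch * s" using c1 by simp
show ?thesis unfolding R3_def cross_frame_coords 1 2 3 unfolding n df[symmetric]
  by (simp add: scaleR_right_distrib scaleR_right_diff_distrib mult.assoc)
qed

end

text \<open>The points of the curve are on the relative boundary of its convex hull because of the supporting functionals. Strictness also prevents three points of the
 curve from being collinear, so the hull has dimension \<open>2\<close>.\<close>
lemma strict_support_convex_planar_curve:
 fixes g :: "real \<Rightarrow> real^3"
 assumes g: "simple_path g" and N: "N \<noteq> 0" "\<And>x. x \<in> path_image g \<Longrightarrow> N \<bullet> x = d"
  and supp: "\<And>x. x \<in> path_image g \<Longrightarrow> \<exists>v. \<forall>y\<in>path_image g. y \<noteq> x \<longrightarrow> v \<bullet> y < v \<bullet> x"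
 shows "convex_planar_curve g"
proof -
 define K where "K = convex hull (path_image g)"
 have sub: "path_image g \<subseteq> K" unfolding K_def by (rule hull_subset)
 have nb: "\<not> between (y, z) x" if pts: "x \<in> path_image g" "y \<in> path_image g" "z \<in> path_image g" "y \<noteq> x" "z \<noteq> x" for x y z
 proof
  assume "between (y, z) x"
  then obtain t where t: "0 \<le> t" "t \<le> 1" "x = (1 - t) *\<^sub>R y + t *\<^sub>R z" unfolding between_mem_segment closed_segment_def by blast
  obtain v where v: "v \<bullet> y < v \<bullet> x" "v \<bullet> z < v \<bullet> x" using supp[of x] pts by blast
  have "v \<bullet> x = (1 - t) * (v \<bullet> y) + t * (v \<bullet> z)" using arg_cong[OF t(3), of "\<lambda>x. v \<bullet> x"] by (simp add: inner_add_right)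
  also have "\<dots> < v \<bullet> x" by (rule convex_bound_lt[OF v]) (use t in auto)
  finally show False by simp
 qed
 obtain p1 p2 p3 where p: "p1 \<in> path_image g" "p2 \<in> path_image g" "p3 \<in> path_image g" "p1 \<noteq> p2" "p2 \<noteq> p3" "p1 \<noteq> p3"
 proof -
  have i: "g x = g y \<Longrightarrow> x = y" if "x \<in> {0<..<1}" "y \<in> {0<..<1}" for x y
   using g that unfolding simple_path_def loop_free_def by fastforce
  show thesis
  proof (rule that[of "g (1/4)" "g (1/2)" "g (3/4)"])
   show "g (1/4) \<noteq> g (1/2)" "g (1/2) \<noteq> g (3/4)" "g (1/4) \<noteq> g (3/4)" using i[of "1/4" "1/2"] i[of "1/2" "3/4"] i[of "1/4" "3/4"] by auto
  qed (auto simp: path_image_def)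
 qed
 have "\<not> collinear K"
 proof
  assume "collinear K"
  then have "collinear {p1, p2, p3}" by (rule collinear_subset) (use p sub in auto)
  then show False unfolding collinear_between_cases using nb p by metis
 qed
 then have "\<not> aff_dim K \<le> 1" by (simp add: collinear_aff_dim)
 moreover have "aff_dim K \<le> 2"
 proof -
  have "K \<subseteq> {x. N \<bullet> x = d}" unfolding K_def
   by (rule hull_minimal) (use N(2) convex_hyperplane in auto)
  then have "aff_dim K \<le> aff_dim {x. N \<bullet> x = d}" by (rule aff_dim_subset)
  then show ?thesis using aff_dim_hyperplane[OF N(1), of d] by simp
 qed
 ultimately have ad: "aff_dim K = 2" by simp
 have cK: "convex K" by (simp add: K_def)
 have "x \<in> rel_frontier K" if x: "x \<in> path_image g" for x
 proof -
  obtain v where v: "\<And>y. y \<in> path_image g \<Longrightarrow> y \<noteq> x \<Longrightarrow> v \<bullet> y < v \<bullet> x" using supp[of x] x by blast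
  have vK: "v \<bullet> y \<le> v \<bullet> x" if "y \<in> K" for y
  proof -
   have "K \<subseteq> {y. v \<bullet> y \<le> v \<bullet> x}" unfolding K_def
    by (rule hull_minimal) (use v convex_halfspace_le in "force+")
   then show ?thesis using that by blast
  qed
  obtain y where y: "y \<in> path_image g" "y \<noteq> x" using p by metis
  have "x \<notin> rel_interior K"
  proof
   assume "x \<in> rel_interior K"
   then obtain e where e: "1 < e" "(1 - e) *\<^sub>R y + e *\<^sub>R x \<in> K"
    using convex_rel_interior_iff[OF cK, of x] sub y by auto
   have "v \<bullet> ((1 - e) *\<^sub>R y + e *\<^sub>R x) \<le> v \<bullet> x" by (rule vK[OF e(2)])
   then have "(e - 1) * (v \<bullet> x - v \<bullet> y) \<le> 0" by (simp add: inner_add_right algebra_simps)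
   moreover have "0 < (e - 1) * (v \<bullet> x - v \<bullet> y)" using e(1) v[OF y] by simp
   ultimately show False by linarith
  qed
  moreover have "x \<in> closure K" using sub x closure_subset by blast
  ultimately show ?thesis by (simp add: rel_frontier_def)
 qed
 then show ?thesis unfolding convex_planar_curve_def using g cK ad by blast
qed

section \<open>The annulus in the pyramid\<close>

context gauss_map begin

text \<open>Extension of \<open>shift_int\<close> to the boundary by continuity.\<close>
lemma \<Psi>_shift_int:
 assumes w: "w \<in> \<Omega>"
 shows "\<Psi> (w + turn k) = \<Psi> w + turn k"
  "DX (w + turn k) = DX w"
proof -
 let ?s = "turn k"
 have c2: "continuous_on \<Omega> (\<lambda>w. \<Psi> (w + ?s))" "continuous_on \<Omega> (\<lambda>w. DX (w + ?s))"
  by (rule continuous_on_compose2[OF \<Psi>_cont(1)] continuous_on_compose2[OF \<Psi>_cont(2)], auto intro!: continuous_intros simp: \<Omega>_def)+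
 have e: "\<Psi> (w + ?s) = \<Psi> w + ?s" "DX (w + ?s) = DX w" if "w \<in> HS" for w
 proof -
  have "0 \<le> Re w" "Re w < l" "\<bar>Re w\<bar> < l" "Re (w + ?s) = Re w" using that by (auto simp: HS_def)
  then show "\<Psi> (w + ?s) = \<Psi> w + ?s" "DX (w + ?s) = DX w"
   using shift_int[of w k] \<Psi>_eq[of w] \<Psi>_eq[of "w + ?s"] by simp_all
 qed
 show "\<Psi> (w + ?s) = \<Psi> w + ?s"
  by (rule \<Omega>_agree[OF c2(1) _ _ w]) (use e in "auto intro!: continuous_intros \<Psi>_cont")
 show "DX (w + ?s) = DX w"
  by (rule \<Omega>_agree[OF c2(2) _ _ w]) (use e in "auto intro!: continuous_intros \<Psi>_cont")
qed

lemma period_shift: "full_turn m = turn (int n * m)"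
proof -
 have pe: "pi = real n * eps" using eps(4) by simp
 show ?thesis unfolding pe by (simp add: algebra_simps)
qed

lemma \<Psi>_period:
 assumes "w \<in> \<Omega>"
 shows "\<Psi> (w + full_turn m) = \<Psi> w + full_turn m"
  "DX (w + full_turn m) = DX w"
 unfolding period_shift by (rule \<Psi>_shift_int[OF assms])+

lemma sinh_cosh_period: "sinh (x + full_turn m) = sinh x" "cosh (x + full_turn m) = cosh x"
proof -
 have "exp (full_turn m) = 1" unfolding exp_eq_1 by (auto intro!: exI[of _ m])
 then show "sinh (x + full_turn m) = sinh x" "cosh (x + full_turn m) = cosh x"
  by (simp_all only: sinh_field_def cosh_field_def exp_add exp_minus mult_1_right)
qed

lemma \<Omega>_interior: "open {w::complex. 0 < Re w \<and> Re w < l}"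
 using open_halfspace_Re_gt[of 0] open_halfspace_Re_lt[of l] by (simp add: Collect_conj_eq open_Int)

lemma at_within_\<Omega>: assumes "0 < Re w" "Re w < l" shows "at w within \<Omega> = at w"
proof (rule at_within_open_subset[OF _ \<Omega>_interior])
 show "{w. 0 < Re w \<and> Re w < l} \<subseteq> \<Omega>" by (auto simp: \<Omega>_def)
qed (use assms in auto)

lemma inner_hol: "\<Psi> holomorphic_on {w. 0 < Re w \<and> Re w < l}" "DX holomorphic_on {w. 0 < Re w \<and> Re w < l}"
proof -
 have sub: "{w. 0 < Re w \<and> Re w < l} \<subseteq> Str" by auto
 show "\<Psi> holomorphic_on {w. 0 < Re w \<and> Re w < l}"
  by (rule holomorphic_transform[OF holomorphic_on_subset[OF \<psi>_hol sub]]) (simp add: \<Psi>_eq)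
 show "DX holomorphic_on {w. 0 < Re w \<and> Re w < l}"
  by (rule holomorphic_transform[OF holomorphic_on_subset[OF D_hol sub]]) (simp add: \<Psi>_eq)
qed

lemma corner_shift: "w + full_turn m \<in> \<Omega> - corners \<Longrightarrow> w \<in> \<Omega> - corners"
proof -
 assume a: "w + full_turn m \<in> \<Omega> - corners"
 have "w \<notin> corners"
 proof
  assume "w \<in> corners"
  then obtain k :: int where k: "Re w = l" "Im w = (2 * of_int k + 1) * eps" unfolding corners_def by blast
  have "Im (w + full_turn m) = (2 * of_int (k + int n * m) + 1) * eps"
   unfolding period_shift using k by (simp add: algebra_simps)
  then have "w + full_turn m \<in> corners" unfolding corners_def using k(1) by (auto simp del: of_int_add of_int_mult)
  then show False using a by blast
 qed
 then show ?thesis using a by (simp add: \<Omega>_def)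
qed

text \<open>Face \<open>k\<close> is face \<open>0\<close> for the parameter moved back by \<open>k\<close> turns.\<close>
lemma rotated_face_ineq:
 assumes w: "w \<in> \<Omega>"
 shows "T * Re (f w * cis (- (2 * real k * eps))) + ht w \<le> dd"
  "T * Re (f w * cis (- (2 * real k * eps))) + ht w = dd \<longleftrightarrow>
    Re w = l \<and> (\<exists>m::int. \<bar>Im w - of_int (2 * (int k + int n * m)) * eps\<bar> \<le> eps)"
proof -
 let ?v = "w + turn (- int k)"
 have v: "?v \<in> \<Omega>" using w by (simp add: \<Omega>_def)
 have e: "f ?v = f w * cis (- (2 * real k * eps))" "ht ?v = ht w"
  using f_shift_int[OF w, of "- int k"] by (simp_all add: mult.commute)
 have i: "Im ?v - 2 * pi * of_int m = Im w - of_int (2 * (int k + int n * m)) * eps" for m :: int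
 proof -
  have pe: "pi = real n * eps" using eps(4) by simp
  show ?thesis unfolding pe by (simp add: algebra_simps)
 qed
 show "T * Re (f w * cis (- (2 * real k * eps))) + ht w \<le> dd" using face_ineq(1)[OF v] unfolding e .
 show "T * Re (f w * cis (- (2 * real k * eps))) + ht w = dd \<longleftrightarrow>
    Re w = l \<and> (\<exists>m::int. \<bar>Im w - of_int (2 * (int k + int n * m)) * eps\<bar> \<le> eps)"
  using face_ineq(2)[OF v] unfolding e i by simp
qed

end

text \<open>The slope of the Gauss image is that of the pyramid; only the scale is left, and \<open>lam\<close> adjusts it.\<close>
locale gauss_pyramid = gauss_map n T l \<psi> + py: pyramid_frame c a b u n h T
 for n :: nat and T l :: real and \<psi> :: "complex \<Rightarrow> complex" and c a b u :: "real^3" and h :: real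
begin

text \<open>\<open>Xs\<close> and \<open>nus\<close> are the surface and its unit normal in the strip; \<open>X\<close> is the surface in the annulus, whose universal cover is
 the closed half strip by means of the exponential function.\<close>
definition "lam = h / dd"
definition "Xs w = py.E (of_real lam * f w) (lam * ht w)"
definition "X z = Xs (Ln z)"
definition "nus w = - ((1 / cosh (Re (\<Psi> w))) *\<^sub>R (cos (Im (\<Psi> w)) *\<^sub>R a + sin (Im (\<Psi> w)) *\<^sub>R b - sinh (Re (\<Psi> w)) *\<^sub>R u))"
abbreviation "CA \<equiv> closed_annulus 1 (exp l)"
abbreviation "OA \<equiv> open_annulus 1 (exp l)"

lemma lam: "0 < lam" "lam * dd = h" using dd_pos py.H by (auto simp: lam_def)

lemma e_eps: "py.e = eps" by (simp add: py.e_def eps_def)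

lemma CA_ln: assumes "z \<in> CA" shows "z \<noteq> 0" "Ln z \<in> \<Omega>"
 using annulus_ln[of z 0 l] assms by (auto simp: \<Omega>_def)

lemma OA_ln: assumes "z \<in> OA" shows "z \<in> CA" "0 < Re (Ln z)" "Re (Ln z) < l" "Ln z \<in> \<Omega>" "Ln z \<notin> corners"
 using open_annulus_ln[of z 0 l] assms not_corner(1)[of "Ln z"] CA_ln(2)[of z] by auto

lemma periodic: "periodic_strip Xs 0 l" "periodic_strip nus 0 l" "periodic_strip ht 0 l" "periodic_strip f 0 l"
 "periodic_strip (\<lambda>w. sinh (\<Psi> w) / DX w) 0 l" "periodic_strip (\<lambda>w. - \<i> * cosh (\<Psi> w) / DX w) 0 l"
 "periodic_strip (\<lambda>w. 1 / DX w) 0 l"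
proof -
 have cs: "cos (x + real_of_int m * (2 * pi)) = cos x" "sin (x + real_of_int m * (2 * pi)) = sin x" for x m
  using cis_multiple_2pi[of "real_of_int m"] by (auto simp: cos_add sin_add complex_eq_iff mult_ac)
 have O: "0 \<le> Re w \<Longrightarrow> Re w \<le> l \<Longrightarrow> w \<in> \<Omega>" for w by (simp add: \<Omega>_def)
 show "periodic_strip Xs 0 l" "periodic_strip ht 0 l" "periodic_strip f 0 l"
  unfolding periodic_strip_def Xs_def using f_period O by simp_all
 show "periodic_strip nus 0 l"
  unfolding periodic_strip_def nus_def using \<Psi>_period O by (simp add: cs)
 show "periodic_strip (\<lambda>w. sinh (\<Psi> w) / DX w) 0 l" "periodic_strip (\<lambda>w. - \<i> * cosh (\<Psi> w) / DX w) 0 l" "periodic_strip (\<lambda>w. 1 / DX w) 0 l"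
  unfolding periodic_strip_def using \<Psi>_period O sinh_cosh_period by simp_all
qed

lemma Xs_cont: "continuous_on \<Omega> Xs" and nus_cont: "continuous_on \<Omega> nus"
proof -
 show "continuous_on \<Omega> Xs" unfolding Xs_def[abs_def] by (intro py.continuous_on_E continuous_intros f_cont)
 have ch: "cosh (Re (\<Psi> w)) \<noteq> 0" for w using cosh_real_pos[of "Re (\<Psi> w)"] by linarith
 show "continuous_on \<Omega> nus" unfolding nus_def[abs_def] by (intro continuous_intros \<Psi>_cont) (use ch in auto)
qed

lemma descend: assumes "periodic_strip F 0 l" "continuous_on \<Omega> F" shows "continuous_on CA (\<lambda>z. F (Ln z))"
 by (rule descend_continuous[OF assms]) (use CA_ln in "auto simp: \<Omega>_def")

lemma X_exp: assumes "w \<in> \<Omega>" shows "X (exp w) = Xs w" "nus (Ln (exp w)) = nus w"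
proof -
 have "exp (Ln (exp w)) = exp w" by simp
 then obtain m :: int where "Ln (exp w) = w + (of_int (2 * m) * pi) * \<i>" unfolding exp_eq by blast
 then have "\<exists>m::int. Ln (exp w) = w + full_turn m" by (intro exI[of _ m]) (simp add: algebra_simps)
 then show "X (exp w) = Xs w" "nus (Ln (exp w)) = nus w" unfolding X_def
  using descend_eq[OF periodic(1)] descend_eq[OF periodic(2)] assms by (auto simp: \<Omega>_def)
qed

lemma X_images:
 "X ` CA = Xs ` \<Omega>" "X ` sphere 0 1 = Xs ` {w. Re w = 0}" "X ` sphere 0 (exp l) = Xs ` {w. Re w = l}"
proof -
 have *: "X ` A = Xs ` B" if "\<And>z. z \<in> A \<Longrightarrow> Ln z \<in> B" "\<And>w. w \<in> B \<Longrightarrow> exp w \<in> A" "B \<subseteq> \<Omega>" for A B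
 proof
  show "X ` A \<subseteq> Xs ` B" unfolding X_def using that(1) by blast
  show "Xs ` B \<subseteq> X ` A"
  proof
   fix x assume "x \<in> Xs ` B"
   then obtain w where w: "w \<in> B" "x = Xs w" by blast
   then have "x = X (exp w)" using X_exp(1)[of w] that(3) by auto
   then show "x \<in> X ` A" using that(2)[OF w(1)] by blast
  qed
 qed
 show "X ` CA = Xs ` \<Omega>"
  by (rule *) (use CA_ln in "auto simp: closed_annulus_def \<Omega>_def")
 show "X ` sphere 0 1 = Xs ` {w. Re w = 0}"
 proof (rule *)
  show "Ln z \<in> {w. Re w = 0}" if "z \<in> sphere 0 1" for z
  proof -
   have "z \<noteq> 0" "norm z = 1" using that by auto
   then show ?thesis by simp
  qed
 qed (use l in "auto simp: \<Omega>_def")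
 show "X ` sphere 0 (exp l) = Xs ` {w. Re w = l}"
 proof (rule *)
  show "Ln z \<in> {w. Re w = l}" if "z \<in> sphere 0 (exp l)" for z
  proof -
   have "norm z = exp l" using that by simp
   then have "z \<noteq> 0" using exp_gt_zero[of l] by (metis norm_zero less_irrefl)
   then show ?thesis using \<open>norm z = exp l\<close> by simp
  qed
 qed (use l in "auto simp: \<Omega>_def")
qed

lemma Xs_inj: assumes "w \<in> \<Omega>" "w' \<in> \<Omega>" "of_real lam * f w = of_real lam * f w'"
 shows "\<exists>m::int. w = w' + full_turn m"
 by (rule f_inj_mod[OF assms(1,2)]) (use assms(3) lam in auto)

lemma X_inj: assumes "z \<in> CA" "z' \<in> CA" "of_real lam * f (Ln z) = of_real lam * f (Ln z')" shows "z = z'"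
proof -
 obtain m :: int where m: "Ln z = Ln z' + full_turn m"
  using Xs_inj[OF _ _ assms(3)] CA_ln assms by blast
 have "exp (Ln z) = exp (Ln z')" unfolding exp_eq m by (intro exI[of _ m]) (simp add: algebra_simps)
 then show ?thesis using CA_ln assms by simp
qed

lemma Xs_deriv:
 assumes "0 < Re w" "Re w < l"
 shows "(Xs has_derivative (\<lambda>h. py.R3 (of_real lam * (sinh (\<Psi> w) / DX w) * h) (of_real lam * (- \<i> * cosh (\<Psi> w) / DX w) * h) (of_real lam * (1 / DX w) * h))) (at w)"
proof -
 have nc: "w \<in> \<Omega>" "w \<notin> corners" using assms not_corner(1)[of w] by (auto simp: \<Omega>_def)
 note at = at_within_\<Omega>[OF assms]
 have s: "sinh (\<Psi> w - \<i> * of_real (pi / 2)) = - \<i> * cosh (\<Psi> w)"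
 proof -
  have "exp (\<i> * of_real (pi / 2)) = \<i>" using cis_conv_exp[of "pi/2"] by simp
  then have "exp (\<Psi> w - \<i> * of_real (pi / 2)) = exp (\<Psi> w) / \<i>" "exp (- (\<Psi> w - \<i> * of_real (pi / 2))) = exp (- \<Psi> w) * \<i>"
   by (simp_all only: exp_diff minus_diff_eq) (simp add: exp_minus field_simps)
  then show ?thesis unfolding sinh_field_def cosh_field_def by (simp add: field_simps)
 qed
 have 1: "((\<lambda>w. of_real lam * cF 0 w) has_field_derivative of_real lam * (sinh (\<Psi> w) / DX w)) (at w)"
  using DERIV_cmult[OF cF_deriv[OF nc, of 0]] unfolding at by simp
 have 2: "((\<lambda>w. of_real lam * cF (pi/2) w) has_field_derivative of_real lam * (- \<i> * cosh (\<Psi> w) / DX w)) (at w)"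
  using DERIV_cmult[OF cF_deriv[OF nc, of "pi/2"]] unfolding at s .
 have 3: "((\<lambda>w. of_real lam * HX w) has_field_derivative of_real lam * (1 / DX w)) (at w)"
  using DERIV_cmult[OF HX(3)[OF nc]] unfolding at .
 have "Xs = (\<lambda>w. c + py.R3 (of_real lam * cF 0 w) (of_real lam * cF (pi/2) w) (of_real lam * HX w))"
 proof
  fix w
  have "Re (f w) = Re (cF 0 w)" "Im (f w) = Re (cF (pi/2) w)" using cmp_special(1,2) cmp_cF by metis+
  then show "Xs w = c + py.R3 (of_real lam * cF 0 w) (of_real lam * cF (pi/2) w) (of_real lam * HX w)"
   by (simp add: Xs_def py.E_def py.R3_def ht_def add.assoc)
 qed
 then show ?thesis using has_derivative_add_const[OF py.R3_has_derivative[OF 1 2 3], of c] by (simp only: add.commute)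
qed

text \<open>The components of the derivative of the null curve in the annulus; the division by \<open>z\<close> comes from the derivative of the logarithm.\<close>
definition "q z = of_real lam * (1 / DX (Ln z)) / z"
definition "\<Phi>1 z = of_real lam * (sinh (\<Psi> (Ln z)) / DX (Ln z)) / z"
definition "\<Phi>2 z = of_real lam * (- \<i> * cosh (\<Psi> (Ln z)) / DX (Ln z)) / z"

lemma \<Phi>_q: "\<Phi>1 z = q z * sinh (\<Psi> (Ln z))" "\<Phi>2 z = q z * (- \<i> * cosh (\<Psi> (Ln z)))"
 by (simp_all add: q_def \<Phi>1_def \<Phi>2_def)

lemma X_deriv:
 assumes "z \<in> OA"
 shows "(X has_derivative (\<lambda>h. py.R3 (\<Phi>1 z * h) (\<Phi>2 z * h) (q z * h))) (at z)"
proof -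
 have "((\<lambda>z. Xs (Ln z)) has_derivative (\<lambda>h. py.R3 (of_real lam * (sinh (\<Psi> (Ln z)) / DX (Ln z)) * (h / z)) (of_real lam * (- \<i> * cosh (\<Psi> (Ln z)) / DX (Ln z)) * (h / z)) (of_real lam * (1 / DX (Ln z)) * (h / z)))) (at z)"
 proof (rule descend_has_derivative[OF periodic(1)])
  show "z \<in> open_annulus (exp 0) (exp l)" using assms by simp
 qed (rule Xs_deriv[OF OA_ln(2,3)[OF assms]])
 then show ?thesis unfolding X_def[abs_def] \<Phi>1_def \<Phi>2_def q_def by (simp only: times_divide_eq_left times_divide_eq_right)
qed

lemma \<Phi>_hol: "\<Phi>1 holomorphic_on OA" "\<Phi>2 holomorphic_on OA" "q holomorphic_on OA"
proof -
 have ne: "\<And>w. w \<in> {w. 0 < Re w \<and> Re w < l} \<Longrightarrow> DX w \<noteq> 0" using DX_ne not_corner(1) by (auto simp: \<Omega>_def)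
 have i: "(\<lambda>w. sinh (\<Psi> w) / DX w) holomorphic_on {w. 0 < Re w \<and> Re w < l}"
  "(\<lambda>w. - \<i> * cosh (\<Psi> w) / DX w) holomorphic_on {w. 0 < Re w \<and> Re w < l}"
  "(\<lambda>w. 1 / DX w) holomorphic_on {w. 0 < Re w \<and> Re w < l}"
  unfolding sinh_field_def cosh_field_def by (intro holomorphic_intros inner_hol ne; simp)+
 have z: "z \<noteq> 0" if "z \<in> OA" for z using CA_ln(1) OA_ln(1) that by blast
 show "\<Phi>1 holomorphic_on OA" "\<Phi>2 holomorphic_on OA" "q holomorphic_on OA"
  unfolding \<Phi>1_def[abs_def] \<Phi>2_def[abs_def] q_def[abs_def]
  by (intro holomorphic_on_divide holomorphic_on_mult[OF holomorphic_on_const] holomorphic_on_ident z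
    descend_holomorphic[OF periodic(5) i(1), unfolded exp_zero] descend_holomorphic[OF periodic(6) i(2), unfolded exp_zero]
    descend_holomorphic[OF periodic(7) i(3), unfolded exp_zero]; assumption)+
qed

definition "nv w = cos (Im (\<Psi> w)) *\<^sub>R a + sin (Im (\<Psi> w)) *\<^sub>R b - sinh (Re (\<Psi> w)) *\<^sub>R u"

lemma norm_nv: "norm (nv w) = cosh (Re (\<Psi> w))"
proof -
 have "nv w \<bullet> nv w = 1 + (sinh (Re (\<Psi> w)))\<^sup>2"
  using sin_cos_squared_add[of "Im (\<Psi> w)"]
  by (simp add: nv_def inner_add_left inner_add_right inner_diff_left inner_diff_right py.dots power2_eq_square)
 then have "(norm (nv w))\<^sup>2 = (cosh (Re (\<Psi> w)))\<^sup>2" using cosh_square_eq[of "Re (\<Psi> w)"] by (simp add: power2_norm_eq_inner)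
 then show ?thesis using cosh_real_pos[of "Re (\<Psi> w)"] by (simp add: power2_eq_iff_nonneg)
qed

lemma cross_X:
 assumes "z \<in> CA" "Ln z \<notin> corners"
 shows "\<exists>k>0. cross3 (py.R3 (\<Phi>1 z) (\<Phi>2 z) (q z)) (py.R3 (\<Phi>1 z * \<i>) (\<Phi>2 z * \<i>) (q z * \<i>)) = - (k *\<^sub>R nv (Ln z))"
proof (intro exI conjI)
 have "DX (Ln z) \<noteq> 0" "z \<noteq> 0" using DX_ne CA_ln assms by auto
 then have "q z \<noteq> 0" using lam by (simp add: q_def)
 then show "0 < (norm (q z))\<^sup>2 * cosh (Re (\<Psi> (Ln z)))" using cosh_real_pos by simp
 show "cross3 (py.R3 (\<Phi>1 z) (\<Phi>2 z) (q z)) (py.R3 (\<Phi>1 z * \<i>) (\<Phi>2 z * \<i>) (q z * \<i>)) = - (((norm (q z))\<^sup>2 * cosh (Re (\<Psi> (Ln z)))) *\<^sub>R nv (Ln z))"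
  unfolding \<Phi>_q nv_def by (rule py.cross_weierstrass)
qed

lemma nv_ne: "nv w \<noteq> 0" using norm_nv[of w] cosh_real_pos[of "Re (\<Psi> w)"] by auto

lemma X_pderiv:
 assumes "z \<in> OA"
 shows "pderiv_dir 1 X z = py.R3 (\<Phi>1 z) (\<Phi>2 z) (q z)" "pderiv_dir \<i> X z = py.R3 (\<Phi>1 z * \<i>) (\<Phi>2 z * \<i>) (q z * \<i>)"
 using py.pderiv_R3[OF X_deriv[OF assms], of 1] py.pderiv_R3[OF X_deriv[OF assms], of \<i>] by simp_all

lemma X_minimal: "minimal_immersion_on OA X"
proof (rule py.null_curve_minimal[OF open_open_annulus \<Phi>_hol X_deriv])
 fix z assume z: "z \<in> OA"
 have "(\<Phi>1 z)\<^sup>2 + (\<Phi>2 z)\<^sup>2 + (q z)\<^sup>2 = (q z)\<^sup>2 * ((sinh (\<Psi> (Ln z)))\<^sup>2 - (cosh (\<Psi> (Ln z)))\<^sup>2 + 1)"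
  unfolding \<Phi>_q by (simp add: power_mult_distrib algebra_simps)
 then show "(\<Phi>1 z)\<^sup>2 + (\<Phi>2 z)\<^sup>2 + (q z)\<^sup>2 = 0" using cosh_square_eq[of "\<Psi> (Ln z)"] by simp
 show "cross3 (pderiv_dir 1 X z) (pderiv_dir \<i> X z) \<noteq> 0"
  unfolding X_pderiv[OF z] using cross_X[of z] OA_ln[OF z] nv_ne by force
qed

lemma X_normal:
 assumes z: "z \<in> OA" shows "nus (Ln z) = unit_normal X z"
proof -
 obtain k where k: "0 < k" "cross3 (py.R3 (\<Phi>1 z) (\<Phi>2 z) (q z)) (py.R3 (\<Phi>1 z * \<i>) (\<Phi>2 z * \<i>) (q z * \<i>)) = - (k *\<^sub>R nv (Ln z))"
  using cross_X[of z] OA_ln[OF z] by blast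
 have "unit_normal X z = - sgn (nv (Ln z))"
  unfolding unit_normal_def X_pderiv[OF z] k(2) using k(1) by (simp add: sgn_minus sgn_scaleR)
 then show ?thesis by (simp add: nus_def nv_def[symmetric] sgn_div_norm norm_nv divide_inverse)
qed

lemma X_C1:
 assumes "\<And>z. z \<in> V \<Longrightarrow> z \<in> CA \<and> Ln z \<notin> corners"
 shows "C1_immersion_up_to OA V X"
 unfolding C1_immersion_up_to_def
proof (intro exI conjI ballI)
 have sub: "z \<in> CA" "Ln z \<notin> corners" if "z \<in> OA \<union> V" for z using that assms OA_ln by blast+
 have DXc: "continuous_on (\<Omega> - corners) DX" "continuous_on (\<Omega> - corners) \<Psi>" using \<Psi>_cont continuous_on_subset by blast+
 have ne: "w \<in> \<Omega> - corners \<Longrightarrow> DX w \<noteq> 0" for w using DX_ne by blast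
 have i: "continuous_on (\<Omega> - corners) (\<lambda>w. sinh (\<Psi> w) / DX w)"
  "continuous_on (\<Omega> - corners) (\<lambda>w. - \<i> * cosh (\<Psi> w) / DX w)"
  "continuous_on (\<Omega> - corners) (\<lambda>w. 1 / DX w)"
  unfolding sinh_field_def cosh_field_def by (intro continuous_intros DXc ballI ne; simp)+
 have d: "continuous_on (OA \<union> V) (\<lambda>z. F (Ln z))" if "periodic_strip F 0 l" "continuous_on (\<Omega> - corners) F" for F :: "complex \<Rightarrow> complex"
 proof (rule descend_continuous[OF that])
  show "Ln z \<in> \<Omega> - corners" if "z \<in> OA \<union> V" for z using sub[OF that] CA_ln(2) by blast
  show "w \<in> \<Omega> - corners" if "w + full_turn m \<in> \<Omega> - corners" for w and m :: int using corner_shift[OF that] .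
  show "OA \<union> V \<subseteq> closed_annulus (exp 0) (exp l)" using sub(1) by auto
 qed
 have \<Phi>c: "continuous_on (OA \<union> V) \<Phi>1" "continuous_on (OA \<union> V) \<Phi>2" "continuous_on (OA \<union> V) q"
  unfolding \<Phi>1_def[abs_def] \<Phi>2_def[abs_def] q_def[abs_def]
  by (intro continuous_on_divide continuous_on_mult[OF continuous_on_const] continuous_on_id ballI
    d[OF periodic(5) i(1)] d[OF periodic(6) i(2)] d[OF periodic(7) i(3)] CA_ln(1) sub(1); simp)+
 show "continuous_on (OA \<union> V) (\<lambda>z. py.R3 (\<Phi>1 z) (\<Phi>2 z) (q z))" "continuous_on (OA \<union> V) (\<lambda>z. py.R3 (\<Phi>1 z * \<i>) (\<Phi>2 z * \<i>) (q z * \<i>))"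
  unfolding py.R3_def by (intro continuous_intros \<Phi>c)+
 show "py.R3 (\<Phi>1 z) (\<Phi>2 z) (q z) = pderiv_dir 1 X z" "py.R3 (\<Phi>1 z * \<i>) (\<Phi>2 z * \<i>) (q z * \<i>) = pderiv_dir \<i> X z" if "z \<in> OA" for z
  using X_pderiv[OF that] by simp_all
 fix z assume "z \<in> OA \<union> V"
 then show "cross3 (py.R3 (\<Phi>1 z) (\<Phi>2 z) (q z)) (py.R3 (\<Phi>1 z * \<i>) (\<Phi>2 z * \<i>) (q z * \<i>)) \<noteq> 0"
  using cross_X[of z] sub[of z] nv_ne by force
qed

end

context gauss_pyramid begin

lemma face_scale: "T * Re (of_real lam * f w * cis x) + lam * ht w = lam * (T * Re (f w * cis x) + ht w)"
 by (simp add: algebra_simps)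

lemma Xs_P0: assumes w: "w \<in> \<Omega>" shows "Xs w \<in> py.P0"
 unfolding Xs_def py.in_P0 e_eps face_scale
 using rotated_face_ineq(1)[OF w] ht_pos(1)[OF w] lam mult_left_mono[of _ dd lam] by fastforce

lemma Xs_FF: assumes w: "w \<in> \<Omega>"
 shows "Xs w \<in> py.FF k \<longleftrightarrow> Re w = l \<and> (\<exists>m::int. \<bar>Im w - of_int (2 * (int k + int n * m)) * eps\<bar> \<le> eps)"
proof -
 have "Xs w \<in> py.FF k \<longleftrightarrow> lam * (T * Re (f w * cis (- (2 * real k * eps))) + ht w) = lam * dd"
  using Xs_P0[OF w] unfolding Xs_def py.in_FF e_eps face_scale lam(2) by blast
 also have "\<dots> \<longleftrightarrow> T * Re (f w * cis (- (2 * real k * eps))) + ht w = dd" using lam(1) by simp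
 finally show ?thesis unfolding rotated_face_ineq(2)[OF w] .
qed

lemma Xs_B0: assumes w: "w \<in> \<Omega>" shows "Xs w \<in> py.B0 \<longleftrightarrow> Re w = 0"
 using Xs_P0[OF w] ht_pos(2)[OF w] lam(1) unfolding Xs_def py.B0_alt by simp

lemma nearest_face:
 obtains k m where "k < n" "\<bar>y - of_int (2 * (int k + int n * m)) * eps\<bar> \<le> eps"
proof -
 obtain j :: int where j: "- eps < y - of_int (2 * j) * eps" "y - of_int (2 * j) * eps \<le> eps" by (rule reduce_Im)
 have "int (nat (j mod int n)) + int n * (j div int n) = j" using n3 by simp
 then have "\<bar>y - of_int (2 * (int (nat (j mod int n)) + int n * (j div int n))) * eps\<bar> \<le> eps" using j by simp
 moreover have "nat (j mod int n) < n" using n3 by (simp add: nat_less_iff)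
 ultimately show thesis by (rule that[rotated])
qed

text \<open>On face \<open>k\<close> the imaginary part of the parameter is within \<open>eps\<close> of an even multiple of \<open>eps\<close>. Being close to two of them forces an odd multiple.\<close>
lemma two_faces_corner:
 assumes w: "w \<in> \<Omega>" and kj: "k < n" "j < n" "k \<noteq> j" "Xs w \<in> py.FF k" "Xs w \<in> py.FF j"
 shows "w \<in> corners"
proof -
 obtain m m' :: int where m: "Re w = l" "\<bar>Im w - of_int (2 * (int k + int n * m)) * eps\<bar> \<le> eps"
  "\<bar>Im w - of_int (2 * (int j + int n * m')) * eps\<bar> \<le> eps" using kj(4,5) unfolding Xs_FF[OF w] by blast
 define K J where "K = int k + int n * m" "J = int j + int n * m'"
 note KJ = this
 have "K mod int n = int k" "J mod int n = int j" using kj by (simp_all add: KJ)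
 then have "K \<noteq> J" using kj(3) by auto
 have b: "\<bar>Im w - (2 * of_int K) * eps\<bar> \<le> eps" "\<bar>Im w - (2 * of_int J) * eps\<bar> \<le> eps" using m(2,3) by (simp_all add: KJ)
 have "\<bar>(2 * (of_int K - of_int J)) * eps\<bar> \<le> 2 * eps" using b by (simp add: left_diff_distrib right_diff_distrib abs_le_iff)
 then have "\<bar>of_int (K - J)\<bar> * eps \<le> 1 * eps" using eps(1) by (simp add: abs_mult)
 then have "\<bar>of_int (K - J)\<bar> \<le> (1::real)" using eps(1) mult_le_cancel_right_pos by blast
 then have "\<bar>K - J\<bar> \<le> 1" by linarith
 then consider "K = J + 1" | "J = K + 1" using \<open>K \<noteq> J\<close> by linarith
 then show ?thesis
 proof cases
  case 1
  have "Im w = (2 * of_int J + 1) * eps" using b unfolding 1 by (simp add: algebra_simps abs_le_iff)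
  then show ?thesis using m(1) unfolding corners_def by blast
 next
  case 2
  have "Im w = (2 * of_int K + 1) * eps" using b unfolding 2 by (simp add: algebra_simps abs_le_iff)
  then show ?thesis using m(1) unfolding corners_def by blast
 qed
qed

lemma face_midline: "Complex l (2 * real k * eps) \<in> \<Omega>" "Complex l (2 * real k * eps) \<notin> corners"
 "Xs (Complex l (2 * real k * eps)) \<in> py.FF k"
proof -
 show O: "Complex l (2 * real k * eps) \<in> \<Omega>" using l by (simp add: \<Omega>_def)
 show "Xs (Complex l (2 * real k * eps)) \<in> py.FF k" unfolding Xs_FF[OF O] using eps by (auto intro!: exI[of _ 0])
 show "Complex l (2 * real k * eps) \<notin> corners"
 proof
  assume "Complex l (2 * real k * eps) \<in> corners"
  then obtain i :: int where "2 * real k * eps = (2 * of_int i + 1) * eps" unfolding corners_def by auto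
  then have "2 * real k = 2 * of_int i + 1" using eps(1) by simp
  then have "real_of_int (2 * int k) = real_of_int (2 * i + 1)" by simp
  then have "2 * int k = 2 * i + 1" by (simp only: of_int_eq_iff)
  then show False by presburger
 qed
qed

lemma FF_distinct: "k < n \<Longrightarrow> j < n \<Longrightarrow> k \<noteq> j \<Longrightarrow> py.FF k \<noteq> py.FF j"
 using two_faces_corner[OF face_midline(1)[of k], of k j] face_midline(2,3)[of k] by auto

lemma corner_two_faces:
 assumes w: "w \<in> \<Omega>" "w \<in> corners"
 obtains k j where "k < n" "j < n" "k \<noteq> j" "Xs w \<in> py.FF k" "Xs w \<in> py.FF j"
proof -
 obtain i :: int where i: "Re w = l" "Im w = (2 * of_int i + 1) * eps" using w(2) unfolding corners_def by blast
 have r: "int (nat (J mod int n)) + int n * (J div int n) = J" "nat (J mod int n) < n" for J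
  using n3 by (simp_all add: nat_less_iff)
 have F: "Xs w \<in> py.FF (nat (J mod int n))" if "\<bar>Im w - of_int (2 * J) * eps\<bar> \<le> eps" for J
  unfolding Xs_FF[OF w(1)] using i(1) that by (intro conjI exI[of _ "J div int n"]) (simp_all only: r(1))
 have "(i + 1) mod int n \<noteq> i mod int n"
 proof
  assume "(i + 1) mod int n = i mod int n"
  then have "int n dvd (i + 1) - i" by (rule mod_eq_dvd_iff[THEN iffD1])
  then show False using n3 by simp
 qed
 then have ne: "nat (i mod int n) \<noteq> nat ((i + 1) mod int n)" using n3 by (simp add: eq_nat_nat_iff)
 show thesis
  by (rule that[OF r(2) r(2) ne F F]) (use i(2) eps(1) in "simp_all add: algebra_simps")
qed

lemma edge_corner: assumes w: "w \<in> \<Omega>" shows "Xs w \<in> edge_points py.P0 \<longleftrightarrow> w \<in> corners"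
proof
 assume "w \<in> corners"
 then obtain k j where kj: "k < n" "j < n" "k \<noteq> j" "Xs w \<in> py.FF k" "Xs w \<in> py.FF j" using corner_two_faces[OF w] by blast
 have "py.FF k facet_of py.P0" "py.FF j facet_of py.P0" using kj by (auto simp: py.facets')
 then show "Xs w \<in> edge_points py.P0" unfolding edge_points_def using kj FF_distinct[of k j] by blast
next
 assume "Xs w \<in> edge_points py.P0"
 then obtain F F' where F: "F facet_of py.P0" "F' facet_of py.P0" "F \<noteq> F'" "Xs w \<in> F" "Xs w \<in> F'" unfolding edge_points_def by blast
 have not: "Xs w \<in> py.B0 \<Longrightarrow> Xs w \<in> py.FF k \<Longrightarrow> False" for k unfolding Xs_B0[OF w] Xs_FF[OF w] using l by simp
 obtain k j where "k < n" "j < n" "F = py.FF k" "F' = py.FF j"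
  using F not unfolding py.facets' by metis
 then show "w \<in> corners" using two_faces_corner[OF w, of k j] F by auto
qed

text \<open>Corners of the annulus are \<open>n\<close>-th roots of a single number.\<close>
lemma finite_corners: "finite {z. z \<noteq> 0 \<and> Ln z \<in> corners}"
proof (rule finite_subset)
 show "finite {z::complex. z ^ n = - exp (of_real (real n * l))}" using n3 by (intro finite_nth_roots) simp
 show "{z. z \<noteq> 0 \<and> Ln z \<in> corners} \<subseteq> {z. z ^ n = - exp (of_real (real n * l))}"
 proof
  fix z assume "z \<in> {z. z \<noteq> 0 \<and> Ln z \<in> corners}"
  then obtain i :: int where z: "z \<noteq> 0" "Re (Ln z) = l" "Im (Ln z) = (2 * of_int i + 1) * eps" unfolding corners_def by blast
  have "of_nat n * Ln z = of_real (real n * l) + \<i> * of_real ((2 * of_int i + 1) * (real n * eps))"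
   using z(2,3) by (simp add: complex_eq_iff)
  also have "real n * eps = pi" by (rule eps(4))
  finally have e: "of_nat n * Ln z = of_real (real n * l) + \<i> * of_real ((2 * of_int i + 1) * pi)" .
  have "exp (\<i> * of_real ((2 * of_int i + 1) * pi)) = cis (pi + 2 * pi * of_int i)" by (simp add: cis_conv_exp algebra_simps)
  also have "\<dots> = - 1" unfolding cis_mult[symmetric] using cis_multiple_2pi[of "of_int i"] by simp
  finally have m: "exp (\<i> * of_real ((2 * of_int i + 1) * pi)) = - 1" .
  have "z ^ n = exp (Ln z) ^ n" using z by simp
  also have "\<dots> = exp (of_nat n * Ln z)" by (rule exp_of_nat_mult[symmetric])
  also have "\<dots> = - exp (of_real (real n * l))" unfolding e exp_add m by simp
  finally show "z \<in> {z. z ^ n = - exp (of_real (real n * l))}" by simp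
 qed
qed

lemma boundary_ln:
 assumes "z \<in> sphere 0 1 \<union> sphere 0 (exp l)"
 shows "z \<in> CA" "z \<noteq> 0" "Ln z \<in> \<Omega>" "Re (Ln z) = 0 \<or> Re (Ln z) = l"
proof -
 have n: "norm z = 1 \<or> norm z = exp l" using assms by auto
 then show c: "z \<in> CA" using l by (auto simp: closed_annulus_def)
 show "z \<noteq> 0" "Ln z \<in> \<Omega>" by (rule CA_ln[OF c])+
 then show "Re (Ln z) = 0 \<or> Re (Ln z) = l" using n by auto
qed

lemma boundary_facet:
 assumes w: "w \<in> \<Omega>" "Re w = 0 \<or> Re w = l" obtains F where "F facet_of py.P0" "Xs w \<in> F"
proof (cases "Re w = 0")
 case True
 then show thesis using that[of py.B0] Xs_B0[OF w(1)] by (simp add: py.facets')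
next
 case False
 obtain k m where "k < n" "\<bar>Im w - of_int (2 * (int k + int n * m)) * eps\<bar> \<le> eps" by (rule nearest_face)
 then show thesis using that[of "py.FF k"] Xs_FF[OF w(1), of k] w(2) False by (auto simp: py.facets')
qed

text \<open>On the base \<open>Re \<Psi> = 0\<close> makes the normal horizontal; on a face the equation of the boundary arc of the Gauss image is the orthogonality relation.\<close>
lemma meets_orthogonally:
 assumes w: "w \<in> \<Omega>" and F: "F facet_of py.P0" "Xs w \<in> F" "normal_to F v"
 shows "orthogonal (nus w) v"
proof -
 have nu: "nus w \<bullet> u = sinh (Re (\<Psi> w)) / cosh (Re (\<Psi> w))"
  by (simp add: nus_def inner_add_left inner_diff_left py.dots)
 consider "F = py.B0" | k where "k < n" "F = py.FF k" using F(1) py.facets' by blast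
 then show ?thesis
 proof cases
  case 1
  then have "Re w = 0" using F(2) Xs_B0[OF w] by simp
  then have "w = Complex 0 (Im w)" by (simp add: complex_eq_iff)
  from base_D(5)[OF this] have "Re (\<Psi> w) = 0" by (metis Re_i_times Im_complex_of_real neg_0_equal_iff_equal)
  then have "nus w \<bullet> u = 0" unfolding nu by simp
  then show ?thesis using py.normal_B0 F(3) 1 by blast
 next
  case 2
  obtain m :: int where m: "Re w = l" "\<bar>Im w - of_int (2 * (int k + int n * m)) * eps\<bar> \<le> eps"
   using F(2) Xs_FF[OF w] 2 by blast
  define v' where "v' = Complex l (Im w - of_int (2 * (int k + int n * m)) * eps)"
  have v': "v' \<in> \<Omega>" "Re v' = l" "\<bar>Im v'\<bar> \<le> eps" using m l by (auto simp: v'_def \<Omega>_def)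
  have wv: "w = v' + turn (int k + int n * m)" using m(1) by (simp add: v'_def complex_eq_iff)
  have P: "\<Psi> w = \<Psi> v' + turn (int k + int n * m)" unfolding wv by (rule \<Psi>_shift_int(1)[OF v'(1)])
  have R: "Re (\<Psi> w) = Re (\<Psi> v')" unfolding P by simp
  have I: "Im (\<Psi> w) - 2 * real k * eps = Im (\<Psi> v') + 2 * pi * of_int m"
  proof -
   have pe: "pi = real n * eps" using eps(4) by simp
   show ?thesis unfolding P pe by (simp add: algebra_simps)
  qed
  have c: "cos (Im (\<Psi> w) - 2 * real k * eps) = cos (Im (\<Psi> v'))"
   unfolding I using cis_multiple_2pi[of "real_of_int m"] by (simp add: cos_add complex_eq_iff)
  have "nus w \<bullet> (T *\<^sub>R py.dir k + u) = - (1 / cosh (Re (\<Psi> w)) * (T * cos (Im (\<Psi> w) - 2 * real k * eps) - sinh (Re (\<Psi> w))))"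
   unfolding nus_def py.dir_def e_eps cos_diff
   by (simp add: inner_add_left inner_diff_left inner_add_right py.dots algebra_simps)
  also have "\<dots> = 0" unfolding c R face_eq'(1)[OF v'(2,3)] by simp
  finally show ?thesis using py.normal_FF[OF 2(1)] F(3) 2(2) by blast
 qed
qed

lemma free_boundary_annulus: "free_boundary_minimal_annulus py.P0 (X ` CA) (X ` sphere 0 1) (X ` sphere 0 (exp l))"
 unfolding free_boundary_minimal_annulus_def
proof (intro exI conjI)
 show "0 < (1::real)" "1 < exp l" using l by auto
 show "continuous_on CA X" unfolding X_def[abs_def] by (rule descend[OF periodic(1) Xs_cont])
 show "continuous_on CA (\<lambda>z. nus (Ln z))" by (rule descend[OF periodic(2) nus_cont])
 show "inj_on X CA"
 proof (rule inj_onI)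
  fix z z' assume z: "z \<in> CA" "z' \<in> CA" "X z = X z'"
  then have "of_real lam * f (Ln z) = of_real lam * f (Ln z')" unfolding X_def Xs_def py.E_inj by blast
  then show "z = z'" by (rule X_inj[OF z(1,2)])
 qed
 show "minimal_immersion_on OA X" by (rule X_minimal)
 show "\<forall>z\<in>OA. nus (Ln z) = unit_normal X z" using X_normal by blast
 show "let T = sphere 0 1 \<union> sphere 0 (exp l); K = {z \<in> T. X z \<in> edge_points py.P0}
   in finite K \<and> C1_immersion_up_to OA (T - K) X"
  unfolding Let_def
 proof (intro conjI)
  have K: "X z \<in> edge_points py.P0 \<longleftrightarrow> Ln z \<in> corners" if "z \<in> sphere 0 1 \<union> sphere 0 (exp l)" for z
   unfolding X_def using edge_corner boundary_ln(3)[OF that] by blast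
  show "finite {z \<in> sphere 0 1 \<union> sphere 0 (exp l). X z \<in> edge_points py.P0}"
   by (rule finite_subset[OF _ finite_corners]) (use K boundary_ln(2) in blast)
  show "C1_immersion_up_to OA (sphere 0 1 \<union> sphere 0 (exp l) - {z \<in> sphere 0 1 \<union> sphere 0 (exp l). X z \<in> edge_points py.P0}) X"
   by (rule X_C1) (use K boundary_ln(1) in blast)
 qed
 show "X ` CA \<subseteq> py.P0" unfolding X_images(1) using Xs_P0 by blast
 show "X ` sphere 0 1 \<union> X ` sphere 0 (exp l) \<subseteq> frontier py.P0"
 proof
  fix x assume "x \<in> X ` sphere 0 1 \<union> X ` sphere 0 (exp l)"
  then obtain z where z: "z \<in> sphere 0 1 \<union> sphere 0 (exp l)" "x = Xs (Ln z)" unfolding X_def by blast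
  obtain F where "F facet_of py.P0" "x \<in> F" unfolding z(2)
   by (rule boundary_facet[OF boundary_ln(3,4)[OF z(1)]])
  then show "x \<in> frontier py.P0" using py.frontier_P0 by blast
 qed
 show "\<forall>z\<in>sphere 0 1 \<union> sphere 0 (exp l). \<forall>F w. F facet_of py.P0 \<and> X z \<in> F \<and> normal_to F w \<longrightarrow> orthogonal (nus (Ln z)) w"
  unfolding X_def using meets_orthogonally boundary_ln(3) by blast
qed (rule refl)+

text \<open>The projection is continuous and injective on a compact set, so the height is a continuous function of it.\<close>
lemma annulus_graph: "graph_over py.B0 (X ` CA)"
proof -
 define p where "p z = py.E (of_real lam * f (Ln z)) 0" for z
 define g where "g q = lam * ht (Ln (the_inv_into CA p q))" for q
 have inj: "inj_on p CA"
 proof (rule inj_onI)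
  fix z z' assume z: "z \<in> CA" "z' \<in> CA" "p z = p z'"
  then have "of_real lam * f (Ln z) = of_real lam * f (Ln z')" unfolding p_def py.E_inj by blast
  then show "z = z'" by (rule X_inj[OF z(1,2)])
 qed
 have compact: "compact CA"
 proof -
  have "CA = cball 0 (exp l) - ball 0 1" by (auto simp: closed_annulus_def)
  then show ?thesis by (simp add: compact_diff)
 qed
 have pc: "continuous_on CA p" unfolding p_def[abs_def]
  by (intro py.continuous_on_E continuous_intros descend periodic f_cont)
 have ic: "continuous_on (p ` CA) (the_inv_into CA p)"
  by (rule continuous_on_inv[OF pc compact]) (auto simp: the_inv_into_f_f[OF inj])
 have gc: "continuous_on (p ` CA) g" unfolding g_def[abs_def]
  by (rule continuous_on_mult[OF continuous_on_const continuous_on_compose2[OF descend[OF periodic(3) f_cont(2)] ic]])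
   (auto simp: the_inv_into_f_f[OF inj])
 have D: "p ` CA \<subseteq> affine hull py.B0"
 proof
  fix x assume "x \<in> p ` CA"
  then obtain z where z: "z \<in> CA" "x = py.E (of_real lam * f (Ln z)) 0" by (auto simp: p_def)
  have O: "Ln z \<in> \<Omega>" by (rule CA_ln(2)[OF z(1)])
  have "py.E (of_real lam * f (Ln z)) (lam * ht (Ln z)) \<in> py.P0" using Xs_P0[OF O] by (simp add: Xs_def)
  moreover have "0 \<le> lam * ht (Ln z)" using ht_pos(1)[OF O] lam by simp
  ultimately have "py.E (of_real lam * f (Ln z)) 0 \<in> py.P0" unfolding py.in_P0 by force
  then have "x \<in> py.B0" unfolding z(2) py.B0_alt by simp
  then show "x \<in> affine hull py.B0" by (rule hull_inc)
 qed
 have "X ` CA = (\<lambda>q. q + g q *\<^sub>R u) ` p ` CA"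
  unfolding image_image
 proof (rule image_cong[OF refl])
  fix z assume "z \<in> CA"
  then have "g (p z) = lam * ht (Ln z)" by (simp add: g_def the_inv_into_f_f[OF inj])
  then show "X z = p z + g (p z) *\<^sub>R u" by (simp add: X_def Xs_def p_def py.E_def)
 qed
 then show ?thesis unfolding graph_over_def
  by (intro exI[of _ u] exI[of _ "p ` CA"] exI[of _ g]) (use py.on(3) py.u_normal D gc in blast)
qed

lemma rotation_E: "axis_rotation c (h *\<^sub>R u) \<theta> (py.E v z) = py.E (cis \<theta> * v) z"
proof -
 have s: "sgn (h *\<^sub>R u) = u" using py.H py.on(3) by (simp add: sgn_scaleR sgn_div_norm)
 have d: "py.E v z - c = Re v *\<^sub>R a + Im v *\<^sub>R b + z *\<^sub>R u" by (simp add: py.E_def)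
 have "cross3 u a = b" "cross3 u b = - a" using py.cross_bu cross_skew[of u b] by auto
 then have cr: "cross3 u (Re v *\<^sub>R a + Im v *\<^sub>R b + z *\<^sub>R u) = Re v *\<^sub>R b - Im v *\<^sub>R a"
  by (simp add: cross_add_right cross_mult_right)
 have i: "u \<bullet> (Re v *\<^sub>R a + Im v *\<^sub>R b + z *\<^sub>R u) = z" by (simp add: inner_add_right py.dots)
 show ?thesis unfolding axis_rotation_def Let_def s d cr i by (simp add: py.E_def algebra_simps)
qed

lemma annulus_rotation: "axis_rotation c (h *\<^sub>R u) (2 * pi / real n) ` X ` CA = X ` CA"
proof -
 have e: "2 * pi / real n = 2 * eps" by (simp add: eps_def)
 have r: "axis_rotation c (h *\<^sub>R u) (2 * pi / real n) (Xs w) = Xs (w + per)" if "w \<in> \<Omega>" for w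
  unfolding e Xs_def rotation_E f_sym(1,2)[OF that] rot_def by (simp add: mult.left_commute)
 show ?thesis unfolding X_images(1)
 proof
  show "axis_rotation c (h *\<^sub>R u) (2 * pi / real n) ` Xs ` \<Omega> \<subseteq> Xs ` \<Omega>"
   using r \<Omega>_sym(2) by auto
  show "Xs ` \<Omega> \<subseteq> axis_rotation c (h *\<^sub>R u) (2 * pi / real n) ` Xs ` \<Omega>"
  proof
   fix x assume "x \<in> Xs ` \<Omega>"
   then obtain w where w: "w \<in> \<Omega>" "x = Xs w" by blast
   have w': "w - per \<in> \<Omega>" using w(1) by (simp add: \<Omega>_def)
   have "x = axis_rotation c (h *\<^sub>R u) (2 * pi / real n) (Xs (w - per))" unfolding r[OF w'] w(2) by simp
   then show "x \<in> axis_rotation c (h *\<^sub>R u) (2 * pi / real n) ` Xs ` \<Omega>" using w' by blast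
  qed
 qed
qed

lemma inner_E: "(cos \<phi> *\<^sub>R a + sin \<phi> *\<^sub>R b - t *\<^sub>R u) \<bullet> py.E v z = (cos \<phi> *\<^sub>R a + sin \<phi> *\<^sub>R b - t *\<^sub>R u) \<bullet> c + (Re (cis (- \<phi>) * v) - t * z)"
 by (simp add: py.E_def inner_add_left inner_add_right inner_diff_left py.dots)

lemma base_curve:
 "\<exists>g. convex_planar_curve g \<and> pathfinish g = pathstart g \<and> path_image g = X ` sphere 0 1"
proof -
 define g where "g x = Xs (Complex 0 (2 * pi * x))" for x
 have O: "Complex 0 y \<in> \<Omega>" for y using l by (simp add: \<Omega>_def)
 have P: "Xs (Complex 0 (y + 2 * pi * of_int m)) = Xs (Complex 0 y)" for y and m :: int
  by (rule descend_eq[OF periodic(1)]) (use l in "auto intro!: exI[of _ m] simp: complex_eq_iff")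
 have im: "path_image g = X ` sphere 0 1" unfolding X_images(2)
 proof
  show "path_image g \<subseteq> Xs ` {w. Re w = 0}" by (auto simp: path_image_def g_def)
  show "Xs ` {w. Re w = 0} \<subseteq> path_image g"
  proof
   fix x assume "x \<in> Xs ` {w. Re w = 0}"
   then obtain w where w: "Re w = 0" "x = Xs w" by blast
   define t where "t = frac (Im w / (2 * pi))"
   have "w = Complex 0 (2 * pi * t + 2 * pi * of_int \<lfloor>Im w / (2 * pi)\<rfloor>)"
    using w(1) by (simp add: t_def frac_def complex_eq_iff right_diff_distrib)
   then have "x = g t" unfolding w(2) g_def using P by metis
   moreover have "t \<in> {0..1}" using frac_ge_0 frac_lt_1 less_imp_le by (auto simp: t_def)
   ultimately show "x \<in> path_image g" by (auto simp: path_image_def)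
  qed
 qed
 have "simple_path g" unfolding simple_path_def loop_free_def path_def
 proof (intro conjI ballI impI)
  show "continuous_on {0..1} g" unfolding g_def[abs_def]
   by (rule continuous_on_compose2[OF Xs_cont]) (auto intro!: continuous_intros O)
  fix x y :: real assume xy: "x \<in> {0..1}" "y \<in> {0..1}" "g x = g y"
  then obtain m :: int where m: "Complex 0 (2 * pi * x) = Complex 0 (2 * pi * y) + full_turn m"
   using Xs_inj[OF O O] unfolding g_def Xs_def py.E_inj by blast
  then have "2 * pi * x = 2 * pi * (y + of_int m)" by (simp add: complex_eq_iff algebra_simps)
  then have xm: "x = y + of_int m" by simp
  then have "\<bar>real_of_int m\<bar> \<le> 1" using xy by auto
  then have "m = 0 \<or> m = 1 \<or> m = -1" by linarith
  then show "x = y \<or> x = 0 \<and> y = 1 \<or> x = 1 \<and> y = 0" using xm xy by auto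
 qed
 then have "convex_planar_curve g"
 proof (rule strict_support_convex_planar_curve)
  show "u \<noteq> 0" using py.on(3) by auto
  show "u \<bullet> x = u \<bullet> c" if "x \<in> path_image g" for x
   using that ht_base by (auto simp: path_image_def g_def Xs_def py.E_def inner_add_right py.dots)
  fix x assume "x \<in> path_image g"
  then obtain y0 where x: "x = Xs (Complex 0 y0)" by (auto simp: path_image_def g_def)
  let ?\<phi> = "Im (\<Psi> (Complex 0 y0))"
  show "\<exists>v. \<forall>y\<in>path_image g. y \<noteq> x \<longrightarrow> v \<bullet> y < v \<bullet> x"
  proof (intro exI[of _ "cos ?\<phi> *\<^sub>R a + sin ?\<phi> *\<^sub>R b - 0 *\<^sub>R u"] ballI impI)
   fix z assume z: "z \<in> path_image g" "z \<noteq> x"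
   then obtain y where y: "z = Xs (Complex 0 y)" by (auto simp: path_image_def g_def)
   have "f (Complex 0 y) \<noteq> f (Complex 0 y0)" using z(2) ht_base unfolding x y Xs_def by auto
   from base_support[OF this] have "lam * cmp ?\<phi> (Complex 0 y) < lam * cmp ?\<phi> (Complex 0 y0)" using lam by simp
   moreover have "Re (cis (- ?\<phi>) * (of_real lam * f w)) = lam * cmp ?\<phi> w" for w by (simp add: cmp_def algebra_simps)
   ultimately show "(cos ?\<phi> *\<^sub>R a + sin ?\<phi> *\<^sub>R b - 0 *\<^sub>R u) \<bullet> z < (cos ?\<phi> *\<^sub>R a + sin ?\<phi> *\<^sub>R b - 0 *\<^sub>R u) \<bullet> x"
    unfolding x y Xs_def inner_E by simp
  qed
 qed
 moreover have "pathfinish g = pathstart g" using P[of 0 1] by (simp add: pathfinish_def pathstart_def g_def)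
 ultimately show ?thesis using im by blast
qed

lemma face_curve:
 "\<exists>g. convex_planar_curve g \<and> path_image g = X ` sphere 0 (exp l) \<inter> py.FF k"
proof -
 define pt where "pt y = Complex l (y + 2 * real k * eps)" for y
 define g where "g x = Xs (pt (2 * eps * x - eps))" for x
 have O: "pt y \<in> \<Omega>" for y using l by (simp add: \<Omega>_def pt_def)
 have im': "path_image g = Xs ` pt ` {- eps..eps}"
 proof -
  have "(\<lambda>x. 2 * eps * x - eps) ` {0..1} = {- eps..eps}"
   using image_affinity_atLeastAtMost[of "2 * eps" "- eps" 0 1] eps by (simp add: algebra_simps)
  then have "Xs ` pt ` {- eps..eps} = Xs ` pt ` (\<lambda>x. 2 * eps * x - eps) ` {0..1}" by (simp only:)
  then show ?thesis by (simp add: path_image_def g_def image_image)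
 qed
 have im: "path_image g = X ` sphere 0 (exp l) \<inter> py.FF k" unfolding X_images(3) im'
 proof
  show "Xs ` pt ` {- eps..eps} \<subseteq> Xs ` {w. Re w = l} \<inter> py.FF k"
  proof
   fix x assume "x \<in> Xs ` pt ` {- eps..eps}"
   then obtain y where y: "x = Xs (pt y)" "- eps \<le> y" "y \<le> eps" by auto
   have "x \<in> py.FF k" unfolding y(1) Xs_FF[OF O] using y by (auto simp: pt_def intro!: exI[of _ 0])
   then show "x \<in> Xs ` {w. Re w = l} \<inter> py.FF k" using y(1) by (auto simp: pt_def)
  qed
  show "Xs ` {w. Re w = l} \<inter> py.FF k \<subseteq> Xs ` pt ` {- eps..eps}"
  proof
   fix x assume "x \<in> Xs ` {w. Re w = l} \<inter> py.FF k"
   then obtain w where w: "Re w = l" "x = Xs w" "x \<in> py.FF k" by blast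
   have wO: "w \<in> \<Omega>" using w l by (simp add: \<Omega>_def)
   obtain m :: int where m: "\<bar>Im w - of_int (2 * (int k + int n * m)) * eps\<bar> \<le> eps"
    using w(3) unfolding w(2) Xs_FF[OF wO] by blast
   define y where "y = Im w - of_int (2 * (int k + int n * m)) * eps"
   have "w = pt y + full_turn m"
    unfolding period_shift using w(1) by (simp add: pt_def y_def complex_eq_iff algebra_simps)
   then have "\<exists>m::int. w = pt y + full_turn m" by blast
   then have "Xs w = Xs (pt y)" using descend_eq[OF periodic(1)] O[of y] by (simp add: \<Omega>_def)
   then show "x \<in> Xs ` pt ` {- eps..eps}" using m by (auto simp: w(2) y_def abs_le_iff)
  qed
 qed
 have inj: "y = y'" if y: "\<bar>y\<bar> \<le> eps" "\<bar>y'\<bar> \<le> eps" and e: "Xs (pt y) = Xs (pt y')" for y y'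
 proof -
  obtain m :: int where m: "pt y = pt y' + full_turn m"
   using Xs_inj[OF O O] e unfolding Xs_def py.E_inj by blast
  have "y = y' + of_int m * (2 * pi)" using arg_cong[OF m, of Im] by (simp add: pt_def)
  then have "\<bar>of_int m\<bar> * (2 * pi) \<le> 2 * eps" using y by (auto simp: abs_mult[symmetric])
  moreover have "2 * eps < 2 * pi" using eps by simp
  ultimately have "\<bar>of_int m\<bar> * (2 * pi) < 1 * (2 * pi)" by linarith
  then have "\<bar>real_of_int m\<bar> < 1" by (rule mult_right_less_imp_less) simp
  then have "m = 0" by linarith
  then show ?thesis using \<open>y = y' + of_int m * (2 * pi)\<close> by simp
 qed
 have "simple_path g" unfolding simple_path_def loop_free_def path_def
 proof (intro conjI ballI impI)
  show "continuous_on {0..1} g" unfolding g_def[abs_def]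
   by (rule continuous_on_compose2[OF Xs_cont]) (use O in "auto intro!: continuous_intros simp: pt_def")
  fix x y :: real assume xy: "x \<in> {0..1}" "y \<in> {0..1}" "g x = g y"
  have b: "\<bar>2 * eps * t - eps\<bar> \<le> eps" if "t \<in> {0..1}" for t
   using that eps(1) mult_left_mono[of t 1 "2 * eps"] by (auto simp: abs_le_iff)
  have "2 * eps * x - eps = 2 * eps * y - eps" by (rule inj[OF b b]) (use xy in "auto simp: g_def")
  then show "x = y \<or> x = 0 \<and> y = 1 \<or> x = 1 \<and> y = 0" using eps(1) by simp
 qed
 then have "convex_planar_curve g"
 proof (rule strict_support_convex_planar_curve)
  have "(T *\<^sub>R py.dir k + u) \<bullet> u = 1" by (simp add: py.dir_def inner_add_left py.dots)
  then show "T *\<^sub>R py.dir k + u \<noteq> 0" by auto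
  show "(T *\<^sub>R py.dir k + u) \<bullet> x = (T *\<^sub>R py.dir k + u) \<bullet> c + h" if "x \<in> path_image g" for x
  proof -
   obtain v z where x: "x = py.E v z" using py.E_surj by blast
   have "T * Re (v * cis (- (2 * real k * py.e))) + z = h" using that unfolding im x by (simp add: py.in_FF)
   then show ?thesis unfolding x py.E_def py.dir_def
    by (simp add: inner_add_left inner_add_right py.dots algebra_simps)
  qed
  fix x assume "x \<in> path_image g"
  then obtain y0 where x: "x = Xs (pt y0)" "\<bar>y0\<bar> \<le> eps" unfolding im' by (auto simp: abs_le_iff)
  let ?\<phi> = "Im (\<Psi> (Complex l y0))"
  let ?\<phi>' = "?\<phi> + 2 * real k * eps"
  let ?v = "cos ?\<phi>' *\<^sub>R a + sin ?\<phi>' *\<^sub>R b - (T * cos ?\<phi>) *\<^sub>R u"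
  have val: "?v \<bullet> Xs (pt y) = ?v \<bullet> c + lam * (cmp ?\<phi> (Complex l y) - T * cos ?\<phi> * ht (Complex l y))" for y
  proof -
   have yO: "Complex l y \<in> \<Omega>" using l by (simp add: \<Omega>_def)
   have ps: "pt y = Complex l y + of_int (2 * int k) * (\<i> * of_real eps)" by (simp add: pt_def complex_eq_iff)
   have F: "f (pt y) = cis (2 * real k * eps) * f (Complex l y)" "ht (pt y) = ht (Complex l y)"
    unfolding ps using f_shift_int[OF yO, of "int k"] by simp_all
   have "cis (- ?\<phi>') * (of_real lam * f (pt y)) = of_real lam * (cis (- ?\<phi>) * f (Complex l y))"
   proof -
    have "cis (- ?\<phi>') * cis (2 * real k * eps) = cis (- ?\<phi>)" unfolding cis_mult by simp
    then show ?thesis unfolding F by (metis mult.left_commute mult.assoc)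
   qed
   then have "Re (cis (- ?\<phi>') * (of_real lam * f (pt y))) = Re (of_real lam * (cis (- ?\<phi>) * f (Complex l y)))" by (rule arg_cong)
   also have "\<dots> = lam * cmp ?\<phi> (Complex l y)" unfolding cmp_def by (simp add: algebra_simps)
   finally have "Re (cis (- ?\<phi>') * (of_real lam * f (pt y))) = lam * cmp ?\<phi> (Complex l y)" .
   then show ?thesis unfolding Xs_def inner_E F(2) by (simp add: algebra_simps)
  qed
  show "\<exists>v. \<forall>y\<in>path_image g. y \<noteq> x \<longrightarrow> v \<bullet> y < v \<bullet> x"
  proof (intro exI[of _ ?v] ballI impI)
   fix z assume z: "z \<in> path_image g" "z \<noteq> x"
   then obtain y where y: "z = Xs (pt y)" "\<bar>y\<bar> \<le> eps" unfolding im' by (auto simp: abs_le_iff)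
   have "y \<noteq> y0" using z(2) x(1) y(1) by auto
   from face_support[OF x(2) y(2) this] show "?v \<bullet> z < ?v \<bullet> x" unfolding x(1) y(1) val using lam(1) by simp
  qed
 qed
 then show ?thesis using im by blast
qed

end

theorem theorem6p1:
  fixes n :: nat and B P :: "(real^3) set" and c p :: "real^3"
  assumes "regular_polygon n c B"
    and "right_pyramid P B c p"
  shows "\<exists>A \<Gamma> \<Gamma>'. free_boundary_minimal_annulus P A \<Gamma> \<Gamma>' \<and>
           graph_over B A \<and>
           axis_rotation c (p - c) (2 * pi / real n) ` A = A \<and>
           \<Gamma> \<subseteq> B \<and>
           (\<exists>g. convex_planar_curve g \<and> pathfinish g = pathstart g \<and> path_image g = \<Gamma>) \<and>
           \<Gamma>' \<subseteq> \<Union> {F. F facet_of P \<and> F \<noteq> B} \<and>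
           (\<forall>F. F facet_of P \<and> F \<noteq> B \<longrightarrow>
              (\<exists>g. convex_planar_curve g \<and> path_image g = \<Gamma>' \<inter> F))"
proof -
  obtain a b u h T where fr: "pyramid_frame a b u n h T" and pc: "p - c = h *\<^sub>R u"
    and B_eq: "B = pyramid_frame.B0 c a b u n h T" and P_eq: "P = pyramid_frame.P0 c a b u n h T"
    using right_pyramid_frame[OF assms] by blast
  have "gauss_polygon n T" by unfold_locales (use fr in "auto simp: pyramid_frame_def pyramid_frame_axioms_def")
  then obtain l \<psi> where gm: "gauss_map n T l \<psi>" using gauss_polygon.gauss_map_exists by blast
  interpret gauss_pyramid n T l \<psi> c a b u h
    by (intro gauss_pyramid.intro gm fr)
  show ?thesis unfolding pc B_eq P_eq
  proof (rule exI[of _ "X ` CA"], rule exI[of _ "X ` sphere 0 1"], rule exI[of _ "X ` sphere 0 (exp l)"], intro conjI)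
    show "free_boundary_minimal_annulus py.P0 (X ` CA) (X ` sphere 0 1) (X ` sphere 0 (exp l))" by (rule free_boundary_annulus)
    show "graph_over py.B0 (X ` CA)" by (rule annulus_graph)
    show "axis_rotation c (h *\<^sub>R u) (2 * pi / real n) ` X ` CA = X ` CA" by (rule annulus_rotation)
    show "X ` sphere 0 1 \<subseteq> py.B0" unfolding X_images(2) using Xs_B0 l by (auto simp: \<Omega>_def)
    show "\<exists>g. convex_planar_curve g \<and> pathfinish g = pathstart g \<and> path_image g = X ` sphere 0 1" by (rule base_curve)
    show "X ` sphere 0 (exp l) \<subseteq> \<Union> {F. F facet_of py.P0 \<and> F \<noteq> py.B0}"
    proof
      fix x assume "x \<in> X ` sphere 0 (exp l)"
      then obtain w where w: "Re w = l" "x = Xs w" unfolding X_images(3) by blast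
      have wO: "w \<in> \<Omega>" using w(1) l by (simp add: \<Omega>_def)
      obtain F where F: "F facet_of py.P0" "Xs w \<in> F" by (rule boundary_facet[OF wO disjI2[OF w(1)]])
      have "x \<notin> py.B0" unfolding w(2) Xs_B0[OF wO] using w(1) l by simp
      then show "x \<in> \<Union> {F. F facet_of py.P0 \<and> F \<noteq> py.B0}" using F w(2) by blast
    qed
    show "\<forall>F. F facet_of py.P0 \<and> F \<noteq> py.B0 \<longrightarrow> (\<exists>g. convex_planar_curve g \<and> path_image g = X ` sphere 0 (exp l) \<inter> F)"
      using py.facets' face_curve by blast
  qed
qed

end
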